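(* Let $K$ be an algebraically closed field of characteristic $0$ and let $W$ be a $2$-dimensional $K$-vector space. Let $f\in\mathrm{Sym}^3(W^* )\otimes\mathrm{Sym}^3(W^* )$ be a stable form with trivial reduced stabilizer (in $\mathrm{GL}_2\times\mathrm{GL}_2\rtimes\mathbb{Z}/2\mathbb{Z}$). Then there exist four covariants of $\mathrm{Sym}^3(W^* )\otimes\mathrm{Sym}^3(W^* )$ of bi-order $(1,1)$ which are linearly independent at $f$. Let $q_0,q_1,q_2,q_3$ be such covariants, and define $$Q(f)=\sum_{0\le i,j\le 3}(q_i(f),q_j(f))_1\,X_iX_j,\qquad E(f)=\sum_{0\le i,j,l\le 3}(q_i(f)q_j(f)q_l(f),f)_3\,X_iX_jX_l.$$ Then the genus $4$ curve defined by $Q(f)$ and $E(f)$ (in $\mathbb{P}^3$ with coordinates $X_0,\dots,X_3$) is isomorphic to the genus $4$ curve defined by the bicubic form $f$. Moreover, the coefficients of $Q$ and $E$ are invariants for the action of $\mathrm{SL}_2\times\mathrm{SL}_2\rtimes\mathbb{Z}/2\mathbb{Z}$.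
   Context: Elements of $\mathrm{Sym}^{a}(W^* )\otimes\mathrm{Sym}^{b}(W^* )$ are viewed as bihomogeneous forms of bidegree $(a,b)$ in the variables $x,y$ (first factor) and $u,v$ (second factor). A bicubic form is one of bidegree $(3,3)$; it defines a curve in $\mathbb{P}^1\times\mathbb{P}^1$. The two copies of $\mathrm{GL}_2$ (or $\mathrm{SL}_2$) act on their respective sets of variables and $\mathbb{Z}/2\mathbb{Z}$ exchanges the two sets of variables. A covariant of $\mathrm{Sym}^{r_1}(W^* )\otimes\mathrm{Sym}^{r_2}(W^* )$ of bi-order $(l_1,l_2)$ is an $\mathrm{SL}_2\times\mathrm{SL}_2$-equivariant homogeneous polynomial map $\mathrm{Sym}^{r_1}(W^* )\otimes\mathrm{Sym}^{r_2}(W^* )\to\mathrm{Sym}^{l_1}(W^* )\otimes\mathrm{Sym}^{l_2}(W^* )$. Covariants are linearly independent at $f$ if their values at $f$ are linearly independent over $K$. The transvectant of bi-level $(l,m)$ of two bihomogeneous forms is $$(F,G)_{l,m}=\sum_{i=0}^{l}\sum_{j=0}^{m}(-1)^{i+j}\binom{l}{i}\binom{m}{j}\frac{\partial^{l+m}F}{\partial x^{i}\partial y^{l-i}\partial u^{j}\partial v^{m-j}}\,\frac{\partial^{l+m}G}{\partial x^{l-i}\partial y^{i}\partial u^{m-j}\partial v^{j}},$$ and $(F,G)_l=(F,G)_{l,l}$. $f$ is stable if some homogeneous $\mathrm{SL}_2\times\mathrm{SL}_2$-invariant of positive degree does not vanish at $f$, its $\mathrm{SL}_2\times\mathrm{SL}_2$-orbit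 is closed, and its stabilizer in $\mathrm{SL}_2\times\mathrm{SL}_2$ is finite. The reduced stabilizer of $f$ is its stabilizer in $\mathrm{GL}_2\times\mathrm{GL}_2\rtimes\mathbb{Z}/2\mathbb{Z}$ modulo the subgroup of pairs of scalar matrices $(\lambda I_2,\mu I_2)$ with $(\lambda\mu)^3=1$, which acts trivially on bicubic forms.
   Formalization: Invariance of the coefficients under the exchange Z/2Z is stated only for covariants that also commute with the exchange (it fails for others, e.g. after multiplying all by a skew invariant); four such covariants are shown to exist, and SL2×SL2-invariance is stated for all. *)

theory Defs
  imports
    "HOL-Analysis.Analysis"
    "HOL-Algebra.Group_Action"
    "HOL-Algebra.Elementary_Groups"
    "HOL-Library.Poly_Mapping"
    "HOL-Library.Numeral_Type"
    "HOL-Computational_Algebra.Polynomial"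
begin

text \<open>
  The polynomial ring over \<open>'a\<close> in the variables \<open>'v\<close>; its ring structure is the
  convolution product of the library theory of finitely supported functions.
\<close>

type_synonym ('v, 'a) mpoly = "('v \<Rightarrow>\<^sub>0 nat) \<Rightarrow>\<^sub>0 'a"

abbreviation keys :: "('b \<Rightarrow>\<^sub>0 'c::zero) \<Rightarrow> 'b set" where
  "keys \<equiv> Poly_Mapping.keys"

abbreviation lookup :: "('b \<Rightarrow>\<^sub>0 'c::zero) \<Rightarrow> 'b \<Rightarrow> 'c" where
  "lookup \<equiv> Poly_Mapping.lookup"

definition Const :: "'a::zero \<Rightarrow> ('v, 'a) mpoly" where
  "Const c = Poly_Mapping.single 0 c"

definition Var :: "'v \<Rightarrow> ('v, 'a::zero_neq_one) mpoly" where
  "Var v = Poly_Mapping.single (Poly_Mapping.single v 1) 1"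

definition mp_eval :: "('v \<Rightarrow> 'a::comm_ring_1) \<Rightarrow> ('v, 'a) mpoly \<Rightarrow> 'a" where
  "mp_eval p F = (\<Sum>m\<in>keys F. lookup F m * (\<Prod>v\<in>keys m. p v ^ lookup m v))"

definition mp_subst :: "('v \<Rightarrow> ('w, 'a::comm_ring_1) mpoly) \<Rightarrow> ('v, 'a) mpoly \<Rightarrow> ('w, 'a) mpoly" where
  "mp_subst s F = (\<Sum>m\<in>keys F. Const (lookup F m) * (\<Prod>v\<in>keys m. s v ^ lookup m v))"

definition mp_deriv :: "'v \<Rightarrow> ('v, 'a::comm_ring_1) mpoly \<Rightarrow> ('v, 'a) mpoly" where
  "mp_deriv v F = (\<Sum>m\<in>keys F.
     Poly_Mapping.single (m - Poly_Mapping.single v 1) (of_nat (lookup m v) * lookup F m))"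

definition homogeneous :: "nat \<Rightarrow> ('v, 'a::zero) mpoly \<Rightarrow> bool" where
  "homogeneous d F \<longleftrightarrow> (\<forall>m\<in>keys F. (\<Sum>v\<in>keys m. lookup m v) = d)"

text \<open>
  The map \<open>b\<close> partitions the variables into blocks, and \<open>e k\<close> is the degree in block \<open>k\<close>.
\<close>

definition multihomogeneous ::
    "('v \<Rightarrow> 'k) \<Rightarrow> ('k \<Rightarrow> nat) \<Rightarrow> ('v, 'a::zero) mpoly \<Rightarrow> bool" where
  "multihomogeneous b e F \<longleftrightarrow>
     (\<forall>m\<in>keys F. \<forall>k. (\<Sum>v\<in>{v\<in>keys m. b v = k}. lookup m v) = e k)"

datatype bivar = vx | vy | vu | vv

text \<open>
  With \<open>W = K\<^sup>2\<close> and coordinate functions \<open>x, y\<close> on the first and \<open>u, v\<close> on the second copy,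
  \<open>biforms a b\<close> is the space \<open>Sym\<^sup>a(W\<^sup>*) \<otimes> Sym\<^sup>b(W\<^sup>*)\<close>.
\<close>

definition biforms :: "nat \<Rightarrow> nat \<Rightarrow> (bivar, 'a::comm_ring_1) mpoly set" where
  "biforms a b = {F. \<forall>m\<in>keys F.
     lookup m vx + lookup m vy = a \<and> lookup m vu + lookup m vv = b}"

text \<open>
  Elements of \<open>GL\<^sub>2 \<times> GL\<^sub>2 \<rtimes> \<int>/2\<int>\<close> are triples \<open>(A, B, s)\<close>, standing for \<open>(A, B) \<sigma>\<^sup>s\<close>,
  where the generator \<open>\<sigma>\<close> of \<open>\<int>/2\<int>\<close> satisfies \<open>\<sigma> (A, B) \<sigma>\<^sup>-\<^sup>1 = (B, A)\<close>.
\<close>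

type_synonym 'a bigroup_elem = "('a^2^2) \<times> ('a^2^2) \<times> bool"

fun bigroup_mult :: "'a::field bigroup_elem \<Rightarrow> 'a bigroup_elem \<Rightarrow> 'a bigroup_elem" where
  "bigroup_mult (A, B, s) (C, D, t) =
     (A ** (if s then D else C), B ** (if s then C else D), s \<noteq> t)"

definition GLxGL_Z2 :: "'a::field bigroup_elem monoid" where
  "GLxGL_Z2 = \<lparr>carrier = {(A, B, s). invertible A \<and> invertible B},
               mult = bigroup_mult, one = (mat 1, mat 1, False)\<rparr>"

definition SLxSL_Z2 :: "'a::field bigroup_elem monoid" where
  "SLxSL_Z2 = GLxGL_Z2\<lparr>carrier := {(A, B, s). det A = 1 \<and> det B = 1}\<rparr>"

definition SLxSL :: "'a::field bigroup_elem monoid" where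
  "SLxSL = GLxGL_Z2\<lparr>carrier := {(A, B, s). det A = 1 \<and> det B = 1 \<and> \<not> s}\<rparr>"

definition exchange :: "'a::field bigroup_elem" where
  "exchange = (mat 1, mat 1, True)"

fun exchange_vars :: "bivar \<Rightarrow> (bivar, 'a::field) mpoly" where
  "exchange_vars vx = Var vu"
| "exchange_vars vy = Var vv"
| "exchange_vars vu = Var vx"
| "exchange_vars vv = Var vy"

fun linear_vars :: "'a::field^2^2 \<Rightarrow> 'a^2^2 \<Rightarrow> bivar \<Rightarrow> (bivar, 'a) mpoly" where
  "linear_vars A B vx = Const (A$1$1) * Var vx + Const (A$1$2) * Var vy"
| "linear_vars A B vy = Const (A$2$1) * Var vx + Const (A$2$2) * Var vy"
| "linear_vars A B vu = Const (B$1$1) * Var vu + Const (B$1$2) * Var vv"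
| "linear_vars A B vv = Const (B$2$1) * Var vu + Const (B$2$2) * Var vv"

text \<open>
  The left action \<open>((A, B) F)(w, w') = F(A\<^sup>-\<^sup>1 w, B\<^sup>-\<^sup>1 w')\<close> on functions on \<open>W \<times> W\<close>.
\<close>

fun act :: "'a::field bigroup_elem \<Rightarrow> (bivar, 'a) mpoly \<Rightarrow> (bivar, 'a) mpoly" where
  "act (A, B, s) F = mp_subst (linear_vars (matrix_inv A) (matrix_inv B))
     (if s then mp_subst exchange_vars F else F)"

text \<open>
  The coordinates on \<open>biforms r1 r2\<close> are the coefficients of a form, so a polynomial in these
  coordinates has the monomials \<open>bivar \<Rightarrow>\<^sub>0 nat\<close> as its variables, and \<open>lookup f\<close> is the
  coordinate vector of \<open>f\<close>.
\<close>

definition hom_poly_fun ::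
    "nat \<Rightarrow> nat \<Rightarrow> nat \<Rightarrow> ((bivar, 'a::field) mpoly \<Rightarrow> 'a) \<Rightarrow> bool" where
  "hom_poly_fun r1 r2 d I \<longleftrightarrow>
     (\<exists>P :: (bivar \<Rightarrow>\<^sub>0 nat, 'a) mpoly. homogeneous d P \<and>
        (\<forall>f\<in>biforms r1 r2. I f = mp_eval (lookup f) P))"

definition covariant ::
    "nat \<Rightarrow> nat \<Rightarrow> nat \<Rightarrow> nat \<Rightarrow> ((bivar, 'a::field) mpoly \<Rightarrow> (bivar, 'a) mpoly) \<Rightarrow> bool" where
  "covariant r1 r2 l1 l2 q \<longleftrightarrow>
     q \<in> biforms r1 r2 \<rightarrow> biforms l1 l2 \<and>
     (\<exists>d. \<forall>m. hom_poly_fun r1 r2 d (\<lambda>f. lookup (q f) m)) \<and>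
     (\<forall>g\<in>carrier SLxSL. \<forall>f\<in>biforms r1 r2. q (act g f) = act g (q f))"

text \<open>
  A covariant is only required to commute with \<open>SL\<^sub>2 \<times> SL\<^sub>2\<close>; commuting with the exchange of the two
  sets of variables is an independent condition, which \<open>J q\<close> violates when \<open>q\<close> satisfies it and \<open>J\<close>
  is an \<open>SL\<^sub>2 \<times> SL\<^sub>2\<close>-invariant that changes sign under the exchange.
\<close>

definition exchange_equivariant ::
    "nat \<Rightarrow> ((bivar, 'a::field) mpoly \<Rightarrow> (bivar, 'a) mpoly) \<Rightarrow> bool" where
  "exchange_equivariant r q \<longleftrightarrow>
     (\<forall>f\<in>biforms r r. q (act exchange f) = act exchange (q f))"

definition hom_invariant ::
    "'a::field bigroup_elem monoid \<Rightarrow> nat \<Rightarrow> nat \<Rightarrow> nat \<Rightarrow> ((bivar, 'a) mpoly \<Rightarrow> 'a) \<Rightarrow> bool" where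
  "hom_invariant H r1 r2 d I \<longleftrightarrow>
     hom_poly_fun r1 r2 d I \<and> (\<forall>g\<in>carrier H. \<forall>f\<in>biforms r1 r2. I (act g f) = I f)"

definition lin_indep_at ::
    "(bivar, 'a::field) mpoly \<Rightarrow> ('i::finite \<Rightarrow> (bivar, 'a) mpoly \<Rightarrow> (bivar, 'a) mpoly) \<Rightarrow> bool" where
  "lin_indep_at f q \<longleftrightarrow>
     (\<forall>c. (\<Sum>i\<in>UNIV. Const (c i) * q i f) = 0 \<longrightarrow> (\<forall>i. c i = 0))"

definition zariski_closed_in_biforms ::
    "nat \<Rightarrow> nat \<Rightarrow> (bivar, 'a::field) mpoly set \<Rightarrow> bool" where
  "zariski_closed_in_biforms r1 r2 Z \<longleftrightarrow>
     (\<exists>T :: (bivar \<Rightarrow>\<^sub>0 nat, 'a) mpoly set.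
        Z = {h\<in>biforms r1 r2. \<forall>P\<in>T. mp_eval (lookup h) P = 0})"

definition stable_form :: "nat \<Rightarrow> nat \<Rightarrow> (bivar, 'a::field) mpoly \<Rightarrow> bool" where
  "stable_form r1 r2 f \<longleftrightarrow>
     (\<exists>d>0. \<exists>I. hom_invariant SLxSL r1 r2 d I \<and> I f \<noteq> 0) \<and>
     zariski_closed_in_biforms r1 r2 (orbit SLxSL act f) \<and>
     finite (stabilizer SLxSL act f)"

definition trivial_scalars :: "'a::field bigroup_elem set" where
  "trivial_scalars = {(mat \<alpha>, mat \<beta>, False) | \<alpha> \<beta>. (\<alpha> * \<beta>) ^ 3 = 1}"

definition reduced_stabilizer ::
    "(bivar, 'a::field) mpoly \<Rightarrow> 'a bigroup_elem set monoid" where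
  "reduced_stabilizer f =
     (GLxGL_Z2\<lparr>carrier := stabilizer GLxGL_Z2 act f\<rparr>) Mod trivial_scalars"

definition bideriv ::
    "nat \<Rightarrow> nat \<Rightarrow> nat \<Rightarrow> nat \<Rightarrow> (bivar, 'a::comm_ring_1) mpoly \<Rightarrow> (bivar, 'a) mpoly" where
  "bideriv i j k l F =
     (mp_deriv vx ^^ i) ((mp_deriv vy ^^ j) ((mp_deriv vu ^^ k) ((mp_deriv vv ^^ l) F)))"

definition transvectant ::
    "nat \<Rightarrow> nat \<Rightarrow> (bivar, 'a::comm_ring_1) mpoly \<Rightarrow> (bivar, 'a) mpoly \<Rightarrow> (bivar, 'a) mpoly" where
  "transvectant l m F G = (\<Sum>i=0..l. \<Sum>j=0..m.
     (-1) ^ (i + j) * of_nat (l choose i) * of_nat (m choose j) *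
     bideriv i (l - i) j (m - j) F * bideriv (l - i) i (m - j) j G)"

text \<open>
  In both definitions below the transvectant has bidegree \<open>(0, 0)\<close>; \<open>lookup _ 0\<close> reads the
  constant polynomial as a scalar.
\<close>

definition Q_form ::
    "(4 \<Rightarrow> (bivar, 'a::field) mpoly \<Rightarrow> (bivar, 'a) mpoly) \<Rightarrow> (bivar, 'a) mpoly \<Rightarrow> (4, 'a) mpoly" where
  "Q_form q f = (\<Sum>i\<in>UNIV. \<Sum>j\<in>UNIV.
     Const (lookup (transvectant 1 1 (q i f) (q j f)) 0) * Var i * Var j)"

definition E_form ::
    "(4 \<Rightarrow> (bivar, 'a::field) mpoly \<Rightarrow> (bivar, 'a) mpoly) \<Rightarrow> (bivar, 'a) mpoly \<Rightarrow> (4, 'a) mpoly" where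
  "E_form q f = (\<Sum>i\<in>UNIV. \<Sum>j\<in>UNIV. \<Sum>l\<in>UNIV.
     Const (lookup (transvectant 3 3 (q i f * q j f * q l f) f) 0) * Var i * Var j * Var l)"

text \<open>
  A block map \<open>b\<close> on the variables determines the product of projective spaces with one factor
  for each block, and a set \<open>S\<close> of multihomogeneous polynomials determines its closed subscheme
  \<open>V(S)\<close>. Closed points are handled through their homogeneous coordinates.
\<close>

definition valid_coords :: "('v \<Rightarrow> 'k) \<Rightarrow> ('v \<Rightarrow> 'a::zero) \<Rightarrow> bool" where
  "valid_coords b p \<longleftrightarrow> (\<forall>k. \<exists>v. b v = k \<and> p v \<noteq> 0)"

definition zero_points :: "('v \<Rightarrow> 'k) \<Rightarrow> ('v, 'a::field) mpoly set \<Rightarrow> ('v \<Rightarrow> 'a) set" where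
  "zero_points b S = {p. valid_coords b p \<and> (\<forall>F\<in>S. mp_eval p F = 0)}"

definition generated_ideal :: "('v, 'a::field) mpoly set \<Rightarrow> ('v, 'a) mpoly set" where
  "generated_ideal S = module.span (*) S"

text \<open>
  A multihomogeneous \<open>F\<close> vanishes on a neighbourhood of \<open>p\<close> in the scheme \<open>V(S)\<close> iff it lies in the
  localization of the ideal of \<open>S\<close> at \<open>p\<close>; if that ideal is radical, this says
  that the values of \<open>F\<close> vanish at all points of \<open>V(S)\<close> near \<open>p\<close>.
\<close>

definition vanishes_near ::
    "('v, 'a::field) mpoly set \<Rightarrow> ('v \<Rightarrow> 'a) \<Rightarrow> ('v, 'a) mpoly \<Rightarrow> bool" where
  "vanishes_near S p F \<longleftrightarrow> (\<exists>h. mp_eval p h \<noteq> 0 \<and> h * F \<in> generated_ideal S)"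

text \<open>
  A morphism from \<open>V(S)\<close> to \<open>V(T)\<close> is given near each point \<open>p\<close> by a tuple \<open>\<Phi> p\<close> of polynomials,
  multihomogeneous of the same multidegree within each block of target coordinates, such that the
  tuples define maps to \<open>V(T)\<close> which agree wherever two of them are defined.
\<close>

definition proj_morphism ::
    "('v \<Rightarrow> 'k) \<Rightarrow> ('v, 'a::field) mpoly set \<Rightarrow> ('w \<Rightarrow> 'l) \<Rightarrow> ('w, 'a) mpoly set \<Rightarrow>
     (('v \<Rightarrow> 'a) \<Rightarrow> 'w \<Rightarrow> ('v, 'a) mpoly) \<Rightarrow> bool" where
  "proj_morphism b S b' T \<Phi> \<longleftrightarrow>
     (\<forall>p\<in>zero_points b S.
        (\<exists>e. \<forall>w. multihomogeneous b (e (b' w)) (\<Phi> p w)) \<and>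
        valid_coords b' (\<lambda>w. mp_eval p (\<Phi> p w)) \<and>
        (\<forall>G\<in>T. vanishes_near S p (mp_subst (\<Phi> p) G)) \<and>
        (\<forall>p'\<in>zero_points b S. valid_coords b' (\<lambda>w. mp_eval p' (\<Phi> p w)) \<longrightarrow>
           (\<forall>w w'. b' w = b' w' \<longrightarrow>
              vanishes_near S p' (\<Phi> p w * \<Phi> p' w' - \<Phi> p w' * \<Phi> p' w))))"

text \<open>\<open>\<Psi>\<close> after \<open>\<Phi>\<close> is the identity morphism of \<open>V(S)\<close>.\<close>

definition left_inverse_morphism ::
    "('v \<Rightarrow> 'k) \<Rightarrow> ('v, 'a::field) mpoly set \<Rightarrow>
     (('v \<Rightarrow> 'a) \<Rightarrow> 'w \<Rightarrow> ('v, 'a) mpoly) \<Rightarrow> (('w \<Rightarrow> 'a) \<Rightarrow> 'v \<Rightarrow> ('w, 'a) mpoly) \<Rightarrow> bool" where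
  "left_inverse_morphism b S \<Phi> \<Psi> \<longleftrightarrow>
     (\<forall>p\<in>zero_points b S. \<forall>v v'. b v = b v' \<longrightarrow>
        (let y = (\<lambda>w. mp_eval p (\<Phi> p w)) in
         vanishes_near S p
           (Var v * mp_subst (\<Phi> p) (\<Psi> y v') - Var v' * mp_subst (\<Phi> p) (\<Psi> y v))))"

definition proj_isomorphic ::
    "('v \<Rightarrow> 'k) \<Rightarrow> ('v, 'a::field) mpoly set \<Rightarrow> ('w \<Rightarrow> 'l) \<Rightarrow> ('w, 'a) mpoly set \<Rightarrow> bool" where
  "proj_isomorphic b S b' T \<longleftrightarrow>
     (\<exists>\<Phi> \<Psi>. proj_morphism b S b' T \<Phi> \<and> proj_morphism b' T b S \<Psi> \<and>
        left_inverse_morphism b S \<Phi> \<Psi> \<and> left_inverse_morphism b' T \<Psi> \<Phi>)"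

fun P1xP1 :: "bivar \<Rightarrow> bool" where
  "P1xP1 vx = False"
| "P1xP1 vy = False"
| "P1xP1 vu = True"
| "P1xP1 vv = True"

definition P3 :: "4 \<Rightarrow> unit" where
  "P3 i = ()"

end

theory Submission
  imports Defs
begin

text \<open>
  Existence of covariants: the restrictions of polynomials to the closed orbit of \<open>f\<close> form an
  algebra \<open>A\<close> of polynomial functions on \<open>SL\<^sub>2 \<times> SL\<^sub>2\<close> that is stable under translation. Invariant
  integration projects all polynomial functions orthogonally onto \<open>A\<close>, so that \<open>A\<close> is detected by
  its fibre over the identity. Since the stabilizer of \<open>f\<close> is trivial up to scalars, this fibre
  consists of \<open>\<plusminus>1\<close> only (the Nullstellensatz for points, and the vanishing of infinitesimal stabilizers
  for the scheme structure). Hence every even function of bi-order \<open>(1, 1)\<close> pairs nontrivially with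
  \<open>A\<close>, and averaging \<open>P(g h) g\<^sup>-\<^sup>1 w\<close> over the group turns this into covariants whose values at \<open>f\<close> span.
  The orbits of \<open>f\<close> and of its exchange are disjoint and closed, so a polynomial separating them makes the
  covariants commute with the exchange.

  The isomorphism: for \<open>\<ell> = \<Sum> X\<^sub>i q\<^sub>i(f)\<close>, \<open>Q\<close> is twice the determinant of the \<open>2 \<times> 2\<close> coefficient
  matrix of \<open>\<ell>\<close>, and \<open>E\<close> is the transvectant of \<open>\<ell>\<^sup>3\<close> with \<open>f\<close>. On \<open>Q = 0\<close> the form \<open>\<ell>\<close> is a product of
  linear forms in \<open>(x, y)\<close> and \<open>(u, v)\<close>, and then \<open>E\<close> is \<open>1296\<close> times the value of \<open>f\<close> at
  their common zero.
\<close>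

subsection \<open>Evaluation and substitution\<close>

text \<open>The coordinate ring of the group is infinite-dimensional and the field carries no
  positivity, so the orthogonal projection cannot come from a positive form. Nondegeneracy of the
  pairing by integrals on \<open>A\<close> comes from closedness: its radical is a proper,
  translation-stable ideal of functions on the orbit, so it has a common zero there, and translation
  spreads this zero over the whole orbit. Integration is an algebraic moment functional. On each
  bounded degree it is a finite weighted sum over group elements, which keeps convolutions inside
  \<open>A\<close> and makes averages polynomial in the form. "Detected by its fibre" means: let
  \<open>\<psi>\<close> be orthogonal to \<open>A\<close> and \<open>1 - \<psi>\<close> a sum of
  \<open>a_i b_i\<close> with \<open>a_i\<close> in \<open>A\<close> vanishing at the identity.
  Projection is linear over \<open>A\<close>, so it yields \<open>1\<close> as a sum of
  \<open>a_i \<alpha>_i\<close> inside \<open>A\<close>, absurd at the identity. The fibre has two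
  points by parity: \<open>(-1, -1)\<close> fixes all forms of bidegree (3,3) and (1,1), and
  \<open>(\<alpha> \<beta>)^3 = 1\<close> with both determinants 1 leaves nothing else. The constant
  1296 is \<open>(3!)^4\<close>, two factorials for each pair of variables.\<close>

definition mp_ins :: "('a::comm_ring_1 \<Rightarrow> 'b::comm_ring_1) \<Rightarrow> ('v \<Rightarrow> 'b) \<Rightarrow> ('v, 'a) mpoly \<Rightarrow> 'b" where
  "mp_ins \<phi> s F = (\<Sum>m\<in>keys F. \<phi> (lookup F m) * (\<Prod>v\<in>keys m. s v ^ lookup m v))"

text \<open>With \<open>\<phi>\<close> the identity this is evaluation, with
  \<open>\<phi> = Const\<close> it is substitution, so the homomorphism laws of both are proved
  once.\<close>

locale coeff_hom =
  fixes \<phi> :: "'a::comm_ring_1 \<Rightarrow> 'b::comm_ring_1"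
  assumes zero: "\<phi> 0 = 0" and one: "\<phi> 1 = 1"
    and add: "\<phi> (a + b) = \<phi> a + \<phi> b" and mult: "\<phi> (a * b) = \<phi> a * \<phi> b"
begin

lemma mp_ins_superset:
  assumes "finite A" "keys F \<subseteq> A"
  shows "mp_ins \<phi> s F = (\<Sum>m\<in>A. \<phi> (lookup F m) * (\<Prod>v\<in>keys m. s v ^ lookup m v))"
  unfolding mp_ins_def
  by (rule sum.mono_neutral_left) (use assms in \<open>auto simp: in_keys_iff zero\<close>)

lemma mp_ins_zero [simp]: "mp_ins \<phi> s 0 = 0"
  by (simp add: mp_ins_def)

lemma mp_ins_add: "mp_ins \<phi> s (F + G) = mp_ins \<phi> s F + mp_ins \<phi> s G"
proof -
  let ?A = "keys F \<union> keys G"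
  have "keys (F + G) \<subseteq> ?A" by (rule Poly_Mapping.keys_add)
  then show ?thesis
    by (simp add: mp_ins_superset[of ?A] lookup_add add distrib_right sum.distrib)
qed

lemma mp_ins_sum: "mp_ins \<phi> s (sum f A) = (\<Sum>i\<in>A. mp_ins \<phi> s (f i))"
  by (induction A rule: infinite_finite_induct) (auto simp: mp_ins_add)

lemma mp_ins_single:
  "mp_ins \<phi> s (Poly_Mapping.single m c) = \<phi> c * (\<Prod>v\<in>keys m. s v ^ lookup m v)"
  by (simp add: mp_ins_superset[of "{m}"] lookup_single zero)

end

lemma keys_add_nat: "keys (m + n :: 'v \<Rightarrow>\<^sub>0 nat) = keys m \<union> keys n"
  by (auto simp: in_keys_iff lookup_add)

lemma monom_power_add:
  fixes s :: "'v \<Rightarrow> 'b::comm_monoid_mult"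
  shows "(\<Prod>v\<in>keys (m + n). s v ^ lookup (m + n) v)
    = (\<Prod>v\<in>keys m. s v ^ lookup m v) * (\<Prod>v\<in>keys n. s v ^ lookup n v)"
proof -
  have "(\<Prod>v\<in>keys m. s v ^ lookup m v) = (\<Prod>v\<in>keys (m + n). s v ^ lookup m v)"
    by (rule prod.mono_neutral_left) (auto simp: keys_add_nat in_keys_iff)
  moreover have "(\<Prod>v\<in>keys n. s v ^ lookup n v) = (\<Prod>v\<in>keys (m + n). s v ^ lookup n v)"
    by (rule prod.mono_neutral_left) (auto simp: keys_add_nat in_keys_iff)
  ultimately show ?thesis
    by (simp add: lookup_add power_add prod.distrib)
qed

lemma sum_single_lookup: "(\<Sum>m\<in>keys F. Poly_Mapping.single m (lookup F m)) = F"
  by (rule poly_mapping_eqI) (auto simp: lookup_sum lookup_single when_def in_keys_iff)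

context coeff_hom
begin

lemma mp_ins_mult: "mp_ins \<phi> s (F * G) = mp_ins \<phi> s F * mp_ins \<phi> s G"
proof -
  have "mp_ins \<phi> s (F * G) = mp_ins \<phi> s ((\<Sum>m\<in>keys F. Poly_Mapping.single m (lookup F m)) *
      (\<Sum>m\<in>keys G. Poly_Mapping.single m (lookup G m)))"
    by (simp add: sum_single_lookup)
  also have "\<dots> = mp_ins \<phi> s F * mp_ins \<phi> s G"
    unfolding sum_product mp_ins_sum mult_single mp_ins_single monom_power_add mult
    by (simp add: mp_ins_def sum_product mult_ac)
  finally show ?thesis .
qed

lemma mp_ins_one [simp]: "mp_ins \<phi> s 1 = 1"
  using mp_ins_single[of s 0 1] by (simp add: one)

end

lemma mp_eval_ins: "mp_eval p = mp_ins (\<lambda>c. c) p"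
  by (simp add: mp_eval_def mp_ins_def fun_eq_iff)

lemma mp_subst_ins: "mp_subst p = mp_ins Const p"
  by (simp add: mp_subst_def mp_ins_def fun_eq_iff)

interpretation eval_hom: coeff_hom "\<lambda>c::'a::comm_ring_1. c"
  by unfold_locales auto

lemma Const_0 [simp]: "Const 0 = 0" by (simp add: Const_def)
lemma Const_1 [simp]: "Const 1 = 1" by (simp add: Const_def)
lemma Const_add: "Const (a + b) = Const a + Const b" by (simp add: Const_def single_add)
lemma Const_mult: "Const (a * b) = Const a * Const (b::'a::comm_ring_1)"
  by (simp add: Const_def mult_single)
lemma Const_uminus: "Const (- a) = - Const (a::'a::comm_ring_1)"
  by (simp add: Const_def single_uminus)
lemma Const_power: "Const (a ^ n) = Const (a::'a::comm_ring_1) ^ n"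
  by (induction n) (simp_all only: power_0 power_Suc Const_mult Const_1)
lemma Const_sum: "Const (sum f A) = (\<Sum>i\<in>A. Const (f i :: 'a::comm_ring_1))"
  by (induction A rule: infinite_finite_induct) (auto simp: Const_add)
lemma lookup_Const: "lookup (Const c) m = (if m = 0 then c else 0)"
  by (auto simp: Const_def lookup_single when_def)

interpretation subst_hom: coeff_hom "Const :: 'a::comm_ring_1 \<Rightarrow> ('v, 'a) mpoly"
  by unfold_locales (auto simp: Const_add Const_mult)

lemma mp_eval_0 [simp]: "mp_eval p 0 = 0"
  and mp_eval_1 [simp]: "mp_eval p 1 = 1"
  and mp_eval_add [simp]: "mp_eval p (F + G) = mp_eval p F + mp_eval p G"
  and mp_eval_mult [simp]: "mp_eval p (F * G) = mp_eval p F * mp_eval p G"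
  and mp_eval_sum [simp]: "mp_eval p (sum f A) = (\<Sum>i\<in>A. mp_eval p (f i))"
  by (simp_all add: mp_eval_ins eval_hom.mp_ins_add eval_hom.mp_ins_mult eval_hom.mp_ins_sum)

lemma mp_eval_uminus [simp]: "mp_eval p (- F) = - mp_eval p F"
proof -
  have "mp_eval p (F + - F) = 0" by simp
  then show ?thesis unfolding mp_eval_add using minus_unique by metis
qed

lemma mp_eval_diff [simp]: "mp_eval p (F - G) = mp_eval p F - mp_eval p G"
  using mp_eval_add[of p F "- G"] by simp

lemma mp_eval_power [simp]: "mp_eval p (F ^ n) = mp_eval p F ^ n"
  by (induction n) auto

lemma mp_eval_prod [simp]: "mp_eval p (prod f A) = (\<Prod>i\<in>A. mp_eval p (f i))"
  by (induction A rule: infinite_finite_induct) auto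

lemma mp_eval_Const [simp]: "mp_eval p (Const c) = c"
  using eval_hom.mp_ins_single[of p 0 c] by (simp add: mp_eval_ins Const_def)

lemma mp_eval_Var [simp]: "mp_eval p (Var v) = p v"
  using eval_hom.mp_ins_single[of p "Poly_Mapping.single v 1" 1]
  by (simp add: mp_eval_ins Var_def)

lemma mp_eval_single:
  "mp_eval p (Poly_Mapping.single m c) = c * (\<Prod>v\<in>keys m. p v ^ lookup m v)"
  by (simp add: mp_eval_ins eval_hom.mp_ins_single)

lemma mp_subst_0 [simp]: "mp_subst p 0 = 0"
  and mp_subst_1 [simp]: "mp_subst p 1 = 1"
  and mp_subst_add [simp]: "mp_subst p (F + G) = mp_subst p F + mp_subst p G"
  and mp_subst_mult [simp]: "mp_subst p (F * G) = mp_subst p F * mp_subst p G"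
  and mp_subst_sum [simp]: "mp_subst p (sum f A) = (\<Sum>i\<in>A. mp_subst p (f i))"
  by (simp_all add: mp_subst_ins subst_hom.mp_ins_add subst_hom.mp_ins_mult subst_hom.mp_ins_sum)

lemma mp_subst_uminus [simp]: "mp_subst p (- F) = - mp_subst p F"
proof -
  have "mp_subst p (F + - F) = 0" by simp
  then show ?thesis unfolding mp_subst_add using minus_unique by metis
qed

lemma mp_subst_diff [simp]: "mp_subst p (F - G) = mp_subst p F - mp_subst p G"
  using mp_subst_add[of p F "- G"] by simp

lemma mp_subst_power [simp]: "mp_subst p (F ^ n) = mp_subst p F ^ n"
  by (induction n) auto

lemma mp_subst_Const [simp]: "mp_subst p (Const c) = Const c"
  using subst_hom.mp_ins_single[of p 0 c] by (simp add: mp_subst_ins Const_def)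

lemma mp_subst_Var [simp]: "mp_subst p (Var v) = p v"
  using subst_hom.mp_ins_single[of p "Poly_Mapping.single v 1" 1]
  by (simp add: mp_subst_ins Var_def)

lemma Var_power: "Var v ^ n = (Poly_Mapping.single (Poly_Mapping.single v n) 1 :: ('v, 'a::comm_ring_1) mpoly)"
  by (induction n) (auto simp: Var_def mult_single simp flip: single_add)

lemma single_eq_monom:
  "Poly_Mapping.single m c = Const c * (\<Prod>v\<in>keys m. Var v ^ lookup m v :: ('v, 'a::comm_ring_1) mpoly)"
proof -
  have "(\<Prod>v\<in>A. Var v ^ lookup m v :: ('v, 'a) mpoly)
      = Poly_Mapping.single (\<Sum>v\<in>A. Poly_Mapping.single v (lookup m v)) 1" if "finite A" for A
    using that by induction (auto simp: Var_power mult_single)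
  then show ?thesis
    by (simp add: Const_def mult_single sum_single_lookup)
qed

lemma mpoly_expand:
  "F = (\<Sum>m\<in>keys F. Const (lookup F m) * (\<Prod>v\<in>keys m. Var v ^ lookup m v))"
  for F :: "('v, 'a::comm_ring_1) mpoly"
  using sum_single_lookup[of F] by (simp add: single_eq_monom)

text \<open>Constants and variables generate the polynomial ring, so identities between ring
  homomorphisms reduce to these two cases.\<close>

lemma mpoly_induct [case_names Const Var add mult]:
  fixes F :: "('v, 'a::comm_ring_1) mpoly"
  assumes C: "\<And>c. P (Const c)" and V: "\<And>v. P (Var v)"
    and A: "\<And>F G. P F \<Longrightarrow> P G \<Longrightarrow> P (F + G)" and M: "\<And>F G. P F \<Longrightarrow> P G \<Longrightarrow> P (F * G)"
  shows "P F"
proof -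
  have pow: "P (Var v ^ n)" for v n
    by (induction n) (use C[of 1] in \<open>auto intro: M V\<close>)
  have mon: "P (\<Prod>v\<in>B. Var v ^ k v)" for B k
    by (induction B rule: infinite_finite_induct) (use C[of 1] in \<open>auto intro: M pow\<close>)
  have "P (\<Sum>m\<in>B. Const (lookup F m) * (\<Prod>v\<in>keys m. Var v ^ lookup m v))" for B
    by (induction B rule: infinite_finite_induct) (use C[of 0] in \<open>auto intro: A M C mon\<close>)
  then show ?thesis
    by (subst mpoly_expand)
qed

lemma mp_eval_subst: "mp_eval p (mp_subst s F) = mp_eval (\<lambda>v. mp_eval p (s v)) F"
  by (induction F rule: mpoly_induct) auto

lemma mp_subst_subst: "mp_subst t (mp_subst s F) = mp_subst (\<lambda>v. mp_subst t (s v)) F"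
  by (induction F rule: mpoly_induct) auto

lemma mp_subst_Var_id [simp]: "mp_subst Var F = F"
  by (induction F rule: mpoly_induct) auto

lemma mp_eval_cong_keys:
  assumes "\<And>m v. m \<in> keys F \<Longrightarrow> v \<in> keys m \<Longrightarrow> p v = p' v"
  shows "mp_eval p F = mp_eval p' F"
  unfolding mp_eval_def using assms by (intro sum.cong refl arg_cong2[of _ _ _ _ times] prod.cong) auto

text \<open>Split off one variable at a time, and use that a nonzero univariate polynomial has finitely
  many roots.\<close>

lemma poly_fun_zero_imp:
  fixes c :: "nat \<Rightarrow> 'a::{idom,ring_char_0}"
  assumes "\<And>x. (\<Sum>k\<le>n. c k * x ^ k) = 0" "k \<le> n"
  shows "c k = 0"
proof -
  define p where "p = (\<Sum>k\<le>n. monom (c k) k)"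
  have "poly p x = 0" for x
    using assms(1)[of x] by (simp add: p_def poly_sum poly_monom)
  then have "p = 0" using poly_all_0_iff_0 by blast
  moreover have "coeff p k = c k" using assms(2) by (simp add: p_def coeff_sum)
  ultimately show ?thesis by simp
qed

lemma mp_eval_eq_0_imp:
  fixes F :: "('v, 'a::{idom,ring_char_0}) mpoly"
  assumes "\<And>p. mp_eval p F = 0"
  shows "F = 0"
proof -
  \<comment> \<open>Induction over the finite set \<open>S\<close> of variables needs arbitrary
    supports \<open>M\<close> and coefficients \<open>c\<close>, because splitting off a variable
    changes both.\<close>
  have main: "\<forall>c::('v \<Rightarrow>\<^sub>0 nat) \<Rightarrow> 'a. finite M \<longrightarrow> (\<forall>m\<in>M. keys m \<subseteq> S) \<longrightarrow>
      (\<forall>p. (\<Sum>m\<in>M. c m * (\<Prod>v\<in>S. p v ^ lookup m v)) = 0) \<longrightarrow> (\<forall>m\<in>M. c m = 0)"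
    if "finite S" for S and M
    using that
  proof (induction S arbitrary: M rule: finite_induct)
    case empty
    show ?case
    proof (intro allI impI)
      fix c :: "('v \<Rightarrow>\<^sub>0 nat) \<Rightarrow> 'a"
      assume h: "finite M" "\<forall>m\<in>M. keys m \<subseteq> {}"
        "\<forall>p::'v \<Rightarrow> 'a. (\<Sum>m\<in>M. c m * (\<Prod>v\<in>{}. p v ^ lookup m v)) = 0"
      then have "M \<subseteq> {0}" by auto
      then have "M = {} \<or> M = {0}" by auto
      then show "\<forall>m\<in>M. c m = 0" using h by auto
    qed
  next
    case (insert x S)
    show ?case
    proof (intro allI impI)
      fix c :: "('v \<Rightarrow>\<^sub>0 nat) \<Rightarrow> 'a"
      assume fin: "finite M" and k: "\<forall>m\<in>M. keys m \<subseteq> insert x S"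
        and z: "\<forall>p::'v \<Rightarrow> 'a. (\<Sum>m\<in>M. c m * (\<Prod>v\<in>insert x S. p v ^ lookup m v)) = 0"
      define N where "N = Max (insert 0 ((\<lambda>m. lookup m x) ` M))"
      have N: "lookup m x \<le> N" if "m \<in> M" for m
        unfolding N_def using fin that by (intro Max_ge) auto
      let ?M = "\<lambda>k. {m\<in>M. lookup m x = k}"
      \<comment> \<open>With the other coordinates fixed, the sum is a univariate polynomial in the
        coordinate \<open>x\<close>; its coefficients are the sums over the monomials of fixed
        exponent in \<open>x\<close>.\<close>
      have zk: "(\<Sum>m\<in>?M k. c m * (\<Prod>v\<in>S. p v ^ lookup m v)) = 0" if "k \<le> N" for k p
      proof (rule poly_fun_zero_imp[where c = "\<lambda>k. \<Sum>m\<in>?M k. c m * (\<Prod>v\<in>S. p v ^ lookup m v)", OF _ that])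
        fix t :: 'a
        have "(\<Sum>k\<le>N. (\<Sum>m\<in>?M k. c m * (\<Prod>v\<in>S. p v ^ lookup m v)) * t ^ k)
            = (\<Sum>k\<le>N. \<Sum>m\<in>?M k. c m * (\<Prod>v\<in>S. p v ^ lookup m v) * t ^ lookup m x)"
          by (simp add: sum_distrib_right)
        also have "\<dots> = (\<Sum>m\<in>M. c m * (\<Prod>v\<in>S. p v ^ lookup m v) * t ^ lookup m x)"
          using N fin by (subst sum.group) auto
        also have "\<dots> = (\<Sum>m\<in>M. c m * (\<Prod>v\<in>insert x S. (p(x := t)) v ^ lookup m v))"
        proof (intro sum.cong refl)
          fix m
          have "(\<Prod>v\<in>S. (p(x := t)) v ^ lookup m v) = (\<Prod>v\<in>S. p v ^ lookup m v)"
            using insert(2) by (intro prod.cong) auto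
          then show "c m * (\<Prod>v\<in>S. p v ^ lookup m v) * t ^ lookup m x
            = c m * (\<Prod>v\<in>insert x S. (p(x := t)) v ^ lookup m v)"
            using insert(1,2) by (simp add: mult_ac)
        qed
        also have "\<dots> = 0" using z by blast
        finally show "(\<Sum>k\<le>N. (\<Sum>m\<in>?M k. c m * (\<Prod>v\<in>S. p v ^ lookup m v)) * t ^ k) = 0" .
      qed
      show "\<forall>m\<in>M. c m = 0"
      proof
        fix m0 assume m0: "m0 \<in> M"
        let ?k = "lookup m0 x"
        \<comment> \<open>Deleting \<open>x\<close> from the monomials is injective on
          \<open>?M ?k\<close>, where the exponent of \<open>x\<close> is constant, and leaves
          monomials in \<open>S\<close> alone.\<close>
        let ?sh = "\<lambda>m. m - Poly_Mapping.single x ?k"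
        have bk: "?sh m + Poly_Mapping.single x ?k = m" if "m \<in> ?M ?k" for m
          using that by (intro poly_mapping_eqI) (auto simp: lookup_add lookup_minus lookup_single when_def)
        have inj: "inj_on ?sh (?M ?k)"
          by (rule inj_on_inverseI[where g = "\<lambda>m. m + Poly_Mapping.single x ?k"]) (rule bk)
        have lk: "lookup (?sh m) v = lookup m v" if "v \<in> S" for m v
          using that insert(2) by (auto simp: lookup_minus lookup_single when_def)
        let ?c = "\<lambda>m. c (m + Poly_Mapping.single x ?k)"
        have "\<forall>p::'v \<Rightarrow> 'a. (\<Sum>m\<in>?sh ` ?M ?k. ?c m * (\<Prod>v\<in>S. p v ^ lookup m v)) = 0"
        proof
          fix p :: "'v \<Rightarrow> 'a"
          have "(\<Sum>m\<in>?sh ` ?M ?k. ?c m * (\<Prod>v\<in>S. p v ^ lookup m v))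
              = (\<Sum>m\<in>?M ?k. ?c (?sh m) * (\<Prod>v\<in>S. p v ^ lookup (?sh m) v))"
            by (subst sum.reindex[OF inj]) simp
          also have "\<dots> = (\<Sum>m\<in>?M ?k. c m * (\<Prod>v\<in>S. p v ^ lookup m v))"
            by (intro sum.cong refl) (simp only: lk bk cong: prod.cong)
          also have "\<dots> = 0" using zk[OF N[OF m0]] by simp
          finally show "(\<Sum>m\<in>?sh ` ?M ?k. ?c m * (\<Prod>v\<in>S. p v ^ lookup m v)) = 0" .
        qed
        moreover have "\<forall>m\<in>?sh ` ?M ?k. keys m \<subseteq> S"
        proof (intro ballI subsetI)
          fix n v assume "n \<in> ?sh ` ?M ?k" and v: "v \<in> keys n"
          then obtain m where m: "m \<in> M" "lookup m x = ?k" "n = ?sh m" by auto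
          have "v \<noteq> x" "v \<in> keys m"
            using v m(2,3) by (auto simp: in_keys_iff lookup_minus lookup_single)
          then show "v \<in> S" using k m(1) by auto
        qed
        moreover have "finite (?sh ` ?M ?k)" using fin by simp
        ultimately have "\<forall>m\<in>?sh ` ?M ?k. ?c m = 0"
          using insert.IH[of "?sh ` ?M ?k", THEN spec, THEN mp, THEN mp, THEN mp, of ?c] by blast
        then have "?c (?sh m0) = 0" using m0 by blast
        then show "c m0 = 0" using bk m0 by simp
      qed
    qed
  qed
  let ?S = "\<Union>m\<in>keys F. keys m"
  have "(\<Sum>m\<in>keys F. lookup F m * (\<Prod>v\<in>?S. p v ^ lookup m v)) = 0" for p
  proof -
    have "(\<Prod>v\<in>?S. p v ^ lookup m v) = (\<Prod>v\<in>keys m. p v ^ lookup m v)" if "m \<in> keys F" for m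
      using that by (intro prod.mono_neutral_right) (auto simp: in_keys_iff)
    then show ?thesis using assms[of p] by (simp add: mp_eval_def)
  qed
  then have "\<forall>m\<in>keys F. lookup F m = 0"
    using main[of ?S "keys F"] by auto
  then show ?thesis
    by (metis in_keys_iff keys_eq_empty ex_in_conv)
qed

text \<open>The main working tool: a field of characteristic zero is infinite, so identities of
  polynomials may be checked pointwise.\<close>

lemma mp_eval_inject:
  fixes F :: "('v, 'a::{idom,ring_char_0}) mpoly"
  assumes "\<And>p. mp_eval p F = mp_eval p G"
  shows "F = G"
  using mp_eval_eq_0_imp[of "F - G"] assms by simp

subsection \<open>Linear algebra in coordinate spaces\<close>

text \<open>Gaussian elimination on the coordinates: a vector \<open>z0\<close> of \<open>X\<close>
  with nonzero \<open>k\<close>-th coordinate is used to clear that coordinate in \<open>X\<close>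
  and in \<open>e\<close>, and the functional found on the remaining coordinates is extended.
  \<open>X\<close> itself may be infinite-dimensional; only its coordinates in \<open>I\<close>
  matter.\<close>

lemma subspace_separation:
  fixes X :: "('i \<Rightarrow> 'a::field) set"
  assumes "finite I" "X \<noteq> {}"
    and lin: "\<And>x y c. x \<in> X \<Longrightarrow> y \<in> X \<Longrightarrow> (\<lambda>i. x i + c * y i) \<in> X"
    and ne: "\<And>x. x \<in> X \<Longrightarrow> \<exists>i\<in>I. x i \<noteq> e i"
  shows "\<exists>c. (\<forall>x\<in>X. (\<Sum>i\<in>I. c i * x i) = 0) \<and> (\<Sum>i\<in>I. c i * e i) \<noteq> 0"
  using assms
proof (induction I arbitrary: X e rule: finite_induct)
  case empty
  then show ?case by auto
next
  case (insert k I)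
  note ins = insert(1,2)
  show ?case
  proof (cases "\<exists>z\<in>X. z k \<noteq> 0")
    case True
    then obtain z0 where z0: "z0 \<in> X" "z0 k \<noteq> 0" by blast
    define X' where "X' = {x \<in> X. x k = 0}"
    define e' where "e' = (\<lambda>i. e i - e k / z0 k * z0 i)"
    have kill: "(\<lambda>i. x i + (- (x k / z0 k)) * z0 i) \<in> X'" if "x \<in> X" for x
      unfolding X'_def mem_Collect_eq
      by (intro conjI insert.prems(2) that z0(1)) (use z0(2) in simp)
    have "X' \<noteq> {}" using kill[OF z0(1)] by blast
    moreover have "(\<lambda>i. x i + c * y i) \<in> X'" if "x \<in> X'" "y \<in> X'" for x y c
      using that insert.prems(2) unfolding X'_def by auto
    moreover have "\<exists>i\<in>I. x i \<noteq> e' i" if x: "x \<in> X'" for x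
    proof (rule ccontr)
      assume "\<not> ?thesis"
      then have eq: "x i = e' i" if "i \<in> I" for i using that by blast
      have "(\<lambda>i. x i + e k / z0 k * z0 i) \<in> X"
        using x z0 insert.prems(2) unfolding X'_def by blast
      from insert.prems(3)[OF this] show False
        using eq x z0 unfolding X'_def e'_def by auto
    qed
    ultimately obtain c where c: "\<forall>x\<in>X'. (\<Sum>i\<in>I. c i * x i) = 0" "(\<Sum>i\<in>I. c i * e' i) \<noteq> 0"
      using insert.IH[of X' e'] by blast
    \<comment> \<open>The value at \<open>k\<close> is forced by the requirement that the functional
      annihilate \<open>z0\<close>.\<close>
    define c' where "c' = c(k := - (\<Sum>i\<in>I. c i * z0 i) / z0 k)"
    have c': "(\<Sum>i\<in>insert k I. c' i * x i) = (\<Sum>i\<in>I. c i * (x i - x k / z0 k * z0 i))" for x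
    proof -
      have "(\<Sum>i\<in>I. c' i * x i) = (\<Sum>i\<in>I. c i * x i)"
        using ins unfolding c'_def by (intro sum.cong) auto
      then have "(\<Sum>i\<in>insert k I. c' i * x i) = (\<Sum>i\<in>I. c i * x i) - x k / z0 k * (\<Sum>i\<in>I. c i * z0 i)"
        using ins by (simp add: c'_def field_simps)
      then show ?thesis by (simp add: algebra_simps sum_subtractf sum_distrib_left)
    qed
    have "(\<Sum>i\<in>insert k I. c' i * x i) = 0" if "x \<in> X" for x
      using c(1) kill[OF that] unfolding c' by auto
    moreover have "(\<Sum>i\<in>insert k I. c' i * e i) \<noteq> 0"
      using c(2) unfolding c' e'_def by simp
    ultimately show ?thesis by blast
  next
    case False
    then have z: "x k = 0" if "x \<in> X" for x using that by blast
    show ?thesis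
    proof (cases "e k = 0")
      case True
      have "\<exists>i\<in>I. x i \<noteq> e i" if "x \<in> X" for x
        using insert.prems(3)[OF that] z[OF that] True by auto
      then obtain c where c: "\<forall>x\<in>X. (\<Sum>i\<in>I. c i * x i) = 0" "(\<Sum>i\<in>I. c i * e i) \<noteq> 0"
        using insert.IH[of X e] insert.prems by blast
      then show ?thesis
        using ins True z by (intro exI[of _ c]) auto
    next
      case False
      have "(\<Sum>i\<in>insert k I. (if i = k then 1 else 0) * x i) = x k" for x :: "'i \<Rightarrow> 'a"
        using ins by (subst sum.remove[of _ k]) (auto intro!: sum.neutral)
      then show ?thesis
        using False z by (intro exI[of _ "\<lambda>i. if i = k then 1 else 0"]) auto
    qed
  qed
qed

text \<open>Duality in the finite-dimensional space of coordinates in \<open>I\<close>, for an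
  arbitrary family of vectors. It supplies the quadrature weights, the orthogonal projection, the
  tangent vectors of the fibre and the spanning set of covariants.\<close>

lemma linear_combination_or_separated:
  fixes v :: "'j \<Rightarrow> 'i \<Rightarrow> 'a::field"
  assumes I: "finite I"
  obtains (comb) T w where "finite T" "T \<subseteq> J" "\<And>i. i \<in> I \<Longrightarrow> e i = (\<Sum>j\<in>T. w j * v j i)"
  | (sep) c where "\<And>j. j \<in> J \<Longrightarrow> (\<Sum>i\<in>I. c i * v j i) = 0" "(\<Sum>i\<in>I. c i * e i) \<noteq> 0"
proof -
  define X where "X = {\<lambda>i. \<Sum>j\<in>T. w j * v j i | T w. finite T \<and> T \<subseteq> J}"
  have ne: "X \<noteq> {}" unfolding X_def by auto
  have lin: "(\<lambda>i. x i + c * y i) \<in> X" if xy: "x \<in> X" "y \<in> X" for x y c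
  proof -
    obtain T w T' w' where T: "finite T" "T \<subseteq> J" "finite T'" "T' \<subseteq> J"
      and x: "x = (\<lambda>i. \<Sum>j\<in>T. w j * v j i)" and y: "y = (\<lambda>i. \<Sum>j\<in>T'. w' j * v j i)"
      using xy unfolding X_def by blast
    let ?w = "\<lambda>j. (if j \<in> T then w j else 0) + c * (if j \<in> T' then w' j else 0)"
    have "x i + c * y i = (\<Sum>j\<in>T \<union> T'. ?w j * v j i)" for i
    proof -
      have "x i = (\<Sum>j\<in>T \<union> T'. (if j \<in> T then w j else 0) * v j i)"
        unfolding x using T by (intro sum.mono_neutral_cong_left) auto
      moreover have "y i = (\<Sum>j\<in>T \<union> T'. (if j \<in> T' then w' j else 0) * v j i)"
        unfolding y using T by (intro sum.mono_neutral_cong_left) auto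
      ultimately show ?thesis
        by (simp add: sum_distrib_left sum.distrib distrib_right mult.assoc)
    qed
    then have "(\<lambda>i. x i + c * y i) = (\<lambda>i. \<Sum>j\<in>T \<union> T'. ?w j * v j i)" by (rule ext)
    then show ?thesis unfolding X_def mem_Collect_eq using T
      by (intro exI[of _ "T \<union> T'"] exI[of _ ?w]) simp
  qed
  show thesis
  proof (cases "\<exists>x\<in>X. \<forall>i\<in>I. x i = e i")
    case True
    then obtain T w where "finite T" "T \<subseteq> J" "\<forall>i\<in>I. (\<Sum>j\<in>T. w j * v j i) = e i"
      unfolding X_def by blast
    then show ?thesis using comb[of T w] by simp
  next
    case False
    then have ne2: "\<And>x. x \<in> X \<Longrightarrow> \<exists>i\<in>I. x i \<noteq> e i" by blast
    obtain c where c: "\<forall>x\<in>X. (\<Sum>i\<in>I. c i * x i) = 0" "(\<Sum>i\<in>I. c i * e i) \<noteq> 0"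
      using subspace_separation[of I X e, OF I ne] lin ne2 by blast
    have "v j \<in> X" if "j \<in> J" for j
      unfolding X_def using that by (auto intro!: exI[of _ "{j}"] exI[of _ "\<lambda>_. 1"])
    then show ?thesis using c sep by blast
  qed
qed

subsection \<open>Ideals and the Nullstellensatz\<close>

definition ring_ideal :: "'r::comm_ring_1 set \<Rightarrow> bool" where
  "ring_ideal J \<longleftrightarrow> 0 \<in> J \<and> (\<forall>x\<in>J. \<forall>y\<in>J. x + y \<in> J) \<and> (\<forall>r. \<forall>x\<in>J. r * x \<in> J)"

lemma ring_idealI:
  assumes "0 \<in> J" "\<And>x y. x \<in> J \<Longrightarrow> y \<in> J \<Longrightarrow> x + y \<in> J" "\<And>r x. x \<in> J \<Longrightarrow> r * x \<in> J"
  shows "ring_ideal J"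
  using assms unfolding ring_ideal_def by blast

context
  fixes J :: "'r::comm_ring_1 set"
  assumes J: "ring_ideal J"
begin

lemma ideal_0: "0 \<in> J" using J by (auto simp: ring_ideal_def)
lemma ideal_add: "x \<in> J \<Longrightarrow> y \<in> J \<Longrightarrow> x + y \<in> J" using J by (auto simp: ring_ideal_def)
lemma ideal_mult: "x \<in> J \<Longrightarrow> r * x \<in> J" using J by (auto simp: ring_ideal_def)
lemma ideal_mult_right: "x \<in> J \<Longrightarrow> x * r \<in> J" using ideal_mult[of x r] by (simp add: mult.commute)
lemma ideal_uminus: "x \<in> J \<Longrightarrow> - x \<in> J" using ideal_mult[of x "-1"] by simp
lemma ideal_diff: "x \<in> J \<Longrightarrow> y \<in> J \<Longrightarrow> x - y \<in> J"
  using ideal_add[of x "- y"] ideal_uminus by simp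
lemma ideal_sum: "(\<And>i. i \<in> A \<Longrightarrow> f i \<in> J) \<Longrightarrow> sum f A \<in> J"
  by (induction A rule: infinite_finite_induct) (auto intro: ideal_0 ideal_add)
lemma ideal_cong_mult: "x - x' \<in> J \<Longrightarrow> y - y' \<in> J \<Longrightarrow> x * y - x' * y' \<in> J"
  using ideal_add[OF ideal_mult_right[of "x - x'" y] ideal_mult[of "y - y'" x']]
  by (simp add: algebra_simps)
text \<open>Elimination of one generator at a time replaces the determinant in Nakayama's lemma.\<close>

lemma nakayama_elimination:
  assumes "finite I"
    and M: "0 \<in> M" "\<And>x y. x \<in> M \<Longrightarrow> y \<in> M \<Longrightarrow> x + y \<in> M" "\<And>x y. x \<in> M \<Longrightarrow> y \<in> M \<Longrightarrow> x - y \<in> M"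
      "\<And>x y. x \<in> M \<Longrightarrow> y \<in> M \<Longrightarrow> x * y \<in> M"
    and m: "\<And>i j. i \<in> I \<Longrightarrow> j \<in> I \<Longrightarrow> m i j \<in> M"
    and t: "\<And>i. i \<in> I \<Longrightarrow> t i - (\<Sum>j\<in>I. m i j * t j) \<in> J"
  shows "\<exists>s. 1 - s \<in> M \<and> (\<forall>i\<in>I. s * t i \<in> J)"
  using assms(1) m t
proof (induction I arbitrary: m rule: finite_induct)
  case empty
  then show ?case using M(1) by (intro exI[of _ 1]) auto
next
  case (insert d I)
  \<comment> \<open>Multiplying by \<open>u\<close> instead of dividing by it eliminates
    \<open>t d\<close>. The diagonal summand of \<open>m'\<close> compensates
    \<open>t i - u * t i\<close>, and all new entries stay in \<open>M\<close>.\<close>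
  define u where "u = 1 - m d d"
  define m' where "m' i j = u * m i j + m i d * m d j + (if i = j then m d d else 0)" for i j
  have rel: "u * t d - (\<Sum>j\<in>I. m d j * t j) \<in> J"
    using insert.prems(2)[of d] insert(1,2) by (simp add: u_def algebra_simps)
  have Mm: "m' i j \<in> M" if "i \<in> I" "j \<in> I" for i j
  proof -
    have "u * m i j = m i j - m d d * m i j" by (simp add: u_def algebra_simps)
    then have "u * m i j \<in> M" using that insert.prems(1) M by simp
    then show ?thesis unfolding m'_def using that insert.prems(1) M by simp
  qed
  have "t i - (\<Sum>j\<in>I. m' i j * t j) \<in> J" if i: "i \<in> I" for i
  proof -
    have "(\<Sum>j\<in>I. m' i j * t j) = u * (\<Sum>j\<in>I. m i j * t j) + m i d * (\<Sum>j\<in>I. m d j * t j)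
        + (\<Sum>j\<in>I. (if i = j then m d d else 0) * t j)"
      by (simp add: m'_def algebra_simps sum.distrib sum_distrib_left)
    also have "(\<Sum>j\<in>I. (if i = j then m d d else 0) * t j) = m d d * t i"
      using i insert(1) by (subst sum.remove[of _ i]) (auto intro!: sum.neutral split: if_splits)
    finally have "t i - (\<Sum>j\<in>I. m' i j * t j)
        = u * (t i - (\<Sum>j\<in>insert d I. m i j * t j)) + m i d * (u * t d - (\<Sum>j\<in>I. m d j * t j))"
      using insert(1,2) by (simp add: u_def algebra_simps)
    then show ?thesis
      using insert.prems(2)[of i] i rel by (simp add: ideal_add ideal_mult)
  qed
  from insert.IH[of m', OF Mm this] obtain s where s: "1 - s \<in> M" "\<forall>i\<in>I. s * t i \<in> J" by blast
  have "s * u * t d = s * (u * t d - (\<Sum>j\<in>I. m d j * t j)) + (\<Sum>j\<in>I. m d j * (s * t j))"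
    by (simp add: algebra_simps sum_distrib_left)
  then have "s * u * t d \<in> J"
    using rel s(2) by (simp add: ideal_add ideal_mult ideal_sum)
  moreover have "s * u * t i \<in> J" if "i \<in> I" for i
    using ideal_mult[of "s * t i" u] s(2) that by (simp add: mult_ac)
  moreover {have "1 - s * u = (1 - s) + (m d d - (1 - s) * m d d)" by (simp add: u_def algebra_simps)
  moreover have "m d d \<in> M" using insert.prems(1) by simp
  ultimately have "1 - s * u \<in> M" using s(1) M(2-4) by metis}
  ultimately show ?case by blast
qed

end

text \<open>An ideal of univariate polynomials is generated by a nonzero element of least degree;
  this generator either is constant or has a root.\<close>

lemma poly_ideal_zero_or_unit:
  fixes P :: "'a::alg_closed_field poly set"
  assumes P: "ring_ideal P"
  shows "(\<exists>x. \<forall>p\<in>P. poly p x = 0) \<or> 1 \<in> P"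
proof (cases "P \<subseteq> {0}")
  case True
  then have "\<forall>p\<in>P. poly p 0 = 0" by auto
  then show ?thesis by blast
next
  case False
  define p where "p = arg_min degree (\<lambda>p. p \<in> P \<and> p \<noteq> 0)"
  have p: "p \<in> P" "p \<noteq> 0" and min: "\<And>q. q \<in> P \<Longrightarrow> q \<noteq> 0 \<Longrightarrow> degree p \<le> degree q"
    using False arg_min_nat_lemma[of "\<lambda>p. p \<in> P \<and> p \<noteq> 0" _ degree] unfolding p_def by auto
  show ?thesis
  proof (cases "degree p = 0")
    case True
    then obtain c where c: "p = [:c:]" "c \<noteq> 0" using p(2) by (metis degree_eq_zeroE pCons_0_0)
    have "[:1 / c:] * p \<in> P" using ideal_mult[OF P p(1)] .
    then show ?thesis using c by (simp add: one_pCons)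
  next
    case False
    then obtain x where x: "poly p x = 0" using alg_closed_imp_poly_has_root by blast
    have "poly q x = 0" if q: "q \<in> P" for q
    proof -
      have "q - q div p * p \<in> P" using q p(1) P by (intro ideal_diff ideal_mult)
      then have "q mod p \<in> P" by (simp add: minus_div_mult_eq_mod)
      moreover have "q mod p = 0 \<or> degree (q mod p) < degree p" using p(2) degree_mod_less by blast
      ultimately have "q mod p = 0" using min[of "q mod p"] by fastforce
      then have "q = q div p * p" by (metis div_mult_mod_eq add.right_neutral)
      then show ?thesis using x by (metis mult_zero_right poly_mult)
    qed
    then show ?thesis by blast
  qed
qed

section \<open>Weak Nullstellensatz by projection along a line\<close>

definition mdeg :: "('v \<Rightarrow>\<^sub>0 nat) \<Rightarrow> nat" where
  "mdeg m = (\<Sum>v\<in>keys m. lookup m v)"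

lemma keys_nonempty: "m \<noteq> 0 \<Longrightarrow> keys m \<noteq> {}"
proof
  assume "m \<noteq> 0" "keys m = {}"
  then have "m = 0" by (intro poly_mapping_eqI) (auto simp: in_keys_iff)
  with \<open>m \<noteq> 0\<close> show False ..
qed

lemma mdeg_eq_0: "mdeg m = 0 \<Longrightarrow> m = 0"
  unfolding mdeg_def by (intro poly_mapping_eqI) (auto simp: in_keys_iff)

lemma single_in_ideal:
  fixes J :: "('v, 'a::comm_ring_1) mpoly set"
  assumes J: "ring_ideal J" and v: "Var v \<in> J" "v \<in> keys m"
  shows "Poly_Mapping.single m c \<in> J"
proof -
  have "m = (m - Poly_Mapping.single v 1) + Poly_Mapping.single v 1"
    using v(2) by (intro poly_mapping_eqI) (auto simp: lookup_add lookup_minus lookup_single when_def in_keys_iff)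
  then have "Poly_Mapping.single m c = Poly_Mapping.single (m - Poly_Mapping.single v 1) c * Var v"
    by (metis Var_def mult_single mult.right_neutral)
  then show ?thesis using ideal_mult[OF J v(1)] by simp
qed

text \<open>The geometry of the induction step. \<open>c\<close> is the direction of projection,
  \<open>T\<close> the coordinate along it, normalised to 1 on \<open>c\<close>, and
  \<open>B\<close> consists of polynomials in the coordinates \<open>\<rho>\<close>, which are
  constant along \<open>c\<close>. The line \<open>pt\<close> runs through the point
  \<open>a\<close> in direction \<open>c\<close>.\<close>

locale nss_step =
  fixes J :: "('v, 'a::{alg_closed_field,field_char_0}) mpoly set"
    and S :: "'v set" and x :: 'v and c a :: "'v \<Rightarrow> 'a"
  assumes J: "ring_ideal J" and x: "x \<in> S" "c x \<noteq> 0"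
    and c_out: "\<And>v. v \<notin> S \<Longrightarrow> c v = 0" and a_out: "\<And>v. v \<notin> S - {x} \<Longrightarrow> a v = 0"
    and out: "\<And>v. v \<notin> S \<Longrightarrow> Var v \<in> J"
begin

definition T :: "('v, 'a) mpoly" where "T = Const (1 / c x) * Var x"

definition \<rho> :: "'v \<Rightarrow> ('v, 'a) mpoly" where
  "\<rho> v = (if v \<in> S - {x} then Var v - Const (c v) * T else 0)"

definition pt :: "'a \<Rightarrow> 'v \<Rightarrow> 'a" where "pt \<tau> = (\<lambda>v. a v + \<tau> * c v)"

definition B :: "('v, 'a) mpoly set" where "B = range (mp_subst \<rho>)"

lemma B_add: "F \<in> B \<Longrightarrow> G \<in> B \<Longrightarrow> F + G \<in> B"
  unfolding B_def by (auto simp flip: mp_subst_add)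

lemma B_mult: "F \<in> B \<Longrightarrow> G \<in> B \<Longrightarrow> F * G \<in> B"
  unfolding B_def by (auto simp flip: mp_subst_mult)

lemma B_uminus: "F \<in> B \<Longrightarrow> - F \<in> B"
  unfolding B_def by (auto simp flip: mp_subst_uminus)

lemma B_Const: "Const k \<in> B"
  unfolding B_def by (metis mp_subst_Const rangeI)

lemma B_0: "0 \<in> B" using B_Const[of 0] by simp

lemma B_sum: "(\<And>i. i \<in> A \<Longrightarrow> f i \<in> B) \<Longrightarrow> sum f A \<in> B"
  by (induction A rule: infinite_finite_induct) (auto intro: B_0 B_add)

lemma pt_rho: "mp_eval (pt \<tau>) (mp_subst \<rho> r) = mp_eval a r"
proof -
  have "mp_eval (pt \<tau>) (\<rho> v) = a v" for v
    using x a_out[of x] a_out[of v] by (auto simp: \<rho>_def pt_def T_def field_simps)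
  then show ?thesis by (simp add: mp_eval_subst)
qed

lemma pt_T: "mp_eval (pt \<tau>) T = \<tau>"
  using x a_out[of x] by (simp add: T_def pt_def)

text \<open>\<open>dec n \<kappa> F\<close>: modulo \<open>J\<close>, \<open>F\<close> is a polynomial in \<open>T\<close> of degree at most \<open>n\<close> over \<open>B\<close> whose
  coefficient of \<open>T\<^sup>n\<close> is the constant \<open>\<kappa>\<close>.\<close>

definition dec :: "nat \<Rightarrow> 'a \<Rightarrow> ('v, 'a) mpoly \<Rightarrow> bool" where
  "dec n \<kappa> F \<longleftrightarrow> (\<exists>R. range (coeff R) \<subseteq> B \<and> degree R \<le> n \<and> coeff R n = Const \<kappa> \<and>
     F - poly R T \<in> J \<and> (\<forall>\<tau>. mp_eval (pt \<tau>) F = mp_eval (pt \<tau>) (poly R T)))"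

lemma dec_add: "dec n \<kappa> F \<Longrightarrow> dec n \<kappa>' G \<Longrightarrow> dec n (\<kappa> + \<kappa>') (F + G)"
proof -
  assume "dec n \<kappa> F" "dec n \<kappa>' G"
  then obtain R R' where R: "range (coeff R) \<subseteq> B" "degree R \<le> n" "coeff R n = Const \<kappa>"
     "F - poly R T \<in> J" "\<And>\<tau>. mp_eval (pt \<tau>) F = mp_eval (pt \<tau>) (poly R T)"
    and R': "range (coeff R') \<subseteq> B" "degree R' \<le> n" "coeff R' n = Const \<kappa>'"
     "G - poly R' T \<in> J" "\<And>\<tau>. mp_eval (pt \<tau>) G = mp_eval (pt \<tau>) (poly R' T)"
    unfolding dec_def by blast
  have "range (coeff (R + R')) \<subseteq> B" using R(1) R'(1) B_add by (auto simp: image_subset_iff)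
  moreover have "F + G - poly (R + R') T \<in> J"
    using ideal_add[OF J R(4) R'(4)] by (simp add: algebra_simps)
  ultimately show ?thesis
    unfolding dec_def using R R'
    by (intro exI[of _ "R + R'"]) (auto simp: degree_add_le Const_add)
qed

lemma coeff_mult_top:
  fixes p q :: "'r::comm_ring_1 poly"
  assumes "degree p \<le> n" "degree q \<le> m"
  shows "coeff (p * q) (n + m) = coeff p n * coeff q m"
proof -
  have "coeff (p * q) (n + m) = (\<Sum>i\<le>n + m. coeff p i * coeff q (n + m - i))"
    by (rule coeff_mult)
  also have "\<dots> = (\<Sum>i\<in>{n}. coeff p i * coeff q (n + m - i))"
  proof (rule sum.mono_neutral_right)
    show "\<forall>i\<in>{..n + m} - {n}. coeff p i * coeff q (n + m - i) = 0"
    proof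
      fix i assume "i \<in> {..n + m} - {n}"
      then have "i > degree p \<or> n + m - i > degree q" using assms by auto
      then show "coeff p i * coeff q (n + m - i) = 0" by (auto simp: coeff_eq_0)
    qed
  qed auto
  finally show ?thesis by simp
qed

lemma dec_mult: "dec n \<kappa> F \<Longrightarrow> dec m \<kappa>' G \<Longrightarrow> dec (n + m) (\<kappa> * \<kappa>') (F * G)"
proof -
  assume "dec n \<kappa> F" "dec m \<kappa>' G"
  then obtain R R' where R: "range (coeff R) \<subseteq> B" "degree R \<le> n" "coeff R n = Const \<kappa>"
     "F - poly R T \<in> J" "\<And>\<tau>. mp_eval (pt \<tau>) F = mp_eval (pt \<tau>) (poly R T)"
    and R': "range (coeff R') \<subseteq> B" "degree R' \<le> m" "coeff R' m = Const \<kappa>'"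
     "G - poly R' T \<in> J" "\<And>\<tau>. mp_eval (pt \<tau>) G = mp_eval (pt \<tau>) (poly R' T)"
    unfolding dec_def by blast
  have "coeff (R * R') k \<in> B" for k
    unfolding coeff_mult using R(1) R'(1) by (auto intro!: B_sum B_mult)
  then have "range (coeff (R * R')) \<subseteq> B" by blast
  moreover have "F * G - poly (R * R') T \<in> J"
    using ideal_cong_mult[OF J R(4) R'(4)] by simp
  moreover have "degree (R * R') \<le> n + m"
    using degree_mult_le[of R R'] R(2) R'(2) by linarith
  ultimately show ?thesis
    unfolding dec_def using R R'
    by (intro exI[of _ "R * R'"]) (auto simp: coeff_mult_top Const_mult)
qed

lemma dec_Const: "dec 0 k (Const k)"
  unfolding dec_def using ideal_0[OF J] B_Const B_0
  by (intro exI[of _ "[:Const k:]"]) (auto simp: coeff_pCons split: nat.split)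

lemma dec_Var: "dec 1 (c v) (Var v)"
proof -
  let ?R = "[:mp_subst \<rho> (Var v), Const (c v):]"
  have "range (coeff ?R) \<subseteq> B"
    using B_Const B_0 by (auto simp: coeff_pCons B_def split: nat.split simp del: mp_subst_Var)
  moreover have eq: "Var v - poly ?R T = (if v \<in> S then 0 else Var v)"
    using x c_out[of v] by (intro mp_eval_inject) (auto simp: \<rho>_def T_def)
  then have "Var v - poly ?R T \<in> J"
    using out ideal_0[OF J] by auto
  moreover have "mp_eval (pt \<tau>) (Var v) = mp_eval (pt \<tau>) (poly ?R T)" for \<tau>
  proof -
    have "mp_eval (pt \<tau>) (Var v - poly ?R T) = 0"
      unfolding eq using c_out[of v] a_out[of v] by (auto simp: pt_def)
    then show ?thesis by (simp del: poly_pCons)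
  qed
  ultimately show ?thesis
    unfolding dec_def by (intro exI[of _ ?R]) (auto simp: coeff_pCons split: nat.split)
qed

lemma dec_raise: "dec n \<kappa> F \<Longrightarrow> n < m \<Longrightarrow> dec m 0 F"
proof -
  assume "dec n \<kappa> F" "n < m"
  then obtain R where R: "range (coeff R) \<subseteq> B" "degree R \<le> n" "F - poly R T \<in> J"
      "\<forall>\<tau>. mp_eval (pt \<tau>) F = mp_eval (pt \<tau>) (poly R T)"
    unfolding dec_def by blast
  moreover have "degree R \<le> m" "coeff R m = Const 0"
    using R(2) \<open>n < m\<close> by (auto simp: coeff_eq_0)
  ultimately show ?thesis
    unfolding dec_def by blast
qed

lemma dec_sum:
  assumes "\<And>i. i \<in> A \<Longrightarrow> dec n (\<kappa> i) (f i)"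
  shows "dec n (sum \<kappa> A) (sum f A)"
proof -
  have 0: "dec n 0 0"
    using dec_Const[of 0] dec_raise[of 0 0 0 n] by (cases n) auto
  show ?thesis
    using assms by (induction A rule: infinite_finite_induct) (auto intro: dec_add 0)
qed

lemma dec_monom: "dec (mdeg m) (k * (\<Prod>v\<in>keys m. c v ^ lookup m v)) (Poly_Mapping.single m k)"
proof -
  have pow: "dec n (c v ^ n) (Var v ^ n)" for v n
    by (induction n) (use dec_Const[of 1] dec_mult[OF dec_Var] in auto)
  have "dec (\<Sum>v\<in>A. lookup m v) (\<Prod>v\<in>A. c v ^ lookup m v) (\<Prod>v\<in>A. Var v ^ lookup m v)" for A
    by (induction A rule: infinite_finite_induct) (use dec_Const[of 1] pow in \<open>auto intro: dec_mult\<close>)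
  from dec_mult[OF dec_Const this[of "keys m"]] show ?thesis
    by (simp add: mdeg_def single_eq_monom)
qed

lemma dec_ex: "\<exists>n \<kappa>. dec n \<kappa> F"
proof (induction F rule: mpoly_induct)
  case (add F G)
  then obtain n \<kappa> m \<kappa>' where nm: "dec n \<kappa> F" "dec m \<kappa>' G" by blast
  have "dec (Suc (n + m)) 0 F" "dec (Suc (n + m)) 0 G"
    using dec_raise[OF nm(1)] dec_raise[OF nm(2)] by auto
  then show ?case using dec_add by blast
qed (use dec_Const dec_Var dec_mult in blast)+

text \<open>Elements of \<open>B\<close> are constant on the line \<open>pt\<close>, while
  \<open>T\<close> is its parameter.\<close>

lemma poly_B_eval:
  assumes "range (coeff R) \<subseteq> B"
  obtains p where "\<And>\<tau>. mp_eval (pt \<tau>) (poly R T) = poly p \<tau>" "\<And>k. coeff p k = mp_eval (pt 0) (coeff R k)"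
proof -
  let ?p = "\<Sum>k\<le>degree R. monom (mp_eval (pt 0) (coeff R k)) k"
  have ev: "mp_eval (pt \<tau>) (coeff R k) = mp_eval (pt 0) (coeff R k)" for \<tau> k
  proof -
    obtain r where "coeff R k = mp_subst \<rho> r" using assms unfolding B_def by blast
    then show ?thesis by (simp add: pt_rho)
  qed
  have "mp_eval (pt \<tau>) (poly R T) = poly ?p \<tau>" for \<tau>
    by (simp add: poly_altdef[of R] poly_sum poly_monom pt_T ev[of \<tau>])
  moreover have "coeff ?p k = mp_eval (pt 0) (coeff R k)" for k
    by (auto simp: coeff_sum coeff_eq_0)
  ultimately show ?thesis using that by blast
qed

text \<open>Lying over: \<open>F0\<close> makes \<open>T\<close> integral over \<open>B\<close>
  modulo \<open>J\<close>, so the quotient by \<open>J\<close> is generated over \<open>B\<close> by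
  the powers of \<open>T\<close> below \<open>d\<close>. An \<open>F\<close> in \<open>J\<close>
  equal to 1 on the line would put all coefficients of \<open>1 - F\<close> into the maximal ideal
  \<open>M\<close> of \<open>a\<close>, so that \<open>M\<close> times this finite module is
  everything. Nakayama then gives an \<open>s\<close> in \<open>J\<close> and \<open>B\<close> with
  \<open>1 - s\<close> in \<open>M\<close>, against the choice of \<open>a\<close>.\<close>

lemma proper_contradiction:
  assumes one: "1 \<notin> J" and a: "\<And>F. mp_subst \<rho> F \<in> J \<Longrightarrow> mp_eval a F = 0"
    and F0: "F0 \<in> J" "dec d \<kappa> F0" "\<kappa> \<noteq> 0" "d > 0"
    and F: "F \<in> J" "\<And>\<tau>. mp_eval (pt \<tau>) F = 1"
  shows False
proof -
  note ideal = ideal_0[OF J] ideal_add[OF J] ideal_mult[OF J] ideal_diff[OF J] ideal_sum[OF J]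
  obtain R0 where R0: "range (coeff R0) \<subseteq> B" "degree R0 \<le> d" "coeff R0 d = Const \<kappa>"
    "F0 - poly R0 T \<in> J"
    using F0(2) unfolding dec_def by blast
  \<comment> \<open>Coefficients of the monic relation for \<open>T ^ d\<close> obtained by dividing
    \<open>F0\<close> by its leading constant \<open>\<kappa>\<close>.\<close>
  define b where "b k = - Const (1 / \<kappa>) * coeff R0 k" for k
  have bB: "b k \<in> B" for k
    unfolding b_def using R0(1) by (auto intro!: B_mult B_uminus B_Const)
  have monic: "T ^ d - (\<Sum>k<d. b k * T ^ k) \<in> J"
  proof -
    have "poly R0 T = (\<Sum>k\<le>d. coeff R0 k * T ^ k)"
      unfolding poly_altdef
      by (rule sum.mono_neutral_left) (use R0(2) in \<open>auto simp: coeff_eq_0\<close>)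
    also have "\<dots> = (\<Sum>k<d. coeff R0 k * T ^ k) + Const \<kappa> * T ^ d"
      by (simp add: R0(3) flip: lessThan_Suc_atMost)
    finally have e: "Const (1 / \<kappa>) * poly R0 T
        = Const (1 / \<kappa>) * (\<Sum>k<d. coeff R0 k * T ^ k) + (Const (1 / \<kappa>) * Const \<kappa>) * T ^ d"
      by (simp add: algebra_simps)
    have k1: "Const (1 / \<kappa>) * Const \<kappa> = (1 :: ('v, 'a) mpoly)"
      using F0(3) by (simp flip: Const_mult)
    have "T ^ d - (\<Sum>k<d. b k * T ^ k) = Const (1 / \<kappa>) * poly R0 T"
      unfolding e k1 b_def by (simp add: sum_distrib_left sum_negf mult.assoc)
    moreover have "poly R0 T \<in> J" using ideal(4)[OF F0(1) R0(4)] by simp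
    ultimately show ?thesis using ideal(3) by simp
  qed
  have "\<exists>\<beta>. (\<forall>j. \<beta> j \<in> B) \<and> T ^ n - (\<Sum>j<d. \<beta> j * T ^ j) \<in> J" for n
  proof (induction n)
    case 0
    have "(\<Sum>j<d. (if j = 0 then 1 else 0) * T ^ j) = (\<Sum>j\<in>{0}. (if j = 0 then 1 else 0) * T ^ j)"
      using F0(4) by (intro sum.mono_neutral_right) auto
    then show ?case
      using B_Const[of 1] B_0 ideal(1) by (intro exI[of _ "\<lambda>j. if j = 0 then 1 else 0"]) auto
  next
    case (Suc n)
    then obtain \<beta> where \<beta>: "\<And>j. \<beta> j \<in> B" "T ^ n - (\<Sum>j<d. \<beta> j * T ^ j) \<in> J" by blast
    obtain d' where d: "d = Suc d'" using F0(4) gr0_conv_Suc by blast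
    \<comment> \<open>Multiplication by \<open>T\<close> shifts the coefficients; the overflowing
      top term \<open>T ^ d\<close> is rewritten with \<open>b\<close>.\<close>
    define \<beta>' where "\<beta>' k = (if k = 0 then 0 else \<beta> (k - 1)) + \<beta> d' * b k" for k
    have "(\<Sum>j<d. \<beta>' j * T ^ j) = (\<Sum>j<d. (if j = 0 then 0 else \<beta> (j - 1)) * T ^ j) + \<beta> d' * (\<Sum>k<d. b k * T ^ k)"
      by (simp add: \<beta>'_def algebra_simps sum.distrib sum_distrib_left)
    also have "(\<Sum>j<d. (if j = 0 then 0 else \<beta> (j - 1)) * T ^ j) = (\<Sum>j<d'. \<beta> j * T ^ Suc j)"
      unfolding d by (subst sum.lessThan_Suc_shift) simp
    finally have "T ^ Suc n - (\<Sum>j<d. \<beta>' j * T ^ j)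
       = T * (T ^ n - (\<Sum>j<d. \<beta> j * T ^ j)) + \<beta> d' * (T ^ d - (\<Sum>k<d. b k * T ^ k))"
      unfolding d by (simp add: algebra_simps sum_distrib_left)
    then have "T ^ Suc n - (\<Sum>j<d. \<beta>' j * T ^ j) \<in> J"
      using \<beta>(2) monic ideal by simp
    moreover have "\<beta>' j \<in> B" for j
      unfolding \<beta>'_def using \<beta>(1) bB B_0 by (auto intro!: B_add B_mult)
    ultimately show ?case by blast
  qed
  then have "\<forall>n. \<exists>\<beta>. (\<forall>j. \<beta> j \<in> B) \<and> T ^ n - (\<Sum>j<d. \<beta> j * T ^ j) \<in> J" by blast
  from choice[OF this] obtain \<beta> where
    \<beta>: "\<And>n j. \<beta> n j \<in> B" "\<And>n. T ^ n - (\<Sum>j<d. \<beta> n j * T ^ j) \<in> J" by blast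
  obtain n \<kappa>' where "dec n \<kappa>' (1 - F)" using dec_ex by blast
  then obtain R where R: "range (coeff R) \<subseteq> B" "(1 - F) - poly R T \<in> J"
    "\<And>\<tau>. mp_eval (pt \<tau>) (1 - F) = mp_eval (pt \<tau>) (poly R T)"
    unfolding dec_def by blast
  \<comment> \<open>The maximal ideal of \<open>B\<close> at the point \<open>a\<close>.\<close>
  define M where "M = mp_subst \<rho> ` {r. mp_eval a r = 0}"
  have RM: "coeff R k \<in> M" for k
  proof -
    obtain p where p: "\<And>\<tau>. mp_eval (pt \<tau>) (poly R T) = poly p \<tau>"
       "\<And>k. coeff p k = mp_eval (pt 0) (coeff R k)" using poly_B_eval[OF R(1)] by blast
    have "poly p \<tau> = 0" for \<tau>
      using R(3)[of \<tau>] F(2)[of \<tau>] p(1)[of \<tau>] by simp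
    then have "p = 0" using poly_all_0_iff_0 by blast
    then have "mp_eval (pt 0) (coeff R k) = 0" using p(2)[of k] by simp
    moreover obtain r where "coeff R k = mp_subst \<rho> r" using R(1) unfolding B_def by blast
    ultimately show ?thesis unfolding M_def by (auto simp: pt_rho)
  qed
  have M0: "0 \<in> M" unfolding M_def by (rule image_eqI[of _ _ 0]) simp_all
  have M_add: "u + w \<in> M" and M_diff: "u - w \<in> M" if "u \<in> M" "w \<in> M" for u w
    using that unfolding M_def by (auto simp flip: mp_subst_add mp_subst_diff)
  have M_mult: "u * w \<in> M" if "u \<in> M" "w \<in> B" for u w
    using that unfolding M_def B_def by (auto simp flip: mp_subst_mult)
  have MB: "M \<subseteq> B" unfolding M_def B_def by blast
  have M_sum: "sum f A \<in> M" if "\<And>i. i \<in> A \<Longrightarrow> f i \<in> M" for f and A :: "nat set"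
    using that by (induction A rule: infinite_finite_induct) (auto intro: M0 M_add)
  \<comment> \<open>Modulo \<open>J\<close>, \<open>1\<close> equals \<open>poly R T\<close>;
    multiplying by \<open>T ^ i\<close> and reducing all powers of \<open>T\<close> below
    \<open>d\<close> gives a linear system with coefficients in \<open>M\<close>.\<close>
  define m where "m i j = (\<Sum>k\<le>degree R. coeff R k * \<beta> (k + i) j)" for i j
  have mM: "m i j \<in> M" for i j
    unfolding m_def using RM \<beta>(1) by (auto intro!: M_sum M_mult)
  have rel: "T ^ i - (\<Sum>j<d. m i j * T ^ j) \<in> J" for i
  proof -
    have "1 - poly R T \<in> J" using ideal(2)[OF R(2) F(1)] by simp
    then have "T ^ i * (1 - poly R T) \<in> J" using ideal(3) by blast
    moreover have "T ^ i * (1 - poly R T) = T ^ i - (\<Sum>k\<le>degree R. coeff R k * T ^ (k + i))"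
      by (simp add: poly_altdef algebra_simps sum_distrib_left power_add)
    moreover have "(\<Sum>k\<le>degree R. coeff R k * (T ^ (k + i) - (\<Sum>j<d. \<beta> (k + i) j * T ^ j))) \<in> J"
      using \<beta>(2) ideal by (auto intro!: ideal(5))
    moreover have "(\<Sum>k\<le>degree R. coeff R k * (T ^ (k + i) - (\<Sum>j<d. \<beta> (k + i) j * T ^ j)))
        = (\<Sum>k\<le>degree R. coeff R k * T ^ (k + i)) - (\<Sum>j<d. m i j * T ^ j)"
    proof -
      have "(\<Sum>k\<le>degree R. coeff R k * (\<Sum>j<d. \<beta> (k + i) j * T ^ j)) = (\<Sum>j<d. m i j * T ^ j)"
        unfolding m_def sum_distrib_left sum_distrib_right by (subst sum.swap) (simp add: mult.assoc)
      then show ?thesis by (simp add: right_diff_distrib sum_subtractf)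
    qed
    ultimately show ?thesis using ideal(2) by fastforce
  qed
  have "\<exists>s. 1 - s \<in> M \<and> (\<forall>i\<in>{..<d}. s * T ^ i \<in> J)"
    by (rule nakayama_elimination[OF J _ M0 M_add M_diff M_mult mM rel]) (use MB in auto)
  then obtain s where s: "1 - s \<in> M" "\<forall>i\<in>{..<d}. s * T ^ i \<in> J" by blast
  \<comment> \<open>The case \<open>i = 0\<close>, available because \<open>d > 0\<close>.\<close>
  have "s \<in> J" using s(2) F0(4) by force
  obtain r where r: "1 - s = mp_subst \<rho> r" "mp_eval a r = 0" using s(1) unfolding M_def by blast
  have "s = mp_subst \<rho> (1 - r)" using r(1) by (simp add: algebra_simps)
  then have "mp_eval a (1 - r) = 0" using a[of "1 - r"] \<open>s \<in> J\<close> by metis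
  then show False using r(2) by simp
qed

end

text \<open>Induction on \<open>card S\<close>. The coefficient coordinates of forms are indexed by
  all monomials, an infinite type; putting the variables outside \<open>S\<close> into
  \<open>J\<close> confines the problem to finitely many.\<close>

theorem nullstellensatz:
  fixes J :: "('v, 'a::{alg_closed_field,field_char_0}) mpoly set"
  assumes "finite S" "ring_ideal J" "1 \<notin> J" "\<And>v. v \<notin> S \<Longrightarrow> Var v \<in> J"
  shows "\<exists>p. \<forall>F\<in>J. mp_eval p F = 0"
  using assms
proof (induction "card S" arbitrary: S J rule: less_induct)
  case less
  note J = less.prems(2) and out = less.prems(4)
  \<comment> \<open>Dropping the monomials with a variable outside \<open>S\<close> changes a
    polynomial only by an element of \<open>J\<close>, so a polynomial in the variables of
    \<open>S\<close> can be selected and a direction supported in \<open>S\<close> chosen.\<close>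
  define cut where "cut F = (\<Sum>m\<in>{m \<in> keys F. keys m \<subseteq> S}. Poly_Mapping.single m (lookup F m))"
    for F :: "('v, 'a) mpoly"
  have cut: "F - cut F \<in> J" for F
  proof -
    have "F = (\<Sum>m\<in>keys F. Poly_Mapping.single m (lookup F m))" by (simp add: sum_single_lookup)
    also have "\<dots> = cut F + (\<Sum>m\<in>keys F - {m \<in> keys F. keys m \<subseteq> S}. Poly_Mapping.single m (lookup F m))"
      unfolding cut_def by (subst sum.subset_diff[of "{m \<in> keys F. keys m \<subseteq> S}"]) auto
    finally have eq: "F = cut F + (\<Sum>m\<in>keys F - {m \<in> keys F. keys m \<subseteq> S}. Poly_Mapping.single m (lookup F m))" .
    have "F - cut F = (\<Sum>m\<in>keys F - {m \<in> keys F. keys m \<subseteq> S}. Poly_Mapping.single m (lookup F m))"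
      unfolding diff_eq_eq add.commute[of _ "cut F"] by (rule eq)
    also have "\<dots> \<in> J"
    proof (rule ideal_sum[OF J])
      fix m assume "m \<in> keys F - {m \<in> keys F. keys m \<subseteq> S}"
      then obtain v where "v \<in> keys m" "v \<notin> S" by blast
      then show "Poly_Mapping.single m (lookup F m) \<in> J" using single_in_ideal[OF J out] by blast
    qed
    finally show ?thesis .
  qed
  show ?case
  proof (cases "\<forall>F\<in>J. cut F = 0")
    \<comment> \<open>Then every element of \<open>J\<close> has constant term zero, so the origin
      is a common zero.\<close>
    case True
    have "mp_eval (\<lambda>_. 0) F = 0" if F: "F \<in> J" for F
    proof -
      have "mp_eval (\<lambda>_. 0) F = lookup F 0"
      proof -
        have "mp_eval (\<lambda>_. 0) F = (\<Sum>m\<in>keys F. if m = 0 then lookup F m else 0)"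
          unfolding mp_eval_def
        proof (intro sum.cong refl)
          fix m :: "'v \<Rightarrow>\<^sub>0 nat"
          have "(\<Prod>v\<in>keys m. (0 :: 'a) ^ lookup m v) = 0" if m: "m \<noteq> 0"
          proof -
            obtain v where "v \<in> keys m" using keys_nonempty[OF m] by blast
            then show ?thesis by (intro prod_zero) (auto simp: in_keys_iff)
          qed
          then show "lookup F m * (\<Prod>v\<in>keys m. 0 ^ lookup m v) = (if m = 0 then lookup F m else 0)"
            by (cases "m = 0") simp_all
        qed
        then show ?thesis by (simp add: in_keys_iff)
      qed
      also have "lookup F 0 = lookup (cut F) 0"
        by (auto simp: cut_def lookup_sum lookup_single when_def in_keys_iff)
      finally show ?thesis using True F by simp
    qed
    then show ?thesis by blast
  next
    case False
    then obtain F0 where F0: "F0 \<in> J" "cut F0 \<noteq> 0" by blast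
    define F where "F = cut F0"
    have F: "F \<in> J" "F \<noteq> 0"
      using ideal_diff[OF J F0(1) cut[of F0]] F0(2) by (auto simp: F_def)
    have lF: "lookup F m = (if keys m \<subseteq> S then lookup F0 m else 0)" for m
      by (auto simp: F_def cut_def lookup_sum lookup_single when_def in_keys_iff)
    have kF: "keys m \<subseteq> S" if "m \<in> keys F" for m
      using that by (auto simp: in_keys_iff lF split: if_splits)
    define d where "d = Max (mdeg ` keys F)"
    have d: "mdeg m \<le> d" if "m \<in> keys F" for m
      unfolding d_def using that by (intro Max_ge) auto
    have "d \<in> mdeg ` keys F" unfolding d_def using F(2) by (intro Max_in) auto
    then obtain m0 where m0: "m0 \<in> keys F" "mdeg m0 = d" by blast
    \<comment> \<open>The top-degree part of \<open>F\<close>. A direction \<open>c\<close> where it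
      does not vanish makes \<open>F\<close> of exact degree \<open>d\<close> in \<open>T\<close>
      with constant leading coefficient.\<close>
    define F' where "F' = (\<Sum>m\<in>{m \<in> keys F. mdeg m = d}. Poly_Mapping.single m (lookup F m))"
    have lF': "lookup F' m = (if mdeg m = d then lookup F m else 0)" for m
      by (auto simp: F'_def lookup_sum lookup_single when_def in_keys_iff)
    have kF': "keys F' \<subseteq> keys F" by (auto simp: in_keys_iff lF' split: if_splits)
    have "lookup F' m0 \<noteq> 0" using m0 by (auto simp: lF' in_keys_iff)
    then have "F' \<noteq> 0" by auto
    then obtain c0 where c0: "mp_eval c0 F' \<noteq> 0" using mp_eval_eq_0_imp by blast
    define c where "c v = (if v \<in> S then c0 v else 0)" for v
    have "mp_eval c F' = mp_eval c0 F'"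
      by (rule mp_eval_cong_keys) (use kF kF' in \<open>auto simp: c_def\<close>)
    with c0 have c: "mp_eval c F' \<noteq> 0" by simp
    have c_out: "c v = 0" if "v \<notin> S" for v using that by (simp add: c_def)
    have dpos: "d > 0"
    proof (rule ccontr)
      assume "\<not> d > 0"
      then have "m = 0" if "m \<in> keys F" for m
        using d[OF that] mdeg_eq_0[of m] by simp
      then have "lookup F m = 0" if "m \<noteq> 0" for m
        using that in_keys_iff[of m F] by blast
      then have FC: "F = Const (lookup F 0)"
        by (intro poly_mapping_eqI) (auto simp: lookup_Const)
      have nz: "lookup F 0 \<noteq> 0"
      proof
        assume "lookup F 0 = 0"
        then show False using FC F(2) by simp
      qed
      have "Const (1 / lookup F 0) * F \<in> J"
        using ideal_mult[OF J F(1)] .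
      moreover have "Const (1 / lookup F 0) * F = Const (1 / lookup F 0) * Const (lookup F 0)"
        using FC by (rule arg_cong)
      moreover have "\<dots> = 1"
        unfolding Const_mult[symmetric] using nz by simp
      ultimately show False using less.prems(3) by argo
    qed
    have "\<exists>x. c x \<noteq> 0"
    proof (rule ccontr)
      assume "\<not> ?thesis"
      then have z: "c v = 0" for v by blast
      have "mp_eval c F' = 0"
        unfolding mp_eval_def
      proof (intro sum.neutral ballI)
        fix m assume "m \<in> keys F'"
        then have "mdeg m = d" by (auto simp: in_keys_iff lF' split: if_splits)
        then have "keys m \<noteq> {}" using dpos by (auto simp: mdeg_def)
        then obtain v where "v \<in> keys m" by blast
        then have "(\<Prod>v\<in>keys m. c v ^ lookup m v) = 0"
          by (intro prod_zero) (auto simp: z in_keys_iff)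
        then show "lookup F' m * (\<Prod>v\<in>keys m. c v ^ lookup m v) = 0" by simp
      qed
      with c show False by simp
    qed
    then obtain x where x: "c x \<noteq> 0" by blast
    then have xS: "x \<in> S" using c_out by blast
    define \<sigma> where "\<sigma> v = (if v \<in> S - {x} then Var v - Const (c v) * (Const (1 / c x) * Var x) else 0)"
      for v :: 'v
    define J' where "J' = {F. mp_subst \<sigma> F \<in> J}"
    have idl: "ring_ideal J'"
      unfolding J'_def
      by (rule ring_idealI) (simp_all add: ideal_0[OF J] ideal_add[OF J] ideal_mult[OF J])
    have one: "1 \<notin> J'" using less.prems(3) by (simp add: J'_def)
    have J'_out: "Var v \<in> J'" if "v \<notin> S - {x}" for v
    proof -
      have "\<sigma> v = 0" unfolding \<sigma>_def using that by (rule if_not_P)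
      then show ?thesis using ideal_0[OF J] by (simp add: J'_def)
    qed
    have lt: "card (S - {x}) < card S"
      using less.prems(1) xS by (rule card_Diff1_less)
    have "\<exists>p. \<forall>F\<in>J'. mp_eval p F = 0"
      by (rule less.hyps[OF lt _ idl one J'_out]) (use less.prems(1) in simp)
    then obtain a where a: "\<forall>F\<in>J'. mp_eval a F = 0" ..
    have a_out: "a v = 0" if "v \<notin> S - {x}" for v
      using bspec[OF a J'_out[OF that]] by simp
    interpret nss_step J S x c a
      by unfold_locales (fact J xS x c_out a_out out)+
    have rho: "\<rho> = \<sigma>" by (simp add: fun_eq_iff \<rho>_def \<sigma>_def T_def)
    have decF: "dec d (mp_eval c F') F"
    proof -
      have mon: "dec d (if mdeg m = d then lookup F m * (\<Prod>v\<in>keys m. c v ^ lookup m v) else 0)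
          (Poly_Mapping.single m (lookup F m))" if "m \<in> keys F" for m
        using dec_monom[of m "lookup F m"] dec_raise[OF dec_monom[of m "lookup F m"], of d] d[OF that]
        by (cases "mdeg m = d") simp_all
      have "dec d (\<Sum>m\<in>keys F. if mdeg m = d then lookup F m * (\<Prod>v\<in>keys m. c v ^ lookup m v) else 0)
          (\<Sum>m\<in>keys F. Poly_Mapping.single m (lookup F m))"
        by (rule dec_sum) (rule mon)
      then have "dec d (\<Sum>m\<in>keys F. if mdeg m = d then lookup F m * (\<Prod>v\<in>keys m. c v ^ lookup m v) else 0) F"
        unfolding sum_single_lookup .
      moreover have "(\<Sum>m\<in>keys F. if mdeg m = d then lookup F m * (\<Prod>v\<in>keys m. c v ^ lookup m v) else 0)
        = mp_eval c F'"
        unfolding F'_def mp_eval_sum mp_eval_single by (rule sum.inter_filter[symmetric]) simp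
      ultimately show ?thesis by simp
    qed
    \<comment> \<open>The restriction of \<open>J\<close> to the line: a common root gives a common
      zero of \<open>J\<close>, while \<open>1\<close> in \<open>P\<close> is excluded by
      integrality.\<close>
    define P where "P = {p. \<exists>G\<in>J. \<forall>\<tau>. poly p \<tau> = mp_eval (pt \<tau>) G}"
    have "ring_ideal P"
    proof (rule ring_idealI)
      show "0 \<in> P" unfolding P_def using ideal_0[OF J] by (auto intro!: bexI[of _ 0])
      show "p + q \<in> P" if pq: "p \<in> P" "q \<in> P" for p q
      proof -
        obtain G H where "G \<in> J" "H \<in> J" "\<forall>\<tau>. poly p \<tau> = mp_eval (pt \<tau>) G" "\<forall>\<tau>. poly q \<tau> = mp_eval (pt \<tau>) H"
          using pq unfolding P_def by blast
        then show ?thesis unfolding P_def using ideal_add[OF J] by (auto intro!: bexI[of _ "G + H"])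
      qed
      show "r * p \<in> P" if p: "p \<in> P" for r p
      proof -
        obtain G where G: "G \<in> J" "\<forall>\<tau>. poly p \<tau> = mp_eval (pt \<tau>) G"
          using p unfolding P_def by blast
        let ?r = "\<Sum>k\<le>degree r. Const (coeff r k) * T ^ k"
        have "poly r \<tau> = mp_eval (pt \<tau>) ?r" for \<tau>
          by (simp add: pt_T poly_altdef[of r])
        then have "\<forall>\<tau>. poly (r * p) \<tau> = mp_eval (pt \<tau>) (?r * G)"
          using G(2) by (simp only: poly_mult mp_eval_mult simp_thms)
        then show ?thesis unfolding P_def using ideal_mult[OF J G(1)] by blast
      qed
    qed
    then consider \<tau> where "\<forall>p\<in>P. poly p \<tau> = 0" | "1 \<in> P"
      using poly_ideal_zero_or_unit by blast
    then show ?thesis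
    proof cases
      case (1 \<tau>)
      have "mp_eval (pt \<tau>) G = 0" if G: "G \<in> J" for G
      proof -
        obtain n \<kappa> where "dec n \<kappa> G" using dec_ex by blast
        then obtain R where R: "range (coeff R) \<subseteq> B" "\<forall>\<tau>. mp_eval (pt \<tau>) G = mp_eval (pt \<tau>) (poly R T)"
          unfolding dec_def by blast
        obtain p where p: "\<And>\<tau>. mp_eval (pt \<tau>) (poly R T) = poly p \<tau>"
          using poly_B_eval[OF R(1)] by blast
        have eq: "poly p \<tau> = mp_eval (pt \<tau>) G" for \<tau>
          using p[of \<tau>] R(2) by metis
        then have "p \<in> P" unfolding P_def using G by blast
        then show ?thesis using 1 eq[of \<tau>] by simp
      qed
      then show ?thesis by blast
    next
      case 2
      then obtain G where G: "G \<in> J" "\<forall>\<tau>. poly 1 \<tau> = mp_eval (pt \<tau>) G"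
        unfolding P_def by blast
      have "mp_eval a H = 0" if "mp_subst \<rho> H \<in> J" for H
        using a that unfolding J'_def rho by blast
      moreover have "mp_eval (pt \<tau>) G = 1" for \<tau>
        using G(2) by simp
      ultimately have False
        using proper_contradiction[OF less.prems(3) _ F(1) decF c dpos G(1)] by blast
      then show ?thesis ..
    qed
  qed
qed

subsection \<open>Invariant integration on the special linear group\<close>

text \<open>A finite substitute for integration over the torus, where only the invariant Laurent
  monomial survives. The weights exist since a linear relation among powers valid at all nonzero
  \<open>s\<close> is trivial.\<close>

lemma laurent_weights:
  "\<exists>T w. finite T \<and> 0 \<notin> T \<and> (\<forall>i\<le>N. \<forall>j\<le>N.
     (\<Sum>s\<in>T. w s * (s ^ i * (1 / s) ^ j)) = (if i = j then 1 else 0 :: 'a::field_char_0))"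
proof (rule linear_combination_or_separated[of "{..2 * N}" "{s::'a. s \<noteq> 0}"
      "\<lambda>k. if k = N then 1 else 0" "\<lambda>s k. s ^ k"])
  show "finite {..2 * N}" by simp
next
  fix T and w :: "'a \<Rightarrow> 'a"
  assume T: "finite T" "T \<subseteq> {s. s \<noteq> 0}"
    and w: "\<And>k. k \<in> {..2 * N} \<Longrightarrow> (if k = N then 1 else 0) = (\<Sum>s\<in>T. w s * s ^ k)"
  \<comment> \<open>The factor \<open>s ^ N\<close> shifts the exponents \<open>i - j\<close> from
    between \<open>- N\<close> and \<open>N\<close> to between 0 and \<open>2 * N\<close>.\<close>
  have "(\<Sum>s\<in>T. (w s * s ^ N) * (s ^ i * (1 / s) ^ j)) = (if i = j then 1 else 0)"
    if "i \<le> N" "j \<le> N" for i j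
  proof -
    have "(w s * s ^ N) * (s ^ i * (1 / s) ^ j) = w s * s ^ (N + i - j)" if "s \<in> T" for s
    proof -
      have "s \<noteq> 0" using T that by auto
      then show ?thesis using \<open>j \<le> N\<close> by (simp add: power_diff power_add power_one_over field_simps)
    qed
    then have "(\<Sum>s\<in>T. (w s * s ^ N) * (s ^ i * (1 / s) ^ j)) = (\<Sum>s\<in>T. w s * s ^ (N + i - j))"
      by (rule sum.cong[OF refl])
    also have "\<dots> = (if N + i - j = N then 1 else 0)"
      using that by (intro w[symmetric]) auto
    finally show ?thesis using that by auto
  qed
  moreover have "0 \<notin> T" using T by auto
  ultimately show ?thesis using T(1) by (intro exI[of _ T] exI[of _ "\<lambda>s. w s * s ^ N"]) simp
next
  fix c :: "nat \<Rightarrow> 'a"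
  assume c: "\<And>s. s \<in> {s. s \<noteq> 0} \<Longrightarrow> (\<Sum>k\<in>{..2 * N}. c k * s ^ k) = 0"
    "(\<Sum>k\<in>{..2 * N}. c k * (if k = N then 1 else 0)) \<noteq> 0"
  let ?p = "\<Sum>k\<le>2 * N. monom (c k) k"
  \<comment> \<open>The extra factor vanishes at 0, the one point not covered by the hypothesis on
    \<open>c\<close>.\<close>
  have "poly (?p * [:0, 1:]) s = 0" for s
    using c(1)[of s] by (cases "s = 0") (auto simp: poly_sum poly_monom)
  then have "?p * [:0, 1:] = 0" using poly_all_0_iff_0 by blast
  then have "?p = 0" by (metis mult_eq_0_iff one_neq_zero pCons_eq_0_iff)
  moreover have "coeff ?p N = c N" by (simp add: coeff_sum)
  ultimately have "c N = 0" by simp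
  moreover have "(\<Sum>k\<le>2 * N. c k * (if k = N then 1 else 0)) = (\<Sum>k\<in>{N}. c k * (if k = N then 1 else 0))"
    by (rule sum.mono_neutral_right) auto
  ultimately show ?thesis using c(2) by simp
qed

text \<open>The right-hand side is the integral of \<open>x ^ i * (x - 1) ^ j\<close> over [0, 1].
  Weights exact for pure powers of \<open>x\<close> are chosen first; then one factor
  \<open>x - 1\<close> at a time is expanded.\<close>

lemma beta_weights:
  "\<exists>T w. finite T \<and> (\<forall>i j. i + j \<le> N \<longrightarrow>
     (\<Sum>x\<in>T. w x * (x ^ i * (x - 1) ^ j)) = (-1) ^ j * fact i * fact j / (fact (i + j + 1) :: 'a::field_char_0))"
proof (rule linear_combination_or_separated[of "{..N}" "UNIV :: 'a set"
      "\<lambda>k. 1 / of_nat (k + 1)" "\<lambda>s k. s ^ k"])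
  show "finite {..N}" by simp
next
  fix T and w :: "'a \<Rightarrow> 'a"
  assume T: "finite T"
    and w: "\<And>k. k \<in> {..N} \<Longrightarrow> 1 / of_nat (k + 1) = (\<Sum>s\<in>T. w s * s ^ k)"
  have "(\<Sum>x\<in>T. w x * (x ^ i * (x - 1) ^ j)) = (-1) ^ j * fact i * fact j / fact (i + j + 1)"
    if "i + j \<le> N" for i j
    using that
  proof (induction j arbitrary: i)
    case 0
    have "fact (i + 1) = (of_nat (i + 1) :: 'a) * fact i" by (simp only: Suc_eq_plus1[symmetric] fact_Suc)
    then show ?case using w[of i] 0 by (simp del: of_nat_add of_nat_Suc fact_Suc)
  next
    case (Suc j)
    have "(\<Sum>x\<in>T. w x * (x ^ i * (x - 1) ^ Suc j))
        = (\<Sum>x\<in>T. w x * (x ^ Suc i * (x - 1) ^ j)) - (\<Sum>x\<in>T. w x * (x ^ i * (x - 1) ^ j))"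
      unfolding sum_subtractf[symmetric] by (intro sum.cong refl) (simp add: algebra_simps)
    also have "\<dots> = (-1) ^ j * fact (Suc i) * fact j / fact (Suc i + j + 1)
        - (-1) ^ j * fact i * fact j / fact (i + j + 1)"
      using Suc.prems by (simp only: Suc.IH)
    also have "\<dots> = (-1) ^ Suc j * fact i * fact (Suc j) / fact (i + Suc j + 1)"
    proof -
      have f: "fact (i + j + 2) = (of_nat (i + j + 2) :: 'a) * fact (i + j + 1)"
        using fact_Suc[of "i + j + 1", where 'a = 'a] by simp
      have n: "(of_nat (i + j + 2) :: 'a) \<noteq> 0" "(fact (i + j + 1) :: 'a) \<noteq> 0"
        by (simp_all only: of_nat_eq_0_iff fact_nonzero) simp_all
      have "(-1) ^ j * fact i * fact j / (fact (i + j + 1) :: 'a)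
          = (-1) ^ j * fact i * fact j * of_nat (i + j + 2) / fact (i + j + 2)"
        unfolding f using n by simp
      then show ?thesis
        by (simp add: diff_divide_distrib[symmetric] algebra_simps)
    qed
    finally show ?case .
  qed
  then show ?thesis using T by blast
next
  fix c :: "nat \<Rightarrow> 'a"
  assume c: "\<And>s. s \<in> UNIV \<Longrightarrow> (\<Sum>k\<in>{..N}. c k * s ^ k) = 0"
    "(\<Sum>k\<in>{..N}. c k * (1 / of_nat (k + 1))) \<noteq> 0"
  have "c k = 0" if "k \<le> N" for k
    using poly_fun_zero_imp[where n = N and c = c and k = k] c(1) that by blast
  then show ?thesis using c(2) by (simp add: sum.neutral)
qed

text \<open>The integral of \<open>a\<^sup>i b\<^sup>j c\<^sup>k d\<^sup>l\<close> over the group of matrices \<open>a b; c d\<close> with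
  \<open>a d - b c = 1\<close>, computed as a Beta integral over \<open>a d \<in> [0, 1]\<close>.\<close>

definition moment :: "nat \<Rightarrow> nat \<Rightarrow> nat \<Rightarrow> nat \<Rightarrow> 'a::field_char_0" where
  "moment i j k l = (if i = l \<and> j = k then (-1) ^ j * fact i * fact j / fact (i + j + 1) else 0)"

text \<open>A quadrature formula on the group, exact up to degree \<open>N\<close>. Invariance of
  the integral is proved by moving quadratures: a translated quadrature has the same
  moments.\<close>

definition quad :: "nat \<Rightarrow> 'k set \<Rightarrow> ('k \<Rightarrow> 'a::field_char_0) \<Rightarrow> ('k \<Rightarrow> 'a) \<Rightarrow> ('k \<Rightarrow> 'a) \<Rightarrow>
    ('k \<Rightarrow> 'a) \<Rightarrow> ('k \<Rightarrow> 'a) \<Rightarrow> bool" where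
  "quad N K w a b c d \<longleftrightarrow> finite K \<and> (\<forall>\<kappa>\<in>K. a \<kappa> * d \<kappa> - b \<kappa> * c \<kappa> = 1) \<and>
     (\<forall>i j k l. i + j + k + l \<le> N \<longrightarrow>
       (\<Sum>\<kappa>\<in>K. w \<kappa> * (a \<kappa> ^ i * b \<kappa> ^ j * c \<kappa> ^ k * d \<kappa> ^ l)) = moment i j k l)"

text \<open>The matrix with rows \<open>x s, (x - 1) t\<close> and \<open>1/t, 1/s\<close> has
  determinant 1. The torus weights in \<open>s\<close> and \<open>t\<close> enforce
  \<open>i = l\<close> and \<open>j = k\<close>; the weights in \<open>x\<close> give the Beta
  integral.\<close>

lemma quad_exists:
  "\<exists>K w a b c d. quad N (K :: ('a::field_char_0 \<times> 'a \<times> 'a) set) (w :: _ \<Rightarrow> 'a) a b c d"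
proof -
  obtain T :: "'a set" and w where T: "finite T" "0 \<notin> T"
    and w: "\<And>i j. i \<le> N \<Longrightarrow> j \<le> N \<Longrightarrow> (\<Sum>s\<in>T. w s * (s ^ i * (1 / s) ^ j)) = (if i = j then 1 else 0)"
    using laurent_weights[of N] by blast
  obtain X :: "'a set" and z where X: "finite X"
    and z: "\<And>i j. i + j \<le> N \<Longrightarrow>
      (\<Sum>x\<in>X. z x * (x ^ i * (x - 1) ^ j)) = (-1) ^ j * fact i * fact j / fact (i + j + 1)"
    using beta_weights[of N, where 'a = 'a] by blast
  let ?K = "X \<times> T \<times> T"
  let ?w = "\<lambda>(x::'a, s::'a, t::'a). z x * w s * w t"
  let ?a = "\<lambda>(x::'a, s::'a, t::'a). x * s" and ?b = "\<lambda>(x::'a, s::'a, t::'a). (x - 1) * t"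
    and ?c = "\<lambda>(x::'a, s::'a, t::'a). 1 / t" and ?d = "\<lambda>(x::'a, s::'a, t::'a). 1 / s"
  have "quad N ?K ?w ?a ?b ?c ?d"
    unfolding quad_def
  proof (intro conjI allI impI ballI)
    show "finite ?K" using T X by simp
  next
    fix \<kappa> assume "\<kappa> \<in> ?K"
    then show "?a \<kappa> * ?d \<kappa> - ?b \<kappa> * ?c \<kappa> = 1" using T(2) by auto
  next
    fix i j k l assume le: "i + j + k + l \<le> N"
    have "(\<Sum>\<kappa>\<in>?K. ?w \<kappa> * (?a \<kappa> ^ i * ?b \<kappa> ^ j * ?c \<kappa> ^ k * ?d \<kappa> ^ l))
        = (\<Sum>x\<in>X. \<Sum>s\<in>T. \<Sum>t\<in>T. (z x * (x ^ i * (x - 1) ^ j)) *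
            ((w s * (s ^ i * (1 / s) ^ l)) * (w t * (t ^ j * (1 / t) ^ k))))"
      by (simp add: sum.cartesian_product' case_prod_unfold power_mult_distrib mult_ac)
    also have "\<dots> = (\<Sum>x\<in>X. z x * (x ^ i * (x - 1) ^ j)) *
        ((\<Sum>s\<in>T. w s * (s ^ i * (1 / s) ^ l)) * (\<Sum>t\<in>T. w t * (t ^ j * (1 / t) ^ k)))"
      by (simp only: sum_distrib_left[symmetric] sum_distrib_right[symmetric])
    also have "\<dots> = moment i j k l"
      using le w z by (simp add: moment_def)
    finally show "(\<Sum>\<kappa>\<in>?K. ?w \<kappa> * (?a \<kappa> ^ i * ?b \<kappa> ^ j * ?c \<kappa> ^ k * ?d \<kappa> ^ l)) = moment i j k l" .
  qed
  then show ?thesis by (intro exI)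
qed

text \<open>Adding \<open>t\<close> times the second row to the first and expanding binomially, only
  the terms with \<open>p + q = r\<close> survive, where \<open>i = l + r\<close> and
  \<open>j = k + r\<close>. Their sum is a multiple of \<open>(1 - 1) ^ r\<close>.\<close>

lemma moment_shear:
  "(\<Sum>p\<le>i. \<Sum>q\<le>j. of_nat (i choose p) * of_nat (j choose q) * t ^ (p + q) *
      moment (i - p) (j - q) (k + p) (l + q)) = (moment i j k l :: 'a::field_char_0)"
proof (cases "\<exists>r. i = l + r \<and> j = k + r")
  case False
  have "moment (i - p) (j - q) (k + p) (l + q) = (0::'a)" if "p \<le> i" "q \<le> j" for p q
  proof -
    have "\<not> (i - p = l + q \<and> j - q = k + p)"
    proof
      assume a: "i - p = l + q \<and> j - q = k + p"
      then have "i = l + (p + q)" "j = k + (p + q)" using that by linarith+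
      then show False using False by blast
    qed
    then show ?thesis unfolding moment_def by (rule if_not_P)
  qed
  moreover have "moment i j k l = (0::'a)"
    using False unfolding moment_def by (auto dest: spec[of _ 0])
  ultimately show ?thesis by (simp add: sum.neutral)
next
  case True
  then obtain r where r: "i = l + r" "j = k + r" by blast
  define C where "C = t ^ r * ((-1) ^ j * fact i * fact j / (fact (i + j - r + 1) * fact r) :: 'a)"
  have trm: "of_nat (i choose p) * of_nat (j choose q) * t ^ (p + q) * moment (i - p) (j - q) (k + p) (l + q)
      = (if q = r - p \<and> p \<le> r then C * (of_nat (r choose p) * (-1) ^ (r - p)) else 0)"
    if pq: "p \<le> i" "q \<le> j" for p q
  proof (cases "p + q = r")
    case False
    then have "\<not> (i - p = l + q)" using pq r by auto
    then show ?thesis using False by (auto simp: moment_def)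
  next
    case True
    have e: "i - p = l + q" "j - q = k + p" "q = r - p" "p \<le> r" using True r by auto
    have s: "(-1::'a) ^ (j - q) = (-1) ^ j * (-1) ^ q"
    proof -
      have "(-1::'a) ^ j = (-1) ^ (j - q) * (-1) ^ q" using pq(2) by (simp flip: power_add)
      then show ?thesis by (simp add: mult.assoc flip: power_mult_distrib)
    qed
    have "(of_nat (i choose p) :: 'a) = fact i / (fact p * fact (i - p))"
      "(of_nat (j choose q) :: 'a) = fact j / (fact q * fact (j - q))"
      "(of_nat (r choose p) :: 'a) = fact r / (fact p * fact (r - p))"
      using pq e(4) by (simp_all add: binomial_fact)
    moreover have "i - p + (j - q) + 1 = i + j - r + 1" using True pq by auto
    moreover have "fi / (fp * fip) * (fj / (fq * fjq)) * u * ((s * v) * fip * fjq / D)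
        = u * (s * fi * fj / (D * fr)) * (fr / (fp * fq) * v)"
      if "fip \<noteq> 0" "fjq \<noteq> 0" "fr \<noteq> 0" for fi fp fip fj fq fjq u s v D fr :: 'a
      using that by (simp add: field_simps)
    ultimately show ?thesis
      using True e unfolding moment_def C_def s by (simp add: mult_ac del: fact_Suc)
  qed
  have "(\<Sum>p\<le>i. \<Sum>q\<le>j. of_nat (i choose p) * of_nat (j choose q) * t ^ (p + q) *
      moment (i - p) (j - q) (k + p) (l + q))
    = (\<Sum>p\<le>i. \<Sum>q\<le>j. if q = r - p \<and> p \<le> r then C * (of_nat (r choose p) * (-1) ^ (r - p)) else 0)"
    by (intro sum.cong refl) (simp add: trm)
  also have "\<dots> = (\<Sum>p\<le>i. if p \<le> r then C * (of_nat (r choose p) * (-1) ^ (r - p)) else 0)"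
  proof (intro sum.cong refl)
    fix p
    have "(\<Sum>q\<le>j. if q = r - p \<and> p \<le> r then C * (of_nat (r choose p) * (-1) ^ (r - p)) else 0)
       = (\<Sum>q\<in>{r - p}. if q = r - p \<and> p \<le> r then C * (of_nat (r choose p) * (-1) ^ (r - p)) else 0)"
      using r by (intro sum.mono_neutral_right) auto
    then show "(\<Sum>q\<le>j. if q = r - p \<and> p \<le> r then C * (of_nat (r choose p) * (-1) ^ (r - p)) else 0)
       = (if p \<le> r then C * (of_nat (r choose p) * (-1) ^ (r - p)) else 0)" by simp
  qed
  also have "\<dots> = (\<Sum>p\<le>r. C * (of_nat (r choose p) * (-1) ^ (r - p)))"
    using r by (intro sum.mono_neutral_cong_right) auto
  also have "\<dots> = C * (1 + (-1)) ^ r"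
    unfolding binomial_ring[of 1 "-1" r] by (simp add: sum_distrib_left)
  also have "\<dots> = moment i j k l"
  proof (cases "r = 0")
    case True
    then show ?thesis using r by (simp add: C_def moment_def)
  next
    case False
    then show ?thesis using r by (simp add: moment_def)
  qed
  finally show ?thesis .
qed

lemma quad_upper:
  assumes "quad N K w a b c d"
  shows "quad N K w (\<lambda>\<kappa>. a \<kappa> + t * c \<kappa>) (\<lambda>\<kappa>. b \<kappa> + t * d \<kappa>) c d"
proof -
  have K: "finite K" "\<And>\<kappa>. \<kappa> \<in> K \<Longrightarrow> a \<kappa> * d \<kappa> - b \<kappa> * c \<kappa> = 1"
    and m: "\<And>i j k l. i + j + k + l \<le> N \<Longrightarrow>
       (\<Sum>\<kappa>\<in>K. w \<kappa> * (a \<kappa> ^ i * b \<kappa> ^ j * c \<kappa> ^ k * d \<kappa> ^ l)) = moment i j k l"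
    using assms unfolding quad_def by auto
  have "(\<Sum>\<kappa>\<in>K. w \<kappa> * ((a \<kappa> + t * c \<kappa>) ^ i * (b \<kappa> + t * d \<kappa>) ^ j * c \<kappa> ^ k * d \<kappa> ^ l)) = moment i j k l"
    if le: "i + j + k + l \<le> N" for i j k l
  proof -
    have "w \<kappa> * ((a \<kappa> + t * c \<kappa>) ^ i * (b \<kappa> + t * d \<kappa>) ^ j * c \<kappa> ^ k * d \<kappa> ^ l)
        = (\<Sum>p\<le>i. \<Sum>q\<le>j. of_nat (i choose p) * of_nat (j choose q) * t ^ (p + q) *
            (w \<kappa> * (a \<kappa> ^ (i - p) * b \<kappa> ^ (j - q) * c \<kappa> ^ (k + p) * d \<kappa> ^ (l + q))))" for \<kappa>
    proof -
      have "(a \<kappa> + t * c \<kappa>) ^ i = (\<Sum>p\<le>i. of_nat (i choose p) * (t * c \<kappa>) ^ p * a \<kappa> ^ (i - p))"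
        "(b \<kappa> + t * d \<kappa>) ^ j = (\<Sum>q\<le>j. of_nat (j choose q) * (t * d \<kappa>) ^ q * b \<kappa> ^ (j - q))"
        by (simp_all add: add.commute[of "a \<kappa>"] add.commute[of "b \<kappa>"] binomial_ring)
      then have "(a \<kappa> + t * c \<kappa>) ^ i * (b \<kappa> + t * d \<kappa>) ^ j
          = (\<Sum>p\<le>i. \<Sum>q\<le>j. (of_nat (i choose p) * (t * c \<kappa>) ^ p * a \<kappa> ^ (i - p)) *
              (of_nat (j choose q) * (t * d \<kappa>) ^ q * b \<kappa> ^ (j - q)))"
        by (simp only: sum_product)
      then show ?thesis
        by (simp only: sum_distrib_left sum_distrib_right)
          (intro sum.cong refl, simp add: power_mult_distrib power_add mult_ac)
    qed
    then have "(\<Sum>\<kappa>\<in>K. w \<kappa> * ((a \<kappa> + t * c \<kappa>) ^ i * (b \<kappa> + t * d \<kappa>) ^ j * c \<kappa> ^ k * d \<kappa> ^ l))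
        = (\<Sum>\<kappa>\<in>K. \<Sum>p\<le>i. \<Sum>q\<le>j. of_nat (i choose p) * of_nat (j choose q) * t ^ (p + q) *
            (w \<kappa> * (a \<kappa> ^ (i - p) * b \<kappa> ^ (j - q) * c \<kappa> ^ (k + p) * d \<kappa> ^ (l + q))))"
      by simp
    also have "\<dots> = (\<Sum>p\<le>i. \<Sum>q\<le>j. of_nat (i choose p) * of_nat (j choose q) * t ^ (p + q) *
            (\<Sum>\<kappa>\<in>K. w \<kappa> * (a \<kappa> ^ (i - p) * b \<kappa> ^ (j - q) * c \<kappa> ^ (k + p) * d \<kappa> ^ (l + q))))"
      unfolding sum_distrib_left by (subst sum.swap, intro sum.cong refl, subst sum.swap) (rule refl)
    also have "\<dots> = (\<Sum>p\<le>i. \<Sum>q\<le>j. of_nat (i choose p) * of_nat (j choose q) * t ^ (p + q) *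
            moment (i - p) (j - q) (k + p) (l + q))"
      using le by (intro sum.cong refl arg_cong2[of _ _ _ _ times] m) auto
    also have "\<dots> = moment i j k l" by (rule moment_shear)
    finally show ?thesis .
  qed
  moreover have "(a \<kappa> + t * c \<kappa>) * d \<kappa> - (b \<kappa> + t * d \<kappa>) * c \<kappa> = 1" if "\<kappa> \<in> K" for \<kappa>
    using K(2)[OF that] by (simp add: algebra_simps)
  ultimately show ?thesis using K(1) unfolding quad_def by blast
qed

lemma quad_transpose:
  assumes "quad N K w a b c d"
  shows "quad N K w a c b d"
proof -
  have "(\<Sum>\<kappa>\<in>K. w \<kappa> * (a \<kappa> ^ i * c \<kappa> ^ j * b \<kappa> ^ k * d \<kappa> ^ l)) = moment i j k l"
    if "i + j + k + l \<le> N" for i j k l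
  proof -
    have "(\<Sum>\<kappa>\<in>K. w \<kappa> * (a \<kappa> ^ i * b \<kappa> ^ k * c \<kappa> ^ j * d \<kappa> ^ l)) = moment i k j l"
      using assms that unfolding quad_def by (simp add: add_ac)
    moreover have "moment i k j l = (moment i j k l :: 'b)" by (simp add: moment_def)
    ultimately show ?thesis by (simp add: mult_ac)
  qed
  then show ?thesis using assms unfolding quad_def by (simp add: mult.commute)
qed

lemma quad_reverse:
  assumes "quad N K w a b c d"
  shows "quad N K w d c b a"
proof -
  have "(\<Sum>\<kappa>\<in>K. w \<kappa> * (d \<kappa> ^ i * c \<kappa> ^ j * b \<kappa> ^ k * a \<kappa> ^ l)) = moment i j k l"
    if "i + j + k + l \<le> N" for i j k l
  proof -
    have "(\<Sum>\<kappa>\<in>K. w \<kappa> * (a \<kappa> ^ l * b \<kappa> ^ k * c \<kappa> ^ j * d \<kappa> ^ i)) = moment l k j i"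
      using assms that unfolding quad_def by (simp add: add_ac)
    moreover have "moment l k j i = (moment i j k l :: 'b)" by (simp add: moment_def)
    ultimately show ?thesis by (simp add: mult_ac)
  qed
  then show ?thesis using assms unfolding quad_def by (simp add: mult.commute)
qed

lemma quad_lower:
  assumes "quad N K w a b c d"
  shows "quad N K w a b (\<lambda>\<kappa>. c \<kappa> + t * a \<kappa>) (\<lambda>\<kappa>. d \<kappa> + t * b \<kappa>)"
  using quad_reverse[OF quad_upper[OF quad_reverse[OF assms]]] .

text \<open>Shears generate the special linear group: a matrix with \<open>r\<close> nonzero is
  upper times lower times upper, and \<open>r = 0\<close> is reduced to this case by one further
  lower shear.\<close>

lemma quad_left_mult:
  assumes Q: "quad N K w a b c d" and det: "p * s - q * r = 1"
  shows "quad N K w (\<lambda>\<kappa>. p * a \<kappa> + q * c \<kappa>) (\<lambda>\<kappa>. p * b \<kappa> + q * d \<kappa>)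
    (\<lambda>\<kappa>. r * a \<kappa> + s * c \<kappa>) (\<lambda>\<kappa>. r * b \<kappa> + s * d \<kappa>)"
proof -
  have main: "quad N K w (\<lambda>\<kappa>. p * a \<kappa> + q * c \<kappa>) (\<lambda>\<kappa>. p * b \<kappa> + q * d \<kappa>)
      (\<lambda>\<kappa>. r * a \<kappa> + s * c \<kappa>) (\<lambda>\<kappa>. r * b \<kappa> + s * d \<kappa>)"
    if Q: "quad N K w a b c d" and det: "p * s - q * r = 1" and r: "r \<noteq> 0" for a b c d p q r s
  proof -
    \<comment> \<open>The three shear parameters come from factoring the matrix
      \<open>p q; r s\<close>, where \<open>q\<close> is determined by the determinant.\<close>
    note Q3 = quad_upper[OF quad_lower[OF quad_upper[OF Q, of "(s - 1) / r"], of r], of "(p - 1) / r"]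
    have q: "q = (p * s - 1) / r" using det r by (simp add: field_simps)
    have 1: "x + (s - 1) / r * y + (p - 1) / r * (y + r * (x + (s - 1) / r * y)) = p * x + q * y" for x y
      using r unfolding q by (simp add: field_simps)
    have 2: "y + r * (x + (s - 1) / r * y) = r * x + s * y" for x y
      using r by (simp add: field_simps)
    show ?thesis using Q3[unfolded 1, unfolded 2] .
  qed
  show ?thesis
  proof (cases "r = 0")
    case False
    then show ?thesis using main[OF Q det] by blast
  next
    case True
    then have s: "s \<noteq> 0" using det by auto
    \<comment> \<open>After subtracting the first row from the second, the matrix
      \<open>p + q, q; s, s\<close> has nonzero lower left entry and restores the product.\<close>
    have "quad N K w (\<lambda>\<kappa>. (p + q) * a \<kappa> + q * (c \<kappa> + (-1) * a \<kappa>)) (\<lambda>\<kappa>. (p + q) * b \<kappa> + q * (d \<kappa> + (-1) * b \<kappa>))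
      (\<lambda>\<kappa>. s * a \<kappa> + s * (c \<kappa> + (-1) * a \<kappa>)) (\<lambda>\<kappa>. s * b \<kappa> + s * (d \<kappa> + (-1) * b \<kappa>))"
      using det True s by (intro main[OF quad_lower[OF Q]]) (simp_all add: algebra_simps)
    then show ?thesis using True by (simp add: algebra_simps)
  qed
qed

lemma quad_right_mult:
  assumes Q: "quad N K w a b c d" and det: "p * s - q * r = 1"
  shows "quad N K w (\<lambda>\<kappa>. a \<kappa> * p + b \<kappa> * r) (\<lambda>\<kappa>. a \<kappa> * q + b \<kappa> * s)
    (\<lambda>\<kappa>. c \<kappa> * p + d \<kappa> * r) (\<lambda>\<kappa>. c \<kappa> * q + d \<kappa> * s)"
  using quad_transpose[OF quad_left_mult[OF quad_transpose[OF Q], of p s r q]] det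
  by (simp add: mult.commute)

subsection \<open>Polynomial functions on the product of two special linear groups\<close>

definition mat2 :: "'a \<Rightarrow> 'a \<Rightarrow> 'a \<Rightarrow> 'a \<Rightarrow> 'a^2^2" where
  "mat2 a b c d = (\<chi> i j. if i = 1 then (if j = 1 then a else b) else (if j = 1 then c else d))"

lemma mat2_nth [simp]:
  "mat2 a b c d $ 1 $ 1 = a" "mat2 a b c d $ 1 $ 2 = b" "mat2 a b c d $ 2 $ 1 = c" "mat2 a b c d $ 2 $ 2 = d"
  by (simp_all add: mat2_def)

lemma mat2_eq_iff: "A = B \<longleftrightarrow> A$1$1 = B$1$1 \<and> A$1$2 = B$1$2 \<and> A$2$1 = B$2$1 \<and> A$2$2 = B$2$2"
  for A B :: "'a^2^2"
  by (auto simp: vec_eq_iff forall_2)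

lemma matrix_mult_2: "(A ** B) $ i $ j = A$i$1 * B$1$j + A$i$2 * B$2$j"
  for A B :: "'a::comm_semiring_1^2^2"
  by (simp add: matrix_matrix_mult_def sum_2)

lemma mat_2: "(mat k :: 'a::zero^2^2) $ 1 $ 1 = k" "(mat k :: 'a^2^2) $ 1 $ 2 = 0"
  "(mat k :: 'a^2^2) $ 2 $ 1 = 0" "(mat k :: 'a^2^2) $ 2 $ 2 = k"
  by (simp_all add: mat_def)

lemmas mat2_simps = matrix_mult_2 mat_2 det_2 mat2_eq_iff

definition adj2 :: "'a::comm_ring_1^2^2 \<Rightarrow> 'a^2^2" where
  "adj2 A = mat2 (A$2$2) (- (A$1$2)) (- (A$2$1)) (A$1$1)"

lemma matrix_inv_eqI: "B ** A = mat 1 \<Longrightarrow> A ** B = mat 1 \<Longrightarrow> matrix_inv A = B"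
  for A B :: "'a::field^'n^'n"
proof -
  assume B: "B ** A = mat 1" "A ** B = mat 1"
  have "A ** matrix_inv A = mat 1 \<and> matrix_inv A ** A = mat 1"
    unfolding matrix_inv_def by (rule someI[of _ B]) (simp add: B)
  then have "B ** A ** matrix_inv A = B" by (simp add: matrix_mul_assoc[symmetric])
  then show "matrix_inv A = B" by (simp add: B)
qed

lemma matrix_inv_det1: "det A = 1 \<Longrightarrow> matrix_inv A = adj2 A" for A :: "'a::field^2^2"
  by (rule matrix_inv_eqI) (simp_all add: mat2_simps adj2_def algebra_simps)

lemma det_adj2: "det (adj2 A) = det A" for A :: "'a::comm_ring_1^2^2"
  by (simp add: mat2_simps adj2_def algebra_simps)

type_synonym sl_coord = "bool \<times> 2 \<times> 2"

fun co :: "sl_coord \<Rightarrow> 'a bigroup_elem \<Rightarrow> 'a" where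
  "co (b, i, j) (A, B, s) = (if b then B else A) $ i $ j"

abbreviation SL2s :: "'a::field bigroup_elem set" where "SL2s \<equiv> carrier SLxSL"

lemma SL2s_iff: "(A, B, s) \<in> SL2s \<longleftrightarrow> det A = 1 \<and> det B = 1 \<and> \<not> s"
  by (simp add: SLxSL_def)

lemma SL2sE: assumes "g \<in> SL2s" obtains A B where "g = (A, B, False)" "det A = 1" "det B = 1"
  using assms by (cases g) (auto simp: SL2s_iff)

text \<open>The exchange flags are ignored, so identities such as associativity hold for all
  triples.\<close>

definition bmul :: "'a::field bigroup_elem \<Rightarrow> 'a bigroup_elem \<Rightarrow> 'a bigroup_elem" where
  "bmul g h = (fst g ** fst h, fst (snd g) ** fst (snd h), False)"

definition binv :: "'a::field bigroup_elem \<Rightarrow> 'a bigroup_elem" where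
  "binv g = (adj2 (fst g), adj2 (fst (snd g)), False)"

definition bone :: "'a::field bigroup_elem" where "bone = (mat 1, mat 1, False)"

lemma bmul_simp: "bmul (A, B, s) (C, D, t) = (A ** C, B ** D, False)" by (simp add: bmul_def)

lemma bmul_closed: "g \<in> SL2s \<Longrightarrow> h \<in> SL2s \<Longrightarrow> bmul g h \<in> SL2s"
  by (erule SL2sE, erule SL2sE) (simp add: bmul_simp SL2s_iff det_mul)

lemma binv_closed: "g \<in> SL2s \<Longrightarrow> binv g \<in> SL2s"
  by (erule SL2sE) (simp add: binv_def SL2s_iff det_adj2)

lemma bone_closed: "bone \<in> SL2s" by (simp add: bone_def SL2s_iff)

lemma bmul_assoc: "bmul (bmul g h) k = bmul g (bmul h k)"
  by (simp add: bmul_def matrix_mul_assoc)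

lemma adj2_mult: "det A = 1 \<Longrightarrow> adj2 A ** A = mat 1" "det A = 1 \<Longrightarrow> A ** adj2 A = mat 1"
  for A :: "'a::field^2^2"
  by (simp_all add: mat2_simps adj2_def algebra_simps)

lemma binv_left: "g \<in> SL2s \<Longrightarrow> bmul (binv g) g = bone"
  by (erule SL2sE) (simp add: bmul_def binv_def bone_def adj2_mult)

lemma binv_right: "g \<in> SL2s \<Longrightarrow> bmul g (binv g) = bone"
  by (erule SL2sE) (simp add: bmul_def binv_def bone_def adj2_mult)

lemma bone_left: "g \<in> SL2s \<Longrightarrow> bmul bone g = g"
  by (erule SL2sE) (simp add: bmul_def bone_def)

lemma bone_right: "g \<in> SL2s \<Longrightarrow> bmul g bone = g"
  by (erule SL2sE) (simp add: bmul_def bone_def)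

lemma binv_bmul: "binv (bmul g h) = bmul (binv h) (binv g)"
  by (simp add: binv_def bmul_def adj2_def mat2_simps algebra_simps)

section \<open>Regular functions of bounded degree on the group\<close>

definition mp_deg_le :: "nat \<Rightarrow> ('v, 'a::zero) mpoly \<Rightarrow> bool" where
  "mp_deg_le n F \<longleftrightarrow> (\<forall>m\<in>keys F. mdeg m \<le> n)"

lemma mdeg_add: "mdeg (m + n) = mdeg m + mdeg n"
proof -
  have "mdeg m = (\<Sum>v\<in>keys (m + n). lookup m v)" "mdeg n = (\<Sum>v\<in>keys (m + n). lookup n v)"
    unfolding mdeg_def by (intro sum.mono_neutral_left; auto simp: keys_add_nat in_keys_iff)+
  then show ?thesis by (simp add: mdeg_def lookup_add sum.distrib)
qed

lemma mp_deg_le_add: "mp_deg_le n F \<Longrightarrow> mp_deg_le n G \<Longrightarrow> mp_deg_le n (F + G)"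
  unfolding mp_deg_le_def using Poly_Mapping.keys_add[of F G] by blast

lemma mp_deg_le_mult: "mp_deg_le n F \<Longrightarrow> mp_deg_le m G \<Longrightarrow> mp_deg_le (n + m) (F * G)"
  for F G :: "('v, 'a::comm_ring_1) mpoly"
  unfolding mp_deg_le_def using Poly_Mapping.keys_mult[of F G] by (fastforce simp: mdeg_add intro: add_mono)

lemma mp_deg_le_mono: "mp_deg_le n F \<Longrightarrow> n \<le> m \<Longrightarrow> mp_deg_le m F"
  unfolding mp_deg_le_def by force

lemma mp_deg_le_Const: "mp_deg_le n (Const c)"
  unfolding mp_deg_le_def Const_def by (auto simp: mdeg_def)

lemma mp_deg_le_Var: "mp_deg_le 1 (Var v :: ('v, 'a::zero_neq_one) mpoly)"
  unfolding mp_deg_le_def Var_def by (auto simp: mdeg_def)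

lemma mp_deg_le_ex: "\<exists>n. mp_deg_le n F"
  unfolding mp_deg_le_def by (intro exI[of _ "Max (mdeg ` keys F)"]) auto

text \<open>Functions matter only on \<open>SL2s\<close>; the degree bound decides which quadrature
  integrates them.\<close>

definition pf :: "nat \<Rightarrow> ('a::field bigroup_elem \<Rightarrow> 'a) \<Rightarrow> bool" where
  "pf n \<phi> \<longleftrightarrow> (\<exists>F. mp_deg_le n F \<and> (\<forall>g\<in>SL2s. \<phi> g = mp_eval (\<lambda>v. co v g) F))"

lemma pf_const: "pf n (\<lambda>_. c)"
  unfolding pf_def by (intro exI[of _ "Const c"]) (simp add: mp_deg_le_Const)

lemma pf_co: "pf 1 (co v)"
  unfolding pf_def by (intro exI[of _ "Var v"]) (simp add: mp_deg_le_Var[unfolded One_nat_def])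

lemma pf_add: "pf n \<phi> \<Longrightarrow> pf n \<psi> \<Longrightarrow> pf n (\<lambda>g. \<phi> g + \<psi> g)"
proof -
  assume "pf n \<phi>" "pf n \<psi>"
  then obtain F G where "mp_deg_le n F" "\<forall>g\<in>SL2s. \<phi> g = mp_eval (\<lambda>v. co v g) F"
    "mp_deg_le n G" "\<forall>g\<in>SL2s. \<psi> g = mp_eval (\<lambda>v. co v g) G"
    unfolding pf_def by blast
  then show ?thesis
    unfolding pf_def by (intro exI[of _ "F + G"]) (simp add: mp_deg_le_add)
qed

lemma pf_mult: "pf n \<phi> \<Longrightarrow> pf m \<psi> \<Longrightarrow> pf (n + m) (\<lambda>g. \<phi> g * \<psi> g)"
proof -
  assume "pf n \<phi>" "pf m \<psi>"
  then obtain F G where "mp_deg_le n F" "\<forall>g\<in>SL2s. \<phi> g = mp_eval (\<lambda>v. co v g) F"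
    "mp_deg_le m G" "\<forall>g\<in>SL2s. \<psi> g = mp_eval (\<lambda>v. co v g) G"
    unfolding pf_def by blast
  then show ?thesis
    unfolding pf_def by (intro exI[of _ "F * G"]) (simp add: mp_deg_le_mult)
qed

lemma pf_mono: "pf n \<phi> \<Longrightarrow> n \<le> m \<Longrightarrow> pf m \<phi>"
  unfolding pf_def using mp_deg_le_mono by blast

lemma pf_cong: "pf n \<phi> \<Longrightarrow> (\<And>g. g \<in> SL2s \<Longrightarrow> \<phi> g = \<psi> g) \<Longrightarrow> pf n \<psi>"
proof -
  assume "pf n \<phi>" and eq: "\<And>g. g \<in> SL2s \<Longrightarrow> \<phi> g = \<psi> g"
  then obtain F where "mp_deg_le n F" "\<forall>g\<in>SL2s. \<phi> g = mp_eval (\<lambda>v. co v g) F"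
    unfolding pf_def by blast
  then show ?thesis unfolding pf_def using eq by (intro exI[of _ F]) simp
qed

lemma pf_scale: "pf n \<phi> \<Longrightarrow> pf n (\<lambda>g. c * \<phi> g)"
  using pf_mult[OF pf_const[of 0 c]] by simp

lemma pf_sum: "(\<And>i. i \<in> A \<Longrightarrow> pf n (f i)) \<Longrightarrow> pf n (\<lambda>g. \<Sum>i\<in>A. f i g)"
  by (induction A rule: infinite_finite_induct) (auto intro: pf_add pf_const)

lemma pf_prod: "(\<And>i. i \<in> A \<Longrightarrow> pf (n i) (f i)) \<Longrightarrow> pf (\<Sum>i\<in>A. n i) (\<lambda>g. \<Prod>i\<in>A. f i g)"
  by (induction A rule: infinite_finite_induct) (auto intro: pf_mult pf_const)

lemma pf_power: "pf n \<phi> \<Longrightarrow> pf (k * n) (\<lambda>g. \<phi> g ^ k)"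
  by (induction k) (auto intro: pf_mult pf_const)

lemma pf_subst:
  assumes "pf n \<phi>" and v: "\<And>v. pf 1 (\<lambda>g. co v (\<gamma> g))" and \<gamma>: "\<And>g. g \<in> SL2s \<Longrightarrow> \<gamma> g \<in> SL2s"
  shows "pf n (\<lambda>g. \<phi> (\<gamma> g))"
proof -
  obtain F where F: "mp_deg_le n F" "\<forall>g\<in>SL2s. \<phi> g = mp_eval (\<lambda>v. co v g) F"
    using assms(1) unfolding pf_def by blast
  have mon: "pf (mdeg m) (\<lambda>g. \<Prod>v\<in>keys m. co v (\<gamma> g) ^ lookup m v)" for m
    unfolding mdeg_def using pf_power[OF v] by (intro pf_prod) simp
  have "pf n (\<lambda>g. \<Sum>m\<in>keys F. lookup F m * (\<Prod>v\<in>keys m. co v (\<gamma> g) ^ lookup m v))"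
  proof (intro pf_sum pf_scale)
    fix m assume "m \<in> keys F"
    then show "pf n (\<lambda>g. \<Prod>v\<in>keys m. co v (\<gamma> g) ^ lookup m v)"
      using F(1) pf_mono[OF mon] unfolding mp_deg_le_def by blast
  qed
  then show ?thesis
    by (rule pf_cong) (use F(2) \<gamma> in \<open>simp add: mp_eval_def\<close>)
qed

lemma pf_lin: "pf 1 (\<lambda>g. x * co v g + y * co w g)"
  by (intro pf_add pf_scale pf_co)

lemma pf_left: "pf n \<phi> \<Longrightarrow> h \<in> SL2s \<Longrightarrow> pf n (\<lambda>g. \<phi> (bmul h g))"
proof (rule pf_subst)
  fix v :: sl_coord
  obtain b i j where v: "v = (b, i, j)" by (cases v)
  have "co v (bmul h g) = co (b, i, 1) h * co (b, 1, j) g + co (b, i, 2) h * co (b, 2, j) g" for g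
    by (cases h; cases g) (simp add: v bmul_simp matrix_mult_2)
  then show "pf 1 (\<lambda>g. co v (bmul h g))" by (simp only: pf_lin)
qed (auto intro: bmul_closed)

lemma pf_right: "pf n \<phi> \<Longrightarrow> h \<in> SL2s \<Longrightarrow> pf n (\<lambda>g. \<phi> (bmul g h))"
proof (rule pf_subst)
  fix v :: sl_coord
  obtain b i j where v: "v = (b, i, j)" by (cases v)
  have "co v (bmul g h) = co (b, 1, j) h * co (b, i, 1) g + co (b, 2, j) h * co (b, i, 2) g" for g
    by (cases h; cases g) (simp add: v bmul_simp matrix_mult_2 mult.commute)
  then show "pf 1 (\<lambda>g. co v (bmul g h))" by (simp only: pf_lin)
qed (auto intro: bmul_closed)

lemma all_sl_coord: "(\<forall>v::sl_coord. P v) \<longleftrightarrow> (\<forall>b. P (b, 1, 1) \<and> P (b, 1, 2) \<and> P (b, 2, 1) \<and> P (b, 2, 2))"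
  by (simp add: split_paired_All forall_2)

lemma pf_inv: "pf n \<phi> \<Longrightarrow> pf n (\<lambda>g. \<phi> (binv g))"
proof (rule pf_subst)
  have e: "co (b, 1, 1) (binv g) = co (b, 2, 2) g" "co (b, 2, 2) (binv g) = co (b, 1, 1) g"
    "co (b, 1, 2) (binv g) = (-1) * co (b, 1, 2) g" "co (b, 2, 1) (binv g) = (-1) * co (b, 2, 1) g"
    for b and g :: "'a bigroup_elem"
    by (cases g; simp add: binv_def adj2_def)+
  have "\<forall>v. pf 1 (\<lambda>g :: 'a bigroup_elem. co v (binv g))"
    unfolding all_sl_coord e by (intro allI conjI pf_scale pf_co)
  then show "pf 1 (\<lambda>g :: 'a bigroup_elem. co v (binv g))" for v by blast
qed (auto intro: binv_closed)

lemma sum_list_prod: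
  "(\<Sum>x\<leftarrow>xs. f x) * (\<Sum>y\<leftarrow>ys. g y) = (\<Sum>(x, y)\<leftarrow>List.product xs ys. f x * g y :: 'b::comm_semiring_0)"
  by (induction xs) (simp_all add: distrib_right sum_list_const_mult o_def)

text \<open>Entries of a matrix product are bilinear in the entries of the factors, and
  decompositions of this kind can be added and multiplied. Hence the translates of one function span
  a finite-dimensional space.\<close>

lemma pf_comult:
  assumes "pf n \<phi>"
  shows "\<exists>(I :: nat set) c d N. finite I \<and> (\<forall>i\<in>I. pf N (c i) \<and> pf N (d i)) \<and>
    (\<forall>g\<in>SL2s. \<forall>h\<in>SL2s. \<phi> (bmul g h) = (\<Sum>i\<in>I. c i g * d i h))"
proof -
  obtain F where F: "\<forall>g\<in>SL2s. \<phi> g = mp_eval (\<lambda>v. co v g) F"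
    using assms unfolding pf_def by blast
  have "\<exists>N L. (\<forall>x\<in>set L. pf N (fst x) \<and> pf N (snd x)) \<and>
      (\<forall>g h. mp_eval (\<lambda>v. co v (bmul g h)) F = (\<Sum>(c, d)\<leftarrow>L. c g * d h))"
  proof (induction F rule: mpoly_induct)
    case (Const k)
    show ?case
      by (intro exI[of _ 0] exI[of _ "[(\<lambda>_. k, \<lambda>_. 1)]"]) (simp add: pf_const)
  next
    case (Var v)
    obtain b i j where v: "v = (b, i, j)" by (cases v)
    have "co v (bmul g h) = co (b, i, 1) g * co (b, 1, j) h + co (b, i, 2) g * co (b, 2, j) h"
      for g h :: "'a bigroup_elem"
      by (cases h; cases g) (simp add: v bmul_simp matrix_mult_2)
    then show ?case
      by (intro exI[of _ 1] exI[of _ "[(co (b, i, 1), co (b, 1, j)), (co (b, i, 2), co (b, 2, j))]"])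
        (simp add: pf_co[unfolded One_nat_def])
  next
    case (add F G)
    then obtain N L N' L' where
      L: "\<forall>x\<in>set L. pf N (fst x) \<and> pf N (snd x)"
        "\<forall>g h. mp_eval (\<lambda>v. co v (bmul g h)) F = (\<Sum>(c, d)\<leftarrow>L. c g * d h)" and
      L': "\<forall>x\<in>set L'. pf N' (fst x) \<and> pf N' (snd x)"
        "\<forall>g h. mp_eval (\<lambda>v. co v (bmul g h)) G = (\<Sum>(c, d)\<leftarrow>L'. c g * d h)" by blast
    have "\<forall>x\<in>set (L @ L'). pf (N + N') (fst x) \<and> pf (N + N') (snd x)"
      using L(1) L'(1) pf_mono[of N _ "N + N'"] pf_mono[of N' _ "N + N'"] by auto
    then show ?case
      using L(2) L'(2) by (intro exI[of _ "N + N'"] exI[of _ "L @ L'"]) auto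
  next
    case (mult F G)
    then obtain N L N' L' where
      L: "\<forall>x\<in>set L. pf N (fst x) \<and> pf N (snd x)"
        "\<forall>g h. mp_eval (\<lambda>v. co v (bmul g h)) F = (\<Sum>(c, d)\<leftarrow>L. c g * d h)" and
      L': "\<forall>x\<in>set L'. pf N' (fst x) \<and> pf N' (snd x)"
        "\<forall>g h. mp_eval (\<lambda>v. co v (bmul g h)) G = (\<Sum>(c, d)\<leftarrow>L'. c g * d h)" by blast
    let ?m = "\<lambda>((c, d), (c', d')). (\<lambda>g. c g * c' g, \<lambda>h. d h * d' h)"
    let ?L = "map ?m (List.product L L')"
    have "\<forall>x\<in>set ?L. pf (N + N') (fst x) \<and> pf (N + N') (snd x)"
      using L(1) L'(1) by (fastforce intro!: pf_mult)
    moreover have "mp_eval (\<lambda>v. co v (bmul g h)) (F * G) = (\<Sum>(c, d)\<leftarrow>?L. c g * d h)" for g h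
      unfolding mp_eval_mult L(2)[rule_format] L'(2)[rule_format] sum_list_prod
      by (simp add: o_def case_prod_unfold mult_ac)
    ultimately show ?case by blast
  qed
  then obtain N L where L: "\<forall>x\<in>set L. pf N (fst x) \<and> pf N (snd x)"
      "\<forall>g h. mp_eval (\<lambda>v. co v (bmul g h)) F = (\<Sum>(c, d)\<leftarrow>L. c g * d h)" by blast
  show ?thesis
  proof (rule exI[of _ "{..<length L}"], rule exI[of _ "\<lambda>i. fst (L ! i)"],
      rule exI[of _ "\<lambda>i. snd (L ! i)"], rule exI[of _ N], intro conjI ballI)
    fix g h :: "'a bigroup_elem" assume "g \<in> SL2s" "h \<in> SL2s"
    then have "\<phi> (bmul g h) = (\<Sum>(c, d)\<leftarrow>L. c g * d h)"
      unfolding L(2)[rule_format, symmetric] using F bmul_closed by blast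
    also have "\<dots> = (\<Sum>i\<in>{..<length L}. fst (L ! i) g * snd (L ! i) h)"
      by (simp add: sum_list_sum_nth atLeast0LessThan case_prod_unfold)
    finally show "\<phi> (bmul g h) = (\<Sum>i\<in>{..<length L}. fst (L ! i) g * snd (L ! i) h)" .
  qed (use L(1) nth_mem in auto)
qed

section \<open>The invariant integral on the product group\<close>

lemma sl_coord_UNIV: "(UNIV :: sl_coord set) = {(False, 1, 1), (False, 1, 2), (False, 2, 1), (False, 2, 2),
    (True, 1, 1), (True, 1, 2), (True, 2, 1), (True, 2, 2)}" (is "_ = ?S")
proof -
  have A: "\<forall>v. v \<in> ?S" unfolding all_sl_coord by (simp add: all_bool_eq)
  show ?thesis by (rule UNIV_eq_I, rule A[THEN spec])
qed

lemma finite_sl_coord: "finite (UNIV :: sl_coord set)"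
  by (simp add: sl_coord_UNIV)

definition bmoment :: "(sl_coord \<Rightarrow>\<^sub>0 nat) \<Rightarrow> 'a::field_char_0" where
  "bmoment m =
     moment (lookup m (False, 1, 1)) (lookup m (False, 1, 2)) (lookup m (False, 2, 1)) (lookup m (False, 2, 2)) *
     moment (lookup m (True, 1, 1)) (lookup m (True, 1, 2)) (lookup m (True, 2, 1)) (lookup m (True, 2, 2))"

lemma prod_sl_coord:
  "(\<Prod>v\<in>keys m. co v (A, B, s) ^ lookup m v :: 'a::comm_ring_1) =
     (A$1$1 ^ lookup m (False, 1, 1) * A$1$2 ^ lookup m (False, 1, 2) *
      A$2$1 ^ lookup m (False, 2, 1) * A$2$2 ^ lookup m (False, 2, 2)) *
     (B$1$1 ^ lookup m (True, 1, 1) * B$1$2 ^ lookup m (True, 1, 2) *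
      B$2$1 ^ lookup m (True, 2, 1) * B$2$2 ^ lookup m (True, 2, 2))"
proof -
  have "(\<Prod>v\<in>keys m. co v (A, B, s) ^ lookup m v) = (\<Prod>v\<in>UNIV. co v (A, B, s) ^ lookup m v)"
    by (rule prod.mono_neutral_left) (use finite_sl_coord in \<open>auto simp: in_keys_iff\<close>)
  then show ?thesis unfolding sl_coord_UNIV by (simp add: mult_ac)
qed

lemma mdeg_sl_coord:
  fixes m :: "sl_coord \<Rightarrow>\<^sub>0 nat"
  shows "mdeg m = (lookup m (False, 1, 1) + lookup m (False, 1, 2) + lookup m (False, 2, 1) + lookup m (False, 2, 2)) +
     (lookup m (True, 1, 1) + lookup m (True, 1, 2) + lookup m (True, 2, 1) + lookup m (True, 2, 2))"
proof -
  have "mdeg m = (\<Sum>v\<in>UNIV. lookup m v)"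
    unfolding mdeg_def by (rule sum.mono_neutral_left) (use finite_sl_coord in \<open>auto simp: in_keys_iff\<close>)
  then show ?thesis unfolding sl_coord_UNIV by simp
qed

text \<open>Moments are read off a representing polynomial; different representatives differ by
  multiples of the determinant relations, and their moment sums agree by
  \<open>mp_moment_unique\<close>.\<close>

definition haar :: "('a::field_char_0 bigroup_elem \<Rightarrow> 'a) \<Rightarrow> 'a" where
  "haar \<phi> = (THE c. \<exists>F. (\<forall>g\<in>SL2s. \<phi> g = mp_eval (\<lambda>v. co v g) F) \<and>
     c = (\<Sum>m\<in>keys F. lookup F m * bmoment m))"

context
  fixes N :: nat and K1 K2 :: "('a::field_char_0 \<times> 'a \<times> 'a) set"
    and w1 a1 b1 c1 d1 w2 a2 b2 c2 d2 :: "'a \<times> 'a \<times> 'a \<Rightarrow> 'a"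
  assumes Q1: "quad N K1 w1 a1 b1 c1 d1" and Q2: "quad N K2 w2 a2 b2 c2 d2"
begin

lemma quads_closed: "\<kappa> \<in> K1 \<Longrightarrow> \<mu> \<in> K2 \<Longrightarrow>
  (mat2 (a1 \<kappa>) (b1 \<kappa>) (c1 \<kappa>) (d1 \<kappa>), mat2 (a2 \<mu>) (b2 \<mu>) (c2 \<mu>) (d2 \<mu>), False) \<in> SL2s"
  using Q1 Q2 by (simp add: quad_def SL2s_iff det_2)

lemma quads_moment:
  assumes F: "mp_deg_le N F" "\<And>g. g \<in> SL2s \<Longrightarrow> \<phi> g = mp_eval (\<lambda>v. co v g) F"
  shows "(\<Sum>\<kappa>\<in>K1. \<Sum>\<mu>\<in>K2. (w1 \<kappa> * w2 \<mu>) *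
      \<phi> (mat2 (a1 \<kappa>) (b1 \<kappa>) (c1 \<kappa>) (d1 \<kappa>), mat2 (a2 \<mu>) (b2 \<mu>) (c2 \<mu>) (d2 \<mu>), False))
    = (\<Sum>m\<in>keys F. lookup F m * bmoment m)"
proof -
  define e1 where "e1 m \<kappa> = a1 \<kappa> ^ lookup m (False, 1, 1) * b1 \<kappa> ^ lookup m (False, 1, 2) *
      c1 \<kappa> ^ lookup m (False, 2, 1) * d1 \<kappa> ^ lookup m (False, 2, 2)" for m :: "sl_coord \<Rightarrow>\<^sub>0 nat" and \<kappa>
  define e2 where "e2 m \<kappa> = a2 \<kappa> ^ lookup m (True, 1, 1) * b2 \<kappa> ^ lookup m (True, 1, 2) *
      c2 \<kappa> ^ lookup m (True, 2, 1) * d2 \<kappa> ^ lookup m (True, 2, 2)" for m :: "sl_coord \<Rightarrow>\<^sub>0 nat" and \<kappa>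
  have "(\<Sum>\<kappa>\<in>K1. \<Sum>\<mu>\<in>K2. (w1 \<kappa> * w2 \<mu>) *
      \<phi> (mat2 (a1 \<kappa>) (b1 \<kappa>) (c1 \<kappa>) (d1 \<kappa>), mat2 (a2 \<mu>) (b2 \<mu>) (c2 \<mu>) (d2 \<mu>), False))
    = (\<Sum>\<kappa>\<in>K1. \<Sum>\<mu>\<in>K2. \<Sum>m\<in>keys F. lookup F m * ((w1 \<kappa> * e1 m \<kappa>) * (w2 \<mu> * e2 m \<mu>)))"
    by (intro sum.cong refl)
      (simp add: F(2)[OF quads_closed] mp_eval_def prod_sl_coord e1_def e2_def sum_distrib_left mult_ac)
  also have "\<dots> = (\<Sum>m\<in>keys F. \<Sum>\<kappa>\<in>K1. \<Sum>\<mu>\<in>K2. lookup F m * ((w1 \<kappa> * e1 m \<kappa>) * (w2 \<mu> * e2 m \<mu>)))"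
    by (subst sum.swap, subst (2) sum.swap) (rule refl)
  also have "\<dots> = (\<Sum>m\<in>keys F. lookup F m * ((\<Sum>\<kappa>\<in>K1. w1 \<kappa> * e1 m \<kappa>) * (\<Sum>\<mu>\<in>K2. w2 \<mu> * e2 m \<mu>)))"
    by (simp only: sum_distrib_left[symmetric] sum_distrib_right[symmetric])
  also have "\<dots> = (\<Sum>m\<in>keys F. lookup F m * bmoment m)"
  proof (intro sum.cong refl)
    fix m assume "m \<in> keys F"
    then have "mdeg m \<le> N" using F(1) by (simp add: mp_deg_le_def)
    then show "lookup F m * ((\<Sum>\<kappa>\<in>K1. w1 \<kappa> * e1 m \<kappa>) * (\<Sum>\<mu>\<in>K2. w2 \<mu> * e2 m \<mu>)) = lookup F m * bmoment m"
      using Q1 Q2 unfolding e1_def e2_def bmoment_def quad_def mdeg_sl_coord by simp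
  qed
  finally show ?thesis .
qed

end

text \<open>A quadrature exact in the degrees of both polynomials computes both moment sums from
  values on the group alone.\<close>

lemma mp_moment_unique:
  fixes F F' :: "(sl_coord, 'a::field_char_0) mpoly"
  assumes "\<And>g. g \<in> SL2s \<Longrightarrow> mp_eval (\<lambda>v. co v g) F = mp_eval (\<lambda>v. co v g) F'"
  shows "(\<Sum>m\<in>keys F. lookup F m * bmoment m) = (\<Sum>m\<in>keys F'. lookup F' m * bmoment m)"
proof -
  obtain n n' where n: "mp_deg_le n F" "mp_deg_le n' F'" using mp_deg_le_ex by blast
  obtain K w a b c d where Q: "quad (n + n') (K :: ('a \<times> 'a \<times> 'a) set) (w :: _ \<Rightarrow> 'a) a b c d"
    using quad_exists by blast
  have "mp_deg_le (n + n') F" "mp_deg_le (n + n') F'" using n by (auto intro: mp_deg_le_mono)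
  from quads_moment[OF Q Q this(1), of "\<lambda>g. mp_eval (\<lambda>v. co v g) F"]
    quads_moment[OF Q Q this(2), of "\<lambda>g. mp_eval (\<lambda>v. co v g) F"]
  show ?thesis using assms by simp
qed

lemma haar_eqI:
  assumes "\<And>g. g \<in> SL2s \<Longrightarrow> \<phi> g = mp_eval (\<lambda>v. co v g) F"
  shows "haar \<phi> = (\<Sum>m\<in>keys F. lookup F m * bmoment m)"
  unfolding haar_def
proof (rule the_equality)
  show "\<exists>F'. (\<forall>g\<in>SL2s. \<phi> g = mp_eval (\<lambda>v. co v g) F') \<and>
      (\<Sum>m\<in>keys F. lookup F m * bmoment m) = (\<Sum>m\<in>keys F'. lookup F' m * bmoment m)"
    using assms by blast
  show "c = (\<Sum>m\<in>keys F. lookup F m * bmoment m)"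
    if h: "\<exists>F'. (\<forall>g\<in>SL2s. \<phi> g = mp_eval (\<lambda>v. co v g) F') \<and> c = (\<Sum>m\<in>keys F'. lookup F' m * bmoment m)" for c
  proof -
    obtain F' where F': "\<forall>g\<in>SL2s. \<phi> g = mp_eval (\<lambda>v. co v g) F'"
      "c = (\<Sum>m\<in>keys F'. lookup F' m * bmoment m)" using h by blast
    show ?thesis unfolding F'(2) by (rule mp_moment_unique) (use F'(1) assms in auto)
  qed
qed

lemma haar_quads:
  fixes K1 K2 :: "('a::field_char_0 \<times> 'a \<times> 'a) set"
    and w1 a1 b1 c1 d1 w2 a2 b2 c2 d2 :: "'a \<times> 'a \<times> 'a \<Rightarrow> 'a"
  assumes Q: "quad N K1 w1 a1 b1 c1 d1" "quad N K2 w2 a2 b2 c2 d2" and \<phi>: "pf N \<phi>"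
  shows "haar \<phi> = (\<Sum>\<kappa>\<in>K1. \<Sum>\<mu>\<in>K2. (w1 \<kappa> * w2 \<mu>) *
      \<phi> (mat2 (a1 \<kappa>) (b1 \<kappa>) (c1 \<kappa>) (d1 \<kappa>), mat2 (a2 \<mu>) (b2 \<mu>) (c2 \<mu>) (d2 \<mu>), False))"
proof -
  obtain F where F: "mp_deg_le N F" "\<And>g. g \<in> SL2s \<Longrightarrow> \<phi> g = mp_eval (\<lambda>v. co v g) F"
    using \<phi> unfolding pf_def by blast
  show ?thesis by (rule trans[OF haar_eqI[OF F(2)] quads_moment[OF Q F, symmetric]])
qed

text \<open>Nodes and weights depend only on the degree bound. This makes convolutions finite sums
  of translates and averages of forms finite sums of forms.\<close>

lemma haar_quadrature:
  "\<exists>(K :: (('a::field_char_0 \<times> 'a \<times> 'a) \<times> ('a \<times> 'a \<times> 'a)) set) w (\<gamma> :: _ \<Rightarrow> 'a bigroup_elem).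
    finite K \<and> (\<forall>\<kappa>\<in>K. \<gamma> \<kappa> \<in> SL2s) \<and> (\<forall>\<phi>. pf N \<phi> \<longrightarrow> haar \<phi> = (\<Sum>\<kappa>\<in>K. w \<kappa> * \<phi> (\<gamma> \<kappa>)))"
proof -
  obtain K w a b c d where Q: "quad N (K :: ('a \<times> 'a \<times> 'a) set) (w :: _ \<Rightarrow> 'a) a b c d"
    using quad_exists by blast
  show ?thesis
  proof (intro exI[of _ "K \<times> K"] exI[of _ "\<lambda>\<kappa>. w (fst \<kappa>) * w (snd \<kappa>)"] exI[of _ "\<lambda>\<kappa>. (mat2 (a (fst \<kappa>)) (b (fst \<kappa>)) (c (fst \<kappa>)) (d (fst \<kappa>)),
        mat2 (a (snd \<kappa>)) (b (snd \<kappa>)) (c (snd \<kappa>)) (d (snd \<kappa>)), False)"] conjI ballI allI impI)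
    show "finite (K \<times> K)" using Q by (simp add: quad_def)
  next
    fix \<kappa> assume "\<kappa> \<in> K \<times> K"
    then show "(mat2 (a (fst \<kappa>)) (b (fst \<kappa>)) (c (fst \<kappa>)) (d (fst \<kappa>)),
        mat2 (a (snd \<kappa>)) (b (snd \<kappa>)) (c (snd \<kappa>)) (d (snd \<kappa>)), False) \<in> SL2s"
      by (intro quads_closed[OF Q Q]) auto
  next
    fix \<phi> :: "'a bigroup_elem \<Rightarrow> 'a" assume "pf N \<phi>"
    from haar_quads[OF Q Q this]
    show "haar \<phi> = (\<Sum>\<kappa>\<in>K \<times> K. w (fst \<kappa>) * w (snd \<kappa>) * \<phi> (mat2 (a (fst \<kappa>)) (b (fst \<kappa>)) (c (fst \<kappa>)) (d (fst \<kappa>)),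
        mat2 (a (snd \<kappa>)) (b (snd \<kappa>)) (c (snd \<kappa>)) (d (snd \<kappa>)), False))"
      by (simp add: sum.cartesian_product case_prod_unfold)
  qed
qed

text \<open>A translated quadrature is again a quadrature, and both compute the same
  integral.\<close>

lemma haar_left:
  fixes h :: "'a::field_char_0 bigroup_elem"
  assumes \<phi>: "pf N \<phi>" and h: "h \<in> SL2s"
  shows "haar (\<lambda>g. \<phi> (bmul h g)) = haar \<phi>"
proof -
  obtain A B where AB: "h = (A, B, False)" "det A = 1" "det B = 1" using h by (rule SL2sE)
  obtain K w a b c d where Q: "quad N (K :: ('a \<times> 'a \<times> 'a) set) (w :: _ \<Rightarrow> 'a) a b c d"
    using quad_exists by blast
  have m: "A ** mat2 x y z t = mat2 (A$1$1 * x + A$1$2 * z) (A$1$1 * y + A$1$2 * t)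
      (A$2$1 * x + A$2$2 * z) (A$2$1 * y + A$2$2 * t)" for A :: "'a^2^2" and x y z t
    by (simp add: mat2_simps)
  show ?thesis
    unfolding haar_quads[OF Q Q pf_left[OF \<phi> h]]
      haar_quads[OF quad_left_mult[OF Q AB(2)[unfolded det_2]] quad_left_mult[OF Q AB(3)[unfolded det_2]] \<phi>]
    by (simp add: AB bmul_simp m)
qed

lemma haar_right:
  fixes h :: "'a::field_char_0 bigroup_elem"
  assumes \<phi>: "pf N \<phi>" and h: "h \<in> SL2s"
  shows "haar (\<lambda>g. \<phi> (bmul g h)) = haar \<phi>"
proof -
  obtain A B where AB: "h = (A, B, False)" "det A = 1" "det B = 1" using h by (rule SL2sE)
  obtain K w a b c d where Q: "quad N (K :: ('a \<times> 'a \<times> 'a) set) (w :: _ \<Rightarrow> 'a) a b c d"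
    using quad_exists by blast
  have m: "mat2 x y z t ** A = mat2 (x * A$1$1 + y * A$2$1) (x * A$1$2 + y * A$2$2)
      (z * A$1$1 + t * A$2$1) (z * A$1$2 + t * A$2$2)" for A :: "'a^2^2" and x y z t
    by (simp add: mat2_simps)
  show ?thesis
    unfolding haar_quads[OF Q Q pf_right[OF \<phi> h]]
      haar_quads[OF quad_right_mult[OF Q AB(2)[unfolded det_2]] quad_right_mult[OF Q AB(3)[unfolded det_2]] \<phi>]
    by (simp add: AB bmul_simp m)
qed

lemma haar_1: "haar (\<lambda>_. 1) = 1"
proof -
  have "haar (\<lambda>_. 1) = (\<Sum>m\<in>keys (1 :: (sl_coord, 'a) mpoly). lookup (1 :: (sl_coord, 'a) mpoly) m * bmoment m)"
    by (rule haar_eqI) simp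
  then show ?thesis by (simp add: bmoment_def moment_def lookup_one)
qed

lemma haar_cong: "(\<And>g. g \<in> SL2s \<Longrightarrow> \<phi> g = \<psi> g) \<Longrightarrow> haar \<phi> = haar \<psi>"
  unfolding haar_def by simp

lemma haar_lin:
  fixes \<phi> \<psi> :: "'a::field_char_0 bigroup_elem \<Rightarrow> 'a"
  assumes "pf N \<phi>" "pf N \<psi>"
  shows "haar (\<lambda>g. \<phi> g + c * \<psi> g) = haar \<phi> + c * haar \<psi>"
proof -
  obtain K :: "(('a \<times> 'a \<times> 'a) \<times> ('a \<times> 'a \<times> 'a)) set" and w and \<gamma> :: "_ \<Rightarrow> 'a bigroup_elem"
    where K: "\<forall>\<phi>. pf N \<phi> \<longrightarrow> haar \<phi> = (\<Sum>\<kappa>\<in>K. w \<kappa> * \<phi> (\<gamma> \<kappa>))"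
    using haar_quadrature[of N] by blast
  have "pf N (\<lambda>g. \<phi> g + c * \<psi> g)" using assms by (intro pf_add pf_scale)
  then show ?thesis
    using assms K by (simp add: algebra_simps sum.distrib sum_distrib_left)
qed

definition PF :: "('a::field bigroup_elem \<Rightarrow> 'a) \<Rightarrow> bool" where "PF \<phi> \<longleftrightarrow> (\<exists>n. pf n \<phi>)"

lemma PF_I: "pf n \<phi> \<Longrightarrow> PF \<phi>" unfolding PF_def by blast

lemma PF_const: "PF (\<lambda>_. c)" unfolding PF_def using pf_const by blast

lemma PF_add: "PF \<phi> \<Longrightarrow> PF \<psi> \<Longrightarrow> PF (\<lambda>g. \<phi> g + \<psi> g)"
proof -
  assume "PF \<phi>" "PF \<psi>"
  then obtain n m where "pf n \<phi>" "pf m \<psi>" unfolding PF_def by blast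
  then have "pf (n + m) \<phi>" "pf (n + m) \<psi>" by (auto intro: pf_mono)
  then show ?thesis using pf_add PF_I by blast
qed

lemma PF_mult: "PF \<phi> \<Longrightarrow> PF \<psi> \<Longrightarrow> PF (\<lambda>g. \<phi> g * \<psi> g)"
  unfolding PF_def using pf_mult by blast

lemma PF_scale: "PF \<phi> \<Longrightarrow> PF (\<lambda>g. c * \<phi> g)"
  unfolding PF_def using pf_scale by blast

lemma PF_sum: "(\<And>i. i \<in> I \<Longrightarrow> PF (f i)) \<Longrightarrow> PF (\<lambda>g. \<Sum>i\<in>I. f i g)"
  by (induction I rule: infinite_finite_induct) (auto intro: PF_const PF_add)

lemma PF_inv: "PF \<phi> \<Longrightarrow> PF (\<lambda>g. \<phi> (binv g))"
  unfolding PF_def using pf_inv by blast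

lemma PF_cong: "PF \<phi> \<Longrightarrow> (\<And>g. g \<in> SL2s \<Longrightarrow> \<phi> g = \<psi> g) \<Longrightarrow> PF \<psi>"
  unfolding PF_def using pf_cong by blast

lemma haar_PF_lin:
  fixes \<phi> \<psi> :: "'a::field_char_0 bigroup_elem \<Rightarrow> 'a"
  assumes "PF \<phi>" "PF \<psi>"
  shows "haar (\<lambda>g. \<phi> g + c * \<psi> g) = haar \<phi> + c * haar \<psi>"
proof -
  obtain n m where "pf n \<phi>" "pf m \<psi>" using assms unfolding PF_def by blast
  then have "pf (n + m) \<phi>" "pf (n + m) \<psi>" by (auto intro: pf_mono)
  then show ?thesis by (rule haar_lin)
qed

lemma haar_0: "haar (\<lambda>_. 0 :: 'a::field_char_0) = 0"
  using haar_PF_lin[OF PF_const[of 0] PF_const[of 0], of "-1"] by simp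

lemma haar_sum:
  fixes f :: "'i \<Rightarrow> 'a::field_char_0 bigroup_elem \<Rightarrow> 'a"
  assumes "\<And>i. i \<in> I \<Longrightarrow> PF (f i)"
  shows "haar (\<lambda>g. \<Sum>i\<in>I. c i * f i g) = (\<Sum>i\<in>I. c i * haar (f i))"
  using assms
proof (induction I rule: infinite_finite_induct)
  case (insert i I)
  have "PF (\<lambda>g. \<Sum>i\<in>I. c i * f i g)" using insert.prems by (intro PF_sum PF_scale) simp
  from haar_PF_lin[OF this, of "f i" "c i"] insert show ?case
    by (simp add: add.commute)
qed (simp_all add: haar_0)

lemma haar_PF_left: "PF \<phi> \<Longrightarrow> h \<in> SL2s \<Longrightarrow> haar (\<lambda>g. \<phi> (bmul h g)) = haar \<phi>"
  unfolding PF_def using haar_left by blast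

lemma haar_PF_right: "PF \<phi> \<Longrightarrow> h \<in> SL2s \<Longrightarrow> haar (\<lambda>g. \<phi> (bmul g h)) = haar \<phi>"
  unfolding PF_def using haar_right by blast

subsection \<open>The coordinate ring of a closed orbit\<close>

text \<open>\<open>A_radical\<close> is nondegeneracy of the integral pairing on \<open>A\<close>;
  for an orbit it is what closedness provides.\<close>

locale closed_orbit_algebra =
  fixes A :: "('a::field_char_0 bigroup_elem \<Rightarrow> 'a) set"
  assumes A_PF: "a \<in> A \<Longrightarrow> PF a"
    and A_const: "(\<lambda>_. c) \<in> A"
    and A_add: "a \<in> A \<Longrightarrow> b \<in> A \<Longrightarrow> (\<lambda>g. a g + b g) \<in> A"
    and A_mult: "a \<in> A \<Longrightarrow> b \<in> A \<Longrightarrow> (\<lambda>g. a g * b g) \<in> A"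
    and A_left: "a \<in> A \<Longrightarrow> h \<in> SL2s \<Longrightarrow> (\<lambda>g. a (bmul h g)) \<in> A"
    and A_cong: "a \<in> A \<Longrightarrow> (\<And>g. g \<in> SL2s \<Longrightarrow> a g = b g) \<Longrightarrow> b \<in> A"
    and A_radical: "a \<in> A \<Longrightarrow> (\<And>b. b \<in> A \<Longrightarrow> haar (\<lambda>g. b g * a g) = 0) \<Longrightarrow> g \<in> SL2s \<Longrightarrow> a g = 0"
begin

lemma A_scale: "a \<in> A \<Longrightarrow> (\<lambda>g. c * a g) \<in> A"
  using A_mult[OF A_const] .

lemma A_sum: "(\<And>i. i \<in> I \<Longrightarrow> f i \<in> A) \<Longrightarrow> (\<lambda>g. \<Sum>i\<in>I. f i g) \<in> A"
  by (induction I rule: infinite_finite_induct) (auto intro: A_const A_add)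

text \<open>By a quadrature the convolution is a finite combination of left translates of
  \<open>a\<close>.\<close>

lemma convolution_in_A:
  assumes a: "a \<in> A" and b: "PF b"
  shows "(\<lambda>k. haar (\<lambda>g. a (bmul g k) * b g)) \<in> A"
proof -
  obtain n m where n: "pf n a" "pf m b" using A_PF[OF a] b unfolding PF_def by blast
  obtain K :: "(('a \<times> 'a \<times> 'a) \<times> ('a \<times> 'a \<times> 'a)) set" and w and \<gamma> :: "_ \<Rightarrow> 'a bigroup_elem"
    where K: "\<forall>\<kappa>\<in>K. \<gamma> \<kappa> \<in> SL2s" "\<forall>\<phi>. pf (n + m) \<phi> \<longrightarrow> haar \<phi> = (\<Sum>\<kappa>\<in>K. w \<kappa> * \<phi> (\<gamma> \<kappa>))"
    using haar_quadrature[of "n + m"] by blast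
  have "(\<lambda>k. \<Sum>\<kappa>\<in>K. (w \<kappa> * b (\<gamma> \<kappa>)) * a (bmul (\<gamma> \<kappa>) k)) \<in> A"
    using K(1) a by (intro A_sum A_scale A_left) auto
  then show ?thesis
  proof (rule A_cong)
    fix k :: "'a bigroup_elem" assume "k \<in> SL2s"
    then have "pf (n + m) (\<lambda>g. a (bmul g k) * b g)" using n by (intro pf_mult pf_right)
    then have "haar (\<lambda>g. a (bmul g k) * b g) = (\<Sum>\<kappa>\<in>K. w \<kappa> * (a (bmul (\<gamma> \<kappa>) k) * b (\<gamma> \<kappa>)))"
      using K(2) by simp
    then show "(\<Sum>\<kappa>\<in>K. (w \<kappa> * b (\<gamma> \<kappa>)) * a (bmul (\<gamma> \<kappa>) k)) = haar (\<lambda>g. a (bmul g k) * b g)"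
      by (simp add: mult_ac)
  qed
qed

text \<open>Convolution by elements of \<open>A\<close> cuts \<open>A\<close>, and its dual, down to spaces of vectors
  \<open>(\<integral> a c\<^sub>j)\<^sub>j\<close> in the coordinates of \<open>b (k h) = \<Sum>\<^sub>j c\<^sub>j(k) d\<^sub>j(h)\<close>, where orthogonal
  complements are available although the whole of \<open>A\<close> has infinite dimension.\<close>

lemma orthogonal_projection:
  assumes b: "PF b"
  shows "\<exists>\<alpha>\<in>A. \<forall>a\<in>A. haar (\<lambda>g. a g * b g) = haar (\<lambda>g. a g * \<alpha> g)"
proof -
  obtain n where n: "pf n b" using b unfolding PF_def by blast
  obtain I :: "nat set" and c d N where I: "finite I" and cd: "\<forall>j\<in>I. pf N (c j) \<and> pf N (d j)"
    and bcd': "\<forall>g\<in>SL2s. \<forall>h\<in>SL2s. b (bmul g h) = (\<Sum>j\<in>I. c j g * d j h)"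
    using pf_comult[OF n] by blast
  have bcd: "b (bmul g h) = (\<Sum>j\<in>I. c j g * d j h)" if "g \<in> SL2s" "h \<in> SL2s" for g h
    using bcd' that by blast
  have PFc: "PF (c j)" and PFd: "PF (d j)" if "j \<in> I" for j
    using cd that PF_I by blast+
  have PFdi: "PF (\<lambda>g. d j (binv g))" if "j \<in> I" for j
    using PF_inv[OF PFd[OF that]] .
  define C where "C a j = haar (\<lambda>g. a g * c j g)" for a j
  define \<Xi> where "\<Xi> a j = haar (\<lambda>g. a g * d j (binv g))" for a j
  \<comment> \<open>One family for two kinds of vectors: \<open>Inl\<close> for the vectors
    \<open>\<Xi> a\<close>, whose expansions in the \<open>c j\<close> lie in \<open>A\<close>, and
    \<open>Inr\<close> for the annihilator of all \<open>C a\<close>.\<close>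
  define v where "v x j = (case x of Inl a \<Rightarrow> \<Xi> a j | Inr y \<Rightarrow> y j)"
    for x :: "('a bigroup_elem \<Rightarrow> 'a) + (nat \<Rightarrow> 'a)" and j
  define Cperp where "Cperp = {y. \<forall>a\<in>A. (\<Sum>j\<in>I. C a j * y j) = 0}"
  have C_pair: "haar (\<lambda>g. a g * (\<Sum>j\<in>I. y j * c j g)) = (\<Sum>j\<in>I. C a j * y j)" if a: "a \<in> A" for a y
  proof -
    have "haar (\<lambda>g. \<Sum>j\<in>I. y j * (a g * c j g)) = (\<Sum>j\<in>I. y j * haar (\<lambda>g. a g * c j g))"
      by (intro haar_sum PF_mult A_PF[OF a] PFc)
    then show ?thesis by (simp add: C_def sum_distrib_left mult_ac)
  qed
  have \<Xi>_pair: "haar (\<lambda>g. a g * (\<Sum>j\<in>I. y j * d j (binv g))) = (\<Sum>j\<in>I. \<Xi> a j * y j)" if a: "a \<in> A" for a y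
  proof -
    have "haar (\<lambda>g. \<Sum>j\<in>I. y j * (a g * d j (binv g))) = (\<Sum>j\<in>I. y j * haar (\<lambda>g. a g * d j (binv g)))"
      by (intro haar_sum PF_mult A_PF[OF a] PFdi)
    then show ?thesis by (simp add: \<Xi>_def sum_distrib_left mult_ac)
  qed
  \<comment> \<open>The substitution of \<open>g k\<close> for \<open>g\<close> moves the dependence
    on \<open>k\<close> from \<open>b\<close> to \<open>a\<close>, where it is a translate.\<close>
  have in_A: "(\<lambda>k. haar (\<lambda>g. a g * b (bmul k (binv g)))) \<in> A" if a: "a \<in> A" for a
  proof (rule A_cong[OF convolution_in_A[OF a PF_inv[OF b]]])
    fix k :: "'a bigroup_elem" assume k: "k \<in> SL2s"
    have "PF (\<lambda>g. a g * (\<Sum>j\<in>I. c j k * d j (binv g)))"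
      by (intro PF_mult PF_sum PF_const A_PF[OF a] PFdi)
    then have "PF (\<lambda>g. a g * b (bmul k (binv g)))"
      by (rule PF_cong) (simp add: bcd[OF k binv_closed])
    from haar_PF_right[OF this k]
    have "haar (\<lambda>g. a g * b (bmul k (binv g))) = haar (\<lambda>g. a (bmul g k) * b (bmul k (binv (bmul g k))))" by simp
    also have "\<dots> = haar (\<lambda>g. a (bmul g k) * b (binv g))"
      by (rule haar_cong)
        (simp add: binv_bmul binv_right[OF k] bone_left[OF binv_closed] bmul_assoc[symmetric])
    finally show "haar (\<lambda>g. a (bmul g k) * b (binv g)) = haar (\<lambda>g. a g * b (bmul k (binv g)))" by simp
  qed
  have in_A': "(\<lambda>g. haar (\<lambda>k. a k * b (bmul k (binv g)))) \<in> A" if a: "a \<in> A" for a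
  proof (rule A_cong[OF convolution_in_A[OF a b]])
    fix k :: "'a bigroup_elem" assume k: "k \<in> SL2s"
    have "PF (\<lambda>g. a g * (\<Sum>j\<in>I. d j (binv k) * c j g))"
      by (intro PF_mult PF_sum PF_const A_PF[OF a] PFc)
    then have "PF (\<lambda>g. a g * b (bmul g (binv k)))"
      by (rule PF_cong) (simp add: bcd[OF _ binv_closed[OF k]] mult.commute)
    from haar_PF_right[OF this k]
    have "haar (\<lambda>g. a g * b (bmul g (binv k))) = haar (\<lambda>g. a (bmul g k) * b (bmul (bmul g k) (binv k)))" by simp
    also have "\<dots> = haar (\<lambda>g. a (bmul g k) * b g)"
      by (rule haar_cong) (simp add: binv_right[OF k] bone_right bmul_assoc)
    finally show "haar (\<lambda>g. a (bmul g k) * b g) = haar (\<lambda>g. a g * b (bmul g (binv k)))" by simp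
  qed
  \<comment> \<open>The vector of values \<open>d j bone\<close> is the coordinate vector of
    \<open>b\<close> itself. It has to be changed, modulo the annihilator of all \<open>C a\<close>,
    into a combination of vectors \<open>\<Xi> a\<close>.\<close>
  have "\<exists>\<xi>. (\<lambda>k. \<Sum>j\<in>I. \<xi> j * c j k) \<in> A \<and> (\<forall>a\<in>A. (\<Sum>j\<in>I. C a j * \<xi> j) = (\<Sum>j\<in>I. C a j * d j bone))"
  proof (rule linear_combination_or_separated[OF I, of "Inl ` A \<union> Inr ` Cperp" "\<lambda>j. d j bone" v])
    fix T w assume T: "finite T" "T \<subseteq> Inl ` A \<union> Inr ` Cperp"
      and e: "\<And>j. j \<in> I \<Longrightarrow> d j bone = (\<Sum>x\<in>T. w x * v x j)"
    define T1 where "T1 = {a. Inl a \<in> T}"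
    define T2 where "T2 = {y. Inr y \<in> T}"
    have "x \<in> T \<longleftrightarrow> x \<in> Inl ` T1 \<union> Inr ` T2" for x
      by (cases x) (auto simp: T1_def T2_def)
    then have Teq: "T = Inl ` T1 \<union> Inr ` T2" by (rule Set.set_eqI)
    have fin: "finite T1" "finite T2"
      using T(1) finite_imageD[of Inl T1] finite_imageD[of Inr T2] unfolding Teq by auto
    have T1A: "T1 \<subseteq> A" and T2C: "T2 \<subseteq> Cperp" using T(2) unfolding T1_def T2_def by auto
    have sumT: "(\<Sum>x\<in>T. w x * v x j) = (\<Sum>a\<in>T1. w (Inl a) * \<Xi> a j) + (\<Sum>y\<in>T2. w (Inr y) * y j)" for j
    proof -
      have "(\<Sum>x\<in>T. w x * v x j) = (\<Sum>x\<in>Inl ` T1. w x * v x j) + (\<Sum>x\<in>Inr ` T2. w x * v x j)"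
        unfolding Teq using fin by (intro sum.union_disjoint) auto
      then show ?thesis by (simp add: sum.reindex v_def)
    qed
    define \<xi> where "\<xi> j = (\<Sum>a\<in>T1. w (Inl a) * \<Xi> a j)" for j
    have "(\<Sum>j\<in>I. C a j * \<xi> j) = (\<Sum>j\<in>I. C a j * d j bone)" if a: "a \<in> A" for a
    proof -
      have "(\<Sum>j\<in>I. C a j * d j bone) = (\<Sum>j\<in>I. C a j * (\<xi> j + (\<Sum>y\<in>T2. w (Inr y) * y j)))"
        by (intro sum.cong refl) (simp add: e sumT \<xi>_def)
      also have "\<dots> = (\<Sum>j\<in>I. C a j * \<xi> j) + (\<Sum>y\<in>T2. w (Inr y) * (\<Sum>j\<in>I. C a j * y j))"
        by (simp add: distrib_left sum.distrib sum_distrib_left mult_ac) (rule sum.swap)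
      also have "(\<Sum>y\<in>T2. w (Inr y) * (\<Sum>j\<in>I. C a j * y j)) = 0"
        using T2C a unfolding Cperp_def by (intro sum.neutral) auto
      finally show ?thesis by simp
    qed
    moreover have "(\<lambda>k. \<Sum>j\<in>I. \<xi> j * c j k) \<in> A"
    proof -
      have "(\<lambda>k. \<Sum>a\<in>T1. w (Inl a) * haar (\<lambda>g. a g * b (bmul k (binv g)))) \<in> A"
        using T1A by (intro A_sum A_scale in_A) auto
      then show ?thesis
      proof (rule A_cong)
        fix k :: "'a bigroup_elem" assume k: "k \<in> SL2s"
        have "haar (\<lambda>g. a g * b (bmul k (binv g))) = (\<Sum>j\<in>I. \<Xi> a j * c j k)" if "a \<in> T1" for a
        proof -
          have "haar (\<lambda>g. a g * b (bmul k (binv g))) = haar (\<lambda>g. a g * (\<Sum>j\<in>I. c j k * d j (binv g)))"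
            by (rule haar_cong) (simp add: bcd[OF k binv_closed])
          also have "\<dots> = (\<Sum>j\<in>I. \<Xi> a j * c j k)" using T1A that by (intro \<Xi>_pair) auto
          finally show ?thesis .
        qed
        then have "(\<Sum>a\<in>T1. w (Inl a) * haar (\<lambda>g. a g * b (bmul k (binv g))))
            = (\<Sum>a\<in>T1. w (Inl a) * (\<Sum>j\<in>I. \<Xi> a j * c j k))" by simp
        also have "\<dots> = (\<Sum>j\<in>I. \<xi> j * c j k)"
          unfolding \<xi>_def sum_distrib_left sum_distrib_right by (subst sum.swap) (simp add: mult.assoc)
        finally show "(\<Sum>a\<in>T1. w (Inl a) * haar (\<lambda>g. a g * b (bmul k (binv g)))) = (\<Sum>j\<in>I. \<xi> j * c j k)" .
      qed
    qed
    ultimately show ?thesis by blast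
  next
    fix y assume y: "\<And>x. x \<in> Inl ` A \<union> Inr ` Cperp \<Longrightarrow> (\<Sum>j\<in>I. y j * v x j) = 0"
      and ne: "(\<Sum>j\<in>I. y j * d j bone) \<noteq> 0"
    have y\<Xi>: "(\<Sum>j\<in>I. y j * \<Xi> a j) = 0" if "a \<in> A" for a
      using y[of "Inl a"] that by (simp add: v_def)
    have yC: "(\<Sum>j\<in>I. y j * z j) = 0" if "z \<in> Cperp" for z
      using y[of "Inr z"] that by (simp add: v_def)
    \<comment> \<open>Double annihilator: \<open>y\<close> kills everything that kills all
      \<open>C a\<close>, so it is itself of this form.\<close>
    have "\<exists>a\<in>A. \<forall>j\<in>I. y j = C a j"
    proof (rule linear_combination_or_separated[OF I, of A y C])
      fix T w assume T: "finite T" "T \<subseteq> A" and e: "\<And>j. j \<in> I \<Longrightarrow> y j = (\<Sum>a\<in>T. w a * C a j)"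
      have "C (\<lambda>g. \<Sum>a\<in>T. w a * a g) j = (\<Sum>a\<in>T. w a * C a j)" if j: "j \<in> I" for j
      proof -
        have "haar (\<lambda>g. \<Sum>a\<in>T. w a * (a g * c j g)) = (\<Sum>a\<in>T. w a * haar (\<lambda>g. a g * c j g))"
          using PFc[OF j] A_PF T(2) by (intro haar_sum PF_mult) auto
        then show ?thesis by (simp add: C_def sum_distrib_right mult.assoc)
      qed
      then have "\<forall>j\<in>I. y j = C (\<lambda>g. \<Sum>a\<in>T. w a * a g) j" using e by simp
      moreover have "(\<lambda>g. \<Sum>a\<in>T. w a * a g) \<in> A" using T(2) by (intro A_sum A_scale) auto
      ultimately show ?thesis by (intro bexI)
    next
      fix z assume z: "\<And>a. a \<in> A \<Longrightarrow> (\<Sum>j\<in>I. z j * C a j) = 0" "(\<Sum>j\<in>I. z j * y j) \<noteq> 0"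
      have "z \<in> Cperp" using z(1) by (simp add: Cperp_def mult.commute)
      from yC[OF this] have "(\<Sum>j\<in>I. z j * y j) = 0" by (simp add: mult.commute)
      with z(2) have False by blast
      then show ?thesis ..
    qed
    then obtain a where a: "a \<in> A" and ya: "\<And>j. j \<in> I \<Longrightarrow> y j = C a j" by blast
    have eq: "haar (\<lambda>k. a k * b (bmul k (binv g))) = (\<Sum>j\<in>I. y j * d j (binv g))" if g: "g \<in> SL2s" for g
    proof -
      have "haar (\<lambda>k. a k * b (bmul k (binv g))) = haar (\<lambda>k. a k * (\<Sum>j\<in>I. d j (binv g) * c j k))"
        by (rule haar_cong) (simp add: bcd[OF _ binv_closed[OF g]] mult.commute)
      also have "\<dots> = (\<Sum>j\<in>I. C a j * d j (binv g))" by (rule C_pair[OF a])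
      finally show ?thesis by (simp add: ya)
    qed
    \<comment> \<open>The function with coordinates \<open>y\<close> lies in \<open>A\<close> and is
      orthogonal to \<open>A\<close>, hence zero; at the identity this contradicts the
      separation.\<close>
    have "haar (\<lambda>k. a k * b (bmul k (binv bone))) = 0"
    proof (rule A_radical[OF in_A'[OF a] _ bone_closed])
      fix a' assume a': "a' \<in> A"
      have "haar (\<lambda>g. a' g * haar (\<lambda>k. a k * b (bmul k (binv g))))
          = haar (\<lambda>g. a' g * (\<Sum>j\<in>I. y j * d j (binv g)))"
        by (rule haar_cong) (simp add: eq)
      also have "\<dots> = (\<Sum>j\<in>I. \<Xi> a' j * y j)" by (rule \<Xi>_pair[OF a'])
      also have "\<dots> = 0" using y\<Xi>[OF a'] by (simp add: mult.commute)
      finally show "haar (\<lambda>g. a' g * haar (\<lambda>k. a k * b (bmul k (binv g)))) = 0" .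
    qed
    moreover have "binv bone = (bone :: 'a bigroup_elem)" by (simp add: binv_def bone_def adj2_def mat2_simps)
    ultimately have False using eq[OF bone_closed] ne by simp
    then show ?thesis ..
  qed
  then obtain \<xi> where \<xi>: "(\<lambda>k. \<Sum>j\<in>I. \<xi> j * c j k) \<in> A"
    "\<And>a. a \<in> A \<Longrightarrow> (\<Sum>j\<in>I. C a j * \<xi> j) = (\<Sum>j\<in>I. C a j * d j bone)" by blast
  have "haar (\<lambda>g. a g * b g) = haar (\<lambda>g. a g * (\<Sum>j\<in>I. \<xi> j * c j g))" if a: "a \<in> A" for a
  proof -
    have "haar (\<lambda>g. a g * b g) = haar (\<lambda>g. a g * (\<Sum>j\<in>I. d j bone * c j g))"
    proof (rule haar_cong)
      fix g :: "'a bigroup_elem" assume g: "g \<in> SL2s"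
      show "a g * b g = a g * (\<Sum>j\<in>I. d j bone * c j g)"
        using bcd[OF g bone_closed] bone_right[OF g] by (simp add: mult.commute)
    qed
    then show ?thesis using \<xi>(2)[OF a] C_pair[OF a] by simp
  qed
  then show ?thesis by (intro bexI[OF _ \<xi>(1)] ballI)
qed

text \<open>Projecting \<open>b i\<close> to \<open>\<alpha> i\<close> preserves all integrals
  against \<open>a' * a i\<close>, since these products lie in \<open>A\<close>. So
  \<open>z = 1 - (sum of a i * \<alpha> i)\<close> is in \<open>A\<close> and orthogonal to
  \<open>A\<close> like \<open>\<psi>\<close>; it vanishes, although its value at the identity is
  1.\<close>

lemma not_orthogonal:
  assumes \<psi>: "PF \<psi>" "\<And>a. a \<in> A \<Longrightarrow> haar (\<lambda>g. a g * \<psi> g) = 0"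
    and I: "finite I" "\<And>i. i \<in> I \<Longrightarrow> a i \<in> A" "\<And>i. i \<in> I \<Longrightarrow> a i bone = 0" "\<And>i. i \<in> I \<Longrightarrow> PF (b i)"
    and eq: "\<And>g. g \<in> SL2s \<Longrightarrow> 1 - \<psi> g = (\<Sum>i\<in>I. a i g * b i g)"
  shows False
proof -
  define \<alpha> where "\<alpha> i = (SOME \<alpha>. \<alpha> \<in> A \<and> (\<forall>a\<in>A. haar (\<lambda>g. a g * b i g) = haar (\<lambda>g. a g * \<alpha> g)))" for i
  have "\<alpha> i \<in> A \<and> (\<forall>a\<in>A. haar (\<lambda>g. a g * b i g) = haar (\<lambda>g. a g * \<alpha> i g))" if "i \<in> I" for i
    using someI_ex[OF orthogonal_projection[OF I(4)[OF that], unfolded Bex_def]] unfolding \<alpha>_def .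
  then have \<alpha>: "\<And>i. i \<in> I \<Longrightarrow> \<alpha> i \<in> A"
    "\<And>i a. i \<in> I \<Longrightarrow> a \<in> A \<Longrightarrow> haar (\<lambda>g. a g * b i g) = haar (\<lambda>g. a g * \<alpha> i g)" by simp_all
  define z where "z g = 1 + (\<Sum>i\<in>I. (-1) * (a i g * \<alpha> i g))" for g
  have z: "z \<in> A"
    unfolding z_def using I(2) \<alpha>(1) by (intro A_add A_const A_sum A_scale A_mult)
  have "haar (\<lambda>g. a' g * z g) = 0" if a': "a' \<in> A" for a'
  proof -
    have exp: "haar (\<lambda>g. a' g + (\<Sum>i\<in>I. (-1) * ((a' g * a i g) * \<beta> i g)))
        = haar a' + (\<Sum>i\<in>I. (-1) * haar (\<lambda>g. (a' g * a i g) * \<beta> i g))"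
      if \<beta>: "\<And>i. i \<in> I \<Longrightarrow> PF (\<beta> i)" for \<beta>
    proof -
      have P: "PF (\<lambda>g. (a' g * a i g) * \<beta> i g)" if "i \<in> I" for i
        using PF_mult[OF A_PF[OF A_mult[OF a' I(2)[OF that]]] \<beta>[OF that]] .
      have "PF (\<lambda>g. \<Sum>i\<in>I. (-1) * ((a' g * a i g) * \<beta> i g))" by (intro PF_sum PF_scale P)
      from haar_PF_lin[OF A_PF[OF a'] this, of 1] show ?thesis
        using haar_sum[of I "\<lambda>i g. (a' g * a i g) * \<beta> i g" "\<lambda>_. -1", OF P] by simp
    qed
    have "haar (\<lambda>g. a' g * z g) = haar (\<lambda>g. a' g + (\<Sum>i\<in>I. (-1) * ((a' g * a i g) * \<alpha> i g)))"
      by (rule haar_cong) (simp add: z_def algebra_simps sum_distrib_left)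
    also have "\<dots> = haar a' + (\<Sum>i\<in>I. (-1) * haar (\<lambda>g. (a' g * a i g) * \<alpha> i g))"
      by (rule exp[OF A_PF[OF \<alpha>(1)]])
    also have "\<dots> = haar a' + (\<Sum>i\<in>I. (-1) * haar (\<lambda>g. (a' g * a i g) * b i g))"
      by (simp add: \<alpha>(2)[OF _ A_mult[OF a' I(2)]])
    also have "\<dots> = haar (\<lambda>g. a' g + (\<Sum>i\<in>I. (-1) * ((a' g * a i g) * b i g)))"
      by (rule exp[OF I(4), symmetric])
    also have "\<dots> = haar (\<lambda>g. a' g * \<psi> g)"
    proof (rule haar_cong)
      fix g :: "'a bigroup_elem" assume g: "g \<in> SL2s"
      have p: "\<psi> g = 1 - (\<Sum>i\<in>I. a i g * b i g)" using eq[OF g] by (simp add: algebra_simps)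
      show "a' g + (\<Sum>i\<in>I. (-1) * ((a' g * a i g) * b i g)) = a' g * \<psi> g"
        unfolding p by (simp add: right_diff_distrib sum_distrib_left sum_negf mult.assoc)
    qed
    finally show ?thesis using \<psi>(2)[OF a'] by simp
  qed
  then have "z bone = 0" using A_radical[OF z _ bone_closed] by blast
  moreover have "z bone = 1" unfolding z_def using I(3) by simp
  ultimately show False by simp
qed

end

subsection \<open>Bihomogeneous forms and the group action\<close>

definition lin :: "'a::comm_ring_1^2^2 \<Rightarrow> 'a^2^2 \<Rightarrow> (bivar \<Rightarrow> 'a) \<Rightarrow> bivar \<Rightarrow> 'a" where
  "lin A B p v = (case v of
     vx \<Rightarrow> A$1$1 * p vx + A$1$2 * p vy | vy \<Rightarrow> A$2$1 * p vx + A$2$2 * p vy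
   | vu \<Rightarrow> B$1$1 * p vu + B$1$2 * p vv | vv \<Rightarrow> B$2$1 * p vu + B$2$2 * p vv)"

lemma lin_simps [simp]:
  "lin A B p vx = A$1$1 * p vx + A$1$2 * p vy" "lin A B p vy = A$2$1 * p vx + A$2$2 * p vy"
  "lin A B p vu = B$1$1 * p vu + B$1$2 * p vv" "lin A B p vv = B$2$1 * p vu + B$2$2 * p vv"
  by (simp_all add: lin_def)

definition swp :: "(bivar \<Rightarrow> 'a) \<Rightarrow> bivar \<Rightarrow> 'a" where
  "swp p v = (case v of vx \<Rightarrow> p vu | vy \<Rightarrow> p vv | vu \<Rightarrow> p vx | vv \<Rightarrow> p vy)"

lemma swp_simps [simp]: "swp p vx = p vu" "swp p vy = p vv" "swp p vu = p vx" "swp p vv = p vy"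
  by (simp_all add: swp_def)

definition scl :: "'a::comm_ring_1 \<Rightarrow> 'a \<Rightarrow> (bivar \<Rightarrow> 'a) \<Rightarrow> bivar \<Rightarrow> 'a" where
  "scl s t p v = (case v of vx \<Rightarrow> s * p vx | vy \<Rightarrow> s * p vy | vu \<Rightarrow> t * p vu | vv \<Rightarrow> t * p vv)"

lemma scl_simps [simp]: "scl s t p vx = s * p vx" "scl s t p vy = s * p vy"
    "scl s t p vu = t * p vu" "scl s t p vv = t * p vv"
  by (simp_all add: scl_def)

lemma fun_bivar_eqI: "f vx = g vx \<Longrightarrow> f vy = g vy \<Longrightarrow> f vu = g vu \<Longrightarrow> f vv = g vv \<Longrightarrow> f = g"
  by (rule ext, case_tac x) auto

lemma UNIV_bivar: "UNIV = {vx, vy, vu, vv}"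
proof (rule UNIV_eq_I)
  show "v \<in> {vx, vy, vu, vv}" for v by (cases v) auto
qed

lemma mp_eval_linear_vars: "(\<lambda>v. mp_eval p (linear_vars A B v)) = lin A B p"
  by (rule fun_bivar_eqI) auto

lemma mp_eval_exchange_vars: "(\<lambda>v. mp_eval p (exchange_vars v)) = swp p"
  by (rule fun_bivar_eqI) auto

text \<open>Together with \<open>mp_eval_inject\<close> this turns identities of the action into
  identities of points.\<close>

lemma mp_eval_act: "mp_eval p (act (A, B, s) F) =
    mp_eval (if s then swp (lin (matrix_inv A) (matrix_inv B) p) else lin (matrix_inv A) (matrix_inv B) p) F"
  by (simp add: mp_eval_subst mp_eval_linear_vars mp_eval_exchange_vars)

lemma prod_bivar: "(\<Prod>v\<in>keys m. p v ^ lookup m v) =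
    (p vx ^ lookup m vx * p vy ^ lookup m vy * p vu ^ lookup m vu * p vv ^ lookup m vv :: 'a::comm_monoid_mult)"
proof -
  have "finite (UNIV :: bivar set)" by (simp add: UNIV_bivar)
  then have "(\<Prod>v\<in>keys m. p v ^ lookup m v) = (\<Prod>v\<in>UNIV. p v ^ lookup m v)"
    by (intro prod.mono_neutral_left) (auto simp: in_keys_iff)
  then show ?thesis unfolding UNIV_bivar by (simp add: mult_ac)
qed

lemma mp_eval_scl_biforms:
  assumes "F \<in> biforms a b"
  shows "mp_eval (scl s t p) F = s ^ a * t ^ b * mp_eval p F"
proof -
  have "lookup F m * (\<Prod>v\<in>keys m. scl s t p v ^ lookup m v)
      = s ^ a * t ^ b * (lookup F m * (\<Prod>v\<in>keys m. p v ^ lookup m v))" if "m \<in> keys F" for m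
  proof -
    have "a = lookup m vx + lookup m vy" "b = lookup m vu + lookup m vv"
      using assms that by (auto simp: biforms_def)
    then show ?thesis by (simp add: prod_bivar power_mult_distrib power_add mult_ac)
  qed
  then show ?thesis unfolding mp_eval_def sum_distrib_left by (rule sum.cong[OF refl])
qed

text \<open>Scaling separates the bidegrees: coefficients are compared at the scale factor 2, whose
  powers are distinct in characteristic zero.\<close>

lemma biformsI_scl:
  fixes F :: "(bivar, 'a::field_char_0) mpoly"
  assumes "\<And>s t p. mp_eval (scl s t p) F = s ^ a * t ^ b * mp_eval p F"
  shows "F \<in> biforms a b"
proof -
  have coeffs: "s ^ (lookup m vx + lookup m vy) * t ^ (lookup m vu + lookup m vv) * lookup F m
      = s ^ a * t ^ b * lookup F m" for s t :: 'a and m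
  proof -
    define F' where "F' = (\<Sum>m\<in>keys F. Poly_Mapping.single m
        (s ^ (lookup m vx + lookup m vy) * t ^ (lookup m vu + lookup m vv) * lookup F m))"
    have "mp_eval p F' = mp_eval (scl s t p) F" for p
      unfolding F'_def mp_eval_sum mp_eval_single
      unfolding mp_eval_def by (intro sum.cong refl) (simp add: prod_bivar power_mult_distrib power_add mult_ac)
    then have 1: "F' = Const (s ^ a * t ^ b) * F"
      using assms by (intro mp_eval_inject) simp
    have 2: "lookup (Const k * F) m = k * lookup F m" for k :: 'a
    proof -
      have "Const k * F = (\<Sum>m\<in>keys F. Poly_Mapping.single m (k * lookup F m))"
        by (subst (1) sum_single_lookup[of F, symmetric])
          (simp add: sum_distrib_left Const_def mult_single)
      then show ?thesis by (auto simp: lookup_sum lookup_single when_def in_keys_iff)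
    qed
    have 3: "lookup F' m = s ^ (lookup m vx + lookup m vy) * t ^ (lookup m vu + lookup m vv) * lookup F m"
      unfolding F'_def by (auto simp: lookup_sum lookup_single when_def in_keys_iff)
    show ?thesis using 3[symmetric] unfolding 1 2 .
  qed
  have two: "n = k" if "(2::'a) ^ n = 2 ^ k" for n k
  proof -
    have "of_nat (2 ^ n) = (of_nat (2 ^ k) :: 'a)" using that by simp
    then have "(2::nat) ^ n = 2 ^ k" unfolding of_nat_eq_iff .
    then show ?thesis by simp
  qed
  show ?thesis
    unfolding biforms_def
  proof (intro CollectI ballI conjI)
    fix m assume m: "m \<in> keys F"
    then have nz: "lookup F m \<noteq> 0" by (simp add: in_keys_iff)
    show "lookup m vx + lookup m vy = a"
      using coeffs[of 2 m 1] nz by (intro two) simp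
    show "lookup m vu + lookup m vv = b"
      using coeffs[of 1 m 2] nz by (intro two) simp
  qed
qed

lemma lin_scl: "lin A B (scl s t p) = scl s t (lin A B p)"
  by (rule fun_bivar_eqI) (simp_all add: algebra_simps)

lemma swp_scl: "swp (scl s t p) = scl t s (swp p)"
  by (rule fun_bivar_eqI) simp_all

lemma act_biforms:
  fixes F :: "(bivar, 'a::field_char_0) mpoly"
  shows "F \<in> biforms a b \<Longrightarrow> act (A, B, False) F \<in> biforms a b"
  by (rule biformsI_scl) (simp only: mp_eval_act if_False lin_scl mp_eval_scl_biforms)

lemma exchange_biforms:
  fixes F :: "(bivar, 'a::field_char_0) mpoly"
  shows "F \<in> biforms a b \<Longrightarrow> act exchange F \<in> biforms b a"
  unfolding exchange_def
  by (rule biformsI_scl) (simp only: mp_eval_act if_True lin_scl swp_scl mp_eval_scl_biforms mult.commute)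

lemma lin_lin: "lin A B (lin C D p) = lin (A ** C) (B ** D) p"
  by (rule fun_bivar_eqI) (simp_all add: matrix_mult_2 algebra_simps)

lemma matrix_inv_mult:
  fixes A B :: "'a::field^2^2"
  assumes "invertible A" "invertible B"
  shows "matrix_inv (A ** B) = matrix_inv B ** matrix_inv A"
proof (rule matrix_inv_eqI)
  have i: "C ** matrix_inv C = mat 1" "matrix_inv C ** C = mat 1" if "invertible C" for C :: "'a^2^2"
  proof -
    have "\<exists>D. C ** D = mat 1 \<and> D ** C = mat 1" using that unfolding invertible_def .
    from someI_ex[OF this] show "C ** matrix_inv C = mat 1" "matrix_inv C ** C = mat 1"
      unfolding matrix_inv_def by auto
  qed
  have "matrix_inv B ** matrix_inv A ** (A ** B) = matrix_inv B ** (matrix_inv A ** A) ** B"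
    by (simp only: matrix_mul_assoc)
  then show "matrix_inv B ** matrix_inv A ** (A ** B) = mat 1" using assms by (simp add: i)
  have "A ** B ** (matrix_inv B ** matrix_inv A) = A ** (B ** matrix_inv B) ** matrix_inv A"
    by (simp only: matrix_mul_assoc)
  then show "A ** B ** (matrix_inv B ** matrix_inv A) = mat 1" using assms by (simp add: i)
qed

lemma matrix_inv_1: "matrix_inv (mat 1) = (mat 1 :: 'a::field^2^2)"
  by (rule matrix_inv_eqI) simp_all

lemma lin_1: "lin (mat 1) (mat 1) p = p"
  by (rule fun_bivar_eqI) (simp_all add: mat_2)

lemma act_act:
  fixes F :: "(bivar, 'a::field_char_0) mpoly"
  assumes "invertible A" "invertible B" "invertible C" "invertible D"
  shows "act (A, B, False) (act (C, D, False) F) = act (A ** C, B ** D, False) F"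
  using assms by (intro mp_eval_inject) (simp add: mp_eval_act lin_lin matrix_inv_mult del: act.simps)

lemma act_1:
  fixes F :: "(bivar, 'a::field_char_0) mpoly"
  shows "act (mat 1, mat 1, False) F = F"
  by (intro mp_eval_inject) (simp add: mp_eval_act matrix_inv_1 lin_1 del: act.simps)

lemma act_exchange_exchange:
  fixes F :: "(bivar, 'a::field_char_0) mpoly"
  shows "act exchange (act exchange F) = F"
proof -
  have "swp (swp p) = p" for p :: "bivar \<Rightarrow> 'a" by (rule fun_bivar_eqI) simp_all
  then show ?thesis
    unfolding exchange_def by (intro mp_eval_inject) (simp add: mp_eval_act matrix_inv_1 lin_1 del: act.simps)
qed

lemma act_exchange_act:
  fixes F :: "(bivar, 'a::field_char_0) mpoly"
  shows "act exchange (act (A, B, False) F) = act (B, A, False) (act exchange F)"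
proof -
  have "lin A B (swp p) = swp (lin B A p)" for A B and p :: "bivar \<Rightarrow> 'a" by (rule fun_bivar_eqI) simp_all
  then show ?thesis
    unfolding exchange_def by (intro mp_eval_inject) (simp add: mp_eval_act matrix_inv_1 lin_1 del: act.simps)
qed

lemma act_exchange_eq:
  fixes F :: "(bivar, 'a::field_char_0) mpoly"
  shows "act (A, B, True) F = act (A, B, False) (act exchange F)"
  unfolding exchange_def
  by (intro mp_eval_inject) (simp add: mp_eval_act matrix_inv_1 lin_1 del: act.simps)

lemma det1_invertible: "det A = 1 \<Longrightarrow> invertible A" for A :: "'a::field^2^2"
  unfolding invertible_def using adj2_mult by blast

lemma act_bmul:
  fixes F :: "(bivar, 'a::field_char_0) mpoly"
  assumes "g \<in> SL2s" "h \<in> SL2s"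
  shows "act (bmul g h) F = act g (act h F)"
  using assms by (elim SL2sE) (simp add: bmul_simp act_act det1_invertible del: act.simps)

lemma act_bone: "act bone F = (F :: (bivar, 'a::field_char_0) mpoly)"
  unfolding bone_def by (rule act_1)

lemma act_SL_biforms:
  fixes F :: "(bivar, 'a::field_char_0) mpoly"
  shows "g \<in> SL2s \<Longrightarrow> F \<in> biforms a b \<Longrightarrow> act g F \<in> biforms a b"
  by (erule SL2sE) (simp add: act_biforms del: act.simps)

lemma act_binv:
  fixes F :: "(bivar, 'a::field_char_0) mpoly"
  assumes "g \<in> SL2s"
  shows "act g (act (binv g) F) = F" "act (binv g) (act g F) = F"
  using assms by (simp_all add: act_bmul[symmetric] binv_closed binv_left binv_right act_bone)

lemma act_0 [simp]: "act g 0 = 0"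
  by (cases g) simp

lemma act_add: "act g (F + G) = act g F + act g G"
  by (cases g) simp

lemma act_sum: "act g (sum f I) = (\<Sum>i\<in>I. act g (f i))"
  by (induction I rule: infinite_finite_induct) (simp_all add: act_add del: act.simps)

lemma act_Const_mult: "act g (Const c * F) = Const c * act g F"
  by (cases g) simp

lemma lookup_Const_mult: "lookup (Const c * F) m = c * lookup F m"
proof -
  have "Const c * F = (\<Sum>m\<in>keys F. Poly_Mapping.single m (c * lookup F m))"
    by (subst (1) sum_single_lookup[of F, symmetric]) (simp add: sum_distrib_left Const_def mult_single)
  then show ?thesis by (auto simp: lookup_sum lookup_single when_def in_keys_iff)
qed

section \<open>Coefficients of bihomogeneous forms as coordinates\<close>

lemma single_Const: "Poly_Mapping.single m c = Const c * Poly_Mapping.single m (1 :: 'a::comm_ring_1)"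
  by (simp add: Const_def mult_single)

definition mm :: "nat \<Rightarrow> nat \<Rightarrow> nat \<Rightarrow> nat \<Rightarrow> bivar \<Rightarrow>\<^sub>0 nat" where
  "mm i j k l = Poly_Mapping.single vx i + Poly_Mapping.single vy j +
     Poly_Mapping.single vu k + Poly_Mapping.single vv l"

lemma lookup_mm [simp]: "lookup (mm i j k l) vx = i" "lookup (mm i j k l) vy = j"
    "lookup (mm i j k l) vu = k" "lookup (mm i j k l) vv = l"
  by (simp_all add: mm_def lookup_add lookup_single)

lemma bimonom_eqI: "lookup m vx = lookup n vx \<Longrightarrow> lookup m vy = lookup n vy \<Longrightarrow>
    lookup m vu = lookup n vu \<Longrightarrow> lookup m vv = lookup n vv \<Longrightarrow> m = n"
  by (rule poly_mapping_eqI, case_tac k) auto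

lemma mm_eq_iff: "mm i j k l = mm i' j' k' l' \<longleftrightarrow> i = i' \<and> j = j' \<and> k = k' \<and> l = l'"
  by (metis lookup_mm)

definition bimonoms :: "nat \<Rightarrow> nat \<Rightarrow> (bivar \<Rightarrow>\<^sub>0 nat) set" where
  "bimonoms a b = (\<lambda>(i, j). mm (a - i) i (b - j) j) ` ({..a} \<times> {..b})"

lemma finite_bimonoms: "finite (bimonoms a b)" by (simp add: bimonoms_def)

lemma bimonoms_iff: "m \<in> bimonoms a b \<longleftrightarrow> lookup m vx + lookup m vy = a \<and> lookup m vu + lookup m vv = b"
proof
  assume h: "lookup m vx + lookup m vy = a \<and> lookup m vu + lookup m vv = b"
  then have "m = mm (a - lookup m vy) (lookup m vy) (b - lookup m vv) (lookup m vv)"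
    by (intro bimonom_eqI) auto
  then show "m \<in> bimonoms a b"
    unfolding bimonoms_def using h by (intro rev_image_eqI[of "(lookup m vy, lookup m vv)"]) auto
qed (auto simp: bimonoms_def)

lemma biforms_iff: "F \<in> biforms a b \<longleftrightarrow> keys F \<subseteq> bimonoms a b"
  by (auto simp: biforms_def bimonoms_iff)

lemma biforms_lookup_0: "F \<in> biforms a b \<Longrightarrow> m \<notin> bimonoms a b \<Longrightarrow> lookup F m = 0"
  by (auto simp: biforms_iff in_keys_iff)

lemma biforms_expand:
  assumes "F \<in> biforms a b"
  shows "F = (\<Sum>m\<in>bimonoms a b. Const (lookup F m) * Poly_Mapping.single m 1)"
proof -
  have "F = (\<Sum>m\<in>keys F. Poly_Mapping.single m (lookup F m))" by (simp add: sum_single_lookup)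
  also have "\<dots> = (\<Sum>m\<in>bimonoms a b. Poly_Mapping.single m (lookup F m))"
    using assms finite_bimonoms by (intro sum.mono_neutral_left) (auto simp: biforms_iff in_keys_iff)
  finally show ?thesis by (simp flip: single_Const)
qed

lemma biforms_of_coords:
  assumes "finite S" "S = bimonoms a b"
  shows "(\<Sum>m\<in>S. Poly_Mapping.single m (p m)) \<in> biforms a b"
    and "lookup (\<Sum>m\<in>S. Poly_Mapping.single m (p m)) m' = (if m' \<in> S then p m' else 0)"
proof -
  show *: "lookup (\<Sum>m\<in>S. Poly_Mapping.single m (p m)) m' = (if m' \<in> S then p m' else 0)" for m'
    using assms(1) by (auto simp: lookup_sum lookup_single when_def)
  show "(\<Sum>m\<in>S. Poly_Mapping.single m (p m)) \<in> biforms a b"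
    unfolding biforms_iff assms(2)[symmetric] by (auto simp: in_keys_iff * split: if_splits)
qed

lemma lookup_act_linear:
  assumes "F \<in> biforms a b"
  shows "lookup (act g F) m = (\<Sum>m'\<in>bimonoms a b. lookup F m' * lookup (act g (Poly_Mapping.single m' 1)) m)"
proof -
  have "act g F = (\<Sum>m'\<in>bimonoms a b. Const (lookup F m') * act g (Poly_Mapping.single m' 1))"
    by (subst (1) biforms_expand[OF assms]) (simp add: act_sum act_Const_mult del: act.simps)
  then show ?thesis by (simp add: lookup_sum lookup_Const_mult)
qed

lemma lookup_mult_finite:
  fixes F G :: "('v, 'a::comm_ring_1) mpoly"
  assumes "finite S" "keys F \<subseteq> S" "finite S'" "keys G \<subseteq> S'"
  shows "lookup (F * G) m = (\<Sum>k\<in>S. \<Sum>l\<in>S'. if k + l = m then lookup F k * lookup G l else 0)"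
proof -
  have e: "H = (\<Sum>m\<in>U. Poly_Mapping.single m (lookup H m))" if "finite U" "keys H \<subseteq> U"
    for H :: "('v, 'a) mpoly" and U
  proof -
    have "H = (\<Sum>m\<in>keys H. Poly_Mapping.single m (lookup H m))" by (simp add: sum_single_lookup)
    also have "\<dots> = (\<Sum>m\<in>U. Poly_Mapping.single m (lookup H m))"
      using that by (intro sum.mono_neutral_left) (auto simp: in_keys_iff)
    finally show ?thesis .
  qed
  have "F * G = (\<Sum>k\<in>S. \<Sum>l\<in>S'. Poly_Mapping.single (k + l) (lookup F k * lookup G l))"
    by (subst e[OF assms(1,2)], subst e[OF assms(3,4)]) (simp only: sum_product mult_single)
  then show ?thesis by (simp add: lookup_sum lookup_single when_def)
qed

text \<open>Polynomial-valued maps on the group. The common finite support makes each coefficient of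
  a product a fixed finite sum.\<close>

definition PC :: "nat \<Rightarrow> ('a::field bigroup_elem \<Rightarrow> (bivar, 'a) mpoly) \<Rightarrow> bool" where
  "PC n \<Phi> \<longleftrightarrow> (\<exists>S. finite S \<and> (\<forall>g. keys (\<Phi> g) \<subseteq> S)) \<and> (\<forall>m. pf n (\<lambda>g. lookup (\<Phi> g) m))"

lemma PC_const: "PC n (\<lambda>_. F)"
  unfolding PC_def by (intro conjI allI exI[of _ "keys F"]) (auto intro: pf_const)

lemma PC_Const_mult: "pf n c \<Longrightarrow> PC n (\<lambda>g. Const (c g) * Poly_Mapping.single m 1)"
  unfolding PC_def
proof (intro conjI allI)
  show "\<exists>S. finite S \<and> (\<forall>g. keys (Const (c g) * Poly_Mapping.single m 1) \<subseteq> S)"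
    by (intro exI[of _ "{m}"]) (simp flip: single_Const)
  show "pf n (\<lambda>g. lookup (Const (c g) * Poly_Mapping.single m 1) m')" if "pf n c" for m'
    using that by (cases "m = m'") (auto simp: lookup_single pf_const simp flip: single_Const)
qed

lemma PC_add: "PC n \<Phi> \<Longrightarrow> PC n \<Psi> \<Longrightarrow> PC n (\<lambda>g. \<Phi> g + \<Psi> g)"
proof -
  assume a: "PC n \<Phi>" "PC n \<Psi>"
  obtain S S' where S: "finite S" "\<And>g. keys (\<Phi> g) \<subseteq> S" "finite S'" "\<And>g. keys (\<Psi> g) \<subseteq> S'"
    using a unfolding PC_def by blast
  have p: "pf n (\<lambda>g. lookup (\<Phi> g) m)" "pf n (\<lambda>g. lookup (\<Psi> g) m)" for m
    using a unfolding PC_def by auto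
  have "keys (\<Phi> g + \<Psi> g) \<subseteq> S \<union> S'" for g
    using Poly_Mapping.keys_add[of "\<Phi> g" "\<Psi> g"] S(2)[of g] S(4)[of g] by blast
  then have "\<exists>U. finite U \<and> (\<forall>g. keys (\<Phi> g + \<Psi> g) \<subseteq> U)"
    using S(1,3) by (intro exI[of _ "S \<union> S'"]) simp
  then show ?thesis
    unfolding PC_def lookup_add by (intro conjI allI pf_add p)
qed

lemma PC_mult: "PC n \<Phi> \<Longrightarrow> PC n' \<Psi> \<Longrightarrow> PC (n + n') (\<lambda>g. \<Phi> g * \<Psi> g)"
proof -
  assume a: "PC n \<Phi>" "PC n' \<Psi>"
  obtain S S' where S: "finite S" "\<And>g. keys (\<Phi> g) \<subseteq> S" "finite S'" "\<And>g. keys (\<Psi> g) \<subseteq> S'"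
    using a unfolding PC_def by blast
  have p: "pf n (\<lambda>g. lookup (\<Phi> g) m)" "pf n' (\<lambda>g. lookup (\<Psi> g) m)" for m
    using a unfolding PC_def by auto
  have "keys (\<Phi> g * \<Psi> g) \<subseteq> (\<lambda>(k, l). k + l) ` (S \<times> S')" for g
  proof
    fix x assume "x \<in> keys (\<Phi> g * \<Psi> g)"
    then obtain k l where "k \<in> keys (\<Phi> g)" "l \<in> keys (\<Psi> g)" "x = k + l"
      using Poly_Mapping.keys_mult[of "\<Phi> g" "\<Psi> g"] by blast
    then show "x \<in> (\<lambda>(k, l). k + l) ` (S \<times> S')"
      using S(2)[of g] S(4)[of g] by (intro image_eqI[of _ _ "(k, l)"]) auto
  qed
  then have "\<exists>U. finite U \<and> (\<forall>g. keys (\<Phi> g * \<Psi> g) \<subseteq> U)"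
    using S(1,3) by (intro exI[of _ "(\<lambda>(k, l). k + l) ` (S \<times> S')"]) simp
  moreover have "pf (n + n') (\<lambda>g. lookup (\<Phi> g * \<Psi> g) m)" for m
  proof -
    have "pf (n + n') (\<lambda>g. \<Sum>k\<in>S. \<Sum>l\<in>S'. if k + l = m then lookup (\<Phi> g) k * lookup (\<Psi> g) l else 0)"
    proof (intro pf_sum)
      show "pf (n + n') (\<lambda>g. if k + l = m then lookup (\<Phi> g) k * lookup (\<Psi> g) l else 0)" for k l
        using pf_mult[OF p(1)[of k] p(2)[of l]] by (cases "k + l = m") (simp_all add: pf_const)
    qed
    then show ?thesis by (simp only: lookup_mult_finite[OF S(1,2,3,4)])
  qed
  ultimately show ?thesis unfolding PC_def by (intro conjI allI)
qed

lemma PC_power: "PC n \<Phi> \<Longrightarrow> PC (k * n) (\<lambda>g. \<Phi> g ^ k)"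
  by (induction k) (auto intro: PC_mult PC_const)

text \<open>With the adjugate in place of the inverse, the action becomes polynomial in the matrix
  entries.\<close>

definition sub_adj :: "'a::field bigroup_elem \<Rightarrow> bivar \<Rightarrow> (bivar, 'a) mpoly" where
  "sub_adj g = linear_vars (adj2 (fst g)) (adj2 (fst (snd g)))"

lemma act_sub_adj: "g \<in> SL2s \<Longrightarrow> act g F = mp_subst (sub_adj g) F"
  by (erule SL2sE) (simp add: sub_adj_def matrix_inv_det1)

lemma PC_sub_adj: "PC 1 (\<lambda>g :: 'a::field bigroup_elem. sub_adj g v)"
proof -
  have e: "fst g $ i $ j = co (False, i, j) g" "fst (snd g) $ i $ j = co (True, i, j) g"
    for g :: "'a bigroup_elem" and i j by (cases g; simp)+
  have neg: "pf 1 (\<lambda>g :: 'a bigroup_elem. - co w g)" for w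
    using pf_scale[OF pf_co, of "-1"] by simp
  show ?thesis
    by (cases v) (auto simp: sub_adj_def adj2_def e Var_def intro!: PC_add PC_Const_mult pf_co[unfolded One_nat_def] neg[unfolded One_nat_def])
qed

text \<open>Each variable is replaced by a form linear in the matrix entries, so the degree on the
  group is the total degree of the form.\<close>

lemma pf_lookup_act:
  fixes F :: "(bivar, 'a::field) mpoly"
  assumes F: "F \<in> biforms a b"
  shows "pf (a + b) (\<lambda>g. lookup (act g F) m)"
proof -
  have mon: "PC (a + b) (\<lambda>g :: 'a bigroup_elem. mp_subst (sub_adj g) (Poly_Mapping.single m' 1))" if "m' \<in> bimonoms a b" for m'
  proof -
    have "PC (lookup m' vx * 1 + lookup m' vy * 1 + lookup m' vu * 1 + lookup m' vv * 1)
        (\<lambda>g :: 'a bigroup_elem. sub_adj g vx ^ lookup m' vx * sub_adj g vy ^ lookup m' vy *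
             sub_adj g vu ^ lookup m' vu * sub_adj g vv ^ lookup m' vv)"
      by (intro PC_mult PC_power PC_sub_adj)
    moreover have "lookup m' vx * 1 + lookup m' vy * 1 + lookup m' vu * 1 + lookup m' vv * 1 = a + b"
      using that by (simp add: bimonoms_iff)
    moreover have "mp_subst (sub_adj g) (Poly_Mapping.single m' 1) =
        sub_adj g vx ^ lookup m' vx * sub_adj g vy ^ lookup m' vy *
             sub_adj g vu ^ lookup m' vu * sub_adj g vv ^ lookup m' vv" for g :: "'a bigroup_elem"
      by (simp add: mp_subst_ins subst_hom.mp_ins_single prod_bivar)
    ultimately show ?thesis by (simp only:)
  qed
  have "pf (a + b) (\<lambda>g. \<Sum>m'\<in>bimonoms a b. lookup F m' * lookup (mp_subst (sub_adj g) (Poly_Mapping.single m' 1)) m)"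
    using mon unfolding PC_def by (intro pf_sum pf_scale) blast
  then show ?thesis
  proof (rule pf_cong)
    fix g :: "'a bigroup_elem" assume g: "g \<in> SL2s"
    show "(\<Sum>m'\<in>bimonoms a b. lookup F m' * lookup (mp_subst (sub_adj g) (Poly_Mapping.single m' 1)) m)
        = lookup (act g F) m"
      unfolding lookup_act_linear[OF F, of g m] unfolding act_sub_adj[OF g] by (rule refl)
  qed
qed

section \<open>Regular functions on the orbit, pulled back to the group\<close>

definition OA :: "(bivar, 'a::field) mpoly \<Rightarrow> ('a bigroup_elem \<Rightarrow> 'a) set" where
  "OA f = {\<phi>. \<exists>P. \<forall>g\<in>SL2s. \<phi> g = mp_eval (lookup (act g f)) P}"

lemma pf_eval_monom:
  assumes "F \<in> biforms a b"
  shows "pf (mdeg m * (a + b)) (\<lambda>g. \<Prod>v\<in>keys m. lookup (act g F) v ^ lookup m v)"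
  unfolding mdeg_def sum_distrib_right
  by (intro pf_prod pf_power pf_lookup_act assms)

lemma PF_eval_act:
  assumes "F \<in> biforms a b"
  shows "PF (\<lambda>g. mp_eval (lookup (act g F)) P)"
  unfolding mp_eval_def by (intro PF_sum PF_scale PF_I[OF pf_eval_monom[OF assms]])

text \<open>Composition with the linear map given by \<open>h\<close> on coefficients, written with
  the matrix of \<open>h\<close> in the monomial basis. It serves for the exchange as well.\<close>

definition pull :: "nat \<Rightarrow> nat \<Rightarrow> 'a::field bigroup_elem \<Rightarrow> (bivar \<Rightarrow>\<^sub>0 nat, 'a) mpoly \<Rightarrow> (bivar \<Rightarrow>\<^sub>0 nat, 'a) mpoly" where
  "pull a b h P = mp_subst (\<lambda>m. \<Sum>m'\<in>bimonoms a b. Const (lookup (act h (Poly_Mapping.single m' 1)) m) * Var m') P"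

lemma mp_eval_pull:
  assumes "F \<in> biforms a b"
  shows "mp_eval (lookup F) (pull a b h P) = mp_eval (lookup (act h F)) P"
proof -
  have "(\<lambda>m. mp_eval (lookup F) (\<Sum>m'\<in>bimonoms a b. Const (lookup (act h (Poly_Mapping.single m' 1)) m) * Var m'))
      = lookup (act h F)"
    by (rule ext) (simp add: lookup_act_linear[OF assms] mult.commute)
  then show ?thesis unfolding pull_def mp_eval_subst by (rule arg_cong)
qed

lemma OA_I: "(\<And>g. g \<in> SL2s \<Longrightarrow> \<phi> g = mp_eval (lookup (act g f)) P) \<Longrightarrow> \<phi> \<in> OA f"
  unfolding OA_def by blast

lemma OA_E:
  assumes "\<phi> \<in> OA f" obtains P where "\<And>g. g \<in> SL2s \<Longrightarrow> \<phi> g = mp_eval (lookup (act g f)) P"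
  using assms unfolding OA_def by blast

lemma orbit_SL: "orbit SLxSL act f = (\<lambda>g. act g f) ` SL2s"
  unfolding orbit_def by blast

lemma OA_left:
  fixes f :: "(bivar, 'a::field_char_0) mpoly"
  assumes f: "f \<in> biforms a b" and \<phi>: "\<phi> \<in> OA f" and h: "h \<in> SL2s"
  shows "(\<lambda>g. \<phi> (bmul h g)) \<in> OA f"
proof -
  obtain P where P: "\<And>g. g \<in> SL2s \<Longrightarrow> \<phi> g = mp_eval (lookup (act g f)) P" using \<phi> unfolding OA_def by blast
  show ?thesis
  proof (rule OA_I[of _ _ "pull a b h P"])
    fix g :: "'a bigroup_elem" assume g: "g \<in> SL2s"
    show "\<phi> (bmul h g) = mp_eval (lookup (act g f)) (pull a b h P)"
      unfolding mp_eval_pull[OF act_SL_biforms[OF g f]] act_bmul[OF h g, symmetric]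
      by (rule P[OF bmul_closed[OF h g]])
  qed
qed

lemma OA_PF: "f \<in> biforms a b \<Longrightarrow> \<phi> \<in> OA f \<Longrightarrow> PF \<phi>"
  by (erule OA_E) (rule PF_cong[OF PF_eval_act], auto)

text \<open>The polynomials restricting to the radical form an ideal, proper because the integral of
  1 is 1. It contains the equations of the orbit, so a common zero lies on the closed orbit. The
  radical is stable under translation, which carries this zero to \<open>act g1 f\<close>.\<close>

lemma closed_orbit_radical:
  fixes f :: "(bivar, 'a::{alg_closed_field,field_char_0}) mpoly"
  assumes f: "f \<in> biforms a b" and closed: "zariski_closed_in_biforms a b (orbit SLxSL act f)"
    and \<phi>: "\<phi> \<in> OA f" "\<And>\<psi>. \<psi> \<in> OA f \<Longrightarrow> haar (\<lambda>g. \<psi> g * \<phi> g) = 0" and g1: "g1 \<in> SL2s"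
  shows "\<phi> g1 = 0"
proof -
  define ev where "ev P g = mp_eval (lookup (act g f)) P" for P g
  define J where "J = {P. \<forall>\<psi>\<in>OA f. haar (\<lambda>g. \<psi> g * ev P g) = 0}"
  have evOA: "ev P \<in> OA f" for P by (rule OA_I[of _ _ P]) (simp add: ev_def)
  have PFO: "PF \<psi>" if "\<psi> \<in> OA f" for \<psi> by (rule OA_PF[OF f that])
  have OA_mult: "(\<lambda>g. \<psi> g * ev R g) \<in> OA f" if \<psi>: "\<psi> \<in> OA f" for \<psi> R
  proof -
    obtain P where P: "\<And>g. g \<in> SL2s \<Longrightarrow> \<psi> g = mp_eval (lookup (act g f)) P" using \<psi> unfolding OA_def by blast
    show ?thesis by (rule OA_I[of _ _ "P * R"]) (simp add: P ev_def)
  qed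
  have idl: "ring_ideal J"
  proof (rule ring_idealI)
    show "0 \<in> J" by (simp add: J_def ev_def haar_0)
    show "P + R \<in> J" if "P \<in> J" "R \<in> J" for P R
    proof -
      have "haar (\<lambda>g. \<psi> g * ev (P + R) g) = 0" if \<psi>: "\<psi> \<in> OA f" for \<psi>
      proof -
        have "haar (\<lambda>g. \<psi> g * ev P g + 1 * (\<psi> g * ev R g)) = haar (\<lambda>g. \<psi> g * ev P g) + 1 * haar (\<lambda>g. \<psi> g * ev R g)"
          by (rule haar_PF_lin; intro PF_mult PFO \<psi> evOA)
        moreover have "haar (\<lambda>g. \<psi> g * ev P g) = 0" "haar (\<lambda>g. \<psi> g * ev R g) = 0"
          using \<open>P \<in> J\<close> \<open>R \<in> J\<close> \<psi> unfolding J_def by auto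
        ultimately show ?thesis by (simp add: ev_def algebra_simps)
      qed
      then show ?thesis unfolding J_def by blast
    qed
    show "R * P \<in> J" if "P \<in> J" for R P
    proof -
      have "haar (\<lambda>g. \<psi> g * ev (R * P) g) = 0" if \<psi>: "\<psi> \<in> OA f" for \<psi>
      proof -
        have "\<forall>\<psi>\<in>OA f. haar (\<lambda>g. \<psi> g * ev P g) = 0" using \<open>P \<in> J\<close> by (simp add: J_def)
        from bspec[OF this OA_mult[OF \<psi>, of R]]
        have "haar (\<lambda>g. (\<psi> g * ev R g) * ev P g) = 0" .
        then show ?thesis by (simp add: ev_def mult_ac)
      qed
      then show ?thesis unfolding J_def by blast
    qed
  qed
  have one: "1 \<notin> J"
  proof
    assume "1 \<in> J"
    then have "\<forall>\<psi>\<in>OA f. haar (\<lambda>g. \<psi> g * ev 1 g) = 0" by (simp add: J_def)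
    moreover have "(\<lambda>_. 1) \<in> OA f" by (rule OA_I[of _ _ 1]) simp
    ultimately have "haar (\<lambda>g. 1 * ev 1 g) = 0" by (rule bspec)
    then show False by (simp add: ev_def haar_1)
  qed
  have van: "P \<in> J" if "\<And>g. g \<in> SL2s \<Longrightarrow> ev P g = 0" for P
  proof -
    have "haar (\<lambda>g. \<psi> g * ev P g) = haar (\<lambda>_. 0)" for \<psi>
      by (rule haar_cong) (simp add: that)
    then show ?thesis unfolding J_def by (simp add: haar_0)
  qed
  have out: "Var m \<in> J" if "m \<notin> bimonoms a b" for m
    by (rule van) (simp add: ev_def biforms_lookup_0[OF act_SL_biforms[OF _ f] that])
  obtain p where p: "\<And>P. P \<in> J \<Longrightarrow> mp_eval p P = 0"
    using nullstellensatz[OF finite_bimonoms idl one out] by blast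
  define v where "v = (\<Sum>m\<in>bimonoms a b. Poly_Mapping.single m (p m))"
  have v: "v \<in> biforms a b" unfolding v_def by (rule biforms_of_coords(1)[OF finite_bimonoms refl])
  have "lookup v m = p m" for m
    unfolding v_def biforms_of_coords(2)[OF finite_bimonoms refl] using p[OF out, of m] by auto
  then have lv: "lookup v = p" by (rule ext)
  obtain T where T: "orbit SLxSL act f = {h \<in> biforms a b. \<forall>P\<in>T. mp_eval (lookup h) P = 0}"
    using closed unfolding zariski_closed_in_biforms_def by blast
  have "mp_eval (lookup v) P = 0" if "P \<in> T" for P
  proof -
    have "P \<in> J"
    proof (rule van)
      fix g :: "'a bigroup_elem" assume "g \<in> SL2s"
      then have "act g f \<in> orbit SLxSL act f" unfolding orbit_SL by blast
      then show "ev P g = 0" unfolding T ev_def using that by blast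
    qed
    then show ?thesis unfolding lv by (rule p)
  qed
  then have "v \<in> orbit SLxSL act f" unfolding T using v by blast
  then obtain g0 where g0: "g0 \<in> SL2s" "v = act g0 f" unfolding orbit_SL by blast
  obtain P0 where P0: "\<And>g. g \<in> SL2s \<Longrightarrow> \<phi> g = mp_eval (lookup (act g f)) P0" using \<phi>(1) unfolding OA_def by blast
  \<comment> \<open>\<open>h\<close> carries the common zero \<open>v = act g0 f\<close> to
    \<open>act g1 f\<close>; pulling back by \<open>h\<close> stays in \<open>J\<close> by left
    invariance of the integral.\<close>
  define h where "h = bmul g1 (binv g0)"
  have h: "h \<in> SL2s" unfolding h_def by (intro bmul_closed binv_closed g1 g0)
  have "pull a b h P0 \<in> J"
    unfolding J_def
  proof (intro CollectI ballI)
    fix \<psi> assume \<psi>: "\<psi> \<in> OA f"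
    let ?\<psi> = "\<lambda>g. \<psi> (bmul (binv h) g)"
    have \<psi>': "?\<psi> \<in> OA f" by (rule OA_left[OF f \<psi> binv_closed[OF h]])
    have "haar (\<lambda>g. \<psi> g * ev (pull a b h P0) g) = haar (\<lambda>g. ?\<psi> (bmul h g) * \<phi> (bmul h g))"
    proof (rule haar_cong)
      fix g :: "'a bigroup_elem" assume g: "g \<in> SL2s"
      have "bmul (binv h) (bmul h g) = g" by (simp add: bmul_assoc[symmetric] binv_left[OF h] bone_left[OF g])
      moreover have "ev (pull a b h P0) g = \<phi> (bmul h g)"
        unfolding ev_def mp_eval_pull[OF act_SL_biforms[OF g f]] act_bmul[OF h g, symmetric]
        by (rule P0[OF bmul_closed[OF h g], symmetric])
      ultimately show "\<psi> g * ev (pull a b h P0) g = ?\<psi> (bmul h g) * \<phi> (bmul h g)" by simp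
    qed
    also have "\<dots> = haar (\<lambda>g. ?\<psi> g * \<phi> g)"
      by (rule haar_PF_left[OF _ h]) (intro PF_mult PFO \<psi>' \<phi>(1))
    also have "\<dots> = 0" by (rule \<phi>(2)[OF \<psi>'])
    finally show "haar (\<lambda>g. \<psi> g * ev (pull a b h P0) g) = 0" .
  qed
  from p[OF this] have "mp_eval (lookup (act h v)) P0 = 0"
    unfolding lv[symmetric] mp_eval_pull[OF v] .
  moreover have "act h v = act g1 f"
    unfolding g0(2) act_bmul[OF h g0(1), symmetric] unfolding h_def
    by (simp add: bmul_assoc binv_left[OF g0(1)] bone_right[OF g1] del: act.simps)
  ultimately show ?thesis using P0[OF g1] by simp
qed

lemma closed_orbit_algebra_OA:
  fixes f :: "(bivar, 'a::{alg_closed_field,field_char_0}) mpoly"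
  assumes f: "f \<in> biforms a b" and closed: "zariski_closed_in_biforms a b (orbit SLxSL act f)"
  shows "closed_orbit_algebra (OA f)"
proof
  fix \<phi> \<psi> :: "'a bigroup_elem \<Rightarrow> 'a" and h :: "'a bigroup_elem" and c :: 'a
  show "PF \<phi>" if "\<phi> \<in> OA f" by (rule OA_PF[OF f that])
  show "(\<lambda>_. c) \<in> OA f" by (rule OA_I[of _ _ "Const c"]) simp
  show "(\<lambda>g. \<phi> (bmul h g)) \<in> OA f" if "\<phi> \<in> OA f" "h \<in> SL2s" by (rule OA_left[OF f that])
  show "(\<lambda>g. \<phi> g + \<psi> g) \<in> OA f" "(\<lambda>g. \<phi> g * \<psi> g) \<in> OA f" if h: "\<phi> \<in> OA f" "\<psi> \<in> OA f"
  proof -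
    obtain P R where "\<And>g. g \<in> SL2s \<Longrightarrow> \<phi> g = mp_eval (lookup (act g f)) P"
      "\<And>g. g \<in> SL2s \<Longrightarrow> \<psi> g = mp_eval (lookup (act g f)) R"
      using h unfolding OA_def by blast
    then show "(\<lambda>g. \<phi> g + \<psi> g) \<in> OA f" "(\<lambda>g. \<phi> g * \<psi> g) \<in> OA f"
      using OA_I[of "\<lambda>g. \<phi> g + \<psi> g" f "P + R"] OA_I[of "\<lambda>g. \<phi> g * \<psi> g" f "P * R"] by simp_all
  qed
  show "\<psi> \<in> OA f" if "\<phi> \<in> OA f" "\<And>g. g \<in> SL2s \<Longrightarrow> \<phi> g = \<psi> g"
    using that unfolding OA_def by auto
  show "\<phi> h = 0" if "\<phi> \<in> OA f" "\<And>b. b \<in> OA f \<Longrightarrow> haar (\<lambda>g. b g * \<phi> g) = 0" "h \<in> SL2s"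
    by (rule closed_orbit_radical[OF f closed that])
qed

subsection \<open>The fibre of the orbit map\<close>

text \<open>The ideal, among all regular functions on the group, of the scheme-theoretic fibre of
  the orbit map through the identity.\<close>

inductive fiber_ideal :: "('a::field bigroup_elem \<Rightarrow> 'a) set \<Rightarrow> ('a bigroup_elem \<Rightarrow> 'a) \<Rightarrow> bool"
  for A where
  zero: "fiber_ideal A (\<lambda>_. 0)"
| step: "fiber_ideal A \<phi> \<Longrightarrow> a \<in> A \<Longrightarrow> a bone = 0 \<Longrightarrow> PF b \<Longrightarrow> fiber_ideal A (\<lambda>g. \<phi> g + a g * b g)"

lemma fiber_ideal_gen: "a \<in> A \<Longrightarrow> a bone = 0 \<Longrightarrow> fiber_ideal A a"
  using fiber_ideal.step[OF fiber_ideal.zero _ _ PF_const[of 1], of a A] by simp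

lemma fiber_ideal_add:
  assumes "fiber_ideal A \<psi>" "fiber_ideal A \<phi>"
  shows "fiber_ideal A (\<lambda>g. \<phi> g + \<psi> g)"
  using assms
proof (induction rule: fiber_ideal.induct)
  case (step \<theta> a b)
  then have "fiber_ideal A (\<lambda>g. (\<phi> g + \<theta> g) + a g * b g)" by (intro fiber_ideal.step)
  then show ?case by (simp only: add.assoc)
qed simp

lemma fiber_ideal_mult:
  assumes "fiber_ideal A \<phi>" "PF c"
  shows "fiber_ideal A (\<lambda>g. c g * \<phi> g)"
  using assms
proof (induction rule: fiber_ideal.induct)
  case (step \<theta> a b)
  then have "fiber_ideal A (\<lambda>g. c g * \<theta> g + a g * (b g * c g))" by (intro fiber_ideal.step PF_mult)
  moreover have "(\<lambda>g. c g * \<theta> g + a g * (b g * c g)) = (\<lambda>g. c g * (\<theta> g + a g * b g))"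
    by (simp add: fun_eq_iff algebra_simps)
  ultimately show ?case by simp
qed (simp add: fiber_ideal.zero)

lemma fiber_ideal_bone: "fiber_ideal A \<phi> \<Longrightarrow> \<phi> bone = 0"
  by (induction rule: fiber_ideal.induct) auto

lemma fiber_ideal_sum:
  assumes "fiber_ideal A \<phi>"
  shows "\<exists>(n::nat) a b. (\<forall>i<n. a i \<in> A \<and> a i bone = 0 \<and> PF (b i)) \<and> (\<forall>g. \<phi> g = (\<Sum>i<n. a i g * b i g))"
  using assms
proof (induction rule: fiber_ideal.induct)
  case zero
  show ?case by (rule exI[of _ "0::nat"]) simp
next
  case (step \<phi> a b)
  then obtain n :: nat and a' b' where h: "\<forall>i<n. a' i \<in> A \<and> a' i bone = 0 \<and> PF (b' i)"
    "\<forall>g. \<phi> g = (\<Sum>i<n. a' i g * b' i g)" by blast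
  show ?case
    by (rule exI[of _ "Suc n"], rule exI[of _ "a'(n := a)"], rule exI[of _ "b'(n := b)"])
      (use h step.hyps in \<open>auto simp: less_Suc_eq\<close>)
qed

lemma (in closed_orbit_algebra) fiber_not_orthogonal:
  assumes \<psi>: "PF \<psi>" "\<And>a. a \<in> A \<Longrightarrow> haar (\<lambda>g. a g * \<psi> g) = 0"
    and \<phi>: "fiber_ideal A \<phi>" "\<And>g. g \<in> SL2s \<Longrightarrow> 1 - \<psi> g = \<phi> g"
  shows False
proof -
  obtain n :: nat and a b where ab: "\<forall>i<n. a i \<in> A \<and> a i bone = 0 \<and> PF (b i)" "\<forall>g. \<phi> g = (\<Sum>i<n. a i g * b i g)"
    using fiber_ideal_sum[OF \<phi>(1)] by blast
  show False
  proof (rule not_orthogonal[OF \<psi>, of "{..<n}" a b])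
    show "1 - \<psi> g = (\<Sum>i<n. a i g * b i g)" if "g \<in> SL2s" for g
      using \<phi>(2)[OF that] ab(2) by simp
  qed (use ab(1) in auto)
qed

text \<open>Multiplication by \<open>(-1, -1)\<close>, which acts trivially on forms of even total
  degree.\<close>

definition bneg :: "'a::field bigroup_elem \<Rightarrow> 'a bigroup_elem" where
  "bneg g = (- fst g, - fst (snd g), False)"

lemma bneg_closed: "g \<in> SL2s \<Longrightarrow> bneg g \<in> SL2s"
  by (erule SL2sE) (simp add: bneg_def SL2s_iff det_2)

lemma PF_bneg: "PF \<phi> \<Longrightarrow> PF (\<lambda>g. \<phi> (bneg g))"
proof -
  assume "PF \<phi>"
  then obtain n where n: "pf n \<phi>" unfolding PF_def by blast
  have "co v (bneg g) = (-1) * co v g" for v and g :: "'a bigroup_elem"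
    by (cases g; cases v) (auto simp: bneg_def)
  then have "pf 1 (\<lambda>g :: 'a bigroup_elem. co v (bneg g))" for v
    using pf_scale[OF pf_co[of v], of "-1 :: 'a"] by simp
  from pf_subst[OF n this bneg_closed] show ?thesis by (rule PF_I)
qed

section \<open>First-order analysis of the fibre at the identity\<close>

abbreviation co1 :: "sl_coord \<Rightarrow> 'a::field" where "co1 v \<equiv> co v bone"

definition tv :: "sl_coord \<Rightarrow> (sl_coord, 'a::field) mpoly" where "tv v = Var v - Const (co1 v)"

text \<open>\<open>d\<close> is the differential at the identity. The remainder coefficients
  \<open>r\<close> vanish there, so \<open>F\<close> is known modulo the square of the maximal
  ideal.\<close>

definition taylor :: "(sl_coord \<Rightarrow> 'a) \<Rightarrow> (sl_coord \<Rightarrow> (sl_coord, 'a::field) mpoly) \<Rightarrow> (sl_coord, 'a) mpoly \<Rightarrow> bool" where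
  "taylor d r F \<longleftrightarrow> (\<forall>w. mp_eval co1 (r w) = 0) \<and>
     F = Const (mp_eval co1 F) + (\<Sum>w\<in>UNIV. (Const (d w) + r w) * tv w)"

lemma taylorI:
  assumes "\<And>w. mp_eval co1 (r w) = 0" "F = Const (mp_eval co1 F) + (\<Sum>w\<in>UNIV. (Const (d w) + r w) * tv w)"
  shows "taylor d r F"
  unfolding taylor_def using assms by (intro conjI allI)

lemma taylorD:
  assumes "taylor d r F" "mp_eval co1 F = 0"
  shows "F = (\<Sum>w\<in>UNIV. (Const (d w) + r w) * tv w)"
  using assms(1)[unfolded taylor_def, THEN conjunct2, unfolded assms(2) Const_0 add_0] .

lemma taylor_r: "taylor d r F \<Longrightarrow> mp_eval co1 (r w) = 0"
  unfolding taylor_def by (elim conjE allE[of _ w])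

lemma tv_co1: "mp_eval co1 (tv v) = 0" by (simp add: tv_def)

lemma taylor_exists: "\<exists>d r. taylor d r F"
proof (induction F rule: mpoly_induct)
  case (Const c)
  show ?case by (rule exI[of _ "\<lambda>_. 0"], rule exI[of _ "\<lambda>_. 0"]) (simp add: taylor_def)
next
  case (Var v)
  have "(\<Sum>w\<in>UNIV. (Const (if w = v then 1 else 0) + 0) * tv w) = (tv v :: (sl_coord, 'a) mpoly)"
    using finite_sl_coord by (simp add: sum.remove[of UNIV v])
  then show ?case
    by (intro exI[of _ "\<lambda>w. if w = v then 1 else 0"] exI[of _ "\<lambda>_. 0"]) (simp add: taylor_def tv_def)
next
  case (add F G)
  then obtain d r d' r' where "taylor d r F" "taylor d' r' G" by blast
  then have h: "\<forall>w. mp_eval co1 (r w) = 0" "\<forall>w. mp_eval co1 (r' w) = 0"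
    "F = Const (mp_eval co1 F) + (\<Sum>w\<in>UNIV. (Const (d w) + r w) * tv w)"
    "G = Const (mp_eval co1 G) + (\<Sum>w\<in>UNIV. (Const (d' w) + r' w) * tv w)"
    unfolding taylor_def by auto
  have "F + G = Const (mp_eval co1 F) + (\<Sum>w\<in>UNIV. (Const (d w) + r w) * tv w)
     + (Const (mp_eval co1 G) + (\<Sum>w\<in>UNIV. (Const (d' w) + r' w) * tv w))"
    using h(3,4) by (rule arg_cong2)
  also have "\<dots> = Const (mp_eval co1 (F + G)) + (\<Sum>w\<in>UNIV. (Const (d w + d' w) + (r w + r' w)) * tv w)"
    by (simp add: Const_add algebra_simps sum.distrib)
  finally have "F + G = Const (mp_eval co1 (F + G)) + (\<Sum>w\<in>UNIV. (Const (d w + d' w) + (r w + r' w)) * tv w)" .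
  moreover have "mp_eval co1 (r w + r' w) = 0" for w using h(1)[THEN spec, of w] h(2)[THEN spec, of w] by simp
  ultimately show ?case by (intro exI taylorI)
next
  case (mult F G)
  then obtain d r d' r' where "taylor d r F" "taylor d' r' G" by blast
  then have h: "\<forall>w. mp_eval co1 (r w) = 0" "\<forall>w. mp_eval co1 (r' w) = 0"
    "F = Const (mp_eval co1 F) + (\<Sum>w\<in>UNIV. (Const (d w) + r w) * tv w)"
    "G = Const (mp_eval co1 G) + (\<Sum>w\<in>UNIV. (Const (d' w) + r' w) * tv w)"
    unfolding taylor_def by auto
  define a b :: "(sl_coord, 'a) mpoly" where "a = Const (mp_eval co1 F)" and "b = Const (mp_eval co1 G)"
  define S where "S = (\<Sum>w\<in>UNIV. (Const (d' w) + r' w) * tv w)"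
  let ?d = "\<lambda>w. mp_eval co1 F * d' w + mp_eval co1 G * d w"
  \<comment> \<open>The product of the two linear parts goes into the remainder, because
    \<open>S\<close> vanishes at the identity.\<close>
  let ?r = "\<lambda>w. Const (mp_eval co1 F) * r' w + Const (mp_eval co1 G) * r w + (Const (d w) + r w) * S"
  have "mp_eval co1 S = 0" unfolding S_def by (simp add: tv_co1)
  then have "mp_eval co1 (?r w) = 0" for w using h(1)[THEN spec, of w] h(2)[THEN spec, of w] by simp
  moreover have "F * G = Const (mp_eval co1 (F * G)) + (\<Sum>w\<in>UNIV. (Const (?d w) + ?r w) * tv w)"
  proof -
    have "F * G = (a + (\<Sum>w\<in>UNIV. (Const (d w) + r w) * tv w)) * (b + S)"
      unfolding a_def b_def S_def using h(3,4) by (rule arg_cong2)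
    also have "\<dots> = a * b + (a * S + (\<Sum>w\<in>UNIV. (Const (d w) + r w) * tv w) * b
        + (\<Sum>w\<in>UNIV. (Const (d w) + r w) * tv w) * S)"
      by (simp add: algebra_simps)
    also have "\<dots> = a * b + (\<Sum>w\<in>UNIV. a * ((Const (d' w) + r' w) * tv w) + (Const (d w) + r w) * tv w * b
        + (Const (d w) + r w) * tv w * S)"
      unfolding sum.distrib sum_distrib_left[symmetric] sum_distrib_right[symmetric] S_def[symmetric] by (rule refl)
    also have "\<dots> = Const (mp_eval co1 (F * G)) + (\<Sum>w\<in>UNIV. (Const (?d w) + ?r w) * tv w)"
      unfolding a_def b_def by (simp add: Const_add Const_mult algebra_simps)
    finally show ?thesis .
  qed
  ultimately show ?case by (intro exI taylorI)
qed

definition line1 :: "(sl_coord \<Rightarrow> 'a::field) \<Rightarrow> 'a \<Rightarrow> sl_coord \<Rightarrow> 'a" where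
  "line1 X \<epsilon> v = co1 v + \<epsilon> * X v"

lemma mp_eval_line: "\<exists>q. \<forall>\<epsilon>. mp_eval (line1 X \<epsilon>) F = poly q \<epsilon>"
proof (induction F rule: mpoly_induct)
  case (Const c)
  show ?case by (rule exI[of _ "[:c:]"]) simp
next
  case (Var v)
  show ?case by (rule exI[of _ "[:co1 v, X v:]"]) (simp add: line1_def)
next
  case (add F G)
  then obtain p q where "\<forall>\<epsilon>. mp_eval (line1 X \<epsilon>) F = poly p \<epsilon>" "\<forall>\<epsilon>. mp_eval (line1 X \<epsilon>) G = poly q \<epsilon>" by blast
  then show ?case by (intro exI[of _ "p + q"]) simp
next
  case (mult F G)
  then obtain p q where "\<forall>\<epsilon>. mp_eval (line1 X \<epsilon>) F = poly p \<epsilon>" "\<forall>\<epsilon>. mp_eval (line1 X \<epsilon>) G = poly q \<epsilon>" by blast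
  then show ?case by (intro exI[of _ "p * q"]) simp
qed

text \<open>On the line the remainder coefficients are divisible by \<open>\<epsilon>\<close>, as
  are the \<open>tv w\<close>, and the first-order term is the pairing of \<open>X\<close> with
  \<open>d\<close>. The line runs in the ambient space of all eight matrix entries.\<close>

lemma taylor_line:
  assumes t: "taylor d r F" and F: "mp_eval co1 F = 0" and X: "(\<Sum>w\<in>UNIV. X w * d w) = 0"
  shows "\<exists>q. \<forall>\<epsilon>. mp_eval (line1 X \<epsilon>) F = \<epsilon> ^ 2 * poly q \<epsilon>"
proof -
  have "\<exists>q. \<forall>\<epsilon>. mp_eval (line1 X \<epsilon>) (r w) = \<epsilon> * poly q \<epsilon>" for w
  proof -
    obtain q where q: "\<And>\<epsilon>. mp_eval (line1 X \<epsilon>) (r w) = poly q \<epsilon>" using mp_eval_line by blast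
    have "line1 X 0 = co1" by (simp add: line1_def fun_eq_iff)
    then have "poly q 0 = 0" using q[of 0] taylor_r[OF t, of w] by simp
    then obtain q' where "q = [:0, 1:] * q'"
      using poly_eq_0_iff_dvd[of q 0] by (auto elim: dvdE)
    then show ?thesis using q by (intro exI[of _ q']) simp
  qed
  then have "\<forall>w. \<exists>q. \<forall>\<epsilon>. mp_eval (line1 X \<epsilon>) (r w) = \<epsilon> * poly q \<epsilon>" by blast
  from choice[OF this] obtain q where q: "\<And>w \<epsilon>. mp_eval (line1 X \<epsilon>) (r w) = \<epsilon> * poly (q w) \<epsilon>" by blast
  have "mp_eval (line1 X \<epsilon>) F = \<epsilon> ^ 2 * poly (\<Sum>w\<in>UNIV. smult (X w) (q w)) \<epsilon>" for \<epsilon>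
  proof -
    have e: "F = (\<Sum>w\<in>UNIV. (Const (d w) + r w) * tv w)" by (rule taylorD[OF t F])
    have "mp_eval (line1 X \<epsilon>) F = (\<Sum>w\<in>UNIV. (d w + \<epsilon> * poly (q w) \<epsilon>) * (\<epsilon> * X w))"
      by (subst e) (simp add: q tv_def line1_def)
    also have "\<dots> = \<epsilon> * (\<Sum>w\<in>UNIV. X w * d w) + \<epsilon> ^ 2 * (\<Sum>w\<in>UNIV. X w * poly (q w) \<epsilon>)"
      by (simp add: algebra_simps sum.distrib sum_distrib_left power2_eq_square)
    finally show ?thesis by (simp add: X poly_sum)
  qed
  then show ?thesis by blast
qed

text \<open>Membership in the Lie algebra of the stabilizer: the form is unchanged to first order in
  \<open>\<epsilon>\<close>.\<close>

definition inf_stab :: "(bivar, 'a::field) mpoly \<Rightarrow> 'a^2^2 \<Rightarrow> 'a^2^2 \<Rightarrow> bool" where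
  "inf_stab f Y Z \<longleftrightarrow> Y$1$1 + Y$2$2 = 0 \<and> Z$1$1 + Z$2$2 = 0 \<and>
     (\<forall>p. \<exists>q. \<forall>\<epsilon>. mp_eval (\<lambda>v. p v + \<epsilon> * lin Y Z p v) f = mp_eval p f + \<epsilon> ^ 2 * poly q \<epsilon>)"

text \<open>A direction annihilating all differentials of \<open>J\<close> would be an infinitesimal
  stabilizer. So \<open>J\<close> contains functions with every prescribed differential, the maximal
  ideal of the identity lies in \<open>J\<close> plus its own square, and Nakayama yields an
  \<open>s\<close> that is 1 at the identity and multiplies it into \<open>J\<close>: there the
  fibre is a reduced point.\<close>

lemma fiber_local:
  fixes f :: "(bivar, 'a::{alg_closed_field,field_char_0}) mpoly"
  assumes f: "f \<in> biforms a b"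
    and inf: "\<And>Y Z. inf_stab f Y Z \<Longrightarrow> Y = 0 \<and> Z = 0"
  defines "J \<equiv> {F. \<exists>\<phi>. fiber_ideal (OA f) \<phi> \<and> (\<forall>g\<in>SL2s. mp_eval (\<lambda>v. co v g) F = \<phi> g)}"
  shows "ring_ideal J" and "\<exists>s. mp_eval co1 s = 1 \<and> (\<forall>v. s * tv v \<in> J)"
proof -
  show idl: "ring_ideal J"
  proof (rule ring_idealI)
    show "0 \<in> J" unfolding J_def using fiber_ideal.zero by (intro CollectI exI conjI) auto
    show "F + G \<in> J" if FG: "F \<in> J" "G \<in> J" for F G
    proof -
      obtain \<phi> \<psi> where h: "fiber_ideal (OA f) \<phi>" "\<forall>g\<in>SL2s. mp_eval (\<lambda>v. co v g) F = \<phi> g"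
        "fiber_ideal (OA f) \<psi>" "\<forall>g\<in>SL2s. mp_eval (\<lambda>v. co v g) G = \<psi> g"
        using FG unfolding J_def by blast
      show ?thesis unfolding J_def
        by (intro CollectI exI[of _ "\<lambda>g. \<phi> g + \<psi> g"] conjI fiber_ideal_add h) (simp add: h)
    qed
    show "G * F \<in> J" if F: "F \<in> J" for F G
    proof -
      obtain \<phi> where h: "fiber_ideal (OA f) \<phi>" "\<forall>g\<in>SL2s. mp_eval (\<lambda>v. co v g) F = \<phi> g"
        using F unfolding J_def by blast
      obtain n where "mp_deg_le n G" using mp_deg_le_ex by blast
      then have "pf n (\<lambda>g. mp_eval (\<lambda>v. co v g) G)" unfolding pf_def by blast
      then have "PF (\<lambda>g. mp_eval (\<lambda>v. co v g) G)" by (rule PF_I)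
      note fiber_ideal_mult[OF h(1) this]
      then show ?thesis unfolding J_def
        by (intro CollectI exI[of _ "\<lambda>g. mp_eval (\<lambda>v. co v g) G * \<phi> g"] conjI) (auto simp: h(2))
    qed
  qed
  have J0: "mp_eval co1 F = 0" if "F \<in> J" for F
    using that bone_closed fiber_ideal_bone unfolding J_def by fastforce
  have Jvan: "F \<in> J" if "\<And>g. g \<in> SL2s \<Longrightarrow> mp_eval (\<lambda>v. co v g) F = 0" for F
    unfolding J_def using that fiber_ideal.zero by (intro CollectI exI conjI) auto
  \<comment> \<open>The differentials at the identity of elements of \<open>J\<close>; the claim
    \<open>unit\<close> is that their span contains every coordinate differential.\<close>
  define D where "D = {d. \<exists>F r. F \<in> J \<and> taylor d r F}"
  have unit: "\<exists>F r. F \<in> J \<and> taylor (\<lambda>w. if w = v then 1 else 0) r F" for v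
  proof (rule linear_combination_or_separated[OF finite_sl_coord, of D "\<lambda>w. if w = v then 1 else 0" "\<lambda>d. d"])
    fix T k assume T: "finite T" "T \<subseteq> D" and e: "\<And>w. w \<in> UNIV \<Longrightarrow> (if w = v then 1 else 0) = (\<Sum>d\<in>T. k d * d w)"
    have "\<forall>d\<in>T. \<exists>x. fst x \<in> J \<and> taylor d (snd x) (fst x)" using T(2) unfolding D_def by fastforce
    from bchoice[OF this] obtain x where x: "\<forall>d\<in>T. fst (x d) \<in> J \<and> taylor d (snd (x d)) (fst (x d))" by blast
    define F where "F = (\<Sum>d\<in>T. Const (k d) * fst (x d))"
    define r where "r w = (\<Sum>d\<in>T. Const (k d) * snd (x d) w)" for w
    have FJ: "F \<in> J" unfolding F_def using x by (intro ideal_sum[OF idl] ideal_mult[OF idl]) blast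
    have "fst (x d) = (\<Sum>w\<in>UNIV. (Const (d w) + snd (x d) w) * tv w)" if "d \<in> T" for d
      using x that by (intro taylorD J0) auto
    then have "F = (\<Sum>d\<in>T. Const (k d) * (\<Sum>w\<in>UNIV. (Const (d w) + snd (x d) w) * tv w))"
      unfolding F_def by (intro sum.cong refl) simp
    also have "\<dots> = (\<Sum>w\<in>UNIV. (\<Sum>d\<in>T. Const (k d) * (Const (d w) + snd (x d) w)) * tv w)"
      unfolding sum_distrib_left sum_distrib_right by (subst sum.swap) (simp add: mult.assoc)
    also have "\<dots> = (\<Sum>w\<in>UNIV. (Const (if w = v then 1 else 0) + r w) * tv w)"
    proof (intro sum.cong refl)
      fix w
      have "(\<Sum>d\<in>T. Const (k d) * (Const (d w) + snd (x d) w)) = Const (\<Sum>d\<in>T. k d * d w) + r w"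
        by (simp add: r_def distrib_left sum.distrib Const_sum Const_mult)
      then show "(\<Sum>d\<in>T. Const (k d) * (Const (d w) + snd (x d) w)) * tv w
          = (Const (if w = v then 1 else 0) + r w) * tv w" using e[of w] by simp
    qed
    finally have FT: "F = (\<Sum>w\<in>UNIV. (Const (if w = v then 1 else 0) + r w) * tv w)" .
    have "taylor (\<lambda>w. if w = v then 1 else 0) r F"
    proof (rule taylorI)
      have "mp_eval co1 (snd (x d) w) = 0" if "d \<in> T" for d w
        using x that by (intro taylor_r[of d _ "fst (x d)"]) auto
      then show "mp_eval co1 (r w) = 0" for w unfolding r_def by (simp add: sum.neutral)
      show "F = Const (mp_eval co1 F) + (\<Sum>w\<in>UNIV. (Const (if w = v then 1 else 0) + r w) * tv w)"
        unfolding J0[OF FJ] Const_0 add_0 by (rule FT)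
    qed
    then show ?thesis using FJ by blast
  next
    fix X assume X: "\<And>d. d \<in> D \<Longrightarrow> (\<Sum>w\<in>UNIV. X w * d w) = 0" "(\<Sum>w\<in>UNIV. X w * (if w = v then 1 else 0)) \<noteq> 0"
    have line: "\<exists>q. \<forall>\<epsilon>. mp_eval (line1 X \<epsilon>) F = \<epsilon> ^ 2 * poly q \<epsilon>" if F: "F \<in> J" for F
    proof -
      obtain d r where t: "taylor d r F" using taylor_exists by blast
      then have "d \<in> D" unfolding D_def using F by blast
      then show ?thesis by (intro taylor_line[OF t J0[OF F]] X(1))
    qed
    have c1: "co1 (b, 1, 1) = (1::'a)" "co1 (b, 1, 2) = (0::'a)" "co1 (b, 2, 1) = (0::'a)" "co1 (b, 2, 2) = (1::'a)" for b
      by (cases b; simp add: bone_def mat_2)+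
    \<comment> \<open>The equation \<open>det - 1\<close> vanishes on the group, so it lies in
      \<open>J\<close>; its differential at the identity is the trace.\<close>
    have tr: "X (b, 1, 1) + X (b, 2, 2) = 0" for b
    proof -
      let ?F = "Var (b, 1, 1) * Var (b, 2, 2) - Var (b, 1, 2) * Var (b, 2, 1) - 1 :: (sl_coord, 'a) mpoly"
      have "?F \<in> J"
        by (rule Jvan, erule SL2sE) (cases b; simp add: det_2)
      from line[OF this] obtain q where q: "\<And>\<epsilon>. mp_eval (line1 X \<epsilon>) ?F = \<epsilon> ^ 2 * poly q \<epsilon>" by blast
      let ?p = "[:0, X (b, 1, 1) + X (b, 2, 2), X (b, 1, 1) * X (b, 2, 2) - X (b, 1, 2) * X (b, 2, 1):]"
      have "poly ?p \<epsilon> = poly ([:0, 0, 1:] * q) \<epsilon>" for \<epsilon>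
        using q[of \<epsilon>] by (simp add: line1_def c1 algebra_simps power2_eq_square)
      then have "?p = [:0, 0, 1:] * q" by (simp add: poly_eq_poly_eq_iff[symmetric] fun_eq_iff)
      then have "coeff ?p 1 = coeff ([:0, 0, 1:] * q) 1" by (rule arg_cong)
      then show ?thesis by (simp add: coeff_mult)
    qed
    \<comment> \<open>The sign comes from the action, which uses inverse matrices.\<close>
    define Y where "Y b = - mat2 (X (b, 1, 1)) (X (b, 1, 2)) (X (b, 2, 1)) (X (b, 2, 2))" for b
    have "inf_stab f (Y False) (Y True)"
      unfolding inf_stab_def
    proof (intro conjI allI)
      show "Y False $ 1 $ 1 + Y False $ 2 $ 2 = 0" "Y True $ 1 $ 1 + Y True $ 2 $ 2 = 0"
        using tr[of False] tr[of True] by (simp_all add: Y_def add_eq_0_iff2)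
    next
      fix p :: "bivar \<Rightarrow> 'a"
      \<comment> \<open>Inserting the adjugate entries makes \<open>mp_eval p (act g f)\<close> a
        polynomial in the entries of \<open>g\<close>. Its difference from the value at the identity
        generates part of the fibre ideal.\<close>
      define S :: "bivar \<Rightarrow> (sl_coord, 'a) mpoly" where "S v = (case v of
          vx \<Rightarrow> Const (p vx) * Var (False, 2, 2) - Const (p vy) * Var (False, 1, 2)
        | vy \<Rightarrow> Const (p vy) * Var (False, 1, 1) - Const (p vx) * Var (False, 2, 1)
        | vu \<Rightarrow> Const (p vu) * Var (True, 2, 2) - Const (p vv) * Var (True, 1, 2)
        | vv \<Rightarrow> Const (p vv) * Var (True, 1, 1) - Const (p vu) * Var (True, 2, 1))" for v
      let ?F = "mp_subst S f - Const (mp_eval p f)"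
      have "mp_eval (\<lambda>v. co v g) ?F = mp_eval p (act g f) - mp_eval p (act bone f)" if g: "g \<in> SL2s" for g
      proof -
        obtain A B where AB: "g = (A, B, False)" "det A = 1" "det B = 1" using g by (rule SL2sE)
        have "(\<lambda>v. mp_eval (\<lambda>v. co v g) (S v)) = lin (adj2 A) (adj2 B) p"
          by (rule fun_bivar_eqI) (simp_all add: S_def AB adj2_def algebra_simps)
        then show ?thesis
          unfolding act_bone by (simp add: AB mp_eval_act mp_eval_subst matrix_inv_det1 del: act.simps)
      qed
      moreover have "fiber_ideal (OA f) (\<lambda>g. mp_eval p (act g f) - mp_eval p (act bone f))"
      proof (rule fiber_ideal_gen)
        show "(\<lambda>g. mp_eval p (act g f) - mp_eval p (act bone f)) \<in> OA f"
        proof (rule OA_I)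
          fix g :: "'a bigroup_elem" assume g: "g \<in> SL2s"
          have "mp_eval p (act g f) = (\<Sum>m\<in>bimonoms a b. lookup (act g f) m * mp_eval p (Poly_Mapping.single m 1))"
            by (subst (1) biforms_expand[OF act_SL_biforms[OF g f]]) simp
          then show "mp_eval p (act g f) - mp_eval p (act bone f)
            = mp_eval (lookup (act g f)) ((\<Sum>m\<in>bimonoms a b. Var m * Const (mp_eval p (Poly_Mapping.single m 1)))
                - Const (mp_eval p (act bone f)))" by simp
        qed
      qed simp
      ultimately have "?F \<in> J" unfolding J_def by blast
      from line[OF this] obtain q where q: "\<And>\<epsilon>. mp_eval (line1 X \<epsilon>) ?F = \<epsilon> ^ 2 * poly q \<epsilon>" by blast
      have "mp_eval (\<lambda>v. p v + \<epsilon> * lin (Y False) (Y True) p v) f = mp_eval p f + \<epsilon> ^ 2 * poly q \<epsilon>" for \<epsilon>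
      proof -
        have x2: "X (b, 2, 2) = - X (b, 1, 1)" for b using tr[of b] by (simp add: add_eq_0_iff)
        have "(\<lambda>v. mp_eval (line1 X \<epsilon>) (S v)) = (\<lambda>v. p v + \<epsilon> * lin (Y False) (Y True) p v)"
          by (rule fun_bivar_eqI) (simp_all add: S_def line1_def c1 Y_def x2 algebra_simps)
        then show ?thesis using q[of \<epsilon>] by (simp add: mp_eval_subst diff_eq_eq add.commute)
      qed
      then show "\<exists>q. \<forall>\<epsilon>. mp_eval (\<lambda>v. p v + \<epsilon> * lin (Y False) (Y True) p v) f = mp_eval p f + \<epsilon> ^ 2 * poly q \<epsilon>" by blast
    qed
    then have "Y False = 0" "Y True = 0" using inf by auto
    then have "Y b = 0" for b by (cases b) auto
    then have Y0: "Y b $ i $ j = 0" for b i j by simp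
    have "X (b, 1, 1) = 0 \<and> X (b, 1, 2) = 0 \<and> X (b, 2, 1) = 0 \<and> X (b, 2, 2) = 0" for b
      using Y0[of b 1 1] Y0[of b 1 2] Y0[of b 2 1] Y0[of b 2 2] by (simp add: Y_def)
    then have "\<forall>v. X v = 0" unfolding all_sl_coord by blast
    then have "X v = 0" for v by (rule spec)
    then have False using X(2) by (simp only: mult_zero_left sum.neutral_const not_True_eq_False simp_thms)
    then show ?thesis ..
  qed
  have "\<forall>v. \<exists>r. (\<forall>w. mp_eval co1 (r w) = 0) \<and> tv v - (\<Sum>w\<in>UNIV. r w * tv w) \<in> J"
  proof
    fix v
    obtain F r where F: "F \<in> J" "taylor (\<lambda>w. if w = v then 1 else 0) r F" using unit by blast
    have "F = (\<Sum>w\<in>UNIV. (Const (if w = v then 1 else 0) + r w) * tv w)"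
      by (rule taylorD[OF F(2) J0[OF F(1)]])
    also have "\<dots> = (\<Sum>w\<in>UNIV. Const (if w = v then 1 else 0) * tv w) + (\<Sum>w\<in>UNIV. r w * tv w)"
      by (simp add: distrib_right sum.distrib)
    also have "(\<Sum>w\<in>UNIV. Const (if w = v then 1 else 0) * tv w) = (tv v :: (sl_coord, 'a) mpoly)"
      using finite_sl_coord by (simp add: sum.remove[of UNIV v])
    finally have "F = tv v - (\<Sum>w\<in>UNIV. (- r w) * tv w)" by (simp add: sum_negf)
    then have "tv v - (\<Sum>w\<in>UNIV. (- r w) * tv w) \<in> J" using F(1) by simp
    then show "\<exists>r. (\<forall>w. mp_eval co1 (r w) = 0) \<and> tv v - (\<Sum>w\<in>UNIV. r w * tv w) \<in> J"
      using taylor_r[OF F(2)] by (intro exI[of _ "\<lambda>w. - r w"] conjI allI) simp_all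
  qed
  from choice[OF this] obtain m where m: "\<And>v w. mp_eval co1 (m v w) = 0"
    "\<And>v. tv v - (\<Sum>w\<in>UNIV. m v w * tv w) \<in> J" by blast
  have "\<exists>s. 1 - s \<in> {F. mp_eval co1 F = 0} \<and> (\<forall>v\<in>UNIV. s * tv v \<in> J)"
    by (rule nakayama_elimination[OF idl finite_sl_coord, where m = m]) (use m in auto)
  then show "\<exists>s. mp_eval co1 s = 1 \<and> (\<forall>v. s * tv v \<in> J)" by auto
qed

subsection \<open>Infinitesimal stabilizers\<close>

text \<open>The eigenvalues are \<open>\<rho>\<close> and \<open>- \<rho>\<close> with
  \<open>\<rho> ^ 2 = - det Y\<close>. For \<open>\<rho>\<close> nonzero the columns of
  \<open>P\<close> are eigenvectors; for \<open>\<rho> = 0\<close> and \<open>Y\<close> nonzero they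
  form a Jordan chain.\<close>

lemma traceless_normal_form:
  fixes Y :: "'a::{alg_closed_field,field_char_0}^2^2"
  assumes "Y$1$1 + Y$2$2 = 0"
  shows "\<exists>P N. det P \<noteq> 0 \<and> Y ** P = P ** N \<and> ((\<exists>c. N = mat2 c 0 0 (- c)) \<or> N = mat2 0 1 0 0)"
proof -
  define a b c where "a = Y$1$1" and "b = Y$1$2" and "c = Y$2$1"
  have Y: "Y = mat2 a b c (- a)"
    using assms by (simp add: mat2_eq_iff a_def b_def c_def add_eq_0_iff)
  obtain \<rho> where \<rho>: "\<rho> ^ 2 = a * a + b * c" using nth_root_exists[of 2 "a * a + b * c"] by auto
  then have \<rho>': "b * c = \<rho> * \<rho> - a * a" by (simp add: power2_eq_square)
  have fin: ?thesis if "det P \<noteq> 0" "Y ** P = P ** N" "(\<exists>c. N = mat2 c 0 0 (- c)) \<or> N = mat2 0 1 0 0" for P N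
    using that by blast
  show ?thesis
  proof (cases "b = 0 \<and> c = 0")
    case True
    then show ?thesis
    proof (intro exI conjI disjI1)
      show "det (mat 1 :: 'a^2^2) \<noteq> 0" by simp
      show "Y ** mat 1 = mat 1 ** mat2 a 0 0 (- a)" using True by (simp add: Y)
    qed (rule refl)
  next
    case nz: False
    show ?thesis
    proof (cases "\<rho> = 0")
      case False
      show ?thesis
      proof (cases "b = 0")
        case False
        let ?P = "mat2 b b (\<rho> - a) (- \<rho> - a)"
        have "det ?P = - 2 * (b * \<rho>)" by (simp add: det_2 algebra_simps)
        then have "det ?P \<noteq> 0" using False \<open>\<rho> \<noteq> 0\<close> by simp
        moreover have "Y ** ?P = ?P ** mat2 \<rho> 0 0 (- \<rho>)"
          using \<rho>' by (simp add: Y mat2_eq_iff matrix_mult_2 algebra_simps)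
        ultimately show ?thesis by (intro fin[of ?P "mat2 \<rho> 0 0 (- \<rho>)"]) (auto simp: det_2)
      next
        case True
        let ?P = "mat2 (\<rho> + a) (- \<rho> + a) c c"
        have "det ?P = 2 * (c * \<rho>)" by (simp add: det_2 algebra_simps)
        then have "det ?P \<noteq> 0" using nz True \<open>\<rho> \<noteq> 0\<close> by simp
        moreover have "Y ** ?P = ?P ** mat2 \<rho> 0 0 (- \<rho>)"
          using \<rho>' True by (simp add: Y mat2_eq_iff matrix_mult_2 algebra_simps)
        ultimately show ?thesis by (intro fin[of ?P "mat2 \<rho> 0 0 (- \<rho>)"]) (auto simp: det_2)
      qed
    next
      case True
      then have d: "b * c = - (a * a)" using \<rho>' by simp
      show ?thesis
      proof (cases "c = 0")
        case False
        let ?P = "mat2 a 1 c 0"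
        have "Y ** ?P = ?P ** mat2 0 1 0 0"
          using d by (simp add: Y mat2_eq_iff matrix_mult_2 algebra_simps)
        then show ?thesis using False
          by (intro fin[of ?P "mat2 0 1 0 0"]) (auto simp: det_2)
      next
        case True
        then have "a = 0" using d by simp
        then have "Y ** mat2 b 0 0 1 = mat2 b 0 0 1 ** mat2 0 1 0 0"
          using True by (simp add: Y mat2_eq_iff matrix_mult_2)
        then show ?thesis using nz True
          by (intro fin[of "mat2 b 0 0 1" "mat2 0 1 0 0"]) (auto simp: det_2)
      qed
    qed
  qed
qed

section \<open>Infinitesimal symmetries of a bicubic form in coefficients\<close>

definition cf :: "nat \<Rightarrow> nat \<Rightarrow> (bivar, 'a::zero) mpoly \<Rightarrow> nat \<Rightarrow> nat \<Rightarrow> 'a" where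
  "cf a b F i j = lookup F (mm (a - i) i (b - j) j)"

definition bival :: "nat \<Rightarrow> nat \<Rightarrow> (nat \<Rightarrow> nat \<Rightarrow> 'a::comm_ring_1) \<Rightarrow> (bivar \<Rightarrow> 'a) \<Rightarrow> 'a" where
  "bival a b c p = (\<Sum>i\<le>a. \<Sum>j\<le>b. c i j * (p vx ^ (a - i) * p vy ^ i * (p vu ^ (b - j) * p vv ^ j)))"

lemma mp_eval_biforms:
  assumes "F \<in> biforms a b"
  shows "mp_eval p F = bival a b (cf a b F) p"
proof -
  have inj: "inj_on (\<lambda>(i, j). mm (a - i) i (b - j) j) ({..a} \<times> {..b})"
    by (auto simp: inj_on_def mm_eq_iff)
  have "mp_eval p F = (\<Sum>m\<in>bimonoms a b. lookup F m * mp_eval p (Poly_Mapping.single m 1))"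
    by (subst (1) biforms_expand[OF assms]) simp
  also have "\<dots> = (\<Sum>(i, j)\<in>{..a} \<times> {..b}. cf a b F i j * mp_eval p (Poly_Mapping.single (mm (a - i) i (b - j) j) 1))"
    unfolding bimonoms_def by (subst sum.reindex[OF inj]) (simp add: case_prod_unfold cf_def o_def)
  also have "\<dots> = bival a b (cf a b F) p"
    by (simp add: bival_def mp_eval_single prod_bivar sum.cartesian_product mult_ac)
  finally show ?thesis .
qed

lemma bisum_zero_imp:
  fixes e :: "nat \<Rightarrow> nat \<Rightarrow> 'a::field_char_0"
  assumes "\<And>y v. (\<Sum>i\<le>n. \<Sum>j\<le>m. e i j * (y ^ i * v ^ j)) = 0" "i \<le> n" "j \<le> m"
  shows "e i j = 0"
proof (rule poly_fun_zero_imp[where c = "e i" and n = m, OF _ assms(3)])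
  fix v
  show "(\<Sum>j\<le>m. e i j * v ^ j) = 0"
  proof (rule poly_fun_zero_imp[where c = "\<lambda>i. \<Sum>j\<le>m. e i j * v ^ j" and n = n, OF _ assms(2)])
    fix y
    have "(\<Sum>i\<le>n. (\<Sum>j\<le>m. e i j * v ^ j) * y ^ i) = (\<Sum>i\<le>n. \<Sum>j\<le>m. e i j * (y ^ i * v ^ j))"
      unfolding sum_distrib_right by (intro sum.cong refl) (simp add: mult_ac)
    then show "(\<Sum>i\<le>n. (\<Sum>j\<le>m. e i j * v ^ j) * y ^ i) = 0" using assms(1) by simp
  qed
qed

lemma coeff_0_1_mult:
  "coeff (p * q) 0 = coeff p 0 * coeff q 0"
  "coeff (p * q) 1 = coeff p 0 * coeff q 1 + coeff p 1 * coeff q 0"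
  for p q :: "'a::comm_ring_1 poly"
  by (simp_all add: coeff_mult)

lemma coeff_0_1_linear_power:
  "coeff ([:1, b:] ^ n) 0 = 1" "coeff ([:1, b:] ^ n) 1 = of_nat n * (b :: 'a::comm_ring_1)"
proof -
  show 0: "coeff ([:1, b:] ^ n) 0 = 1" for n
    by (induction n) (simp_all add: coeff_0_1_mult)
  show "coeff ([:1, b:] ^ n) 1 = of_nat n * b"
  proof (induction n)
    case (Suc n)
    have "coeff ([:1, b:] ^ Suc n) 1 = coeff ([:1, b:] ^ n) 1 + b"
      unfolding power_Suc coeff_0_1_mult by (simp add: 0)
    then show ?case using Suc by (simp add: algebra_simps)
  qed simp
qed

text \<open>The coefficients of the derivative of the form with coefficients \<open>c\<close> along
  a pair of upper triangular matrices. Diagonal entries act by the weights \<open>3 - 2 i\<close>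
  and \<open>3 - 2 j\<close>; the nilpotent parts move index \<open>i - 1\<close> to
  \<open>i\<close> with the factor \<open>3 - (i - 1)\<close>.\<close>

definition shift_coeff :: "'a::comm_ring_1 \<Rightarrow> 'a \<Rightarrow> 'a \<Rightarrow> 'a \<Rightarrow> (nat \<Rightarrow> nat \<Rightarrow> 'a) \<Rightarrow> nat \<Rightarrow> nat \<Rightarrow> 'a" where
  "shift_coeff \<alpha> \<beta> \<gamma> \<delta> c i j =
     (of_int (3 - 2 * int i) * \<alpha> + of_int (3 - 2 * int j) * \<gamma>) * c i j
     + (if i = 0 then 0 else of_nat (4 - i) * \<beta> * c (i - 1) j)
     + (if j = 0 then 0 else of_nat (4 - j) * \<delta> * c i (j - 1))"

text \<open>The coefficient of \<open>\<epsilon>\<close> is compared after setting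
  \<open>x = u = 1\<close>, which loses nothing for a form of known bidegree.\<close>

lemma inf_coeffs:
  fixes c :: "nat \<Rightarrow> nat \<Rightarrow> 'a::field_char_0"
  assumes inf: "\<And>p. \<exists>q. \<forall>\<epsilon>. bival 3 3 c (\<lambda>v. p v + \<epsilon> * lin (mat2 \<alpha> \<beta> 0 (- \<alpha>)) (mat2 \<gamma> \<delta> 0 (- \<gamma>)) p v)
      = bival 3 3 c p + \<epsilon> ^ 2 * poly q \<epsilon>"
    and ij: "i \<le> 3" "j \<le> 3"
  shows "shift_coeff \<alpha> \<beta> \<gamma> \<delta> c i j = 0"
proof (rule bisum_zero_imp[OF _ ij])
  fix y v :: 'a
  define p where "p w = (case w of vx \<Rightarrow> 1 | vy \<Rightarrow> y | vu \<Rightarrow> 1 | vv \<Rightarrow> v)" for w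
  obtain q where q: "\<And>\<epsilon>. bival 3 3 c (\<lambda>v. p v + \<epsilon> * lin (mat2 \<alpha> \<beta> 0 (- \<alpha>)) (mat2 \<gamma> \<delta> 0 (- \<gamma>)) p v)
      = bival 3 3 c p + \<epsilon> ^ 2 * poly q \<epsilon>" using inf by blast
  define R where "R i j = [:1, \<alpha> + \<beta> * y:] ^ (3 - i) * [:1, - \<alpha>:] ^ i * ([:1, \<gamma> + \<delta> * v:] ^ (3 - j) * [:1, - \<gamma>:] ^ j)" for i j
  let ?P = "\<Sum>i\<le>3. \<Sum>j\<le>3. smult (c i j * (y ^ i * v ^ j)) (R i j)"
  have "poly ?P \<epsilon> = bival 3 3 c (\<lambda>v. p v + \<epsilon> * lin (mat2 \<alpha> \<beta> 0 (- \<alpha>)) (mat2 \<gamma> \<delta> 0 (- \<gamma>)) p v)" for \<epsilon>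
  proof -
    have "y - \<epsilon> * (\<alpha> * y) = y * (1 - \<epsilon> * \<alpha>)" "v - \<epsilon> * (\<gamma> * v) = v * (1 - \<epsilon> * \<gamma>)" by (simp_all add: algebra_simps)
    then show ?thesis
      by (simp add: bival_def p_def R_def poly_sum power_mult_distrib mult_ac)
  qed
  then have "poly ?P \<epsilon> = poly ([:bival 3 3 c p:] + [:0, 0, 1:] * q) \<epsilon>" for \<epsilon>
    using q[of \<epsilon>] by (simp add: power2_eq_square algebra_simps)
  then have "?P = [:bival 3 3 c p:] + [:0, 0, 1:] * q"
    by (simp add: poly_eq_poly_eq_iff[symmetric] fun_eq_iff)
  then have "coeff ?P 1 = coeff ([:bival 3 3 c p:] + [:0, 0, 1:] * q) 1" by (rule arg_cong)
  then have 1: "coeff ?P 1 = 0" by (simp add: coeff_0_1_mult[unfolded One_nat_def])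
  have R1: "coeff (R i j) 1 = of_nat (3 - i) * (\<alpha> + \<beta> * y) - of_nat i * \<alpha> + of_nat (3 - j) * (\<gamma> + \<delta> * v) - of_nat j * \<gamma>" for i j
    unfolding R_def coeff_0_1_mult coeff_0_1_linear_power by (simp add: algebra_simps)
  have "coeff ?P 1 = (\<Sum>i\<le>3. \<Sum>j\<le>3. c i j * (y ^ i * v ^ j) * coeff (R i j) 1)"
    by (simp add: coeff_sum)
  also have "\<dots> = (\<Sum>i\<le>3. \<Sum>j\<le>3. shift_coeff \<alpha> \<beta> \<gamma> \<delta> c i j * (y ^ i * v ^ j))"
    unfolding R1 shift_coeff_def by (simp add: numeral_3_eq_3 algebra_simps)
  finally show "(\<Sum>i\<le>3. \<Sum>j\<le>3. shift_coeff \<alpha> \<beta> \<gamma> \<delta> c i j * (y ^ i * v ^ j)) = 0" using 1 by simp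
qed

lemma torus_term:
  fixes x y :: "'a::field_char_0"
  assumes "i \<le> 3"
  shows "(2 powi m * x) ^ (3 - i) * ((1 / 2 powi m) * y) ^ i = 2 powi (m * (3 - 2 * int i)) * (x ^ (3 - i) * y ^ i)"
proof -
  have inv: "1 / 2 powi m = (2 powi (- m) :: 'a)" by (simp add: power_int_minus inverse_eq_divide)
  have "(2 powi m :: 'a) ^ (3 - i) * (1 / 2 powi m) ^ i = 2 powi (m * int (3 - i)) * 2 powi (- (m * int i))"
    unfolding inv power_int_power' by (simp only: mult_minus_left)
  also have "\<dots> = 2 powi (m * int (3 - i) + - (m * int i))" by (rule power_int_add[symmetric]) simp
  also have "m * int (3 - i) + - (m * int i) = m * (3 - 2 * int i)"
    using assms by (simp add: of_nat_diff algebra_simps)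
  finally have E: "(2 powi m :: 'a) ^ (3 - i) * (1 / 2 powi m) ^ i = 2 powi (m * (3 - 2 * int i))" .
  have "(2 powi m * x) ^ (3 - i) * ((1 / 2 powi m) * y) ^ i
      = ((2 powi m) ^ (3 - i) * (1 / 2 powi m) ^ i) * (x ^ (3 - i) * y ^ i)"
    by (simp only: power_mult_distrib mult_ac)
  then show ?thesis unfolding E .
qed

definition moves :: "'a::field^2^2 \<Rightarrow> 'a^2^2 \<Rightarrow> bool" where
  "moves C D \<longleftrightarrow> det C = 1 \<and> det D = 1 \<and> \<not> (\<exists>\<alpha> \<beta>. C = mat \<alpha> \<and> D = mat \<beta>)"

lemma not_mat_shear: "mat2 1 1 0 1 \<noteq> (mat \<alpha> :: 'a::field^2^2)"
  by (simp add: mat2_eq_iff mat_2)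

text \<open>An infinitesimal symmetry is replaced by an actual nonscalar one, without exponentials.
  Torus directions give a diagonal pair with powers of 2 as entries, nilpotent ones a unipotent
  shear, and a mixture with a nonzero torus part forces the form to vanish.\<close>

lemma inf_stab_normal:
  fixes c :: "nat \<Rightarrow> nat \<Rightarrow> 'a::field_char_0"
  assumes e: "\<And>i j. i \<le> 3 \<Longrightarrow> j \<le> 3 \<Longrightarrow> shift_coeff \<alpha> \<beta> \<gamma> \<delta> c i j = 0"
    and N: "\<beta> = 0 \<or> \<alpha> = 0 \<and> \<beta> = 1" and M: "\<delta> = 0 \<or> \<gamma> = 0 \<and> \<delta> = 1"
    and nz: "\<not> (\<alpha> = 0 \<and> \<beta> = 0 \<and> \<gamma> = 0 \<and> \<delta> = 0)"
  shows "\<exists>C D. moves C D \<and> (\<forall>p. bival 3 3 c (lin C D p) = bival 3 3 c p)"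
proof -
  let ?U = "mat2 1 1 0 1 :: 'a^2^2"
  have U1: "moves ?U (mat 1)" "moves (mat 1) ?U" "moves ?U ?U"
    unfolding moves_def using not_mat_shear by (auto simp: det_2 mat_2)
  have zero: ?thesis if z: "\<And>i j. i \<le> 3 \<Longrightarrow> j \<le> 3 \<Longrightarrow> c i j = 0"
  proof -
    have "bival 3 3 c p = 0" for p unfolding bival_def using z by (intro sum.neutral ballI) auto
    then show ?thesis using U1(1) by auto
  qed
  have num: "{..3} = {0, 1, 2, 3::nat}" by auto
  consider (tt) "\<beta> = 0" "\<delta> = 0" | (tu) "\<beta> = 0" "\<gamma> = 0" "\<delta> = 1" | (ut) "\<alpha> = 0" "\<beta> = 1" "\<delta> = 0"
    | (uu) "\<alpha> = 0" "\<beta> = 1" "\<gamma> = 0" "\<delta> = 1" using N M by blast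
  then show ?thesis
  proof cases
    case tt
    have w: "of_int (3 - 2 * int i) * \<alpha> + of_int (3 - 2 * int j) * \<gamma> = 0" if "i \<le> 3" "j \<le> 3" "c i j \<noteq> 0" for i j
      using e[OF that(1,2)] that(3) unfolding shift_coeff_def tt by (simp cong: if_cong)
    show ?thesis
    proof (cases "\<forall>i j. i \<le> 3 \<longrightarrow> j \<le> 3 \<longrightarrow> c i j = 0")
      case True
      then show ?thesis using zero by blast
    next
      case False
      then obtain i0 j0 where ij0: "i0 \<le> 3" "j0 \<le> 3" "c i0 j0 \<noteq> 0" by blast
      \<comment> \<open>All weights in the support are orthogonal to
        \<open>(\<alpha>, \<gamma>)\<close>, hence proportional to the weight at
        \<open>i0, j0\<close>. The integers \<open>m, n\<close> are chosen orthogonal to that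
        weight.\<close>
      define m n where "m = 3 - 2 * int j0" and "n = - (3 - 2 * int i0)"
      have rel: "m * (3 - 2 * int i) + n * (3 - 2 * int j) = 0" if ij: "i \<le> 3" "j \<le> 3" "c i j \<noteq> 0" for i j
      proof -
        have ring: "x * z + x' * z' = 0 \<Longrightarrow> y * z + y' * z' = 0 \<Longrightarrow> \<not> (z = 0 \<and> z' = 0) \<Longrightarrow> y' * x + - y * x' = 0"
          for x y x' y' z z' :: 'a
          by algebra
        have "(of_int (m * (3 - 2 * int i) + n * (3 - 2 * int j)) :: 'a) = 0"
          using ring[OF w[OF ij] w[OF ij0]] nz tt by (simp only: m_def n_def of_int_add of_int_mult of_int_minus) simp
        then show ?thesis by (simp only: of_int_eq_0_iff)
      qed
      define s t where "s = (2 powi m :: 'a)" and "t = (2 powi n :: 'a)"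
      have st: "s \<noteq> 0" "t \<noteq> 0" by (simp_all add: s_def t_def)
      let ?C = "mat2 s 0 0 (1 / s)" and ?D = "mat2 t 0 0 (1 / t)"
      have "bival 3 3 c (lin ?C ?D p) = bival 3 3 c p" for p
        unfolding bival_def
      proof (intro sum.cong refl)
        fix i j assume ij: "i \<in> {..(3::nat)}" "j \<in> {..(3::nat)}"
        show "c i j * (lin ?C ?D p vx ^ (3 - i) * lin ?C ?D p vy ^ i * (lin ?C ?D p vu ^ (3 - j) * lin ?C ?D p vv ^ j))
          = c i j * (p vx ^ (3 - i) * p vy ^ i * (p vu ^ (3 - j) * p vv ^ j))"
        proof (cases "c i j = 0")
          case False
          have h1: "2 powi (m * (3 - 2 * int i)) * 2 powi (n * (3 - 2 * int j)) = (1::'a)"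
            using rel[of i j] ij False by (simp flip: power_int_add)
          have h2: "lin ?C ?D p vx ^ (3 - i) * lin ?C ?D p vy ^ i = 2 powi (m * (3 - 2 * int i)) * (p vx ^ (3 - i) * p vy ^ i)"
            using torus_term[of i m "p vx" "p vy"] ij by (simp add: s_def)
          have h3: "lin ?C ?D p vu ^ (3 - j) * lin ?C ?D p vv ^ j = 2 powi (n * (3 - 2 * int j)) * (p vu ^ (3 - j) * p vv ^ j)"
            using torus_term[of j n "p vu" "p vv"] ij by (simp add: t_def)
          have gen: "A * B = 1 \<Longrightarrow> k * ((A * x) * (B * y)) = k * (x * y)" for A B k x y :: 'a by algebra
          show ?thesis unfolding h2 h3 by (rule gen[OF h1])
        qed simp
      qed
      \<comment> \<open>\<open>m\<close> is odd, so \<open>m + m\<close> is nonzero and the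
        corresponding power of 2 is not 1 in characteristic zero.\<close>
      moreover have "s \<noteq> 1 / s"
      proof
        assume "s = 1 / s"
        then have "s * s = 1" using st by (metis nonzero_divide_eq_eq)
        then have "(2::'a) powi (m + m) = 1" unfolding s_def by (subst power_int_add) simp_all
        moreover have "(2::'a) powi (m + m) \<noteq> 1"
        proof (cases "m + m \<ge> 0")
          case True
          then have "(2::'a) powi (m + m) = of_nat (2 ^ nat (m + m))" by (simp add: power_int_def)
          moreover have "(2::nat) ^ nat (m + m) \<noteq> 1" using True by (simp add: m_def) presburger
          ultimately show ?thesis by (metis of_nat_eq_1_iff)
        next
          case False
          then have "(2::'a) powi (m + m) = inverse (of_nat (2 ^ nat (- (m + m))))" by (simp add: power_int_def inverse_eq_divide power_one_over)
          moreover have "(2::nat) ^ nat (- (m + m)) \<noteq> 1" using False by simp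
          ultimately show ?thesis by (metis of_nat_eq_1_iff inverse_eq_1_iff)
        qed
        ultimately show False by simp
      qed
      then have "moves ?C ?D" unfolding moves_def using st by (auto simp: det_2 mat2_eq_iff mat_2)
      ultimately show ?thesis by blast
    qed
  next
    case tu
    have r: "of_int (3 - 2 * int i) * \<alpha> * c i j + (if j = 0 then 0 else of_nat (4 - j) * c i (j - 1)) = 0"
      if "i \<le> 3" "j \<le> 3" for i j
      using e[OF that] unfolding shift_coeff_def tu by (simp cong: if_cong)
    show ?thesis
    proof (cases "\<alpha> = 0")
      case True
      have z: "c i 0 = 0" "c i 1 = 0" "c i 2 = 0" if "i \<le> 3" for i
        using r[OF that, of 1] r[OF that, of 2] r[OF that, of 3] True by simp_all
      have "bival 3 3 c (lin (mat 1) ?U p) = bival 3 3 c p" for p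
        unfolding bival_def
      proof (rule sum.cong[OF refl])
        fix i assume "i \<in> {..(3::nat)}"
        then have "i \<le> 3" by simp
        then show "(\<Sum>j\<le>3. c i j * (lin (mat 1) ?U p vx ^ (3 - i) * lin (mat 1) ?U p vy ^ i * (lin (mat 1) ?U p vu ^ (3 - j) * lin (mat 1) ?U p vv ^ j)))
          = (\<Sum>j\<le>3. c i j * (p vx ^ (3 - i) * p vy ^ i * (p vu ^ (3 - j) * p vv ^ j)))"
          using z[OF \<open>i \<le> 3\<close>] by (simp add: num mat_2)
      qed
      then show ?thesis using U1(2) by blast
    next
      case False
      \<comment> \<open>Odd weights never vanish, so the relations determine the coefficients
        recursively in \<open>j\<close>, all zero.\<close>
      have odd: "(of_int (3 - 2 * int i) :: 'a) \<noteq> 0" for i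
        unfolding of_int_eq_0_iff by presburger
      have z: "c i 0 = 0" "c i 1 = 0" "c i 2 = 0" "c i 3 = 0" if i: "i \<le> 3" for i
      proof -
        show 0: "c i 0 = 0" using r[OF i, of 0] False odd[of i] by simp
        show 1: "c i 1 = 0" using r[OF i, of 1] False odd[of i] 0 by simp
        show 2: "c i 2 = 0" using r[OF i, of 2] False odd[of i] 1 by simp
        show "c i 3 = 0" using r[OF i, of 3] False odd[of i] 2 by simp
      qed
      show ?thesis
      proof (rule zero)
        fix i j :: nat assume "i \<le> 3" "j \<le> 3"
        then have "j = 0 \<or> j = 1 \<or> j = 2 \<or> j = 3" by auto
        then show "c i j = 0" using z[OF \<open>i \<le> 3\<close>] by auto
      qed
    qed
  next
    case ut
    have r: "of_int (3 - 2 * int j) * \<gamma> * c i j + (if i = 0 then 0 else of_nat (4 - i) * c (i - 1) j) = 0"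
      if "i \<le> 3" "j \<le> 3" for i j
      using e[OF that] unfolding shift_coeff_def ut by (simp cong: if_cong)
    show ?thesis
    proof (cases "\<gamma> = 0")
      case True
      have z: "c 0 j = 0" "c 1 j = 0" "c 2 j = 0" if "j \<le> 3" for j
        using r[OF _ that, of 1] r[OF _ that, of 2] r[OF _ that, of 3] True by simp_all
      have "bival 3 3 c (lin ?U (mat 1) p) = bival 3 3 c p" for p
        unfolding bival_def using z by (simp add: num mat_2)
      then show ?thesis using U1(1) by blast
    next
      case False
      have odd: "(of_int (3 - 2 * int i) :: 'a) \<noteq> 0" for i
        unfolding of_int_eq_0_iff by presburger
      have z: "c 0 j = 0" "c 1 j = 0" "c 2 j = 0" "c 3 j = 0" if j: "j \<le> 3" for j
      proof -
        show 0: "c 0 j = 0" using r[OF _ j, of 0] False odd[of j] by simp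
        show 1: "c 1 j = 0" using r[OF _ j, of 1] False odd[of j] 0 by simp
        show 2: "c 2 j = 0" using r[OF _ j, of 2] False odd[of j] 1 by simp
        show "c 3 j = 0" using r[OF _ j, of 3] False odd[of j] 2 by simp
      qed
      show ?thesis
      proof (rule zero)
        fix i j :: nat assume "i \<le> 3" "j \<le> 3"
        then have "i = 0 \<or> i = 1 \<or> i = 2 \<or> i = 3" by auto
        then show "c i j = 0" using z[OF \<open>j \<le> 3\<close>] by auto
      qed
    qed
  next
    case uu
    have r: "(if i = 0 then 0 else of_nat (4 - i) * c (i - 1) j) + (if j = 0 then 0 else of_nat (4 - j) * c i (j - 1)) = 0"
      if "i \<le> 3" "j \<le> 3" for i j
      using e[OF that] unfolding shift_coeff_def uu by (simp cong: if_cong)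
    \<comment> \<open>The equations leave \<open>c 0 3\<close>, \<open>c 1 3\<close>,
      \<open>c 2 3\<close> and \<open>c 3 3\<close> free, one parameter for each irreducible summand
      of the tensor square of the cubics under the diagonal group. The simultaneous shear is then
      checked directly.\<close>
    have z: "c 0 0 = 0" "c 1 0 = 0" "c 2 0 = 0" "c 0 1 = 0" "c 0 2 = 0"
      using r[of 1 0] r[of 2 0] r[of 3 0] r[of 0 2] r[of 0 3] by simp_all
    have two: "y = - x" if "2 * x + 2 * y = 0" for x y :: 'a
    proof -
      have "2 * (x + y) = 0" using that by (simp only: distrib_left)
      then have "x + y = 0" by (simp only: mult_eq_0_iff zero_neq_numeral[symmetric] simp_thms)
      then show ?thesis by (rule minus_unique[symmetric])
    qed
    have c11: "c 1 1 = 0" using r[of 1 2] z by simp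
    have "3 * c 0 3 + c 1 2 = 0" using r[of 1 3] by simp
    then have c12: "c 1 2 = - (3 * c 0 3)" by (rule minus_unique[symmetric])
    have c21: "c 2 1 = 3 * c 0 3"
      using two[of "c 1 2" "c 2 1"] r[of 2 2] c12 by simp
    have "2 * c 1 3 + c 2 2 = 0" using r[of 2 3] by simp
    then have c22: "c 2 2 = - (2 * c 1 3)" by (rule minus_unique[symmetric])
    have "3 * (c 0 3 + c 3 0) = 0" using r[of 3 1] c21 by (simp add: distrib_left)
    then have "c 0 3 + c 3 0 = 0" by (simp only: mult_eq_0_iff zero_neq_numeral[symmetric] simp_thms)
    then have c30: "c 3 0 = - c 0 3" by (rule minus_unique[symmetric])
    have c31: "c 3 1 = c 1 3"
      using two[of "- c 1 3" "c 3 1"] r[of 3 2] c22 by simp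
    have "c 2 3 + c 3 2 = 0" using r[of 3 3] by simp
    then have c32: "c 3 2 = - c 2 3" by (rule minus_unique[symmetric])
    note z1 = c11 c12 c21 c22 c30 c31 c32
    have "bival 3 3 c (lin ?U ?U p) = bival 3 3 c p" for p
      unfolding bival_def
      by (simp add: num z z1 z1[unfolded One_nat_def] z[unfolded One_nat_def]) (simp add: power2_eq_square power3_eq_cube algebra_simps)
    then show ?thesis using U1(3) by blast
  qed
qed

lemma triangular_form:
  assumes "(\<exists>c. N = mat2 c 0 0 (- c)) \<or> N = mat2 0 1 0 (0 :: 'a::comm_ring_1)"
  shows "\<exists>\<alpha> \<beta>. N = mat2 \<alpha> \<beta> 0 (- \<alpha>) \<and> (\<beta> = 0 \<or> \<alpha> = 0 \<and> \<beta> = 1)"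
  using assms
proof (elim disjE exE)
  fix c assume N: "N = mat2 c 0 0 (- c)"
  show ?thesis by (rule exI[of _ c], rule exI[of _ 0]) (simp add: N)
next
  assume N: "N = mat2 0 1 0 0"
  show ?thesis by (rule exI[of _ 0], rule exI[of _ 1]) (simp add: N)
qed

section \<open>Trivial reduced stabilizer excludes infinitesimal symmetries\<close>

definition GL_trivial :: "(bivar, 'a::field) mpoly \<Rightarrow> bool" where
  "GL_trivial f \<longleftrightarrow> (\<forall>A B s. invertible A \<longrightarrow> invertible B \<longrightarrow> act (A, B, s) f = f \<longrightarrow>
     (A, B, s) \<in> trivial_scalars)"

text \<open>Triviality of the quotient identifies the coset of a stabilizing element with
  \<open>trivial_scalars\<close>, and the coset contains that element.\<close>

lemma reduced_stabilizer_trivial: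
  fixes f :: "(bivar, 'a::field) mpoly"
  assumes "trivial_group (reduced_stabilizer f)"
  shows "GL_trivial f"
  unfolding GL_trivial_def
proof (intro allI impI)
  fix A B :: "'a^2^2" and s
  assume h: "invertible A" "invertible B" "act (A, B, s) f = f"
  let ?G = "GLxGL_Z2\<lparr>carrier := stabilizer GLxGL_Z2 act f\<rparr> :: 'a bigroup_elem monoid"
  let ?g = "(A, B, s)"
  have g: "?g \<in> carrier ?G"
    using h by (simp add: stabilizer_def GLxGL_Z2_def del: act.simps)
  have "trivial_scalars #>\<^bsub>?G\<^esub> ?g \<in> carrier (?G Mod trivial_scalars)"
    using g unfolding FactGroup_def RCOSETS_def by auto
  then have "trivial_scalars #>\<^bsub>?G\<^esub> ?g = trivial_scalars"
    using assms unfolding reduced_stabilizer_def trivial_group_def by (simp add: FactGroup_def)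
  moreover have "(mat 1, mat 1, False) \<in> (trivial_scalars :: 'a bigroup_elem set)"
    unfolding trivial_scalars_def by force
  then have "mult ?G (mat 1, mat 1, False) ?g \<in> trivial_scalars #>\<^bsub>?G\<^esub> ?g"
    unfolding r_coset_def by blast
  moreover have "mult ?G (mat 1, mat 1, False) ?g = ?g"
    by (simp add: GLxGL_Z2_def)
  ultimately show "?g \<in> trivial_scalars" by simp
qed

lemma det_nz_inverse:
  fixes P :: "'a::field^2^2"
  assumes "det P \<noteq> 0"
  obtains P' where "P ** P' = mat 1" "P' ** P = mat 1"
proof -
  have "invertible P" using assms invertible_det_nz by blast
  then show ?thesis using that unfolding invertible_def by blast
qed

lemma invertible_conj:
  fixes P :: "'a::field^2^2"
  assumes "P ** P' = mat 1" "P' ** P = mat 1" "det C = 1"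
  shows "invertible (P ** C ** P')" "matrix_inv (P ** adj2 C ** P') = P ** C ** P'"
    "invertible (P ** adj2 C ** P')"
proof -
  have c: "C ** adj2 C = mat 1" "adj2 C ** C = mat 1" using assms(3) by (simp_all add: adj2_mult)
  have e: "(P ** X ** P') ** (P ** Y ** P') = P ** (X ** Y) ** P'" for X Y
  proof -
    have "(P ** X ** P') ** (P ** Y ** P') = P ** X ** (P' ** P) ** Y ** P'" by (simp only: matrix_mul_assoc)
    then show ?thesis unfolding assms(2) by (simp add: matrix_mul_assoc)
  qed
  have 1: "(P ** C ** P') ** (P ** adj2 C ** P') = mat 1" "(P ** adj2 C ** P') ** (P ** C ** P') = mat 1"
    unfolding e c by (simp_all add: assms)
  show "invertible (P ** C ** P')" "invertible (P ** adj2 C ** P')" unfolding invertible_def using 1 by blast+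
  show "matrix_inv (P ** adj2 C ** P') = P ** C ** P'" by (rule matrix_inv_eqI) (rule 1)+
qed

text \<open>After conjugating \<open>Y\<close> and \<open>Z\<close> to triangular form, the
  transported form has a nonscalar symmetry; conjugating it back gives a forbidden symmetry of
  \<open>f\<close>.\<close>

lemma inf_stab_trivial:
  fixes f :: "(bivar, 'a::{alg_closed_field,field_char_0}) mpoly"
  assumes f: "f \<in> biforms 3 3" and triv: "GL_trivial f" and inf: "inf_stab f Y Z"
  shows "Y = 0 \<and> Z = 0"
proof (rule ccontr)
  assume nz: "\<not> (Y = 0 \<and> Z = 0)"
  obtain P N where P: "det P \<noteq> 0" "Y ** P = P ** N" "(\<exists>c. N = mat2 c 0 0 (- c)) \<or> N = mat2 0 1 0 0"
    using traceless_normal_form inf unfolding inf_stab_def by blast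
  obtain R M where R: "det R \<noteq> 0" "Z ** R = R ** M" "(\<exists>c. M = mat2 c 0 0 (- c)) \<or> M = mat2 0 1 0 0"
    using traceless_normal_form inf unfolding inf_stab_def by blast
  obtain \<alpha> \<beta> where N: "N = mat2 \<alpha> \<beta> 0 (- \<alpha>)" "\<beta> = 0 \<or> \<alpha> = 0 \<and> \<beta> = 1" using triangular_form[OF P(3)] by blast
  obtain \<gamma> \<delta> where M: "M = mat2 \<gamma> \<delta> 0 (- \<gamma>)" "\<delta> = 0 \<or> \<gamma> = 0 \<and> \<delta> = 1" using triangular_form[OF R(3)] by blast
  obtain P' where P': "P ** P' = mat 1" "P' ** P = mat 1" using P(1) by (rule det_nz_inverse)
  obtain R' where R': "R ** R' = mat 1" "R' ** R = mat 1" using R(1) by (rule det_nz_inverse)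
  define F where "F = mp_subst (linear_vars P R) f"
  have evF: "mp_eval p F = mp_eval (lin P R p) f" for p
    unfolding F_def by (simp add: mp_eval_subst mp_eval_linear_vars)
  have F: "F \<in> biforms 3 3"
    by (rule biformsI_scl) (simp only: evF lin_scl mp_eval_scl_biforms[OF f])
  let ?c = "cf 3 3 F"
  have ev: "bival 3 3 ?c p = mp_eval (lin P R p) f" for p
    unfolding mp_eval_biforms[OF F, symmetric] by (rule evF)
  have "\<exists>q. \<forall>\<epsilon>. bival 3 3 ?c (\<lambda>v. p v + \<epsilon> * lin N M p v) = bival 3 3 ?c p + \<epsilon> ^ 2 * poly q \<epsilon>" for p
  proof -
    obtain q where q: "\<And>\<epsilon>. mp_eval (\<lambda>v. lin P R p v + \<epsilon> * lin Y Z (lin P R p) v) f = mp_eval (lin P R p) f + \<epsilon> ^ 2 * poly q \<epsilon>"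
      using inf unfolding inf_stab_def by blast
    have "lin P R (\<lambda>v. p v + \<epsilon> * lin N M p v) = (\<lambda>v. lin P R p v + \<epsilon> * lin Y Z (lin P R p) v)" for \<epsilon>
    proof -
      have "lin P R (\<lambda>v. p v + \<epsilon> * lin N M p v) = (\<lambda>v. lin P R p v + \<epsilon> * lin P R (lin N M p) v)"
        by (rule fun_bivar_eqI) (simp_all add: algebra_simps)
      then show ?thesis by (simp add: lin_lin P(2) R(2))
    qed
    then show ?thesis unfolding ev using q by (intro exI[of _ q]) simp
  qed
  then have "shift_coeff \<alpha> \<beta> \<gamma> \<delta> ?c i j = 0" if "i \<le> 3" "j \<le> 3" for i j
    using inf_coeffs[of ?c \<alpha> \<beta> \<gamma> \<delta>] that unfolding N(1) M(1) by blast
  moreover have "\<not> (\<alpha> = 0 \<and> \<beta> = 0 \<and> \<gamma> = 0 \<and> \<delta> = 0)"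
  proof
    assume z: "\<alpha> = 0 \<and> \<beta> = 0 \<and> \<gamma> = 0 \<and> \<delta> = 0"
    have "N = 0" "M = 0" using z by (simp_all add: N M mat2_eq_iff)
    moreover have "Y = P ** N ** P'" unfolding P(2)[symmetric] matrix_mul_assoc[symmetric] P' by simp
    moreover have "Z = R ** M ** R'" unfolding R(2)[symmetric] matrix_mul_assoc[symmetric] R' by simp
    ultimately have "Y = 0 \<and> Z = 0" by (simp add: mat2_eq_iff matrix_mult_2)
    then show False using nz by blast
  qed
  ultimately obtain C D where CD: "moves C D" "\<And>p. bival 3 3 ?c (lin C D p) = bival 3 3 ?c p"
    using inf_stab_normal[of \<alpha> \<beta> \<gamma> \<delta> ?c] N(2) M(2) by blast
  have det: "det C = 1" "det D = 1" using CD(1) by (auto simp: moves_def)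
  note ic = invertible_conj[OF P' det(1)] and id = invertible_conj[OF R' det(2)]
  \<comment> \<open>The adjugates cancel the inversion in the action, so that \<open>C\<close> and
    \<open>D\<close> act on points.\<close>
  let ?g = "(P ** adj2 C ** P', R ** adj2 D ** R', False)"
  have "act ?g f = f"
  proof (rule mp_eval_inject)
    fix p
    have "mp_eval p (act ?g f) = mp_eval (lin (P ** C ** P') (R ** D ** R') p) f"
      by (simp only: mp_eval_act if_False ic id)
    also have "lin (P ** C ** P') (R ** D ** R') p = lin P R (lin C D (lin P' R' p))"
      by (simp add: lin_lin matrix_mul_assoc)
    also have "mp_eval \<dots> f = mp_eval (lin P R (lin P' R' p)) f"
      unfolding ev[symmetric] by (rule CD(2))
    also have "lin P R (lin P' R' p) = p" by (simp add: lin_lin P' R' lin_1)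
    finally show "mp_eval p (act ?g f) = mp_eval p f" .
  qed
  then have "?g \<in> trivial_scalars"
    using triv ic(3) id(3) unfolding GL_trivial_def by blast
  then obtain a b where ab: "P ** adj2 C ** P' = mat a" "R ** adj2 D ** R' = mat b"
    unfolding trivial_scalars_def by blast
  have scal: "\<exists>k. C = mat k" if "P ** adj2 C ** P' = mat a" "P ** P' = mat 1" "P' ** P = mat 1" for P P' C :: "'a^2^2" and a
  proof -
    have "P' ** (P ** adj2 C ** P') ** P = (P' ** P) ** adj2 C ** (P' ** P)" by (simp only: matrix_mul_assoc)
    then have "adj2 C = P' ** (P ** adj2 C ** P') ** P" unfolding that(3) by simp
    also have "\<dots> = P' ** mat a ** P" unfolding that(1) ..
    also have "\<dots> = mat a ** (P' ** P)" by (simp add: mat2_simps algebra_simps)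
    also have "\<dots> = mat a" by (simp add: that)
    finally have "C = mat a" by (simp add: adj2_def mat2_eq_iff mat_2)
    then show ?thesis ..
  qed
  have "(\<exists>k. C = mat k) \<and> (\<exists>k. D = mat k)" using scal[OF ab(1) P'] scal[OF ab(2) R'] by blast
  then show False using CD(1) unfolding moves_def by blast
qed

subsection \<open>Existence of covariants\<close>

lemma act_bneg:
  fixes F :: "(bivar, 'a::field_char_0) mpoly"
  assumes F: "F \<in> biforms a b" and g: "g \<in> SL2s" and ab: "even (a + b)"
  shows "act (bneg g) F = act g F"
proof (rule mp_eval_inject)
  fix p
  obtain A B where AB: "g = (A, B, False)" "det A = 1" "det B = 1" using g by (rule SL2sE)
  have "det (- A) = 1" "det (- B) = 1" using AB by (simp_all add: det_2)
  then have "mp_eval p (act (bneg g) F) = mp_eval (lin (adj2 (- A)) (adj2 (- B)) p) F"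
    by (simp add: AB bneg_def mp_eval_act matrix_inv_det1 del: act.simps)
  also have "lin (adj2 (- A)) (adj2 (- B)) p = scl (-1) (-1) (lin (adj2 A) (adj2 B) p)"
    by (rule fun_bivar_eqI) (simp_all add: adj2_def)
  also have "mp_eval \<dots> F = mp_eval (lin (adj2 A) (adj2 B) p) F"
    using ab by (simp add: mp_eval_scl_biforms[OF F] flip: power_add)
  also have "\<dots> = mp_eval p (act g F)"
    using AB by (simp add: mp_eval_act matrix_inv_det1 del: act.simps)
  finally show "mp_eval p (act (bneg g) F) = mp_eval p (act g F)" .
qed

text \<open>The determinants give squares equal to 1, so the cube condition reduces to
  \<open>\<alpha> * \<beta> = 1\<close>.\<close>

lemma mat_scalar_cases:
  fixes \<alpha> \<beta> :: "'a::field"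
  assumes "det (mat \<alpha> :: 'a^2^2) = 1" "det (mat \<beta> :: 'a^2^2) = 1" "(\<alpha> * \<beta>) ^ 3 = 1"
  shows "\<alpha> = \<beta> \<and> (\<alpha> = 1 \<or> \<alpha> = -1)"
proof -
  have 1: "\<alpha> * \<alpha> = 1" "\<beta> * \<beta> = 1" using assms(1,2) by (simp_all add: det_2 mat_2)
  have "(\<alpha> * \<beta>) ^ 3 = (\<alpha> * \<alpha>) * (\<beta> * \<beta>) * (\<alpha> * \<beta>)" by (simp add: power3_eq_cube mult_ac)
  then have "\<alpha> * \<beta> = 1" using assms(3) 1 by simp
  then have "\<alpha> * \<alpha> * \<beta> = \<alpha>" by (simp add: mult.assoc)
  then have "\<alpha> = \<beta>" using 1 by simp
  moreover have "(\<alpha> - 1) * (\<alpha> + 1) = 0" using 1 by (simp add: algebra_simps)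
  then have "\<alpha> = 1 \<or> \<alpha> = -1" by (auto simp: eq_neg_iff_add_eq_0)
  ultimately show ?thesis by blast
qed

text \<open>The multipliers of \<open>1 - \<psi>\<close> into the fibre ideal form an ideal
  \<open>Q\<close>. A common zero of \<open>Q\<close> would be a group element fixing
  \<open>f\<close>, hence plus or minus the identity; \<open>s\<close> excludes the first and its
  reflection \<open>s'\<close> the second. So \<open>Q\<close> contains 1.\<close>

lemma fiber_full:
  fixes f :: "(bivar, 'a::{alg_closed_field,field_char_0}) mpoly"
  assumes f: "f \<in> biforms 3 3" and triv: "GL_trivial f"
    and \<psi>: "PF \<psi>" "\<psi> bone = 1" "\<And>g. g \<in> SL2s \<Longrightarrow> \<psi> (bneg g) = \<psi> g"
  shows "\<exists>\<phi>. fiber_ideal (OA f) \<phi> \<and> (\<forall>g\<in>SL2s. 1 - \<psi> g = \<phi> g)"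
proof -
  obtain \<Psi> where \<Psi>: "\<And>g. g \<in> SL2s \<Longrightarrow> \<psi> g = mp_eval (\<lambda>v. co v g) \<Psi>"
    using \<psi>(1) unfolding PF_def pf_def by blast
  define J where "J = {F. \<exists>\<phi>. fiber_ideal (OA f) \<phi> \<and> (\<forall>g\<in>SL2s. mp_eval (\<lambda>v. co v g) F = \<phi> g)}"
  note loc = fiber_local[OF f inf_stab_trivial[OF f triv], folded J_def]
  have idl: "ring_ideal J" by (rule loc(1))
  obtain s where s: "mp_eval co1 s = 1" "\<And>v. s * tv v \<in> J" using loc(2) by blast
  have Jvan: "F \<in> J" if "\<And>g. g \<in> SL2s \<Longrightarrow> mp_eval (\<lambda>v. co v g) F = 0" for F
    unfolding J_def using that fiber_ideal.zero by (intro CollectI exI conjI) auto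
  define Q where "Q = {C. C * (1 - \<Psi>) \<in> J}"
  have Qidl: "ring_ideal Q"
    unfolding Q_def
    by (rule ring_idealI) (simp_all add: ideal_0[OF idl] distrib_right ideal_add[OF idl] mult.assoc ideal_mult[OF idl])
  have JQ: "J \<subseteq> Q" unfolding Q_def using ideal_mult_right[OF idl] by blast
  \<comment> \<open>\<open>1 - \<Psi>\<close> vanishes at the identity, so it is a combination of
    the \<open>tv w\<close>, each of which \<open>s\<close> multiplies into
    \<open>J\<close>.\<close>
  have sQ: "s \<in> Q"
  proof -
    obtain d r where t: "taylor d r (1 - \<Psi>)" using taylor_exists by blast
    have "mp_eval co1 (1 - \<Psi>) = 0" using \<psi>(2) \<Psi>[OF bone_closed] by simp
    from taylorD[OF t this] have "s * (1 - \<Psi>) = s * (\<Sum>w\<in>UNIV. (Const (d w) + r w) * tv w)" by (rule arg_cong)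
    also have "\<dots> = (\<Sum>w\<in>UNIV. (Const (d w) + r w) * (s * tv w))"
      by (simp add: sum_distrib_left mult.left_commute)
    also have "\<dots> \<in> J" by (intro ideal_sum[OF idl] ideal_mult[OF idl] s(2))
    finally show ?thesis by (simp add: Q_def)
  qed
  \<comment> \<open>Reflecting \<open>s\<close> moves its nonzero value to minus the identity;
    evenness of \<open>\<psi>\<close> and of functions on the orbit keeps it in
    \<open>Q\<close>.\<close>
  define s' where "s' = mp_subst (\<lambda>v. - Var v) s"
  have s'_eval: "mp_eval p s' = mp_eval (\<lambda>v. - p v) s" for p
    by (simp add: s'_def mp_eval_subst)
  have co_neg: "(\<lambda>v. - co v g) = (\<lambda>v. co v (bneg g))" for g :: "'a bigroup_elem"
  proof
    show "- co v g = co v (bneg g)" for v by (cases g; cases v) (auto simp: bneg_def)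
  qed
  have s'Q: "s' \<in> Q"
  proof -
    obtain \<phi> where \<phi>: "fiber_ideal (OA f) \<phi>" "\<forall>g\<in>SL2s. mp_eval (\<lambda>v. co v g) (s * (1 - \<Psi>)) = \<phi> g"
      using sQ unfolding Q_def J_def by blast
    have OAneg: "a (bneg g) = a g" if "a \<in> OA f" "g \<in> SL2s" for a g
    proof -
      obtain P where P: "\<And>g. g \<in> SL2s \<Longrightarrow> a g = mp_eval (lookup (act g f)) P" using \<open>a \<in> OA f\<close> unfolding OA_def by blast
      show ?thesis using P[OF that(2)] P[OF bneg_closed[OF that(2)]] act_bneg[OF f that(2)] by simp
    qed
    have "fiber_ideal (OA f) (\<lambda>g. \<phi> (bneg g))"
      using \<phi>(1)
    proof (induction rule: fiber_ideal.induct)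
      case (step \<phi> a b)
      have "(\<lambda>g. a (bneg g)) \<in> OA f"
      proof -
        obtain P where P: "\<And>g. g \<in> SL2s \<Longrightarrow> a g = mp_eval (lookup (act g f)) P"
          using step.hyps(2) unfolding OA_def by blast
        show ?thesis by (rule OA_I[of _ _ P]) (simp add: OAneg[OF step.hyps(2)] P del: act.simps)
      qed
      moreover have "a (bneg bone) = 0" using OAneg[OF step.hyps(2) bone_closed] step.hyps(3) by simp
      ultimately show ?case by (intro fiber_ideal.step[OF step.IH] PF_bneg[OF step.hyps(4)])
    qed (rule fiber_ideal.zero)
    moreover have "mp_eval (\<lambda>v. co v g) (s' * (1 - \<Psi>)) = \<phi> (bneg g)" if g: "g \<in> SL2s" for g
    proof -
      have "mp_eval (\<lambda>v. co v (bneg g)) (s * (1 - \<Psi>)) = \<phi> (bneg g)" using \<phi>(2) bneg_closed[OF g] by blast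
      then show ?thesis
        using \<Psi>[OF g] \<Psi>[OF bneg_closed[OF g]] \<psi>(3)[OF g] by (simp add: s'_eval co_neg)
    qed
    ultimately show ?thesis unfolding Q_def J_def by blast
  qed
  have "1 \<in> Q"
  proof (rule ccontr)
    assume "1 \<notin> Q"
    then obtain p where p: "\<And>C. C \<in> Q \<Longrightarrow> mp_eval p C = 0"
      using nullstellensatz[OF finite_sl_coord Qidl] by blast
    define A where "A b = mat2 (p (b, 1, 1)) (p (b, 1, 2)) (p (b, 2, 1)) (p (b, 2, 2))" for b
    define g where "g = (A False, A True, False)"
    have "\<forall>v. co v g = p v" unfolding all_sl_coord by (simp add: all_bool_eq g_def A_def)
    then have cop: "(\<lambda>v. co v g) = p" by (simp add: fun_eq_iff)
    have "det (A b) = 1" for b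
    proof -
      let ?F = "Var (b, 1, 1) * Var (b, 2, 2) - Var (b, 1, 2) * Var (b, 2, 1) - 1 :: (sl_coord, 'a) mpoly"
      have "?F \<in> J"
        by (rule Jvan, erule SL2sE) (cases b; simp add: det_2)
      then have "mp_eval p ?F = 0" using p JQ by blast
      then show ?thesis by (simp add: A_def det_2)
    qed
    then have g: "g \<in> SL2s" by (simp add: g_def SL2s_iff)
    have "lookup (act g f) m = lookup f m" for m
    proof -
      let ?a = "\<lambda>g. lookup (act g f) m - lookup f m"
      have aOA: "?a \<in> OA f" by (rule OA_I[of _ _ "Var m - Const (lookup f m)"]) simp
      obtain F where F: "\<And>g. g \<in> SL2s \<Longrightarrow> ?a g = mp_eval (\<lambda>v. co v g) F"
        using OA_PF[OF f aOA] unfolding PF_def pf_def by blast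
      have "fiber_ideal (OA f) ?a" by (rule fiber_ideal_gen[OF aOA]) (simp add: act_bone del: act.simps)
      then have "F \<in> J" unfolding J_def using F by (intro CollectI exI[of _ ?a]) (simp del: act.simps)
      then have "mp_eval p F = 0" using p JQ by blast
      then show ?thesis using F[OF g] unfolding cop by simp
    qed
    then have "act g f = f" by (rule poly_mapping_eqI)
    then have "g \<in> trivial_scalars"
      using triv det1_invertible \<open>\<And>b. det (A b) = 1\<close> unfolding GL_trivial_def g_def by blast
    then obtain \<alpha> \<beta> where ab: "A False = mat \<alpha>" "A True = mat \<beta>" "(\<alpha> * \<beta>) ^ 3 = 1"
      unfolding trivial_scalars_def g_def by blast
    then have "\<alpha> = \<beta> \<and> (\<alpha> = 1 \<or> \<alpha> = -1)"
      using \<open>\<And>b. det (A b) = 1\<close>[of False] \<open>\<And>b. det (A b) = 1\<close>[of True] by (intro mat_scalar_cases) simp_all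
    then consider "g = bone" | "g = bneg bone"
      using ab by (auto simp: g_def bone_def bneg_def mat2_eq_iff mat_2)
    then show False
    proof cases
      case 1
      then show False using p[OF sQ] s(1) cop by simp
    next
      case 2
      have "bneg (bneg bone) = (bone :: 'a bigroup_elem)" by (simp add: bneg_def bone_def)
      then have "(\<lambda>v. - p v) = co1" unfolding cop[symmetric] 2 co_neg by simp
      then show False using p[OF s'Q] s(1) s'_eval[of p] by simp
    qed
  qed
  then have "1 - \<Psi> \<in> J" by (simp add: Q_def)
  then obtain \<phi> where "fiber_ideal (OA f) \<phi>" "\<forall>g\<in>SL2s. mp_eval (\<lambda>v. co v g) (1 - \<Psi>) = \<phi> g"
    unfolding J_def by blast
  then show ?thesis using \<Psi> by (intro exI[of _ \<phi>]) simp
qed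

section \<open>Homogeneous polynomial functions of the coefficients\<close>

lemma homogeneous_iff: "homogeneous d F \<longleftrightarrow> (\<forall>m\<in>keys F. mdeg m = d)"
  by (simp add: homogeneous_def mdeg_def)

lemma homogeneous_0: "homogeneous d 0" by (simp add: homogeneous_iff)

lemma homogeneous_add: "homogeneous d F \<Longrightarrow> homogeneous d G \<Longrightarrow> homogeneous d (F + G)"
  unfolding homogeneous_iff using Poly_Mapping.keys_add[of F G] by blast

lemma homogeneous_mult: "homogeneous d F \<Longrightarrow> homogeneous e G \<Longrightarrow> homogeneous (d + e) (F * G)"
proof -
  assume h: "homogeneous d F" "homogeneous e G"
  show "homogeneous (d + e) (F * G)"
    unfolding homogeneous_iff
  proof
    fix m assume "m \<in> keys (F * G)"
    then obtain k l where "k \<in> keys F" "l \<in> keys G" "m = k + l" using Poly_Mapping.keys_mult[of F G] by blast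
    then show "mdeg m = d + e" using h by (simp add: homogeneous_iff mdeg_add)
  qed
qed

lemma homogeneous_Const: "homogeneous 0 (Const c)"
  by (auto simp: homogeneous_iff Const_def mdeg_def)

lemma homogeneous_1: "homogeneous 0 (1 :: ('v, 'a::comm_ring_1) mpoly)"
  by (auto simp: homogeneous_iff mdeg_def)

lemma homogeneous_Var: "homogeneous 1 (Var v :: ('v, 'a::zero_neq_one) mpoly)"
  by (auto simp: homogeneous_iff Var_def mdeg_def)

lemma homogeneous_scale: "homogeneous d F \<Longrightarrow> homogeneous d (Const c * F)"
  using homogeneous_mult[OF homogeneous_Const] by force

lemma homogeneous_sum: "(\<And>i. i \<in> I \<Longrightarrow> homogeneous d (f i)) \<Longrightarrow> homogeneous d (sum f I)"
  by (induction I rule: infinite_finite_induct) (auto intro: homogeneous_0 homogeneous_add)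

lemma homogeneous_power:
  fixes F :: "('v, 'a::comm_ring_1) mpoly"
  shows "homogeneous d F \<Longrightarrow> homogeneous (k * d) (F ^ k)"
proof (induction k)
  case 0
  show ?case using homogeneous_1 by simp
next
  case (Suc k)
  then show ?case using homogeneous_mult[of d F "k * d" "F ^ k"] by simp
qed

lemma homogeneous_prod:
  fixes f :: "'i \<Rightarrow> ('v, 'a::comm_ring_1) mpoly"
  shows "(\<And>i. i \<in> I \<Longrightarrow> homogeneous (n i) (f i)) \<Longrightarrow> homogeneous (\<Sum>i\<in>I. n i) (\<Prod>i\<in>I. f i)"
proof (induction I rule: infinite_finite_induct)
  case (insert i I)
  then show ?case using homogeneous_mult[of "n i" "f i" "sum n I" "prod f I"] by simp
qed (simp_all add: homogeneous_1)

lemma homogeneous_subst: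
  assumes P: "homogeneous d P" and s: "\<And>v. homogeneous 1 (s v)"
  shows "homogeneous d (mp_subst s P)"
  unfolding mp_subst_def
proof (intro homogeneous_sum homogeneous_scale)
  fix m assume "m \<in> keys P"
  then have d: "d = (\<Sum>v\<in>keys m. lookup m v)" using P by (simp add: homogeneous_def)
  show "homogeneous d (\<Prod>v\<in>keys m. s v ^ lookup m v)"
    unfolding d using homogeneous_power[OF s] by (intro homogeneous_prod) simp
qed

lemma hom_poly_add: "hom_poly_fun a b d I \<Longrightarrow> hom_poly_fun a b d J \<Longrightarrow> hom_poly_fun a b d (\<lambda>h. I h + J h)"
proof -
  assume "hom_poly_fun a b d I" "hom_poly_fun a b d J"
  then obtain P R where "homogeneous d P" "\<forall>f\<in>biforms a b. I f = mp_eval (lookup f) P"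
    "homogeneous d R" "\<forall>f\<in>biforms a b. J f = mp_eval (lookup f) R" unfolding hom_poly_fun_def by blast
  then show ?thesis unfolding hom_poly_fun_def by (intro exI[of _ "P + R"]) (simp add: homogeneous_add)
qed

lemma hom_poly_mult: "hom_poly_fun a b d I \<Longrightarrow> hom_poly_fun a b e J \<Longrightarrow> hom_poly_fun a b (d + e) (\<lambda>h. I h * J h)"
proof -
  assume "hom_poly_fun a b d I" "hom_poly_fun a b e J"
  then obtain P R where "homogeneous d P" "\<forall>f\<in>biforms a b. I f = mp_eval (lookup f) P"
    "homogeneous e R" "\<forall>f\<in>biforms a b. J f = mp_eval (lookup f) R" unfolding hom_poly_fun_def by blast
  then show ?thesis unfolding hom_poly_fun_def by (intro exI[of _ "P * R"]) (simp add: homogeneous_mult)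
qed

lemma hom_poly_const: "hom_poly_fun a b 0 (\<lambda>_. c)"
  unfolding hom_poly_fun_def by (intro exI[of _ "Const c"]) (simp add: homogeneous_Const)

lemma hom_poly_0: "hom_poly_fun a b d (\<lambda>_. 0)"
  unfolding hom_poly_fun_def by (intro exI[of _ 0]) (simp add: homogeneous_0)

lemma hom_poly_scale: "hom_poly_fun a b d I \<Longrightarrow> hom_poly_fun a b d (\<lambda>h. c * I h)"
  using hom_poly_mult[OF hom_poly_const] by force

lemma hom_poly_sum: "(\<And>i. i \<in> S \<Longrightarrow> hom_poly_fun a b d (I i)) \<Longrightarrow> hom_poly_fun a b d (\<lambda>h. \<Sum>i\<in>S. I i h)"
  by (induction S rule: infinite_finite_induct) (auto intro: hom_poly_0 hom_poly_add)

lemma hom_poly_coord: "hom_poly_fun a b 1 (\<lambda>h. lookup h m)"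
  unfolding hom_poly_fun_def by (intro exI[of _ "Var m"]) (simp add: homogeneous_Var[unfolded One_nat_def])

lemma hom_poly_act:
  assumes I: "hom_poly_fun a b d I" and g: "\<And>h. h \<in> biforms a b \<Longrightarrow> act g h \<in> biforms a b"
  shows "hom_poly_fun a b d (\<lambda>h. I (act g h))"
proof -
  obtain P where P: "homogeneous d P" "\<forall>f\<in>biforms a b. I f = mp_eval (lookup f) P"
    using I unfolding hom_poly_fun_def by blast
  have "homogeneous d (pull a b g P)"
    unfolding pull_def by (intro homogeneous_subst[OF P(1)] homogeneous_sum homogeneous_scale homogeneous_Var)
  then show ?thesis
    unfolding hom_poly_fun_def using P(2) g by (intro exI[of _ "pull a b g P"]) (simp add: mp_eval_pull del: act.simps)
qed

lemma hom_poly_monom: "hom_poly_fun a b (mdeg m) (\<lambda>h. \<Prod>v\<in>keys m. lookup h v ^ lookup m v)"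
  unfolding hom_poly_fun_def
  by (intro exI[of _ "Poly_Mapping.single m 1"]) (auto simp: mp_eval_single homogeneous_iff)

lemma hom_poly_lookup_act:
  assumes "\<And>m. hom_poly_fun a b d (\<lambda>h. lookup (q h) m)" "\<And>h. h \<in> biforms a b \<Longrightarrow> q h \<in> biforms k l"
  shows "hom_poly_fun a b d (\<lambda>h. lookup (act g (q h)) m)"
proof -
  have "hom_poly_fun a b d (\<lambda>h. \<Sum>m'\<in>bimonoms k l. lookup (act g (Poly_Mapping.single m' 1)) m * lookup (q h) m')"
    by (intro hom_poly_sum hom_poly_scale assms(1))
  then obtain P where P: "homogeneous d P" "\<forall>h\<in>biforms a b. (\<Sum>m'\<in>bimonoms k l. lookup (act g (Poly_Mapping.single m' 1)) m * lookup (q h) m')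
      = mp_eval (lookup h) P" unfolding hom_poly_fun_def by blast
  have "lookup (act g (q h)) m = mp_eval (lookup h) P" if "h \<in> biforms a b" for h
    using P(2) that unfolding lookup_act_linear[OF assms(2)[OF that], of g m] by (simp add: mult.commute)
  then show ?thesis unfolding hom_poly_fun_def using P(1) by blast
qed

lemma biforms_0: "0 \<in> biforms a b" by (simp add: biforms_def)
lemma biforms_add: "F \<in> biforms a b \<Longrightarrow> G \<in> biforms a b \<Longrightarrow> F + G \<in> biforms a b"
  unfolding biforms_iff using Poly_Mapping.keys_add[of F G] by blast
lemma biforms_scale:
  fixes F :: "(bivar, 'a::comm_ring_1) mpoly"
  shows "F \<in> biforms a b \<Longrightarrow> Const c * F \<in> biforms a b"
  unfolding biforms_iff
  by (metis in_keys_iff lookup_Const_mult mult_zero_right subset_iff)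
lemma biforms_sum: "(\<And>i. i \<in> I \<Longrightarrow> f i \<in> biforms a b) \<Longrightarrow> sum f I \<in> biforms a b"
  by (induction I rule: infinite_finite_induct) (auto intro: biforms_0 biforms_add)

text \<open>The average is taken for a single monomial \<open>m\<close>, since a covariant must be
  homogeneous. Replacing \<open>g\<close> by \<open>g x\<close> under the integral gives
  equivariance; a quadrature makes the average polynomial in \<open>h\<close>.\<close>

lemma covariant_exists:
  fixes w :: "(bivar, 'a::field_char_0) mpoly" and m :: "(bivar \<Rightarrow>\<^sub>0 nat) \<Rightarrow>\<^sub>0 nat"
  assumes w: "w \<in> biforms k l"
  shows "\<exists>q. covariant a b k l q \<and> (\<forall>h\<in>biforms a b. \<forall>m'. lookup (q h) m' =
     haar (\<lambda>g. (\<Prod>v\<in>keys m. lookup (act g h) v ^ lookup m v) * lookup (act (binv g) w) m'))"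
proof -
  define N where "N = mdeg m * (a + b) + (k + l)"
  have pfN: "pf N (\<lambda>g. (\<Prod>v\<in>keys m. lookup (act g h) v ^ lookup m v) * lookup (act (binv g) w) m')"
    if "h \<in> biforms a b" for h m'
    unfolding N_def by (intro pf_mult pf_eval_monom[OF that] pf_inv[OF pf_lookup_act[OF w]])
  obtain K :: "(('a \<times> 'a \<times> 'a) \<times> ('a \<times> 'a \<times> 'a)) set" and c and \<gamma> :: "_ \<Rightarrow> 'a bigroup_elem"
    where K: "\<forall>\<kappa>\<in>K. \<gamma> \<kappa> \<in> SL2s" "\<forall>\<phi>. pf N \<phi> \<longrightarrow> haar \<phi> = (\<Sum>\<kappa>\<in>K. c \<kappa> * \<phi> (\<gamma> \<kappa>))"
    using haar_quadrature[of N] by blast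
  define q where "q h = (\<Sum>\<kappa>\<in>K. Const (c \<kappa> * (\<Prod>v\<in>keys m. lookup (act (\<gamma> \<kappa>) h) v ^ lookup m v)) * act (binv (\<gamma> \<kappa>)) w)" for h
  have lq: "lookup (q h) m' = haar (\<lambda>g. (\<Prod>v\<in>keys m. lookup (act g h) v ^ lookup m v) * lookup (act (binv g) w) m')"
    if h: "h \<in> biforms a b" for h m'
    using K(2)[rule_format, OF pfN[OF h]]
    by (simp add: q_def lookup_sum lookup_Const_mult mult.assoc del: act.simps)
  have qb: "q h \<in> biforms k l" for h
    unfolding q_def using K(1) by (intro biforms_sum biforms_scale act_SL_biforms[OF binv_closed w]) blast
  have "hom_poly_fun a b (mdeg m) (\<lambda>h. lookup (q h) m')" for m'
  proof -
    have "hom_poly_fun a b (mdeg m) (\<lambda>h. \<Sum>\<kappa>\<in>K. (c \<kappa> * lookup (act (binv (\<gamma> \<kappa>)) w) m') *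
        (\<Prod>v\<in>keys m. lookup (act (\<gamma> \<kappa>) h) v ^ lookup m v))"
    proof (intro hom_poly_sum hom_poly_scale)
      fix \<kappa> assume "\<kappa> \<in> K"
      then show "hom_poly_fun a b (mdeg m) (\<lambda>h. \<Prod>v\<in>keys m. lookup (act (\<gamma> \<kappa>) h) v ^ lookup m v)"
        using K(1) by (intro hom_poly_act[OF hom_poly_monom] act_SL_biforms) auto
    qed
    moreover have "lookup (q h) m' = (\<Sum>\<kappa>\<in>K. (c \<kappa> * lookup (act (binv (\<gamma> \<kappa>)) w) m') *
        (\<Prod>v\<in>keys m. lookup (act (\<gamma> \<kappa>) h) v ^ lookup m v))" for h
      unfolding q_def lookup_sum lookup_Const_mult by (simp only: mult_ac)
    ultimately show ?thesis by (simp only:)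
  qed
  moreover have "q (act x h) = act x (q h)" if x: "x \<in> SL2s" and h: "h \<in> biforms a b" for x h
  proof (rule poly_mapping_eqI)
    fix m'
    define \<Phi> where "\<Phi> g = (\<Prod>v\<in>keys m. lookup (act g h) v ^ lookup m v) * lookup (act x (act (binv g) w)) m'" for g
    define L where "L m'' = lookup (act x (Poly_Mapping.single m'' 1)) m'" for m''
    define G where "G m'' g = (\<Prod>v\<in>keys m. lookup (act g h) v ^ lookup m v) * lookup (act (binv g) w) m''" for m'' g
    have GPF: "PF (G m'')" for m'' unfolding G_def using pfN[OF h] by (rule PF_I)
    have \<Phi>_eq: "\<Phi> g = (\<Sum>m''\<in>bimonoms k l. L m'' * G m'' g)" if g: "g \<in> SL2s" for g
      unfolding \<Phi>_def G_def L_def lookup_act_linear[OF act_SL_biforms[OF binv_closed[OF g] w], of x m']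
      by (simp add: sum_distrib_left mult_ac)
    have \<Phi>PF: "PF \<Phi>"
    proof (rule PF_cong)
      show "PF (\<lambda>g. \<Sum>m''\<in>bimonoms k l. L m'' * G m'' g)" by (intro PF_sum PF_scale GPF)
    qed (simp add: \<Phi>_eq)
    have "lookup (act x (q h)) m' = (\<Sum>m''\<in>bimonoms k l. L m'' * haar (G m''))"
      unfolding lookup_act_linear[OF qb[of h], of x m'] lq[OF h] G_def L_def by (simp add: mult.commute)
    also have "\<dots> = haar (\<lambda>g. \<Sum>m''\<in>bimonoms k l. L m'' * G m'' g)"
      by (rule haar_sum[OF GPF, symmetric])
    also have "\<dots> = haar \<Phi>" by (rule haar_cong) (simp add: \<Phi>_eq)
    also have "\<dots> = haar (\<lambda>g. \<Phi> (bmul g x))" by (rule haar_PF_right[OF \<Phi>PF x, symmetric])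
    also have "\<dots> = lookup (q (act x h)) m'"
      unfolding lq[OF act_SL_biforms[OF x h]]
    proof (rule haar_cong)
      fix g :: "'a bigroup_elem" assume g: "g \<in> SL2s"
      have "act x (act (binv (bmul g x)) w) = act (binv g) w"
        by (simp add: binv_bmul act_bmul[OF binv_closed[OF x] binv_closed[OF g]] act_binv[OF x] del: act.simps)
      then show "\<Phi> (bmul g x) = (\<Prod>v\<in>keys m. lookup (act g (act x h)) v ^ lookup m v) * lookup (act (binv g) w) m'"
        by (simp add: \<Phi>_def act_bmul[OF g x] del: act.simps)
    qed
    finally show "lookup (q (act x h)) m' = lookup (act x (q h)) m'" by simp
  qed
  ultimately have "covariant a b k l q" unfolding covariant_def using qb by blast
  then show ?thesis using lq by blast
qed

text \<open>The entries \<open>xu\<close>, \<open>xv\<close>, \<open>yu\<close>, \<open>yv\<close>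
  of a 2 x 2 coefficient matrix, row by row. In the type \<open>4\<close> the numeral 4 equals 0, so
  the indices 1 to 4 are all of it.\<close>

definition mon11 :: "4 \<Rightarrow> bivar \<Rightarrow>\<^sub>0 nat" where
  "mon11 i = (if i = 1 then mm 1 0 1 0 else if i = 2 then mm 1 0 0 1 else if i = 3 then mm 0 1 1 0 else mm 0 1 0 1)"

lemma exhaust_4: "(i::4) = 1 \<or> i = 2 \<or> i = 3 \<or> i = 4"
proof (induct i)
  case (of_int z)
  then have "0 \<le> z" "z < 4" by simp_all
  then have "z = 0 \<or> z = 1 \<or> z = 2 \<or> z = 3" by arith
  then show ?case by auto
qed

lemma UNIV_4: "(UNIV :: 4 set) = {1, 2, 3, 4}"
  by (rule UNIV_eq_I) (use exhaust_4 in blast)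

lemma sum_4: "(\<Sum>i\<in>UNIV. g (i::4)) = g 1 + g 2 + g 3 + (g 4 :: 'b::comm_monoid_add)"
  unfolding UNIV_4 by (simp add: add_ac)

lemma mon11_simps: "mon11 1 = mm 1 0 1 0" "mon11 2 = mm 1 0 0 1" "mon11 3 = mm 0 1 1 0" "mon11 4 = mm 0 1 0 1"
  by (simp_all add: mon11_def)

lemma bimonoms_11: "bimonoms 1 1 = mon11 ` UNIV"
proof -
  have "{..(1::nat)} = {0, 1}" by auto
  then show ?thesis unfolding bimonoms_def UNIV_4 by (auto simp: mon11_simps)
qed

lemma inj_mon11: "inj mon11"
proof (rule injI)
  fix i j assume "mon11 i = mon11 j"
  then show "i = j" using exhaust_4[of i] exhaust_4[of j] by (auto simp: mon11_simps mm_eq_iff)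
qed

text \<open>A common point of the two orbits would yield a stabilizing element with the exchange
  flag set, which is no scalar pair. Both orbits being closed, the Nullstellensatz makes their
  ideals comaximal, and \<open>R\<close> is the second part of a decomposition of 1.\<close>

lemma separating_polynomial:
  fixes f :: "(bivar, 'a::{alg_closed_field,field_char_0}) mpoly"
  assumes f: "f \<in> biforms a a" and closed: "zariski_closed_in_biforms a a (orbit SLxSL act f)" and triv: "GL_trivial f"
  shows "\<exists>R. \<forall>g\<in>SL2s. mp_eval (lookup (act g f)) R = 1 \<and> mp_eval (lookup (act g (act exchange f))) R = 0"
proof -
  let ?e = "act exchange f"
  have e: "?e \<in> biforms a a" by (rule exchange_biforms[OF f])
  define J1 where "J1 = {P. \<forall>g\<in>SL2s. mp_eval (lookup (act g f)) P = 0}"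
  define J2 where "J2 = {P. \<forall>g\<in>SL2s. mp_eval (lookup (act g ?e)) P = 0}"
  define J where "J = {P. \<exists>P1\<in>J1. \<exists>P2\<in>J2. P = P1 + P2}"
  have 0: "0 \<in> J1" "0 \<in> J2" by (simp_all add: J1_def J2_def)
  have J1J: "J1 \<subseteq> J"
  proof
    fix P assume "P \<in> J1"
    then show "P \<in> J" unfolding J_def using 0(2) by (intro CollectI bexI[of _ P] bexI[of _ 0]) auto
  qed
  have J2J: "J2 \<subseteq> J"
  proof
    fix P assume "P \<in> J2"
    then show "P \<in> J" unfolding J_def using 0(1) by (intro CollectI bexI[of _ 0] bexI[of _ P]) auto
  qed
  have idl: "ring_ideal J"
  proof (rule ring_idealI)
    show "0 \<in> J" using J1J 0 by blast
    show "x + y \<in> J" if xy: "x \<in> J" "y \<in> J" for x y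
    proof -
      obtain x1 x2 y1 y2 where h: "x1 \<in> J1" "x2 \<in> J2" "x = x1 + x2" "y1 \<in> J1" "y2 \<in> J2" "y = y1 + y2"
        using xy unfolding J_def by blast
      have "x1 + y1 \<in> J1" "x2 + y2 \<in> J2" using h by (simp_all add: J1_def J2_def)
      moreover have "x + y = (x1 + y1) + (x2 + y2)" using h by (simp add: algebra_simps)
      ultimately show ?thesis unfolding J_def by blast
    qed
    show "r * x \<in> J" if xJ: "x \<in> J" for r x
    proof -
      obtain x1 x2 where h: "x1 \<in> J1" "x2 \<in> J2" "x = x1 + x2" using xJ unfolding J_def by blast
      have "r * x1 \<in> J1" "r * x2 \<in> J2" using h by (simp_all add: J1_def J2_def)
      moreover have "r * x = r * x1 + r * x2" using h by (simp add: algebra_simps)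
      ultimately show ?thesis unfolding J_def by blast
    qed
  qed
  have "1 \<in> J"
  proof (rule ccontr)
    assume one: "1 \<notin> J"
    have out: "Var m \<in> J" if "m \<notin> bimonoms a a" for m
    proof -
      have "Var m \<in> J1" unfolding J1_def
        by (simp add: biforms_lookup_0[OF act_SL_biforms[OF _ f] that] del: act.simps)
      then show ?thesis using J1J by blast
    qed
    obtain p where p: "\<And>P. P \<in> J \<Longrightarrow> mp_eval p P = 0"
      using nullstellensatz[OF finite_bimonoms idl one out] by blast
    define v where "v = (\<Sum>m\<in>bimonoms a a. Poly_Mapping.single m (p m))"
    have v: "v \<in> biforms a a" unfolding v_def by (rule biforms_of_coords(1)[OF finite_bimonoms refl])
    have "lookup v m = p m" for m
      unfolding v_def biforms_of_coords(2)[OF finite_bimonoms refl] using p[OF out, of m] by auto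
    then have lv: "lookup v = p" by (rule ext)
    obtain T where T: "orbit SLxSL act f = {h \<in> biforms a a. \<forall>P\<in>T. mp_eval (lookup h) P = 0}"
      using closed unfolding zariski_closed_in_biforms_def by blast
    have TJ: "mp_eval (lookup (act g f)) P = 0" if "P \<in> T" "g \<in> SL2s" for P g
    proof -
      have "act g f \<in> orbit SLxSL act f" unfolding orbit_SL using that(2) by blast
      then show ?thesis unfolding T using that(1) by blast
    qed
    have "mp_eval (lookup v) P = 0" if "P \<in> T" for P
    proof -
      have "P \<in> J" using J1J TJ[OF that] unfolding J1_def by blast
      then show ?thesis unfolding lv by (rule p)
    qed
    then have "v \<in> orbit SLxSL act f" unfolding T using v by blast
    then obtain g1 where g1: "g1 \<in> SL2s" "v = act g1 f" unfolding orbit_SL by blast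
    \<comment> \<open>Equations of the orbit of \<open>f\<close>, pulled back by the exchange,
      vanish on the exchanged orbit; they therefore lie in \<open>J2\<close> and vanish at
      \<open>v\<close>.\<close>
    have "mp_eval (lookup (act exchange v)) P = 0" if "P \<in> T" for P
    proof -
      have "mp_eval (lookup (act g ?e)) (pull a a exchange P) = 0" if g: "g \<in> SL2s" for g
      proof -
        obtain A B where AB: "g = (A, B, False)" "det A = 1" "det B = 1" using g by (rule SL2sE)
        have "act exchange (act g ?e) = act (B, A, False) f"
          unfolding AB(1) act_exchange_act act_exchange_exchange ..
        moreover have "(B, A, False) \<in> SL2s" using AB by (simp add: SL2s_iff)
        ultimately show ?thesis
          unfolding mp_eval_pull[OF act_SL_biforms[OF g e]] using TJ[OF \<open>P \<in> T\<close>] by (simp del: act.simps)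
      qed
      then have "pull a a exchange P \<in> J" using J2J unfolding J2_def by blast
      from p[OF this] show ?thesis unfolding lv[symmetric] mp_eval_pull[OF v] .
    qed
    then have "act exchange v \<in> orbit SLxSL act f" unfolding T using exchange_biforms[OF v] by blast
    then obtain g2 where g2: "g2 \<in> SL2s" "act exchange v = act g2 f" unfolding orbit_SL by blast
    obtain A B where AB: "g1 = (A, B, False)" "det A = 1" "det B = 1" using g1(1) by (rule SL2sE)
    have "(B, A, False) \<in> SL2s" using AB by (simp add: SL2s_iff)
    then have h: "bmul (binv g2) (B, A, False) \<in> SL2s" by (intro bmul_closed binv_closed g2)
    then obtain C D where CD: "bmul (binv g2) (B, A, False) = (C, D, False)" "det C = 1" "det D = 1" by (rule SL2sE)
    have "act (C, D, True) f = act (bmul (binv g2) (B, A, False)) ?e"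
      unfolding CD(1) by (rule act_exchange_eq)
    also have "\<dots> = act (binv g2) (act (B, A, False) ?e)"
      by (rule act_bmul[OF binv_closed[OF g2(1)] \<open>(B, A, False) \<in> SL2s\<close>])
    also have "act (B, A, False) ?e = act g2 f"
      using g2(2) unfolding g1(2) AB(1) act_exchange_act .
    also have "act (binv g2) (act g2 f) = f" by (rule act_binv(2)[OF g2(1)])
    finally have "(C, D, True) \<in> trivial_scalars"
      using triv CD det1_invertible unfolding GL_trivial_def by blast
    then show False unfolding trivial_scalars_def by blast
  qed
  then obtain P R where PR: "P \<in> J1" "R \<in> J2" "1 = P + R" unfolding J_def by blast
  have "R = 1 - P" using PR(3) by (simp add: algebra_simps)
  then show ?thesis using PR(1,2) unfolding J1_def J2_def by (intro exI[of _ R]) (simp del: act.simps)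
qed

text \<open>The exchange conjugates \<open>(A, B)\<close> into \<open>(B, A)\<close>, so conjugating
  a covariant by it gives a covariant of the same degree.\<close>

lemma covariant_symmetrize:
  fixes q :: "(bivar, 'a::field_char_0) mpoly \<Rightarrow> (bivar, 'a) mpoly"
  assumes q: "covariant r r l l q"
  defines "q' \<equiv> \<lambda>h. q h + act exchange (q (act exchange h))"
  shows "covariant r r l l q'" "exchange_equivariant r q'"
proof -
  obtain d where d: "\<And>m. hom_poly_fun r r d (\<lambda>h. lookup (q h) m)" using q unfolding covariant_def by blast
  have qb: "q h \<in> biforms l l" if "h \<in> biforms r r" for h using q that unfolding covariant_def by blast
  have qe: "q (act g h) = act g (q h)" if "g \<in> SL2s" "h \<in> biforms r r" for g h
    using q that unfolding covariant_def by blast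
  have "q' \<in> biforms r r \<rightarrow> biforms l l"
    unfolding q'_def by (intro Pi_I biforms_add exchange_biforms qb)
  moreover have "hom_poly_fun r r d (\<lambda>h. lookup (q' h) m)" for m
    unfolding q'_def lookup_add
  proof (intro hom_poly_add d hom_poly_lookup_act)
    show "hom_poly_fun r r d (\<lambda>h. lookup (q (act exchange h)) m)" for m
      by (rule hom_poly_act[OF d]) (rule exchange_biforms)
    show "q (act exchange h) \<in> biforms l l" if "h \<in> biforms r r" for h
      using that by (intro qb exchange_biforms)
  qed
  moreover have "q' (act g h) = act g (q' h)" if g: "g \<in> SL2s" and h: "h \<in> biforms r r" for g h
  proof -
    obtain A B where AB: "g = (A, B, False)" "det A = 1" "det B = 1" using g by (rule SL2sE)
    have BA: "(B, A, False) \<in> SL2s" using AB by (simp add: SL2s_iff)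
    have "act exchange (q (act exchange (act g h))) = act exchange (q (act (B, A, False) (act exchange h)))"
      unfolding AB(1) act_exchange_act ..
    also have "\<dots> = act exchange (act (B, A, False) (q (act exchange h)))"
      unfolding qe[OF BA exchange_biforms[OF h]] ..
    also have "\<dots> = act g (act exchange (q (act exchange h)))"
      unfolding act_exchange_act AB(1) ..
    finally show ?thesis unfolding q'_def qe[OF g h] act_add by simp
  qed
  ultimately show "covariant r r l l q'" unfolding covariant_def by blast
  show "exchange_equivariant r q'"
    unfolding exchange_equivariant_def q'_def
    by (simp add: act_add act_exchange_exchange add.commute del: act.simps)
qed

text \<open>A functional killing all values at \<open>f\<close> makes the matrix coefficient
  \<open>\<psi>\<close> orthogonal to \<open>OA f\<close>, because each integral is a combination of
  such values. But \<open>\<psi>\<close> is even and 1 at the identity, so \<open>1 - \<psi>\<close>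
  lies in the fibre ideal.\<close>

lemma covariants_separate:
  fixes f :: "(bivar, 'a::{alg_closed_field,field_char_0}) mpoly" and c :: "4 \<Rightarrow> 'a"
  assumes f: "f \<in> biforms 3 3" and closed: "zariski_closed_in_biforms 3 3 (orbit SLxSL act f)" and triv: "GL_trivial f"
    and c: "\<forall>q. covariant 3 3 1 1 q \<and> exchange_equivariant 3 q \<longrightarrow> (\<Sum>i\<in>UNIV. c i * lookup (q f) (mon11 i)) = 0"
    and i0: "c i0 \<noteq> 0"
  shows False
proof -
  interpret closed_orbit_algebra "OA f" by (rule closed_orbit_algebra_OA[OF f closed])
  let ?e = "act exchange f"
  have e: "?e \<in> biforms 3 3" by (rule exchange_biforms[OF f])
  \<comment> \<open>Normalised so that the functional \<open>c\<close> takes the value 1 on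
    \<open>w\<close>.\<close>
  define w where "w = Poly_Mapping.single (mon11 i0) (1 / c i0)"
  have w: "w \<in> biforms 1 1" unfolding biforms_iff w_def bimonoms_11 by auto
  define W where "W m g = lookup (act (binv g) w) m" for m and g :: "'a bigroup_elem"
  have WPF: "PF (W m)" for m unfolding W_def by (rule PF_I[OF pf_inv[OF pf_lookup_act[OF w]]])
  define \<psi> where "\<psi> g = (\<Sum>i\<in>UNIV. c i * W (mon11 i) g)" for g
  have \<psi>PF: "PF \<psi>" unfolding \<psi>_def by (intro PF_sum PF_scale WPF)
  have \<psi>1: "\<psi> bone = 1"
  proof -
    have "binv bone = (bone :: 'a bigroup_elem)" by (simp add: binv_def bone_def adj2_def mat2_simps)
    then have "\<psi> bone = (\<Sum>i\<in>UNIV. c i * lookup w (mon11 i))" by (simp add: \<psi>_def W_def act_bone del: act.simps)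
    also have "\<dots> = (\<Sum>i\<in>{i0}. c i * lookup w (mon11 i))"
      by (rule sum.mono_neutral_right) (auto simp: w_def lookup_single when_def inj_eq[OF inj_mon11])
    also have "\<dots> = 1" using i0 by (simp add: w_def)
    finally show ?thesis .
  qed
  have \<psi>neg: "\<psi> (bneg g) = \<psi> g" if g: "g \<in> SL2s" for g
  proof -
    have "binv (bneg g) = bneg (binv g)" by (simp add: binv_def bneg_def adj2_def mat2_eq_iff)
    then show ?thesis unfolding \<psi>_def W_def using act_bneg[OF w binv_closed[OF g]] by simp
  qed
  obtain R where R: "\<And>g. g \<in> SL2s \<Longrightarrow> mp_eval (lookup (act g f)) R = 1"
    "\<And>g. g \<in> SL2s \<Longrightarrow> mp_eval (lookup (act g ?e)) R = 0"
    using separating_polynomial[OF f closed triv] by blast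
  have orth: "haar (\<lambda>g. a g * \<psi> g) = 0" if a: "a \<in> OA f" for a
  proof -
    obtain P0 where P0: "\<And>g. g \<in> SL2s \<Longrightarrow> a g = mp_eval (lookup (act g f)) P0" using a unfolding OA_def by blast
    \<comment> \<open>Unchanged on the orbit of \<open>f\<close> and zero on the exchanged orbit:
      symmetrizing the covariants then adds nothing, in total, to their values at
      \<open>f\<close>.\<close>
    define P where "P = P0 * R"
    define mon where "mon m h g = (\<Prod>v\<in>keys m. lookup (act g h) v ^ lookup m v)"
      for m :: "(bivar \<Rightarrow>\<^sub>0 nat) \<Rightarrow>\<^sub>0 nat" and h :: "(bivar, 'a) mpoly" and g
    have "\<forall>m. \<exists>q. covariant 3 3 1 1 q \<and> (\<forall>h\<in>biforms 3 3. \<forall>m'. lookup (q h) m' = haar (\<lambda>g. mon m h g * W m' g))"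
      using covariant_exists[OF w, of 3 3] unfolding mon_def W_def by blast
    from choice[OF this] obtain q where q: "\<And>m. covariant 3 3 1 1 (q m)"
      "\<And>m h m'. h \<in> biforms 3 3 \<Longrightarrow> lookup (q m h) m' = haar (\<lambda>g. mon m h g * W m' g)" by blast
    have tot: "(\<Sum>m\<in>keys P. lookup P m * lookup (q m h) m') = haar (\<lambda>g. mp_eval (lookup (act g h)) P * W m' g)"
      if h: "h \<in> biforms 3 3" for h m'
    proof -
      have "PF (\<lambda>g. mon m h g * W m' g)" for m
        unfolding mon_def by (intro PF_mult WPF PF_I[OF pf_eval_monom[OF h]])
      then have "(\<Sum>m\<in>keys P. lookup P m * haar (\<lambda>g. mon m h g * W m' g))
          = haar (\<lambda>g. \<Sum>m\<in>keys P. lookup P m * (mon m h g * W m' g))"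
        by (intro haar_sum[symmetric])
      then show ?thesis by (simp add: q(2)[OF h] mp_eval_def mon_def sum_distrib_right mult.assoc)
    qed
    have tot_f: "(\<Sum>m\<in>keys P. lookup P m * lookup (q m f) m') = haar (\<lambda>g. a g * W m' g)" for m'
      unfolding tot[OF f] by (rule haar_cong) (simp add: P_def R P0 del: act.simps)
    have tot_e: "(\<Sum>m\<in>keys P. lookup P m * lookup (q m ?e) m') = 0" for m'
    proof -
      have "haar (\<lambda>g. mp_eval (lookup (act g ?e)) P * W m' g) = haar (\<lambda>_. 0)"
        by (rule haar_cong) (simp add: P_def R del: act.simps)
      then show ?thesis unfolding tot[OF e] by (simp add: haar_0)
    qed
    define q' where "q' m h = q m h + act exchange (q m (act exchange h))" for m h
    have qb: "q m ?e \<in> biforms 1 1" for m using q(1)[of m] e unfolding covariant_def by blast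
    have lq': "lookup (q' m f) m' = lookup (q m f) m' +
        (\<Sum>m''\<in>bimonoms 1 1. lookup (q m ?e) m'' * lookup (act exchange (Poly_Mapping.single m'' 1)) m')" for m m'
      unfolding q'_def lookup_add lookup_act_linear[OF qb[of m], of exchange m'] ..
    have "(\<Sum>m\<in>keys P. lookup P m * lookup (q' m f) m') = haar (\<lambda>g. a g * W m' g)" for m'
    proof -
      have "(\<Sum>m\<in>keys P. lookup P m * (\<Sum>m''\<in>bimonoms 1 1. lookup (q m ?e) m'' * lookup (act exchange (Poly_Mapping.single m'' 1)) m'))
        = (\<Sum>m''\<in>bimonoms 1 1. (\<Sum>m\<in>keys P. lookup P m * lookup (q m ?e) m'') * lookup (act exchange (Poly_Mapping.single m'' 1)) m')"
        unfolding sum_distrib_left sum_distrib_right by (subst sum.swap) (simp only: mult.assoc)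
      also have "\<dots> = 0" unfolding tot_e by simp
      finally show ?thesis unfolding lq' distrib_left sum.distrib tot_f by simp
    qed
    note tot' = this
    have sym: "(\<Sum>i\<in>UNIV. c i * lookup (q' m f) (mon11 i)) = 0" for m
      by (rule c[rule_format])
        (unfold q'_def, intro conjI covariant_symmetrize[OF q(1)])
    have "haar (\<lambda>g. a g * \<psi> g) = haar (\<lambda>g. \<Sum>i\<in>UNIV. c i * (a g * W (mon11 i) g))"
      by (rule haar_cong) (simp add: \<psi>_def sum_distrib_left mult.left_commute)
    also have "\<dots> = (\<Sum>i\<in>UNIV. c i * haar (\<lambda>g. a g * W (mon11 i) g))"
      by (intro haar_sum PF_mult OA_PF[OF f a] WPF)
    also have "\<dots> = (\<Sum>i\<in>UNIV. c i * (\<Sum>m\<in>keys P. lookup P m * lookup (q' m f) (mon11 i)))"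
      unfolding tot' ..
    also have "\<dots> = (\<Sum>m\<in>keys P. lookup P m * (\<Sum>i\<in>UNIV. c i * lookup (q' m f) (mon11 i)))"
      unfolding sum_distrib_left by (subst sum.swap) (simp only: mult.left_commute)
    also have "\<dots> = 0" unfolding sym by simp
    finally show ?thesis .
  qed
  obtain \<phi> where "fiber_ideal (OA f) \<phi>" "\<forall>g\<in>SL2s. 1 - \<psi> g = \<phi> g"
    using fiber_full[OF f triv \<psi>PF \<psi>1 \<psi>neg] by blast
  then show False by (intro fiber_not_orthogonal[OF \<psi>PF orth]) auto
qed

text \<open>No nonzero functional kills the values at \<open>f\<close> of all exchange-equivariant
  covariants, so they span the 4-dimensional space of (1,1)-forms; four of them form a
  basis.\<close>

theorem independent_covariants_exist:
  fixes f :: "(bivar, 'a::{alg_closed_field,field_char_0}) mpoly"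
  assumes f: "f \<in> biforms 3 3" and closed: "zariski_closed_in_biforms 3 3 (orbit SLxSL act f)" and triv: "GL_trivial f"
  shows "\<exists>q :: 4 \<Rightarrow> (bivar, 'a) mpoly \<Rightarrow> (bivar, 'a) mpoly.
    (\<forall>i. covariant 3 3 1 1 (q i) \<and> exchange_equivariant 3 (q i)) \<and> lin_indep_at f q"
proof -
  define QS :: "((bivar, 'a) mpoly \<Rightarrow> (bivar, 'a) mpoly) set"
    where "QS = {q. covariant 3 3 1 1 q \<and> exchange_equivariant 3 q}"
  define \<kappa> :: "((bivar, 'a) mpoly \<Rightarrow> (bivar, 'a) mpoly) \<Rightarrow> 'a^4" where "\<kappa> q = (\<chi> i. lookup (q f) (mon11 i))" for q
  have span: "vec.span (\<kappa> ` QS) = UNIV"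
  proof -
    have "x \<in> vec.span (\<kappa> ` QS)" for x :: "'a^4"
    proof (rule linear_combination_or_separated[of UNIV QS "\<lambda>i. x $ i" "\<lambda>q i. \<kappa> q $ i"])
      fix T k assume T: "finite T" "T \<subseteq> QS" and e: "\<And>i. i \<in> UNIV \<Longrightarrow> x $ i = (\<Sum>q\<in>T. k q * \<kappa> q $ i)"
      have "x = (\<Sum>q\<in>T. k q *s \<kappa> q)"
        by (simp add: vec_eq_iff e)
      moreover have "\<kappa> q \<in> \<kappa> ` QS" if "q \<in> T" for q using T(2) that by blast
      ultimately show ?thesis by (simp only: vec.span_sum vec.span_scale vec.span_base)
    next
      fix c assume c: "\<And>q. q \<in> QS \<Longrightarrow> (\<Sum>i\<in>UNIV. c i * \<kappa> q $ i) = 0" "(\<Sum>i\<in>UNIV. c i * x $ i) \<noteq> 0"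
      obtain i0 where i0: "c i0 \<noteq> 0"
      proof (rule ccontr)
        assume "\<not> thesis"
        then have "c i = 0" for i using that by blast
        then show False using c(2) by simp
      qed
      have cz: "\<forall>q. covariant 3 3 1 1 q \<and> exchange_equivariant 3 q \<longrightarrow> (\<Sum>i\<in>UNIV. c i * lookup (q f) (mon11 i)) = 0"
        using c(1) by (simp add: QS_def \<kappa>_def)
      have False by (rule covariants_separate[OF f closed triv cz i0])
      then show ?thesis ..
    qed simp
    then show ?thesis by blast
  qed
  obtain Bs where Bs: "Bs \<subseteq> \<kappa> ` QS" "vec.independent Bs" "\<kappa> ` QS \<subseteq> vec.span Bs" "card Bs = vec.dim (\<kappa> ` QS)"
    using vec.basis_exists[of "\<kappa> ` QS"] by blast
  have "card Bs = 4"
  proof -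
    have "vec.dim (\<kappa> ` QS) = vec.dim (UNIV :: ('a^4) set)"
      unfolding span[symmetric] by (rule vec.dim_span[symmetric])
    then show ?thesis using Bs(4) by (simp add: vec.dim_UNIV card_cart_basis)
  qed
  moreover have "finite Bs" using vec.finiteI_independent[OF Bs(2)] .
  ultimately have "\<exists>b. bij_betw b (UNIV :: 4 set) Bs"
    by (intro finite_same_card_bij) simp_all
  then obtain b :: "4 \<Rightarrow> 'a^4" where b: "bij_betw b UNIV Bs" by (rule exE)
  have "\<forall>i. \<exists>q. q \<in> QS \<and> \<kappa> q = b i"
  proof
    fix i
    have "b i \<in> \<kappa> ` QS" using bij_betwE[OF b] Bs(1) by (meson UNIV_I subsetD)
    then show "\<exists>q. q \<in> QS \<and> \<kappa> q = b i" by (elim imageE) (intro exI conjI, assumption, rule sym)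
  qed
  from choice[OF this] have "\<exists>q. \<forall>i. q i \<in> QS \<and> \<kappa> (q i) = b i" .
  then obtain q where qq: "\<forall>i. q i \<in> QS \<and> \<kappa> (q i) = b i" by (rule exE)
  have q: "q i \<in> QS" "\<kappa> (q i) = b i" for i using qq by simp_all
  have "lin_indep_at f q"
    unfolding lin_indep_at_def
  proof (intro allI impI)
    fix c and i :: 4 assume z: "(\<Sum>i\<in>UNIV. Const (c i) * q i f) = 0"
    have "(\<Sum>i\<in>UNIV. c i *s b i) = 0"
    proof (simp only: vec_eq_iff, intro allI)
      fix j
      have "(\<Sum>i\<in>UNIV. c i *s b i) $ j = (\<Sum>i\<in>UNIV. c i * lookup (q i f) (mon11 j))"
        by (simp add: q(2)[symmetric] \<kappa>_def)
      also have "\<dots> = lookup (\<Sum>i\<in>UNIV. Const (c i) * q i f) (mon11 j)"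
        by (simp add: lookup_sum lookup_Const_mult)
      finally show "(\<Sum>i\<in>UNIV. c i *s b i) $ j = 0 $ j" using z by simp
    qed
    moreover have "(\<Sum>i\<in>UNIV. c i *s b i) = (\<Sum>v\<in>Bs. c (inv_into UNIV b v) *s v)"
      using sum.reindex_bij_betw[OF b, of "\<lambda>v. c (inv_into UNIV b v) *s v"] bij_betw_imp_inj_on[OF b] by simp
    ultimately have "(\<Sum>v\<in>Bs. c (inv_into UNIV b v) *s v) = 0" by simp
    moreover have "b i \<in> Bs" using bij_betwE[OF b] by blast
    ultimately have "c (inv_into UNIV b (b i)) = 0"
      by (rule vec.independentD[OF Bs(2) \<open>finite Bs\<close> subset_refl])
    then show "c i = 0" using bij_betw_imp_inj_on[OF b] by simp
  qed
  moreover have "\<forall>i. covariant 3 3 1 1 (q i) \<and> exchange_equivariant 3 (q i)" using q(1) by (simp add: QS_def)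
  ultimately show ?thesis by (intro exI[of _ q] conjI)
qed

subsection \<open>Transvectants of complementary order\<close>

lemma lookup_mp_deriv:
  fixes F :: "('v, 'a::comm_ring_1) mpoly"
  shows "lookup (mp_deriv v F) n = of_nat (lookup n v + 1) * lookup F (n + Poly_Mapping.single v 1)"
proof -
  let ?n = "n + Poly_Mapping.single v 1"
  have t: "(of_nat (lookup m v) * lookup F m when m - Poly_Mapping.single v 1 = n) =
      (of_nat (lookup m v) * lookup F m when m = ?n)" for m
  proof (cases "lookup m v = 0")
    case False
    then have "m - Poly_Mapping.single v 1 = n \<longleftrightarrow> m = ?n"
      by (auto simp: poly_mapping_eq_iff fun_eq_iff lookup_add lookup_minus lookup_single when_def)
    then show ?thesis by simp
  qed (auto simp: when_def)
  have "lookup (mp_deriv v F) n = (\<Sum>m\<in>keys F. of_nat (lookup m v) * lookup F m when m = ?n)"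
    unfolding mp_deriv_def lookup_sum lookup_single t ..
  also have "\<dots> = of_nat (lookup ?n v) * lookup F ?n"
    by (simp add: when_def in_keys_iff)
  finally show ?thesis by (simp add: lookup_add)
qed

lemma lookup_mp_deriv_power:
  fixes F :: "('v, 'a::field_char_0) mpoly"
  shows "fact (lookup m v) * lookup ((mp_deriv v ^^ k) F) m
    = fact (lookup m v + k) * lookup F (m + Poly_Mapping.single v k)"
proof (induction k arbitrary: m)
  case (Suc k)
  let ?m = "m + Poly_Mapping.single v 1"
  have "fact (lookup m v) * lookup ((mp_deriv v ^^ Suc k) F) m
      = fact (lookup ?m v) * lookup ((mp_deriv v ^^ k) F) ?m"
    by (simp add: lookup_mp_deriv lookup_add algebra_simps)
  also have "\<dots> = fact (lookup ?m v + k) * lookup F (?m + Poly_Mapping.single v k)"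
    by (rule Suc.IH)
  also have "?m + Poly_Mapping.single v k = m + Poly_Mapping.single v (Suc k)"
    by (simp add: add.assoc flip: single_add)
  finally show ?case by (simp add: lookup_add)
qed simp

lemma lookup_mp_deriv_power_0:
  fixes F :: "('v, 'a::field_char_0) mpoly"
  assumes "lookup m v = 0"
  shows "lookup ((mp_deriv v ^^ k) F) m = fact k * lookup F (m + Poly_Mapping.single v k)"
  using lookup_mp_deriv_power[of m v k F] assms by simp

lemma lookup_bideriv_0:
  fixes F :: "(bivar, 'a::field_char_0) mpoly"
  shows "lookup (bideriv i j k l F) 0 = fact i * fact j * fact k * fact l * lookup F (mm i j k l)"
  unfolding bideriv_def mm_def
  by (simp add: lookup_mp_deriv_power_0 lookup_add lookup_single mult.assoc)

lemma mp_eval_const_term: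
  fixes F :: "('v, 'b::comm_ring_1) mpoly"
  shows "mp_eval (\<lambda>_. 0) F = lookup F 0"
proof -
  have z: "(\<Prod>v\<in>keys m. 0 ^ lookup m v) = (if m = 0 then 1 else (0::'b))" for m :: "'v \<Rightarrow>\<^sub>0 nat"
  proof (cases "m = 0")
    case False
    then obtain v where "v \<in> keys m" by fastforce
    then have "\<exists>v\<in>keys m. (0::'b) ^ lookup m v = 0" by (intro bexI[of _ v]) (simp_all add: in_keys_iff zero_power)
    then show ?thesis using False by (simp add: prod_zero)
  qed simp
  show ?thesis by (simp add: mp_eval_def z in_keys_iff if_distrib cong: if_cong)
qed

lemma mp_eval_of_nat [simp]: "mp_eval p (of_nat n) = of_nat n"
  by (induction n) auto

text \<open>Reading the constant term makes the pairing bilinear on all polynomials, whatever their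
  bidegrees.\<close>

definition tv_pair :: "nat \<Rightarrow> (bivar, 'a::comm_ring_1) mpoly \<Rightarrow> (bivar, 'a) mpoly \<Rightarrow> 'a" where
  "tv_pair l F G = lookup (transvectant l l F G) 0"

lemma tv_pair_eq:
  fixes F G :: "(bivar, 'a::field_char_0) mpoly"
  shows "tv_pair l F G = (\<Sum>i\<le>l. \<Sum>j\<le>l. (-1) ^ (i + j) * of_nat (l choose i) * of_nat (l choose j) *
    (fact i * fact (l - i) * fact j * fact (l - j)) ^ 2 *
    lookup F (mm i (l - i) j (l - j)) * lookup G (mm (l - i) i (l - j) j))"
proof -
  have "tv_pair l F G = mp_eval (\<lambda>_. 0) (transvectant l l F G)"
    unfolding tv_pair_def mp_eval_const_term ..
  then show ?thesis
    unfolding transvectant_def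
    apply (simp add: atLeast0AtMost)
    by (simp add: mp_eval_const_term lookup_bideriv_0 power2_eq_square mult_ac)
qed

lemma tv_pair_add:
  fixes F F' G :: "(bivar, 'a::field_char_0) mpoly"
  shows "tv_pair l (F + F') G = tv_pair l F G + tv_pair l F' G"
  unfolding tv_pair_eq by (simp add: lookup_add distrib_left distrib_right sum.distrib)

lemma tv_pair_scale:
  fixes F G :: "(bivar, 'a::field_char_0) mpoly"
  shows "tv_pair l (Const c * F) G = c * tv_pair l F G"
  unfolding tv_pair_eq lookup_Const_mult sum_distrib_left by (simp only: mult_ac)

lemma tv_pair_0:
  fixes G :: "(bivar, 'a::field_char_0) mpoly"
  shows "tv_pair l 0 G = 0"
  unfolding tv_pair_eq by simp

lemma tv_pair_sum:
  fixes G :: "(bivar, 'a::field_char_0) mpoly"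
  shows "tv_pair l (sum F I) G = (\<Sum>i\<in>I. tv_pair l (F i) G)"
  by (induction I rule: infinite_finite_induct) (simp_all add: tv_pair_0 tv_pair_add)

text \<open>Multiplying by the binomials cancels all factorials into \<open>fact l ^ 4\<close>,
  since \<open>l choose i\<close> times \<open>i! (l - i)!\<close> is \<open>l!\<close>.\<close>

lemma tv_pair_monom:
  fixes G :: "(bivar, 'a::field_char_0) mpoly"
  assumes "i \<le> l" "j \<le> l"
  shows "tv_pair l (Poly_Mapping.single (mm i (l - i) j (l - j)) 1) G * (of_nat (l choose i) * of_nat (l choose j))
    = fact l ^ 4 * ((-1) ^ (i + j) * lookup G (mm (l - i) i (l - j) j))"
proof -
  have "tv_pair l (Poly_Mapping.single (mm i (l - i) j (l - j)) 1) G =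
    (\<Sum>i'\<le>l. if i' = i then \<Sum>j'\<le>l. if j' = j then (-1) ^ (i' + j') * of_nat (l choose i') * of_nat (l choose j') *
      (fact i' * fact (l - i') * fact j' * fact (l - j')) ^ 2 * lookup G (mm (l - i') i' (l - j') j') else 0 else 0)"
  proof -
    have "lookup (Poly_Mapping.single (mm i (l - i) j (l - j)) 1) (mm i' (l - i') j' (l - j')) =
        (if i' = i then if j' = j then 1 else 0 else (0 :: 'a))" for i' j'
      by (auto simp: lookup_single when_def mm_eq_iff)
    then have "(-1) ^ (i' + j') * of_nat (l choose i') * of_nat (l choose j') * (fact i' * fact (l - i') * fact j' * fact (l - j')) ^ 2 *
        lookup (Poly_Mapping.single (mm i (l - i) j (l - j)) 1) (mm i' (l - i') j' (l - j')) * lookup G (mm (l - i') i' (l - j') j') =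
        (if i' = i then if j' = j then (-1) ^ (i' + j') * of_nat (l choose i') * of_nat (l choose j') * (fact i' * fact (l - i') * fact j' * fact (l - j')) ^ 2 * lookup G (mm (l - i') i' (l - j') j') else 0 else 0)" for i' j' by simp
    note t = this
    show ?thesis
      unfolding tv_pair_eq t
    proof (intro sum.cong refl)
      fix i' assume "i' \<in> {..l}"
      show "(\<Sum>j'\<le>l. if i' = i then if j' = j then (-1) ^ (i' + j') * of_nat (l choose i') * of_nat (l choose j') * (fact i' * fact (l - i') * fact j' * fact (l - j')) ^ 2 * lookup G (mm (l - i') i' (l - j') j') else 0 else 0) =
        (if i' = i then \<Sum>j'\<le>l. if j' = j then (-1) ^ (i' + j') * of_nat (l choose i') * of_nat (l choose j') * (fact i' * fact (l - i') * fact j' * fact (l - j')) ^ 2 * lookup G (mm (l - i') i' (l - j') j') else 0 else 0)"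
        by (cases "i' = i") (simp_all del: sum.delta)
    qed
  qed
  also have "\<dots> = (-1) ^ (i + j) * of_nat (l choose i) * of_nat (l choose j) *
      (fact i * fact (l - i) * fact j * fact (l - j)) ^ 2 * lookup G (mm (l - i) i (l - j) j)"
    using assms by simp
  finally have e: "tv_pair l (Poly_Mapping.single (mm i (l - i) j (l - j)) 1) G * (of_nat (l choose i) * of_nat (l choose j)) =
      (of_nat (l choose i) * (fact i * fact (l - i))) ^ 2 * (of_nat (l choose j) * (fact j * fact (l - j))) ^ 2
      * ((-1) ^ (i + j) * lookup G (mm (l - i) i (l - j) j))"
    by (simp add: power2_eq_square mult_ac)
  have b: "of_nat (l choose k) * (fact k * fact (l - k)) = (fact l :: 'a)" if "k \<le> l" for k
  proof -
    have "of_nat (fact k * fact (l - k) * (l choose k)) = (of_nat (fact l) :: 'a)"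
      using binomial_fact_lemma[OF that] by simp
    then show ?thesis by (simp add: mult_ac)
  qed
  have "(fact l ^ 2 * fact l ^ 2 :: 'a) = fact l ^ 4" by (simp flip: power_add)
  then show ?thesis unfolding e b[OF assms(1)] b[OF assms(2)] by simp
qed

definition powform :: "nat \<Rightarrow> (bivar \<Rightarrow> 'a::comm_ring_1) \<Rightarrow> (bivar, 'a) mpoly" where
  "powform l p = (Const (p vx) * Var vx + Const (p vy) * Var vy) ^ l * (Const (p vu) * Var vu + Const (p vv) * Var vv) ^ l"

text \<open>The common zero of the linear forms with coefficients \<open>p\<close>. Pairing with
  \<open>powform l p\<close> amounts to evaluation at this point.\<close>

definition perp :: "(bivar \<Rightarrow> 'a::comm_ring_1) \<Rightarrow> bivar \<Rightarrow> 'a" where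
  "perp p v = (case v of vx \<Rightarrow> p vy | vy \<Rightarrow> - p vx | vu \<Rightarrow> p vv | vv \<Rightarrow> - p vu)"

lemma perp_simps [simp]: "perp p vx = p vy" "perp p vy = - p vx" "perp p vu = p vv" "perp p vv = - p vu"
  by (simp_all add: perp_def)

lemma powform_expand: "powform l p = (\<Sum>i\<le>l. \<Sum>j\<le>l.
    Const (of_nat (l choose i) * of_nat (l choose j) * (p vx ^ i * p vy ^ (l - i) * (p vu ^ j * p vv ^ (l - j)))) *
    Poly_Mapping.single (mm i (l - i) j (l - j)) 1)"
proof -
  have nat: "of_nat n = (Const (of_nat n) :: (bivar, 'a) mpoly)" for n
    by (induction n) (simp_all add: Const_add)
  have mono: "Poly_Mapping.single (mm i j k m) 1 = (Var vx ^ i * Var vy ^ j * Var vu ^ k * Var vv ^ m :: (bivar, 'a) mpoly)" for i j k m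
    by (simp add: Var_power mm_def mult_single)
  show ?thesis
    unfolding powform_def binomial_ring sum_product nat mono
    by (intro sum.cong refl) (simp add: Const_mult Const_power power_mult_distrib mult_ac)
qed

lemma functional_zero_on_monomials:
  fixes l :: nat
  assumes "\<And>i j. i \<le> l \<Longrightarrow> j \<le> l \<Longrightarrow> Lf (Poly_Mapping.single (mm i (l - i) j (l - j)) 1) = 0"
    and add: "\<And>F G. Lf (F + G) = Lf F + Lf G" and scale: "\<And>c F. Lf (Const c * F) = c * Lf F"
    and F: "F \<in> biforms l l"
  shows "Lf F = (0 :: 'a::field_char_0)"
proof -
  have 0: "Lf 0 = 0" using scale[of 0 0] by simp
  have sum: "Lf (sum f I) = (\<Sum>i\<in>I. Lf (f i))" for f :: "'i \<Rightarrow> _" and I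
    by (induction I rule: infinite_finite_induct) (simp_all add: 0 add)
  have "Lf (Poly_Mapping.single m 1) = 0" if m: "m \<in> bimonoms l l" for m
  proof -
    have "m = mm (lookup m vx) (l - lookup m vx) (lookup m vu) (l - lookup m vu)"
      using m by (intro bimonom_eqI) (auto simp: bimonoms_iff)
    moreover have "lookup m vx \<le> l" "lookup m vu \<le> l" using m by (auto simp: bimonoms_iff)
    ultimately show ?thesis using assms(1) by metis
  qed
  then show ?thesis by (subst biforms_expand[OF F]) (simp add: sum scale)
qed

text \<open>Products of powers of linear forms span bidegree \<open>(l, l)\<close> in characteristic
  zero: with \<open>vy\<close> and \<open>vv\<close> set to 1, the other two parameters separate the
  monomials, whose binomial factors are nonzero.\<close>

lemma functional_zero_on_powforms:
  fixes Lf :: "(bivar, 'a::field_char_0) mpoly \<Rightarrow> 'a"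
  assumes z: "\<And>p. Lf (powform l p) = 0"
    and add: "\<And>F G. Lf (F + G) = Lf F + Lf G" and scale: "\<And>c F. Lf (Const c * F) = c * Lf F"
    and F: "F \<in> biforms l l"
  shows "Lf F = 0"
proof (rule functional_zero_on_monomials[OF _ add scale F])
  fix i j assume ij: "i \<le> l" "j \<le> l"
  have 0: "Lf 0 = 0" using scale[of 0 0] by simp
  have sum: "Lf (sum f I) = (\<Sum>i\<in>I. Lf (f i))" for f :: "nat \<Rightarrow> _" and I
    by (induction I rule: infinite_finite_induct) (simp_all add: 0 add)
  let ?e = "\<lambda>i j. of_nat (l choose i) * of_nat (l choose j) * Lf (Poly_Mapping.single (mm i (l - i) j (l - j)) 1)"
  have "?e i j = 0"
  proof (rule bisum_zero_imp[where e = ?e and n = l and m = l, OF _ ij])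
    fix y v
    have "Lf (powform l (\<lambda>w. case w of vx \<Rightarrow> y | vy \<Rightarrow> 1 | vu \<Rightarrow> v | vv \<Rightarrow> 1)) = 0" by (rule z)
    then show "(\<Sum>i\<le>l. \<Sum>j\<le>l. ?e i j * (y ^ i * v ^ j)) = 0"
      unfolding powform_expand sum scale by (simp add: mult_ac)
  qed
  then show "Lf (Poly_Mapping.single (mm i (l - i) j (l - j)) 1) = 0" using ij by simp
qed

lemma tv_pair_powform:
  fixes G :: "(bivar, 'a::field_char_0) mpoly"
  assumes G: "G \<in> biforms l l"
  shows "tv_pair l (powform l p) G = fact l ^ 4 * mp_eval (perp p) G"
proof -
  have "tv_pair l (powform l p) G = (\<Sum>i\<le>l. \<Sum>j\<le>l. (p vx ^ i * p vy ^ (l - i) * (p vu ^ j * p vv ^ (l - j))) *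
     (tv_pair l (Poly_Mapping.single (mm i (l - i) j (l - j)) 1) G * (of_nat (l choose i) * of_nat (l choose j))))"
    unfolding powform_expand tv_pair_sum tv_pair_scale by (simp only: mult_ac)
  also have "\<dots> = (\<Sum>i\<le>l. \<Sum>j\<le>l. (p vx ^ i * p vy ^ (l - i) * (p vu ^ j * p vv ^ (l - j))) *
     (fact l ^ 4 * ((-1) ^ (i + j) * lookup G (mm (l - i) i (l - j) j))))"
    by (intro sum.cong refl) (simp only: tv_pair_monom atMost_iff)
  also have "\<dots> = fact l ^ 4 * bival l l (cf l l G) (perp p)"
    unfolding bival_def sum_distrib_left
    by (intro sum.cong refl) (simp add: cf_def power_minus[of "p vx"] power_minus[of "p vu"] power_add mult_ac)
  finally show ?thesis unfolding mp_eval_biforms[OF G] .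
qed

lemma mp_eval_powform: "mp_eval z (powform l p) = (p vx * z vx + p vy * z vy) ^ l * (p vu * z vu + p vv * z vv) ^ l"
  by (simp add: powform_def)

section \<open>Invariance of the transvectant pairing\<close>

definition tv_preserving :: "'a::field bigroup_elem \<Rightarrow> bool" where
  "tv_preserving g \<longleftrightarrow> (\<forall>l. \<forall>F\<in>biforms l l. \<forall>G\<in>biforms l l. tv_pair l (act g F) (act g G) = tv_pair l F G)"

text \<open>By linearity \<open>F\<close> may be a power form; then both sides are values of
  \<open>G\<close> at points, to be matched by \<open>\<rho>\<close>.\<close>

lemma tv_preservingI:
  fixes g :: "'a::field_char_0 bigroup_elem"
  assumes "\<And>l p. act g (powform l p) = powform l (\<rho> p)"
    and "\<And>G p. mp_eval (perp (\<rho> p)) (act g G) = mp_eval (perp p) G"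
    and g: "\<And>l G. G \<in> biforms l l \<Longrightarrow> act g G \<in> biforms l l"
  shows "tv_preserving g"
  unfolding tv_preserving_def
proof (intro allI ballI)
  fix l and F G :: "(bivar, 'a) mpoly" assume F: "F \<in> biforms l l" and G: "G \<in> biforms l l"
  have "tv_pair l (act g F) (act g G) - tv_pair l F G = 0"
  proof (rule functional_zero_on_powforms[where Lf = "\<lambda>F. tv_pair l (act g F) (act g G) - tv_pair l F G", OF _ _ _ F])
    show "tv_pair l (act g (powform l p)) (act g G) - tv_pair l (powform l p) G = 0" for p
      unfolding assms(1) tv_pair_powform[OF G] tv_pair_powform[OF g[OF G]] assms(2) by simp
  qed (simp_all add: act_add act_Const_mult tv_pair_add tv_pair_scale right_diff_distrib del: act.simps)
  then show "tv_pair l (act g F) (act g G) = tv_pair l F G" by simp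
qed

lemma tv_preserving_SL:
  fixes g :: "'a::field_char_0 bigroup_elem"
  assumes "g \<in> SL2s"
  shows "tv_preserving g"
proof -
  obtain A B where g: "g = (A, B, False)" "det A = 1" "det B = 1" using assms by (rule SL2sE)
  \<comment> \<open>Coefficient vectors of linear forms transform contragrediently to
    points.\<close>
  define \<rho> :: "(bivar \<Rightarrow> 'a) \<Rightarrow> bivar \<Rightarrow> 'a" where "\<rho> p = lin (transpose (adj2 A)) (transpose (adj2 B)) p" for p
  have d: "A$1$1 * A$2$2 = 1 + A$1$2 * A$2$1" "B$1$1 * B$2$2 = 1 + B$1$2 * B$2$1"
    using g by (simp_all add: det_2 algebra_simps)
  show ?thesis
  proof (rule tv_preservingI[where \<rho> = \<rho>])
    show "act g (powform l p) = powform l (\<rho> p)" for l p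
      by (rule mp_eval_inject)
        (simp add: g mp_eval_act matrix_inv_det1 mp_eval_powform \<rho>_def transpose_def algebra_simps del: act.simps)
    show "mp_eval (perp (\<rho> p)) (act g G) = mp_eval (perp p) G" for G p
    proof -
      have "lin (adj2 A) (adj2 B) (perp (\<rho> p)) = perp p"
        apply (rule fun_bivar_eqI)
        using d by (simp_all add: \<rho>_def transpose_def adj2_def, algebra+)
      then show ?thesis using g by (simp add: mp_eval_act matrix_inv_det1 del: act.simps)
    qed
  qed (rule act_SL_biforms[OF assms])
qed

lemma tv_preserving_exchange: "tv_preserving (exchange :: 'a::field_char_0 bigroup_elem)"
proof (rule tv_preservingI[where \<rho> = swp])
  have 1: "mp_eval p (act exchange F) = mp_eval (swp p) F" for p and F :: "(bivar, 'a) mpoly"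
    unfolding exchange_def mp_eval_act by (simp add: matrix_inv_1 lin_1)
  show "act exchange (powform l p) = powform l (swp p)" for l and p :: "bivar \<Rightarrow> 'a"
    by (rule mp_eval_inject) (simp add: 1 mp_eval_powform mult.commute del: act.simps)
  show "mp_eval (perp (swp p)) (act exchange G) = mp_eval (perp p) G" for G and p :: "bivar \<Rightarrow> 'a"
  proof -
    have "swp (perp (swp p)) = perp p" by (rule fun_bivar_eqI) simp_all
    then show ?thesis by (simp add: 1 del: act.simps)
  qed
qed (rule exchange_biforms)

lemma act_mult: "act g (F * G) = act g F * act g (G :: (bivar, 'a::field) mpoly)"
  by (cases g) simp

lemma tv_preservingD:
  "tv_preserving g \<Longrightarrow> F \<in> biforms l l \<Longrightarrow> G \<in> biforms l l \<Longrightarrow> tv_pair l (act g F) (act g G) = tv_pair l F G"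
  unfolding tv_preserving_def by blast

lemma biforms_mult:
  fixes F G :: "(bivar, 'a::comm_ring_1) mpoly"
  assumes "F \<in> biforms a b" "G \<in> biforms c d"
  shows "F * G \<in> biforms (a + c) (b + d)"
  unfolding biforms_iff
proof
  fix m assume "m \<in> keys (F * G)"
  then obtain k l where "k \<in> keys F" "l \<in> keys G" "m = k + l" using Poly_Mapping.keys_mult[of F G] by blast
  moreover from this have "k \<in> bimonoms a b" "l \<in> bimonoms c d" using assms unfolding biforms_iff by blast+
  ultimately show "m \<in> bimonoms (a + c) (b + d)" by (simp add: bimonoms_iff lookup_add)
qed

section \<open>The coefficients of both forms as invariants\<close>

lemma Q_form_eq: "Q_form q f = (\<Sum>i\<in>UNIV. \<Sum>j\<in>UNIV. Const (tv_pair 1 (q i f) (q j f)) * Var i * Var j)"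
  unfolding Q_form_def tv_pair_def ..

lemma E_form_eq: "E_form q f = (\<Sum>i\<in>UNIV. \<Sum>j\<in>UNIV. \<Sum>l\<in>UNIV.
    Const (tv_pair 3 (q i f * q j f * q l f) f) * Var i * Var j * Var l)"
  unfolding E_form_def tv_pair_def ..

lemma triple_biforms:
  fixes F G H :: "(bivar, 'a::comm_ring_1) mpoly"
  assumes "F \<in> biforms 1 1" "G \<in> biforms 1 1" "H \<in> biforms 1 1"
  shows "F * G * H \<in> biforms 3 3"
  using biforms_mult[OF biforms_mult[OF assms(1,2)] assms(3)] by (simp add: numeral_3_eq_3)

lemma forms_act_invariant:
  fixes q :: "4 \<Rightarrow> (bivar, 'a::field_char_0) mpoly \<Rightarrow> (bivar, 'a) mpoly"
  assumes g: "tv_preserving g" and q: "\<And>i. q i h \<in> biforms 1 1" "\<And>i. q i (act g h) = act g (q i h)" and h: "h \<in> biforms 3 3"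
  shows "Q_form q (act g h) = Q_form q h" "E_form q (act g h) = E_form q h"
  unfolding Q_form_eq E_form_eq q(2) act_mult[symmetric]
    tv_preservingD[OF g q(1) q(1)] tv_preservingD[OF g triple_biforms[OF q(1) q(1) q(1)] h] by (rule refl)+

lemma hom_poly_tv_pair:
  fixes F G :: "(bivar, 'a::field_char_0) mpoly \<Rightarrow> (bivar, 'a) mpoly"
  assumes "\<And>m. hom_poly_fun a b d (\<lambda>h. lookup (F h) m)" "\<And>m. hom_poly_fun a b e (\<lambda>h. lookup (G h) m)"
  shows "hom_poly_fun a b (d + e) (\<lambda>h. tv_pair l (F h) (G h))"
  unfolding tv_pair_eq mult.assoc
  by (intro hom_poly_sum hom_poly_scale hom_poly_mult assms)

lemma hom_poly_cong:
  assumes "\<And>h. h \<in> biforms a b \<Longrightarrow> I h = J h" "hom_poly_fun a b d J"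
  shows "hom_poly_fun a b d I"
  using assms unfolding hom_poly_fun_def by simp

lemma hom_poly_if: "(P \<Longrightarrow> hom_poly_fun a b d I) \<Longrightarrow> hom_poly_fun a b d (\<lambda>h. if P then I h else 0)"
  by (cases P) (simp_all add: hom_poly_0)

lemma hom_poly_lookup_mult:
  fixes F G :: "(bivar, 'a::field_char_0) mpoly \<Rightarrow> (bivar, 'a) mpoly"
  assumes F: "\<And>m. hom_poly_fun a b d (\<lambda>h. lookup (F h) m)" "\<And>h. h \<in> biforms a b \<Longrightarrow> F h \<in> biforms r s"
    and G: "\<And>m. hom_poly_fun a b e (\<lambda>h. lookup (G h) m)" "\<And>h. h \<in> biforms a b \<Longrightarrow> G h \<in> biforms r' s'"
  shows "hom_poly_fun a b (d + e) (\<lambda>h. lookup (F h * G h) m)"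
proof (rule hom_poly_cong)
  fix h :: "(bivar, 'a) mpoly" assume h: "h \<in> biforms a b"
  show "lookup (F h * G h) m = (\<Sum>k\<in>bimonoms r s. \<Sum>l\<in>bimonoms r' s'. if k + l = m then lookup (F h) k * lookup (G h) l else 0)"
    using F(2)[OF h] G(2)[OF h] unfolding biforms_iff by (intro lookup_mult_finite finite_bimonoms)
qed (intro hom_poly_sum hom_poly_if hom_poly_mult F(1) G(1))

lemma lookup_Const_monom:
  "lookup (Const c * Var i * Var j) m = (if Poly_Mapping.single i 1 + Poly_Mapping.single j 1 = m then c else (0::'a::comm_ring_1))"
  "lookup (Const c * Var i * Var j * Var l) m =
    (if Poly_Mapping.single i 1 + Poly_Mapping.single j 1 + Poly_Mapping.single l 1 = m then c else (0::'a::comm_ring_1))"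
  by (simp_all add: Const_def Var_def mult_single lookup_single when_def)

lemma forms_hom_poly:
  fixes q :: "4 \<Rightarrow> (bivar, 'a::field_char_0) mpoly \<Rightarrow> (bivar, 'a) mpoly"
  assumes q: "\<And>i. covariant 3 3 1 1 (q i)"
  shows "\<exists>d. hom_poly_fun 3 3 d (\<lambda>h. lookup (Q_form q h) m)" "\<exists>d. hom_poly_fun 3 3 d (\<lambda>h. lookup (E_form q h) m)"
proof -
  have "\<forall>i. \<exists>d. \<forall>m. hom_poly_fun 3 3 d (\<lambda>h. lookup (q i h) m)" using q unfolding covariant_def by blast
  from choice[OF this] obtain d where d: "\<And>i m. hom_poly_fun 3 3 (d i) (\<lambda>h. lookup (q i h) m)" by blast
  have qb: "q i h \<in> biforms 1 1" if "h \<in> biforms 3 3" for i h using q[of i] that unfolding covariant_def by blast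
  \<comment> \<open>The covariants may have different degrees, so the degree of a coefficient
    depends on its monomial; \<open>E\<close> has one more because of the factor
    \<open>f\<close>.\<close>
  define D where "D m = (\<Sum>i\<in>UNIV. d i * lookup m i)" for m :: "4 \<Rightarrow>\<^sub>0 nat"
  have D_add: "D (m + n) = D m + D n" for m n by (simp add: D_def lookup_add distrib_left sum.distrib)
  have D_single: "D (Poly_Mapping.single i 1) = d i" for i
    by (simp add: D_def lookup_single when_def if_distrib cong: if_cong)
  have "hom_poly_fun 3 3 (D m) (\<lambda>h. lookup (Q_form q h) m)"
    unfolding Q_form_eq lookup_sum lookup_Const_monom
  proof (intro hom_poly_sum hom_poly_if)
    fix i j :: 4 assume "Poly_Mapping.single i 1 + Poly_Mapping.single j 1 = m"
    then have "D m = d i + d j" using D_add D_single by metis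
    then show "hom_poly_fun 3 3 (D m) (\<lambda>h. tv_pair 1 (q i h) (q j h))" by (simp only: hom_poly_tv_pair[OF d d])
  qed
  then show "\<exists>d. hom_poly_fun 3 3 d (\<lambda>h. lookup (Q_form q h) m)" ..
  have "hom_poly_fun 3 3 (D m + 1) (\<lambda>h. lookup (E_form q h) m)"
    unfolding E_form_eq lookup_sum lookup_Const_monom
  proof (intro hom_poly_sum hom_poly_if)
    fix i j l :: 4 assume "Poly_Mapping.single i 1 + Poly_Mapping.single j 1 + Poly_Mapping.single l 1 = m"
    then have e: "D m = d i + d j + d l" using D_add D_single by metis
    show "hom_poly_fun 3 3 (D m + 1) (\<lambda>h. tv_pair 3 (q i h * q j h * q l h) h)"
      unfolding e by (intro hom_poly_tv_pair hom_poly_coord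
          hom_poly_lookup_mult[OF hom_poly_lookup_mult[OF d qb d qb] biforms_mult[OF qb qb] d qb])
  qed
  then show "\<exists>d. hom_poly_fun 3 3 d (\<lambda>h. lookup (E_form q h) m)" ..
qed

lemma forms_SL_invariant:
  fixes q :: "4 \<Rightarrow> (bivar, 'a::field_char_0) mpoly \<Rightarrow> (bivar, 'a) mpoly"
  assumes q: "\<And>i. covariant 3 3 1 1 (q i)"
  shows "\<exists>d. hom_invariant SLxSL 3 3 d (\<lambda>h. lookup (Q_form q h) m)" (is ?Q)
    and "\<exists>d. hom_invariant SLxSL 3 3 d (\<lambda>h. lookup (E_form q h) m)" (is ?E)
    and "\<lbrakk>\<And>i. exchange_equivariant 3 (q i)\<rbrakk> \<Longrightarrow> \<exists>d. hom_invariant SLxSL_Z2 3 3 d (\<lambda>h. lookup (Q_form q h) m)"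
    and "\<lbrakk>\<And>i. exchange_equivariant 3 (q i)\<rbrakk> \<Longrightarrow> \<exists>d. hom_invariant SLxSL_Z2 3 3 d (\<lambda>h. lookup (E_form q h) m)"
proof -
  have qb: "q i h \<in> biforms 1 1" if "h \<in> biforms 3 3" for i h using q[of i] that unfolding covariant_def by blast
  have qe: "q i (act g h) = act g (q i h)" if "g \<in> carrier SLxSL" "h \<in> biforms 3 3" for i g h
    using q[of i] that unfolding covariant_def by blast
  have inv: "Q_form q (act g h) = Q_form q h" "E_form q (act g h) = E_form q h"
    if g: "g \<in> carrier SLxSL" and h: "h \<in> biforms 3 3" for g h
    using forms_act_invariant[OF tv_preserving_SL[OF g] qb[OF h] qe[OF g h] h] .
  have hp: "\<exists>d. hom_poly_fun 3 3 d (\<lambda>h. lookup (Q_form q h) m)" "\<exists>d. hom_poly_fun 3 3 d (\<lambda>h. lookup (E_form q h) m)"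
    by (rule forms_hom_poly, rule q)+
  show ?Q ?E using hp inv unfolding hom_invariant_def by (simp_all del: act.simps)
  assume "\<And>i. exchange_equivariant 3 (q i)"
  then have qx: "q i (act exchange h) = act exchange (q i h)" if "h \<in> biforms 3 3" for i h
    using that unfolding exchange_equivariant_def by blast
  have invx: "Q_form q (act exchange h) = Q_form q h" "E_form q (act exchange h) = E_form q h"
    if h: "h \<in> biforms 3 3" for h
    using forms_act_invariant[OF tv_preserving_exchange qb[OF h] qx[OF h] h] .
  have invz: "Q_form q (act g h) = Q_form q h \<and> E_form q (act g h) = E_form q h"
    if g: "g \<in> carrier SLxSL_Z2" and h: "h \<in> biforms 3 3" for g h
  proof -
    obtain A B s where g': "g = (A, B, s)" by (cases g)
    have AB: "(A, B, False) \<in> carrier SLxSL" using g unfolding g' by (simp add: SLxSL_Z2_def SLxSL_def)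
    show ?thesis
    proof (cases s)
      case True
      then have "act g h = act (A, B, False) (act exchange h)" unfolding g' by (simp only: act_exchange_eq)
      then show ?thesis using inv[OF AB exchange_biforms[OF h]] invx[OF h] by (simp only:)
    next
      case False
      then show ?thesis using inv[OF AB h] unfolding g' by (simp only:)
    qed
  qed
  show "\<exists>d. hom_invariant SLxSL_Z2 3 3 d (\<lambda>h. lookup (Q_form q h) m)" "\<exists>d. hom_invariant SLxSL_Z2 3 3 d (\<lambda>h. lookup (E_form q h) m)"
    using hp invz unfolding hom_invariant_def by (simp_all del: act.simps)
qed

subsection \<open>The isomorphism of curves\<close>

lemma tv_pair_add_right:
  fixes F G G' :: "(bivar, 'a::field_char_0) mpoly"
  shows "tv_pair l F (G + G') = tv_pair l F G + tv_pair l F G'"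
  unfolding tv_pair_eq by (simp add: lookup_add distrib_left distrib_right sum.distrib)

lemma tv_pair_scale_right:
  fixes F G :: "(bivar, 'a::field_char_0) mpoly"
  shows "tv_pair l F (Const c * G) = c * tv_pair l F G"
  unfolding tv_pair_eq lookup_Const_mult sum_distrib_left by (simp only: mult_ac)

lemma tv_pair_sum_right:
  fixes F :: "(bivar, 'a::field_char_0) mpoly"
  shows "tv_pair l F (sum G I) = (\<Sum>i\<in>I. tv_pair l F (G i))"
proof -
  have "tv_pair l F 0 = 0" unfolding tv_pair_eq by simp
  then show ?thesis by (induction I rule: infinite_finite_induct) (simp_all add: tv_pair_add_right)
qed

lemma mp_eval_Q_form:
  fixes q :: "4 \<Rightarrow> (bivar, 'a::field_char_0) mpoly \<Rightarrow> (bivar, 'a) mpoly"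
  shows "mp_eval X (Q_form q f) = tv_pair 1 (\<Sum>i\<in>UNIV. Const (X i) * q i f) (\<Sum>i\<in>UNIV. Const (X i) * q i f)"
  unfolding tv_pair_sum tv_pair_scale
  unfolding tv_pair_sum_right tv_pair_scale_right Q_form_eq
  by (simp add: sum_distrib_left mult_ac)

lemma cube_sum: "(\<Sum>i\<in>S. a i) ^ 3 = (\<Sum>i\<in>S. \<Sum>j\<in>S. \<Sum>l\<in>S. a i * a j * (a l :: 'b::comm_ring_1))"
  unfolding power3_eq_cube sum_product[of a S a S] sum_distrib_right sum_distrib_left
  by (simp only: mult_ac)

lemma mp_eval_E_form:
  fixes q :: "4 \<Rightarrow> (bivar, 'a::field_char_0) mpoly \<Rightarrow> (bivar, 'a) mpoly"
  shows "mp_eval X (E_form q f) = tv_pair 3 ((\<Sum>i\<in>UNIV. Const (X i) * q i f) ^ 3) f"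
proof -
  have e: "Const (X i) * q i f * (Const (X j) * q j f) * (Const (X l) * q l f)
      = Const (X i * X j * X l) * (q i f * q j f * q l f)" for i j l
    by (simp add: Const_mult mult_ac)
  show ?thesis
    unfolding cube_sum e tv_pair_sum tv_pair_scale E_form_eq by (simp add: mult_ac)
qed

section \<open>Rank one matrices and the universal cubic\<close>

definition b11 :: "4 \<Rightarrow> (bivar, 'a::comm_ring_1) mpoly" where
  "b11 k = Poly_Mapping.single (mon11 k) 1"

lemma mp_eval_b11: "mp_eval z (b11 1) = z vx * z vu" "mp_eval z (b11 2) = z vx * z vv"
    "mp_eval z (b11 3) = z vy * z vu" "mp_eval z (b11 4) = z vy * z vv"
  by (simp_all add: b11_def mp_eval_single prod_bivar mon11_simps)

lemma lookup_b11: "lookup (\<Sum>k\<in>UNIV. Const (c k) * b11 k) (mon11 k) = (c k :: 'a::comm_ring_1)"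
proof -
  have "lookup (\<Sum>k\<in>UNIV. Const (c k) * b11 k) (mon11 k) = (\<Sum>k'\<in>UNIV. if k' = k then c k' else 0)"
    unfolding lookup_sum lookup_Const_mult b11_def
    by (intro sum.cong refl) (auto simp: lookup_single when_def inj_eq[OF inj_mon11])
  then show ?thesis by simp
qed

lemma biforms_11_expand:
  fixes F :: "(bivar, 'a::comm_ring_1) mpoly"
  assumes "F \<in> biforms 1 1"
  shows "F = (\<Sum>k\<in>UNIV. Const (lookup F (mon11 k)) * b11 k)"
  by (subst biforms_expand[OF assms]) (simp only: bimonoms_11 sum.reindex[OF inj_mon11] o_def b11_def)

text \<open>The Segre map: the entries of column times row, in the order of
  \<open>mon11\<close>.\<close>

definition rk1 :: "(bivar \<Rightarrow> 'b::comm_ring_1) \<Rightarrow> 4 \<Rightarrow> 'b" where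
  "rk1 p k = (if k = 1 then p vx * p vu else if k = 2 then p vx * p vv else if k = 3 then p vy * p vu else p vy * p vv)"

lemma rk1_simps [simp]: "rk1 p 1 = p vx * p vu" "rk1 p 2 = p vx * p vv" "rk1 p 3 = p vy * p vu" "rk1 p 4 = p vy * p vv"
  by (simp_all add: rk1_def)

lemma mp_eval_rk1: "mp_eval z (rk1 P k) = rk1 (\<lambda>v. mp_eval z (P v)) k"
  by (simp add: rk1_def)

lemma mp_subst_rk1: "mp_subst z (rk1 P k) = rk1 (\<lambda>v. mp_subst z (P v)) k"
  by (simp add: rk1_def)

lemma mp_eval_perp: "mp_eval z (perp P v) = perp (\<lambda>v. mp_eval z (P v)) v"
  by (cases v) simp_all

lemma mp_subst_perp: "mp_subst z (perp P v) = perp (\<lambda>v. mp_subst z (P v)) v"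
  by (cases v) simp_all

text \<open>The cubic for the monomial basis, a form on all 2 x 2 matrices. \<open>E\<close> arises
  from it by a linear change of coordinates.\<close>

definition E11 :: "(bivar, 'a::field_char_0) mpoly \<Rightarrow> (4, 'a) mpoly" where
  "E11 f = E_form (\<lambda>k _. b11 k) f"

lemma mp_eval_E11: "mp_eval c (E11 f) = tv_pair 3 ((\<Sum>k\<in>UNIV. Const (c k) * b11 k) ^ 3) f"
  unfolding E11_def mp_eval_E_form ..

text \<open>A rank one matrix is the product of two linear forms, so its cube is a power form; 1296
  is \<open>fact 3 ^ 4\<close>.\<close>

lemma E11_rk1:
  assumes "f \<in> biforms 3 3"
  shows "mp_subst (rk1 P) (E11 f) = Const 1296 * mp_subst (perp P) f"
proof (rule mp_eval_inject)
  fix z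
  let ?p = "\<lambda>v. mp_eval z (P v)"
  have "(\<Sum>k\<in>UNIV. Const (rk1 ?p k) * b11 k) = powform 1 ?p"
    by (rule mp_eval_inject) (simp add: mp_eval_powform sum_4 mp_eval_b11 algebra_simps)
  moreover have "powform 1 ?p ^ 3 = powform 3 ?p"
    by (simp add: powform_def power_mult_distrib)
  ultimately have "mp_eval (rk1 ?p) (E11 f) = fact 3 ^ 4 * mp_eval (perp ?p) f"
    unfolding mp_eval_E11 by (simp only: tv_pair_powform[OF assms])
  moreover have "fact 3 ^ 4 = (1296 :: 'a)" by (simp add: fact_numeral)
  ultimately show "mp_eval z (mp_subst (rk1 P) (E11 f)) = mp_eval z (Const 1296 * mp_subst (perp P) f)"
    unfolding mp_eval_subst mp_eval_rk1 by (simp add: mp_eval_subst mp_eval_perp)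
qed

lemma E11_scale: "mp_subst (\<lambda>k. w * M k) (E11 f) = w ^ 3 * mp_subst M (E11 f)"
proof (rule mp_eval_inject)
  fix z
  let ?w = "mp_eval z w" and ?M = "\<lambda>k. mp_eval z (M k)"
  have "(\<Sum>k\<in>UNIV. Const (?w * ?M k) * b11 k) ^ 3 = Const (?w ^ 3) * (\<Sum>k\<in>UNIV. Const (?M k) * b11 k) ^ 3"
    by (simp only: Const_mult mult.assoc Const_power flip: sum_distrib_left power_mult_distrib)
  then have "mp_eval (\<lambda>k. ?w * ?M k) (E11 f) = ?w ^ 3 * mp_eval ?M (E11 f)"
    unfolding mp_eval_E11 by (simp only: tv_pair_scale)
  then show "mp_eval z (mp_subst (\<lambda>k. w * M k) (E11 f)) = mp_eval z (w ^ 3 * mp_subst M (E11 f))"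
    by (simp add: mp_eval_subst)
qed

lemma ideal_cong_subst:
  assumes J: "ring_ideal J" and st: "\<And>v. s v - t v \<in> J"
  shows "mp_subst s F - mp_subst t F \<in> J"
proof (induction F rule: mpoly_induct)
  case (add F G)
  then show ?case using ideal_add[OF J add.IH] by (simp add: algebra_simps)
qed (simp_all add: ideal_0[OF J] st ideal_cong_mult[OF J])

lemma ring_ideal_generated:
  fixes S :: "('v, 'b::field) mpoly set"
  shows "ring_ideal (generated_ideal S)"
proof -
  interpret module "times :: ('v, 'b) mpoly \<Rightarrow> _"
    by unfold_locales (simp_all add: algebra_simps)
  show ?thesis unfolding generated_ideal_def
    by (rule ring_idealI) (simp_all add: span_zero span_add span_scale)
qed

lemma generated_ideal_base:
  fixes S :: "('v, 'b::field) mpoly set"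
  shows "F \<in> S \<Longrightarrow> F \<in> generated_ideal S"
proof -
  interpret module "times :: ('v, 'b) mpoly \<Rightarrow> _"
    by unfold_locales (simp_all add: algebra_simps)
  show "F \<in> S \<Longrightarrow> F \<in> generated_ideal S" unfolding generated_ideal_def by (rule span_base)
qed

lemma vanishes_nearI: "F \<in> generated_ideal S \<Longrightarrow> vanishes_near S p F"
  unfolding vanishes_near_def by (intro exI[of _ 1]) simp

lemma homogeneous_P3: "homogeneous d F \<Longrightarrow> multihomogeneous P3 (\<lambda>_. d) F"
  unfolding homogeneous_def multihomogeneous_def by (simp add: P3_def)

lemma biforms_P1xP1:
  assumes "F \<in> biforms a b"
  shows "multihomogeneous P1xP1 (\<lambda>s. if s then b else a) F"
  unfolding multihomogeneous_def
proof (intro ballI allI)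
  fix m k assume "m \<in> keys F"
  then have m: "lookup m vx + lookup m vy = a" "lookup m vu + lookup m vv = b"
    using assms unfolding biforms_def by blast+
  define D where "D = (if k then {vu, vv} else {vx, vy})"
  have D: "v \<in> D \<longleftrightarrow> P1xP1 v = k" for v by (cases v; cases k; simp add: D_def)
  have "(\<Sum>v\<in>{v \<in> keys m. P1xP1 v = k}. lookup m v) = (\<Sum>v\<in>D. lookup m v)"
  proof (rule sum.mono_neutral_left)
    show "finite D" by (simp add: D_def)
    show "{v \<in> keys m. P1xP1 v = k} \<subseteq> D" by (intro subsetI) (simp add: D)
    show "\<forall>v\<in>D - {v \<in> keys m. P1xP1 v = k}. lookup m v = 0" by (intro ballI, cases k) (auto simp: D in_keys_iff)
  qed
  then show "(\<Sum>v\<in>{v \<in> keys m. P1xP1 v = k}. lookup m v) = (if k then b else a)"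
    using m by (cases k; simp add: D_def)
qed

lemma sum_Const_delta:
  fixes V :: "4 \<Rightarrow> ('w, 'a::comm_ring_1) mpoly"
  shows "(\<Sum>j\<in>UNIV. Const (if i = j then 1 else 0) * V j) = V i"
proof -
  have "Const (if i = j then 1 else 0) * V j = (if i = j then V j else 0)" for j by simp
  then show ?thesis by (simp only: sum.delta'[OF finite] UNIV_I if_True)
qed

text \<open>Linear independence at \<open>f\<close> in matrix form: \<open>N\<close> is the
  two-sided inverse of the matrix of coefficients of the values \<open>q i f\<close>.\<close>

locale bicubic_model =
  fixes f :: "(bivar, 'a::field_char_0) mpoly" and q :: "4 \<Rightarrow> (bivar, 'a) mpoly \<Rightarrow> (bivar, 'a) mpoly" and N :: "4 \<Rightarrow> 4 \<Rightarrow> 'a"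
  assumes f: "f \<in> biforms 3 3" and qb: "\<And>i. q i f \<in> biforms 1 1"
    and NA: "\<And>i j. (\<Sum>k\<in>UNIV. N i k * lookup (q j f) (mon11 k)) = (if i = j then 1 else 0)"
    and AN: "\<And>k l. (\<Sum>i\<in>UNIV. lookup (q i f) (mon11 k) * N i l) = (if k = l then 1 else 0)"
begin

text \<open>The coefficient matrix of the generic combination of the \<open>q i f\<close>, with rows
  \<open>M 1, M 2\<close> and \<open>M 3, M 4\<close>, as linear forms in the coordinates of the
  projective space.\<close>

definition M :: "4 \<Rightarrow> (4, 'a) mpoly" where
  "M k = (\<Sum>i\<in>UNIV. Const (lookup (q i f) (mon11 k)) * Var i)"

definition J :: "(4, 'a) mpoly set" where
  "J = generated_ideal {Q_form q f, E_form q f}"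

lemma J: "ring_ideal J" unfolding J_def by (rule ring_ideal_generated)

lemma ell: "(\<Sum>i\<in>UNIV. Const (X i) * q i f) = (\<Sum>k\<in>UNIV. Const (mp_eval X (M k)) * b11 k)"
proof -
  have "(\<Sum>i\<in>UNIV. Const (X i) * q i f) = (\<Sum>i\<in>UNIV. \<Sum>k\<in>UNIV. Const (X i) * (Const (lookup (q i f) (mon11 k)) * b11 k))"
    by (subst (1) biforms_11_expand[OF qb]) (simp only: sum_distrib_left)
  also have "\<dots> = (\<Sum>k\<in>UNIV. \<Sum>i\<in>UNIV. Const (X i) * (Const (lookup (q i f) (mon11 k)) * b11 k))"
    by (rule sum.swap)
  also have "\<dots> = (\<Sum>k\<in>UNIV. Const (mp_eval X (M k)) * b11 k)"
  proof (intro sum.cong refl)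
    fix k
    have e: "mp_eval X (M k) = (\<Sum>i\<in>UNIV. X i * lookup (q i f) (mon11 k))" by (simp add: M_def mult.commute)
    show "(\<Sum>i\<in>UNIV. Const (X i) * (Const (lookup (q i f) (mon11 k)) * b11 k)) = Const (mp_eval X (M k)) * b11 k"
      unfolding e Const_sum sum_distrib_right Const_mult mult.assoc ..
  qed
  finally show ?thesis .
qed

lemma Q_eq: "Q_form q f = Const 2 * (M 1 * M 4 - M 2 * M 3)"
proof (rule mp_eval_inject)
  fix X
  let ?c = "\<lambda>k. mp_eval X (M k)"
  define L where "L = (\<Sum>k\<in>UNIV. Const (?c k) * b11 k)"
  have l: "lookup L (mm 1 0 1 0) = ?c 1" "lookup L (mm 1 0 0 1) = ?c 2" "lookup L (mm 0 1 1 0) = ?c 3" "lookup L (mm 0 1 0 1) = ?c 4"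
    using lookup_b11[of ?c 1] lookup_b11[of ?c 2] lookup_b11[of ?c 3] lookup_b11[of ?c 4] by (simp_all only: mon11_simps L_def)
  have "mp_eval X (Q_form q f) = tv_pair 1 L L" unfolding mp_eval_Q_form ell L_def ..
  also have "\<dots> = 2 * (?c 1 * ?c 4 - ?c 2 * ?c 3)"
    unfolding tv_pair_eq by (simp add: l[unfolded One_nat_def] algebra_simps)
  finally show "mp_eval X (Q_form q f) = mp_eval X (Const 2 * (M 1 * M 4 - M 2 * M 3))" by simp
qed

lemma E_eq: "E_form q f = mp_subst M (E11 f)"
  by (rule mp_eval_inject) (simp only: mp_eval_E_form ell mp_eval_subst mp_eval_E11)

lemma N_M: "(\<Sum>k\<in>UNIV. Const (N i k) * M k) = Var i"
proof -
  have "(\<Sum>k\<in>UNIV. Const (N i k) * M k) = (\<Sum>k\<in>UNIV. \<Sum>j\<in>UNIV. Const (N i k * lookup (q j f) (mon11 k)) * Var j)"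
    by (simp add: M_def sum_distrib_left Const_mult mult.assoc)
  also have "\<dots> = (\<Sum>j\<in>UNIV. Const (\<Sum>k\<in>UNIV. N i k * lookup (q j f) (mon11 k)) * Var j)"
    by (subst sum.swap) (simp add: Const_sum sum_distrib_right)
  also have "\<dots> = Var i" unfolding NA by (rule sum_Const_delta)
  finally show ?thesis .
qed

text \<open>A point of the product of lines goes to the product of linear forms vanishing there,
  expressed in the basis of the \<open>q i f\<close>.\<close>

definition \<Psi> :: "4 \<Rightarrow> (bivar, 'a) mpoly" where
  "\<Psi> i = (\<Sum>k\<in>UNIV. Const (N i k) * rk1 (perp Var) k)"

lemma M_\<Psi>: "mp_subst \<Psi> (M k) = rk1 (perp Var) k"
proof -
  have "mp_subst \<Psi> (M k) = (\<Sum>i\<in>UNIV. \<Sum>l\<in>UNIV. Const (lookup (q i f) (mon11 k) * N i l) * rk1 (perp Var) l)"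
    by (simp add: M_def \<Psi>_def sum_distrib_left Const_mult mult.assoc)
  also have "\<dots> = (\<Sum>l\<in>UNIV. Const (\<Sum>i\<in>UNIV. lookup (q i f) (mon11 k) * N i l) * rk1 (perp Var) l)"
    by (subst sum.swap) (simp add: Const_sum sum_distrib_right)
  also have "\<dots> = rk1 (perp Var) k" unfolding AN by (rule sum_Const_delta)
  finally show ?thesis .
qed

lemma Q_\<Psi>: "mp_subst \<Psi> (Q_form q f) = 0"
  by (simp add: Q_eq M_\<Psi> mult_ac)

lemma E_\<Psi>: "mp_subst \<Psi> (E_form q f) = Const 1296 * f"
proof -
  \<comment> \<open>\<open>perp\<close> applied twice is multiplication by -1, harmless in bidegree
    (3,3).\<close>
  have "mp_subst (perp (perp Var)) f = f"
  proof (rule mp_eval_inject)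
    fix z :: "bivar \<Rightarrow> 'a"
    have "(\<lambda>v. mp_eval z (perp (perp Var) v)) = scl (-1) (-1) z" by (rule fun_bivar_eqI) simp_all
    then show "mp_eval z (mp_subst (perp (perp Var)) f) = mp_eval z f"
      by (simp add: mp_eval_subst mp_eval_scl_biforms[OF f])
  qed
  then show ?thesis unfolding E_eq mp_subst_subst M_\<Psi> E11_rk1[OF f] by simp
qed

text \<open>A rank one matrix is recovered from any nonzero column and row: \<open>s\<close> selects
  the second column for \<open>x, y\<close>, and \<open>t\<close> the second row for
  \<open>u, v\<close>.\<close>

definition pt :: "bool \<Rightarrow> bool \<Rightarrow> bivar \<Rightarrow> (4, 'a) mpoly" where
  "pt s t v = (case v of vx \<Rightarrow> M (if s then 2 else 1) | vy \<Rightarrow> M (if s then 4 else 3)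
     | vu \<Rightarrow> M (if t then 3 else 1) | vv \<Rightarrow> M (if t then 4 else 2))"

lemma pt_simps [simp]: "pt s t vx = M (if s then 2 else 1)" "pt s t vy = M (if s then 4 else 3)"
    "pt s t vu = M (if t then 3 else 1)" "pt s t vv = M (if t then 4 else 2)"
  by (simp_all add: pt_def)

definition \<Phi> :: "bool \<Rightarrow> bool \<Rightarrow> bivar \<Rightarrow> (4, 'a) mpoly" where
  "\<Phi> s t = perp (pt s t)"

lemma det_J: "c * (M 1 * M 4 - M 2 * M 3) \<in> J"
proof -
  have "Const 2 * (M 1 * M 4 - M 2 * M 3) \<in> J" unfolding Q_eq[symmetric] J_def by (rule generated_ideal_base) simp
  then have "c * Const (1/2) * (Const 2 * (M 1 * M 4 - M 2 * M 3)) \<in> J" by (rule ideal_mult[OF J])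
  moreover have "c * Const (1/2) * (Const 2 * F) = c * F" for F :: "(4, 'a) mpoly"
  proof -
    have "c * Const (1/2) * (Const 2 * F) = c * (Const (1/2 * 2) * F)" by (simp only: Const_mult mult_ac)
    then show ?thesis by simp
  qed
  ultimately show ?thesis by (simp only:)
qed

lemma det_J': "F = c * (M 1 * M 4 - M 2 * M 3) \<Longrightarrow> F \<in> J" using det_J by simp

text \<open>The entry where the chosen column and row cross. On rank one matrices, column times row
  is this entry times the matrix.\<close>

definition wt :: "bool \<Rightarrow> bool \<Rightarrow> (4, 'a) mpoly" where
  "wt s t = M (if s then if t then 4 else 2 else if t then 3 else 1)"

lemma rk1_pt: "rk1 (pt s t) k - wt s t * M k \<in> J"
  \<comment> \<open>The two sides differ only at the entry diagonally opposite the crossing, and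
    there by the determinant up to sign.\<close>
  by (rule det_J'[where c = "if k = (if t then if s then 1 else 2 else if s then 3 else 4) then if s = t then -1 else 1 else 0"])
    (use exhaust_4[of k] in \<open>elim disjE; cases s; cases t; simp add: wt_def algebra_simps\<close>)

text \<open>Modulo \<open>J\<close> the rank one matrix of \<open>pt s t\<close> is
  \<open>wt s t\<close> times \<open>M\<close>, so its cubic is a multiple of \<open>E\<close>; on
  rank one matrices that cubic is 1296 times \<open>f\<close> at the common zero.\<close>

lemma f_\<Phi>: "mp_subst (\<Phi> s t) f \<in> J"
proof -
  have "mp_subst (rk1 (pt s t)) (E11 f) - mp_subst (\<lambda>k. wt s t * M k) (E11 f) \<in> J"
    by (rule ideal_cong_subst[OF J rk1_pt])
  moreover have "mp_subst (\<lambda>k. wt s t * M k) (E11 f) \<in> J"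
    unfolding E11_scale E_eq[symmetric] J_def
    by (intro ideal_mult[OF ring_ideal_generated] generated_ideal_base) simp
  ultimately have "mp_subst (rk1 (pt s t)) (E11 f) \<in> J" using ideal_add[OF J] by force
  then have "Const (1/1296) * (Const 1296 * mp_subst (\<Phi> s t) f) \<in> J"
    unfolding E11_rk1[OF f] \<Phi>_def[symmetric] by (rule ideal_mult[OF J])
  then show ?thesis by (simp add: mult.assoc[symmetric] Const_mult[symmetric])
qed

text \<open>Both columns, and both rows, are proportional once the determinant vanishes.\<close>

lemma agree_\<Phi>: "P1xP1 v = P1xP1 w \<Longrightarrow> \<Phi> s t v * \<Phi> s' t' w - \<Phi> s t w * \<Phi> s' t' v \<in> J"
proof -
  assume vw: "P1xP1 v = P1xP1 w"
  have x: "\<Phi> s t vx * \<Phi> s' t' vy - \<Phi> s t vy * \<Phi> s' t' vx \<in> J"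
    by (rule det_J'[where c = "if s = s' then 0 else if s' then 1 else -1"])
      (cases s; cases s'; simp add: \<Phi>_def algebra_simps)
  have u: "\<Phi> s t vu * \<Phi> s' t' vv - \<Phi> s t vv * \<Phi> s' t' vu \<in> J"
    by (rule det_J'[where c = "if t = t' then 0 else if t' then 1 else -1"])
      (cases t; cases t'; simp add: \<Phi>_def algebra_simps)
  have "v = w \<or> v = vx \<and> w = vy \<or> v = vy \<and> w = vx \<or> v = vu \<and> w = vv \<or> v = vv \<and> w = vu"
    using vw by (cases v; cases w; simp)
  then show ?thesis
    using x u ideal_uminus[OF J x] ideal_uminus[OF J u] ideal_0[OF J] by (elim disjE conjE) (simp_all add: mult.commute)
qed

text \<open>The composite is multiplication by \<open>wt s t\<close> modulo \<open>J\<close>, a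
  common factor that is projectively the identity.\<close>

lemma \<Psi>_\<Phi>: "mp_subst (\<Phi> s t) (\<Psi> i) - wt s t * Var i \<in> J"
proof -
  have pp: "rk1 (perp (perp p)) k = rk1 p k" for p :: "bivar \<Rightarrow> (4, 'a) mpoly" and k
    by (simp add: rk1_def)
  have "mp_subst (\<Phi> s t) (\<Psi> i) = (\<Sum>k\<in>UNIV. Const (N i k) * rk1 (pt s t) k)"
    by (simp add: \<Psi>_def mp_subst_rk1 mp_subst_perp \<Phi>_def pp)
  moreover have "wt s t * Var i = (\<Sum>k\<in>UNIV. Const (N i k) * (wt s t * M k))"
    unfolding N_M[symmetric] by (simp add: sum_distrib_left mult_ac)
  ultimately have "mp_subst (\<Phi> s t) (\<Psi> i) - wt s t * Var i = (\<Sum>k\<in>UNIV. Const (N i k) * (rk1 (pt s t) k - wt s t * M k))"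
    by (simp only: sum_subtractf right_diff_distrib)
  then show ?thesis by (simp add: ideal_sum[OF J] ideal_mult[OF J] rk1_pt)
qed

lemma \<Phi>_\<Psi>: "P1xP1 v = P1xP1 w \<Longrightarrow> Var v * mp_subst \<Psi> (\<Phi> s t w) - Var w * mp_subst \<Psi> (\<Phi> s t v) = 0"
  by (cases v; cases w; cases s; cases t; simp add: \<Phi>_def M_\<Psi>)

text \<open>The second column or row is chosen exactly when the first one vanishes at
  \<open>X\<close>; as the matrix is nonzero there, the choice is nonzero.\<close>

definition \<Phi>_at :: "(4 \<Rightarrow> 'a) \<Rightarrow> bivar \<Rightarrow> (4, 'a) mpoly" where
  "\<Phi>_at X = \<Phi> (mp_eval X (M 1) = 0 \<and> mp_eval X (M 3) = 0) (mp_eval X (M 1) = 0 \<and> mp_eval X (M 2) = 0)"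

lemma M_nonzero:
  assumes "valid_coords P3 X"
  shows "\<exists>k. mp_eval X (M k) \<noteq> 0"
proof (rule ccontr)
  assume "\<nexists>k. mp_eval X (M k) \<noteq> 0"
  then have "X i = 0" for i using arg_cong[OF N_M[of i], of "mp_eval X"] by simp
  then show False using assms unfolding valid_coords_def by blast
qed

lemma valid_\<Phi>:
  assumes "valid_coords P3 X"
  shows "valid_coords P1xP1 (\<lambda>v. mp_eval X (\<Phi>_at X v))"
proof -
  obtain k where "mp_eval X (M k) \<noteq> 0" using M_nonzero[OF assms] ..
  then have nz: "mp_eval X (M 1) \<noteq> 0 \<or> mp_eval X (M 2) \<noteq> 0 \<or> mp_eval X (M 3) \<noteq> 0 \<or> mp_eval X (M 4) \<noteq> 0"
    using exhaust_4[of k] by auto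
  have "mp_eval X (\<Phi>_at X vx) \<noteq> 0 \<or> mp_eval X (\<Phi>_at X vy) \<noteq> 0"
    "mp_eval X (\<Phi>_at X vu) \<noteq> 0 \<or> mp_eval X (\<Phi>_at X vv) \<noteq> 0"
    using nz by (auto simp: \<Phi>_at_def \<Phi>_def)
  then have "\<exists>v. P1xP1 v = False \<and> mp_eval X (\<Phi>_at X v) \<noteq> 0" "\<exists>v. P1xP1 v = True \<and> mp_eval X (\<Phi>_at X v) \<noteq> 0"
    by (meson P1xP1.simps)+
  then show ?thesis unfolding valid_coords_def all_bool_eq by blast
qed

lemma \<Phi>_homogeneous: "homogeneous 1 (\<Phi> s t v)"
proof -
  have M: "homogeneous 1 (M k)" for k
    unfolding M_def by (intro homogeneous_sum homogeneous_scale homogeneous_Var)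
  have "- M k = Const (-1) * M k" for k by (simp add: Const_uminus)
  then have "homogeneous 1 (- M k)" for k using homogeneous_scale[OF M] by metis
  then show ?thesis using M by (cases v) (simp_all add: \<Phi>_def)
qed

lemma \<Psi>_biform: "\<Psi> i \<in> biforms 1 1"
proof -
  \<comment> \<open>Passing to the common zero exchanges opposite entries of the matrix, hence the
    index \<open>5 - k\<close>, with the signs of the adjugate.\<close>
  have "rk1 (perp Var) k = (Const (if k = 1 \<or> k = 4 then 1 else -1) * b11 (5 - k) :: (bivar, 'a) mpoly)" for k
    by (rule mp_eval_inject) (use exhaust_4[of k] in \<open>elim disjE; simp add: mp_eval_b11\<close>)
  moreover have "b11 k \<in> biforms 1 1" for k
    unfolding b11_def biforms_iff bimonoms_11 by auto
  ultimately show ?thesis unfolding \<Psi>_def by (simp only:) (intro biforms_sum biforms_scale)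
qed

lemma valid_\<Psi>:
  assumes "valid_coords P1xP1 z"
  shows "valid_coords P3 (\<lambda>i. mp_eval z (\<Psi> i))"
proof -
  have z: "z vx \<noteq> 0 \<or> z vy \<noteq> 0" "z vu \<noteq> 0 \<or> z vv \<noteq> 0"
    using assms unfolding valid_coords_def by (metis P1xP1.simps bivar.exhaust)+
  have "\<exists>i. mp_eval z (\<Psi> i) \<noteq> 0"
  proof (rule ccontr)
    assume "\<nexists>i. mp_eval z (\<Psi> i) \<noteq> 0"
    then have 0: "mp_eval (\<lambda>i. mp_eval z (\<Psi> i)) (M k) = 0" for k by (simp add: M_def)
    have "rk1 (perp z) k = 0" for k
      using 0[of k] unfolding mp_eval_subst[symmetric] M_\<Psi> mp_eval_rk1 mp_eval_perp by simp
    from this[of 1] this[of 2] this[of 3] this[of 4] show False using z by simp blast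
  qed
  then show ?thesis unfolding valid_coords_def P3_def by simp
qed

lemma J_vanishes: "F \<in> J \<Longrightarrow> vanishes_near {Q_form q f, E_form q f} X F"
  unfolding J_def by (rule vanishes_nearI)

lemma zero_vanishes: "vanishes_near S p 0"
  by (intro vanishes_nearI ideal_0 ring_ideal_generated)

theorem isomorphic: "proj_isomorphic P3 {Q_form q f, E_form q f} P1xP1 {f}"
  unfolding proj_isomorphic_def
\<comment> \<open>The map to projective space is given by one tuple everywhere; its inverse needs
  the charts selected by \<open>\<Phi>_at\<close>.\<close>
proof (rule exI[of _ \<Phi>_at], rule exI[of _ "\<lambda>_. \<Psi>"], intro conjI)
  let ?S = "{Q_form q f, E_form q f}"
  show "proj_morphism P3 ?S P1xP1 {f} \<Phi>_at"
    unfolding proj_morphism_def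
  proof (intro ballI conjI allI impI)
    fix X assume "X \<in> zero_points P3 ?S"
    then have X: "valid_coords P3 X" by (simp add: zero_points_def)
    have "\<forall>w. multihomogeneous P3 (\<lambda>_. 1) (\<Phi>_at X w)"
      unfolding \<Phi>_at_def by (intro allI homogeneous_P3 \<Phi>_homogeneous)
    then show "\<exists>e. \<forall>w. multihomogeneous P3 (e (P1xP1 w)) (\<Phi>_at X w)" by (intro exI[of _ "\<lambda>_ _. 1"])
    show "valid_coords P1xP1 (\<lambda>w. mp_eval X (\<Phi>_at X w))" by (rule valid_\<Phi>[OF X])
    show "vanishes_near ?S X (mp_subst (\<Phi>_at X) G)" if "G \<in> {f}" for G
      using that unfolding \<Phi>_at_def by (simp add: J_vanishes f_\<Phi>)
    show "vanishes_near ?S Y (\<Phi>_at X w * \<Phi>_at Y w' - \<Phi>_at X w' * \<Phi>_at Y w)" if "P1xP1 w = P1xP1 w'" for Y w w'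
      unfolding \<Phi>_at_def by (intro J_vanishes agree_\<Phi> that)
  qed
  show "proj_morphism P1xP1 {f} P3 ?S (\<lambda>_. \<Psi>)"
    unfolding proj_morphism_def
  proof (intro ballI conjI allI impI)
    fix z assume "z \<in> zero_points P1xP1 {f}"
    then have z: "valid_coords P1xP1 z" by (simp add: zero_points_def)
    show "\<exists>e. \<forall>w. multihomogeneous P1xP1 (e (P3 w)) (\<Psi> w)"
      by (intro exI[of _ "\<lambda>_ s. if s then 1 else 1"] allI biforms_P1xP1 \<Psi>_biform)
    show "valid_coords P3 (\<lambda>w. mp_eval z (\<Psi> w))" by (rule valid_\<Psi>[OF z])
    have "mp_subst \<Psi> (E_form q f) \<in> generated_ideal {f}"
      unfolding E_\<Psi> by (intro ideal_mult[OF ring_ideal_generated] generated_ideal_base) simp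
    then show "vanishes_near {f} z (mp_subst \<Psi> G)" if "G \<in> ?S" for G
      using that by (auto simp: Q_\<Psi> intro: zero_vanishes vanishes_nearI)
    show "vanishes_near {f} z' (\<Psi> w * \<Psi> w' - \<Psi> w' * \<Psi> w)" for z' w w'
      by (simp add: mult.commute zero_vanishes)
  qed
  show "left_inverse_morphism P3 ?S \<Phi>_at (\<lambda>_. \<Psi>)"
    unfolding left_inverse_morphism_def Let_def
  proof (intro ballI allI impI)
    fix X v v'
    let ?s = "mp_subst (\<Phi>_at X)"
    obtain w where w: "?s (\<Psi> i) - w * Var i \<in> J" for i using \<Psi>_\<Phi> unfolding \<Phi>_at_def by blast
    have "Var v * (?s (\<Psi> v') - w * Var v') - Var v' * (?s (\<Psi> v) - w * Var v) \<in> J"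
      by (intro ideal_diff[OF J] ideal_mult[OF J] w)
    then have "Var v * ?s (\<Psi> v') - Var v' * ?s (\<Psi> v) \<in> J" by (simp add: algebra_simps)
    then show "vanishes_near ?S X (Var v * ?s (\<Psi> v') - Var v' * ?s (\<Psi> v))" by (rule J_vanishes)
  qed
  show "left_inverse_morphism P1xP1 {f} (\<lambda>_. \<Psi>) \<Phi>_at"
    unfolding left_inverse_morphism_def Let_def
  proof (intro ballI allI impI)
    fix z v v' assume "P1xP1 v = P1xP1 v'"
    then show "vanishes_near {f} z (Var v * mp_subst \<Psi> (\<Phi>_at (\<lambda>w. mp_eval z (\<Psi> w)) v')
        - Var v' * mp_subst \<Psi> (\<Phi>_at (\<lambda>w. mp_eval z (\<Psi> w)) v))"
      unfolding \<Phi>_at_def by (simp only: \<Phi>_\<Psi> zero_vanishes)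
  qed
qed

end

text \<open>Independence says that the 4 x 4 matrix of coefficients of the \<open>q i f\<close> has
  trivial kernel, which makes it invertible on both sides.\<close>

lemma curves_isomorphic:
  fixes f :: "(bivar, 'a::field_char_0) mpoly"
  assumes f: "f \<in> biforms 3 3" and qb: "\<And>i. q i f \<in> biforms 1 1" and indep: "lin_indep_at f q"
  shows "proj_isomorphic P3 {Q_form q f, E_form q f} P1xP1 {f}"
proof -
  define A :: "'a^4^4" where "A = (\<chi> k i. lookup (q i f) (mon11 k))"
  have "x = 0" if x: "A *v x = 0" for x
  proof -
    have "(\<Sum>i\<in>UNIV. Const (x $ i) * q i f) = 0"
    proof (rule poly_mapping_eqI)
      fix m
      show "lookup (\<Sum>i\<in>UNIV. Const (x $ i) * q i f) m = lookup 0 m"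
      proof (cases "m \<in> bimonoms 1 1")
        case True
        then obtain k where "m = mon11 k" unfolding bimonoms_11 by blast
        moreover have "(A *v x) $ k = 0" using x by simp
        ultimately show ?thesis
          unfolding lookup_sum lookup_Const_mult by (simp add: A_def matrix_vector_mult_def mult.commute)
      next
        case False
        then show ?thesis by (simp add: lookup_sum lookup_Const_mult biforms_lookup_0[OF qb])
      qed
    qed
    then have "\<forall>i. x $ i = 0" using indep[unfolded lin_indep_at_def, rule_format, of "\<lambda>i. x $ i"] by blast
    then show ?thesis by (simp add: vec_eq_iff)
  qed
  then have "\<exists>N :: 'a^4^4. N ** A = mat 1" unfolding matrix_left_invertible_ker by blast
  then obtain N :: "'a^4^4" where N: "N ** A = mat 1" ..
  then have AN: "A ** N = mat 1" by (simp add: matrix_left_right_inverse)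
  interpret bicubic_model f q "\<lambda>i k. N $ i $ k"
  proof
    show "(\<Sum>k\<in>UNIV. N $ i $ k * lookup (q j f) (mon11 k)) = (if i = j then 1 else 0)" for i j
      using arg_cong[OF N, of "\<lambda>B. B $ i $ j"] by (simp add: A_def matrix_matrix_mult_def mat_def)
    show "(\<Sum>i\<in>UNIV. lookup (q i f) (mon11 k) * N $ i $ l) = (if k = l then 1 else 0)" for k l
      using arg_cong[OF AN, of "\<lambda>B. B $ k $ l"] by (simp add: A_def matrix_matrix_mult_def mat_def)
  qed (rule f qb)+
  show ?thesis by (rule isomorphic)
qed

theorem theorem5p3p4:
  fixes f :: "(bivar, 'a::{alg_closed_field, field_char_0}) mpoly"
  assumes "f \<in> biforms 3 3"
    and "stable_form 3 3 f"
    and "trivial_group (reduced_stabilizer f)"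
  shows "(\<exists>q :: 4 \<Rightarrow> (bivar, 'a) mpoly \<Rightarrow> (bivar, 'a) mpoly.
            (\<forall>i. covariant 3 3 1 1 (q i) \<and> exchange_equivariant 3 (q i)) \<and> lin_indep_at f q)
    \<and> (\<forall>q :: 4 \<Rightarrow> (bivar, 'a) mpoly \<Rightarrow> (bivar, 'a) mpoly.
            (\<forall>i. covariant 3 3 1 1 (q i)) \<and> lin_indep_at f q \<longrightarrow>
              proj_isomorphic P3 {Q_form q f, E_form q f} P1xP1 {f}
              \<and> (\<forall>m. \<exists>d. hom_invariant SLxSL 3 3 d (\<lambda>h. lookup (Q_form q h) m))
              \<and> (\<forall>m. \<exists>d. hom_invariant SLxSL 3 3 d (\<lambda>h. lookup (E_form q h) m))
              \<and> ((\<forall>i. exchange_equivariant 3 (q i)) \<longrightarrow>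
                    (\<forall>m. \<exists>d. hom_invariant SLxSL_Z2 3 3 d (\<lambda>h. lookup (Q_form q h) m))
                    \<and> (\<forall>m. \<exists>d. hom_invariant SLxSL_Z2 3 3 d (\<lambda>h. lookup (E_form q h) m))))"
proof (intro conjI allI impI; (elim conjE)?)
  have closed: "zariski_closed_in_biforms 3 3 (orbit SLxSL act f)" using assms(2) unfolding stable_form_def by blast
  show "\<exists>q :: 4 \<Rightarrow> (bivar, 'a) mpoly \<Rightarrow> (bivar, 'a) mpoly.
      (\<forall>i. covariant 3 3 1 1 (q i) \<and> exchange_equivariant 3 (q i)) \<and> lin_indep_at f q"
    by (rule independent_covariants_exist[OF assms(1) closed reduced_stabilizer_trivial[OF assms(3)]])
  fix q :: "4 \<Rightarrow> (bivar, 'a) mpoly \<Rightarrow> (bivar, 'a) mpoly"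
  assume q: "\<forall>i. covariant 3 3 1 1 (q i)" and indep: "lin_indep_at f q"
  have "q i f \<in> biforms 1 1" for i using q assms(1) unfolding covariant_def by blast
  then show "proj_isomorphic P3 {Q_form q f, E_form q f} P1xP1 {f}"
    by (rule curves_isomorphic[OF assms(1) _ indep])
  have cov: "covariant 3 3 1 1 (q i)" for i using q ..
  fix m
  show "\<exists>d. hom_invariant SLxSL 3 3 d (\<lambda>h. lookup (Q_form q h) m)"
    "\<exists>d. hom_invariant SLxSL 3 3 d (\<lambda>h. lookup (E_form q h) m)"
    by (rule forms_SL_invariant(1,2), rule cov)+
  assume e: "\<forall>i. exchange_equivariant 3 (q i)"
  have ex: "exchange_equivariant 3 (q i)" for i using e ..
  show "\<exists>d. hom_invariant SLxSL_Z2 3 3 d (\<lambda>h. lookup (Q_form q h) m)"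
    "\<exists>d. hom_invariant SLxSL_Z2 3 3 d (\<lambda>h. lookup (E_form q h) m)"
    by (rule forms_SL_invariant(3,4), rule cov, rule ex)+
qed

end
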